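(* Let $0<m\le M<\infty$, $k,K\in\mathbb R$, $N>1$ and $0<\Lambda<D_k/2$, where $D_k=\pi/\sqrt{-k}$ for $k<0$ and $D_k=+\infty$ otherwise. The class of covered Lorentzian pre-length spaces $(X,\mathcal U)$ described as follows is precompact with respect to Lorentzian Gromov–Hausdorff convergence: (1) $X=I((\bar s,\bar y),(\bar t,\bar y))$ is a subset of a globally hyperbolic, timelike non-branching, regular Lorentzian length space ${}^{-}J\times_fY$ which is a generalized cone with $m\le f\le M$; $\operatorname{diam}^\tau(X)\le\Lambda$; the global $\mathrm{TCBA}(k)$-condition holds; and $X$ can be equipped with a non-negative, full-support Radon measure $\mathfrak m$ such that it (and its causally reversed structure) satisfies the $\mathrm{TMCP}^e(K,N)$-condition. (2) $\mathcal U=\{U_n\}_{n\in\mathbb N}=\{I((\bar s+1/n,\bar y),(\bar t-1/n,\bar y))\}_{n\in\mathbb N}$ (for the fixed $\bar y\in Y$).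
   Context: **Covered spaces and Lorentzian Gromov–Hausdorff (LGH) convergence (Mondino–Sämann).** A covered Lorentzian pre-length space $(X,\mathcal U)$ is a Lorentzian pre-length space $X$ with a countable cover $\mathcal U=\{U_k\}_{k\in\mathbb N}$, $U_k\subset U_{k+1}$. For $A\subset X$, $\varepsilon>0$, an $\varepsilon$-net for $A$ is a collection of causal diamonds $\{J(p_i,q_i)\}_{i\in\Omega}$ with $\tau(p_i,q_i)\le\varepsilon$, $A\cap J(p_i,q_i)\neq\emptyset$ and $A\subset\bigcup_iJ(p_i,q_i)$; its vertex set is $V(S)=\{p_i,q_i:i\in\Omega\}$. A correspondence between sets $V,W$ is $R\subset V\times W$ with both projections surjective; for subsets of Lorentzian pre-length spaces its distortion is $\operatorname{dis}R=\sup\{|\tau_V(v,v')-\tau_W(w,w')|:(v,w),(v',w')\in R\}$. $(X_n,\mathcal U_n)$ converges to $(X,\mathcal U)$ if for all $k,l\in\mathbb N$ there are finite $1/l$-nets $S^{k,l}_n$ of $U_{n,k}$ in $X_n$ (for all large $n$) and $S^{k,l}$ of $U_k$ in $X$, with vertex sets increasing in $l$, and correspondences $R^{k,l}_n$ between $V(S^{k,l}_n)$ and $V(S^{k,l})$, increasing in $l$ and matching the diamonds of the nets, with $\operatorname{dis}R^{k,l}_n\to0$ as $n\to\infty$, and such that $\bigcup_lV(S^{k,l})$ is forward dense in $U_k$, i.e. each $x\in U_k$ is the limit of a sequence $v_1\le v_2\le\dots\le x$ of such vertices. A class is precompact if every sequence in it has a subsequence converging to some covered Lorentzian pre-length space (not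 necessarily in the class). **Generalized cones.** Let $(Y,d_Y)$ be a length space, $J\subset\mathbb R$ an open interval, $f:J\to(0,\infty)$ continuous. On $J\times Y$ put $D((t,y),(t',y'))=|t-t'|+d_Y(y,y')$. An absolutely continuous curve $\gamma=(\alpha,\beta)$ with $\alpha$ strictly monotone is timelike/null/causal if $-\dot\alpha^2+(f\circ\alpha)^2v_\beta^2$ is $<0$/$=0$/$\le0$ a.e., $v_\beta$ being the metric derivative of $\beta$; it is future directed if $\alpha$ is increasing. $x\ll x'$ (resp. $x\le x'$) iff there is a future-directed timelike (resp. causal) curve from $x$ to $x'$, and $x\le x$ always. $L(\gamma)=\int\sqrt{\dot\alpha^2-(f\circ\alpha)^2v_\beta^2}$ and $\tau(x,y)=\sup L(\gamma)$ over future-directed causal curves from $x$ to $y$ (0 if none). The Lorentzian pre-length space $(J\times Y,D,\ll,\le,\tau)$ is ${}^{-}J\times_fY$. Subsets carry the restricted structure. **Lorentzian pre-length spaces.** A Lorentzian pre-length space $(X,d,\ll,\le,\tau)$ is a set $X$ with a metric $d$, transitive relations $\ll\,\subset\,\le$ with $\le$ reflexive, and a map $\tau:X\times X\to[0,\infty]$ that is lower semicontinuous for $d$, satisfies $\tau(p,r)\ge\tau(p,q)+\tau(q,r)$ for $p\le q\le r$, and $\tau(p,q)>0\iff p\ll q$. Put $I^+(p)=\{q:p\ll q\}$, $I^-(q)=\{p:p\ll q\}$, and $J^\pm$ likewise with $\le$; $I(p,q)=I^+(p)\cap I^-(q)$ (chronological diamond), $J(p,q)=J^+(p)\cap J^-(q)$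 (causal diamond). $\operatorname{diam}^\tau(S)=\sup\{\tau(x,y):x,y\in S\}$. A non-constant locally Lipschitz curve $\gamma$ is future-directed causal (timelike) if $\gamma(s)\le\gamma(t)$ ($\gamma(s)\ll\gamma(t)$) for all $s<t$, and null if it is causal and no two of its points are $\ll$-related. $L_\tau(\gamma)$ is the infimum over partitions of $\sum_i\tau(\gamma(t_i),\gamma(t_{i+1}))$. A distance realiser (geodesic) from $p$ to $q$ is a future-directed causal curve from $p$ to $q$ with $L_\tau=\tau(p,q)$. **Lorentzian length spaces.** $X$ is a Lorentzian length space if it is: causally path connected ($p\ll q$, resp. $p\le q$ with $p\neq q$, are joined by a future-directed timelike, resp. causal, curve); locally causally closed (each point has a neighbourhood $U$ such that $p_n,q_n\in U$, $p_n\le q_n$, $p_n\to p\in\overline U$, $q_n\to q\in\overline U$ imply $p\le q$); intrinsic ($\tau(p,q)$ is the supremum of $L_\tau$ over future-directed causal curves from $p$ to $q$, for causally related points); and localizable: each $x$ has an open neighbourhood $\Omega_x$ such that (i) the $d$-lengths of causal curves in $\Omega_x$ are uniformly bounded; (ii) there is a continuous $\omega_x:\Omega_x\times\Omega_x\to[0,\infty)$ making $\Omega_x$ with restricted $d,\ll,\le$ a Lorentzian pre-length space, and $I^\pm(y)\cap\Omega_x\ne\emptyset$ for $y\in\Omega_x$; (iii) all $p\le q$, $p\ne q$, in $\Omega_x$ are joined by a future-directed causal curve $\gamma_{p,q}$ in $\Omega_x$ maximizing $L_\tau$ among such curves in $\Omega_x$, with $L_\tau(\gamma_{p,q})=\omega_x(p,q)\le\tau(p,q)$.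 It is regular (regularly localizable) if moreover, whenever $p\ll q$ in $\Omega_x$, $\gamma_{p,q}$ is timelike and strictly longer than any future-directed causal curve in $\Omega_x$ from $p$ to $q$ containing a null segment. $X$ is globally hyperbolic if all $J(p,q)$ are compact and for each compact set the $d$-lengths of causal curves contained in it are bounded. It is timelike non-branching if two distance realisers on $[0,\varepsilon)$ which agree on $[0,t]$ for some $t\in(0,\varepsilon)$ are equal (timelike geodesics are parametrized by $\tau$-arclength). The causally reversed structure replaces $\ll,\le$ by the opposite relations and $\tau(x,y)$ by $\tau(y,x)$. **$\mathrm{TMCP}^e(K,N)$.** For $p\in(0,1)$ and Borel probability measures $\mu,\nu$, $\ell_p(\mu,\nu)=\sup_\pi(\int\tau^p\,d\pi)^{1/p}$ over couplings $\pi$ concentrated on $\{x\le y\}$ ($-\infty$ if none). An $\ell_p$-geodesic is a curve $(\mu_t)_{t\in[0,1]}$ with $\ell_p(\mu_s,\mu_t)=(t-s)\ell_p(\mu_0,\mu_1)\in(0,\infty)$ for $s<t$. $\mathrm{Ent}(\mu|\mathfrak m)=\int\rho\log\rho\,d\mathfrak m$ if $\mu=\rho\mathfrak m$ and $(\rho\log\rho)_+$ is integrable, $+\infty$ otherwise; $\mathrm{Dom}(\mathrm{Ent})=\{|\mathrm{Ent}|<\infty\}$; $U_N(\mu|\mathfrak m)=e^{-\mathrm{Ent}(\mu|\mathfrak m)/N}$. $\sigma^{(t)}_\kappa(\theta)=\frac{\sin(t\sqrt\kappa\theta)}{\sin(\sqrt\kappa\theta)}$ if $0<\kappa\theta^2<\pi^2$,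 $t$ if $\kappa\theta^2=0$, $\frac{\sinh(t\sqrt{-\kappa}\theta)}{\sinh(\sqrt{-\kappa}\theta)}$ if $\kappa\theta^2<0$, $+\infty$ if $\kappa\theta^2\ge\pi^2$. $X$ satisfies $\mathrm{TMCP}^e(K,N)$ if for every compactly supported probability $\mu_0\in\mathrm{Dom}(\mathrm{Ent})$, every $x_1$ with $x\ll x_1$ for $\mu_0$-a.e. $x$, and some (equivalently any) $p\in(0,1)$, there is an $\ell_p$-geodesic from $\mu_0$ to $\mu_1=\delta_{x_1}$ with $U_N(\mu_t|\mathfrak m)\ge\sigma^{(1-t)}_{K/N}(\|\tau(\cdot,x_1)\|_{L^2(\mu_0)})U_N(\mu_0|\mathfrak m)$ for all $t\in[0,1)$. **Global $\mathrm{TCBA}(k)$.** $\mathbb L^2(k)$ is the two-dimensional simply connected Lorentzian model space of constant curvature $k$: Minkowski plane $\mathbb R^2_1$ for $k=0$; universal cover of $\{b(v,v)=1/k\}$ in $\mathbb R^3_1$ for $k>0$ and in $\mathbb R^3_2$ for $k<0$, where $\mathbb R^n_m$ has the inner product $b$ with $m$ negative directions; $\bar\tau$ is its time separation. An admissible causal triangle consists of $p_1\ll p_2\le p_3$ or $p_1\le p_2\ll p_3$ with finite mutual $\tau$, and (possibly constant) future-directed causal distance realisers as sides; a side is timelike if its endpoints are $\ll$-related. A comparison triangle in $\mathbb L^2(k)$ is an admissible causal triangle with the same side lengths; a point $q$ on a timelike side from $p_i$ to $p_j$ corresponds to $\bar q$ on the comparison side with $\bar\tau(\bar p_i,\bar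 q)=\tau(p_i,q)$. A globally hyperbolic Lorentzian length space satisfies global $\mathrm{TCBA}(k)$ if for every admissible causal triangle with all side lengths $<D_k$ and all $p,q$ on its timelike sides with corresponding points $\bar p,\bar q$ in a comparison triangle, $\tau(p,q)\ge\bar\tau(\bar p,\bar q)$. *)

theory Defs
  imports "HOL-Probability.Probability"
begin

section \<open>Lorentzian pre-length spaces\<close>

record 'a lpls =
  lmet   :: "'a metric"
  lchron :: "'a \<Rightarrow> 'a \<Rightarrow> bool"
  lcaus  :: "'a \<Rightarrow> 'a \<Rightarrow> bool"
  ltau   :: "'a \<Rightarrow> 'a \<Rightarrow> ennreal"

abbreviation lpts :: "'a lpls \<Rightarrow> 'a set" where
  "lpts X \<equiv> mspace (lmet X)"

abbreviation ldist :: "'a lpls \<Rightarrow> 'a \<Rightarrow> 'a \<Rightarrow> real" where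
  "ldist X \<equiv> mdist (lmet X)"

abbreviation ltop :: "'a lpls \<Rightarrow> 'a topology" where
  "ltop X \<equiv> mtopology_of (lmet X)"

text \<open>The values of the relations and of the time separation outside the
  underlying set are irrelevant.\<close>

definition is_lpls :: "'a lpls \<Rightarrow> bool" where
  "is_lpls X \<longleftrightarrow>
     (\<forall>p\<in>lpts X. \<forall>q\<in>lpts X. \<forall>r\<in>lpts X. lchron X p q \<longrightarrow> lchron X q r \<longrightarrow> lchron X p r) \<and>
     (\<forall>p\<in>lpts X. \<forall>q\<in>lpts X. \<forall>r\<in>lpts X. lcaus X p q \<longrightarrow> lcaus X q r \<longrightarrow> lcaus X p r) \<and>
     (\<forall>p\<in>lpts X. \<forall>q\<in>lpts X. lchron X p q \<longrightarrow> lcaus X p q) \<and>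
     (\<forall>p\<in>lpts X. lcaus X p p) \<and>
     (\<forall>c. openin (prod_topology (ltop X) (ltop X)) {(p, q) \<in> lpts X \<times> lpts X. c < ltau X p q}) \<and>
     (\<forall>p\<in>lpts X. \<forall>q\<in>lpts X. \<forall>r\<in>lpts X.
        lcaus X p q \<longrightarrow> lcaus X q r \<longrightarrow> ltau X p q + ltau X q r \<le> ltau X p r) \<and>
     (\<forall>p\<in>lpts X. \<forall>q\<in>lpts X. 0 < ltau X p q \<longleftrightarrow> lchron X p q)"

definition chron_future :: "'a lpls \<Rightarrow> 'a \<Rightarrow> 'a set" where
  "chron_future X p = {q \<in> lpts X. p \<in> lpts X \<and> lchron X p q}"

definition chron_past :: "'a lpls \<Rightarrow> 'a \<Rightarrow> 'a set" where
  "chron_past X q = {p \<in> lpts X. q \<in> lpts X \<and> lchron X p q}"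

definition caus_future :: "'a lpls \<Rightarrow> 'a \<Rightarrow> 'a set" where
  "caus_future X p = {q \<in> lpts X. p \<in> lpts X \<and> lcaus X p q}"

definition caus_past :: "'a lpls \<Rightarrow> 'a \<Rightarrow> 'a set" where
  "caus_past X q = {p \<in> lpts X. q \<in> lpts X \<and> lcaus X p q}"

definition chron_diamond :: "'a lpls \<Rightarrow> 'a \<Rightarrow> 'a \<Rightarrow> 'a set" where
  "chron_diamond X p q = chron_future X p \<inter> chron_past X q"

definition caus_diamond :: "'a lpls \<Rightarrow> 'a \<Rightarrow> 'a \<Rightarrow> 'a set" where
  "caus_diamond X p q = caus_future X p \<inter> caus_past X q"

definition lrestrict :: "'a lpls \<Rightarrow> 'a set \<Rightarrow> 'a lpls" where
  "lrestrict X A = X\<lparr>lmet := submetric (lmet X) A\<rparr>"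

definition lreverse :: "'a lpls \<Rightarrow> 'a lpls" where
  "lreverse X = X\<lparr>lchron := \<lambda>p q. lchron X q p, lcaus := \<lambda>p q. lcaus X q p,
                  ltau := \<lambda>p q. ltau X q p\<rparr>"

definition tau_diam :: "'a lpls \<Rightarrow> 'a set \<Rightarrow> ennreal" where
  "tau_diam X S = (SUP (p, q) \<in> S \<times> S. ltau X p q)"


section \<open>Curves\<close>

definition curve_length :: "'a metric \<Rightarrow> real set \<Rightarrow> (real \<Rightarrow> 'a) \<Rightarrow> ennreal" where
  "curve_length m I \<gamma> =
     (SUP (n, t) \<in> {(n, t :: nat \<Rightarrow> real). mono_on {..n} t \<and> t ` {..n} \<subseteq> I}.
        \<Sum>i<n. ennreal (mdist m (\<gamma> (t i)) (\<gamma> (t (Suc i)))))"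

definition loc_lipschitz :: "'a metric \<Rightarrow> real set \<Rightarrow> (real \<Rightarrow> 'a) \<Rightarrow> bool" where
  "loc_lipschitz m I \<gamma> \<longleftrightarrow>
     (\<forall>u\<in>I. \<exists>\<delta>>0. \<exists>C. \<forall>s\<in>I. \<forall>t\<in>I. \<bar>s - u\<bar> < \<delta> \<longrightarrow> \<bar>t - u\<bar> < \<delta> \<longrightarrow>
        mdist m (\<gamma> s) (\<gamma> t) \<le> C * \<bar>s - t\<bar>)"

text \<open>All curves below are future directed.\<close>

definition lip_curve :: "'a lpls \<Rightarrow> real set \<Rightarrow> (real \<Rightarrow> 'a) \<Rightarrow> bool" where
  "lip_curve X I \<gamma> \<longleftrightarrow> is_interval I \<and> \<gamma> \<in> I \<rightarrow> lpts X \<and> loc_lipschitz (lmet X) I \<gamma> \<and>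
     (\<exists>s\<in>I. \<exists>t\<in>I. \<gamma> s \<noteq> \<gamma> t)"

definition causal_curve :: "'a lpls \<Rightarrow> real set \<Rightarrow> (real \<Rightarrow> 'a) \<Rightarrow> bool" where
  "causal_curve X I \<gamma> \<longleftrightarrow> lip_curve X I \<gamma> \<and>
     (\<forall>s\<in>I. \<forall>t\<in>I. s < t \<longrightarrow> lcaus X (\<gamma> s) (\<gamma> t))"

definition timelike_curve :: "'a lpls \<Rightarrow> real set \<Rightarrow> (real \<Rightarrow> 'a) \<Rightarrow> bool" where
  "timelike_curve X I \<gamma> \<longleftrightarrow> lip_curve X I \<gamma> \<and>
     (\<forall>s\<in>I. \<forall>t\<in>I. s < t \<longrightarrow> lchron X (\<gamma> s) (\<gamma> t))"

definition null_curve :: "'a lpls \<Rightarrow> real set \<Rightarrow> (real \<Rightarrow> 'a) \<Rightarrow> bool" where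
  "null_curve X I \<gamma> \<longleftrightarrow> causal_curve X I \<gamma> \<and> (\<forall>s\<in>I. \<forall>t\<in>I. \<not> lchron X (\<gamma> s) (\<gamma> t))"

definition Ltau :: "'a lpls \<Rightarrow> real \<Rightarrow> real \<Rightarrow> (real \<Rightarrow> 'a) \<Rightarrow> ennreal" where
  "Ltau X a b \<gamma> =
     (INF (n, t) \<in> {(n, t :: nat \<Rightarrow> real). t 0 = a \<and> t n = b \<and> strict_mono_on {..n} t}.
        \<Sum>i<n. ltau X (\<gamma> (t i)) (\<gamma> (t (Suc i))))"

text \<open>Curves with two prescribed endpoints are parametrized on the unit interval; affine
  reparametrization shows that this is no restriction.\<close>

definition causal_from_to :: "'a lpls \<Rightarrow> 'a \<Rightarrow> 'a \<Rightarrow> (real \<Rightarrow> 'a) \<Rightarrow> bool" where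
  "causal_from_to X p q \<gamma> \<longleftrightarrow> causal_curve X {0..1} \<gamma> \<and> \<gamma> 0 = p \<and> \<gamma> 1 = q"

definition timelike_from_to :: "'a lpls \<Rightarrow> 'a \<Rightarrow> 'a \<Rightarrow> (real \<Rightarrow> 'a) \<Rightarrow> bool" where
  "timelike_from_to X p q \<gamma> \<longleftrightarrow> timelike_curve X {0..1} \<gamma> \<and> \<gamma> 0 = p \<and> \<gamma> 1 = q"


section \<open>Lorentzian length spaces\<close>

definition causally_path_connected :: "'a lpls \<Rightarrow> bool" where
  "causally_path_connected X \<longleftrightarrow> (\<forall>p\<in>lpts X. \<forall>q\<in>lpts X.
     (lchron X p q \<longrightarrow> (\<exists>\<gamma>. timelike_from_to X p q \<gamma>)) \<and>
     (lcaus X p q \<and> p \<noteq> q \<longrightarrow> (\<exists>\<gamma>. causal_from_to X p q \<gamma>)))"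

definition locally_causally_closed :: "'a lpls \<Rightarrow> bool" where
  "locally_causally_closed X \<longleftrightarrow> (\<forall>x\<in>lpts X. \<exists>U V. openin (ltop X) V \<and> x \<in> V \<and> V \<subseteq> U \<and> U \<subseteq> lpts X \<and>
     (\<forall>(p :: nat \<Rightarrow> _) q p' q'. range p \<subseteq> U \<longrightarrow> range q \<subseteq> U \<longrightarrow> (\<forall>n. lcaus X (p n) (q n)) \<longrightarrow>
        limitin (ltop X) p p' sequentially \<longrightarrow> limitin (ltop X) q q' sequentially \<longrightarrow>
        p' \<in> (ltop X) closure_of U \<longrightarrow> q' \<in> (ltop X) closure_of U \<longrightarrow> lcaus X p' q'))"

definition intrinsic :: "'a lpls \<Rightarrow> bool" where
  "intrinsic X \<longleftrightarrow> (\<forall>p\<in>lpts X. \<forall>q\<in>lpts X. lcaus X p q \<longrightarrow>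
     ltau X p q = (SUP \<gamma> \<in> {\<gamma>. causal_from_to X p q \<gamma>}. Ltau X 0 1 \<gamma>))"

text \<open>\<open>G p q\<close> is the maximizing curve from \<open>p\<close> to \<open>q\<close> inside the neighbourhood \<open>\<Omega>\<close>,
  and \<open>\<omega>\<close> the local time separation.\<close>

definition localizing_nbhd ::
  "'a lpls \<Rightarrow> 'a set \<Rightarrow> ('a \<Rightarrow> 'a \<Rightarrow> real) \<Rightarrow> ('a \<Rightarrow> 'a \<Rightarrow> real \<Rightarrow> 'a) \<Rightarrow> bool" where
  "localizing_nbhd X \<Omega> \<omega> G \<longleftrightarrow>
     openin (ltop X) \<Omega> \<and>
     (\<exists>C::real. \<forall>I \<gamma>. causal_curve X I \<gamma> \<and> \<gamma> ` I \<subseteq> \<Omega> \<longrightarrow> curve_length (lmet X) I \<gamma> \<le> ennreal C) \<and>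
     (\<forall>p\<in>\<Omega>. \<forall>q\<in>\<Omega>. 0 \<le> \<omega> p q) \<and>
     continuous_map (prod_topology (subtopology (ltop X) \<Omega>) (subtopology (ltop X) \<Omega>)) euclideanreal
       (\<lambda>(p, q). \<omega> p q) \<and>
     is_lpls ((lrestrict X \<Omega>)\<lparr>ltau := \<lambda>p q. ennreal (\<omega> p q)\<rparr>) \<and>
     (\<forall>y\<in>\<Omega>. chron_future X y \<inter> \<Omega> \<noteq> {} \<and> chron_past X y \<inter> \<Omega> \<noteq> {}) \<and>
     (\<forall>p\<in>\<Omega>. \<forall>q\<in>\<Omega>. lcaus X p q \<and> p \<noteq> q \<longrightarrow>
        causal_from_to X p q (G p q) \<and> G p q ` {0..1} \<subseteq> \<Omega> \<and>
        (\<forall>\<gamma>. causal_from_to X p q \<gamma> \<and> \<gamma> ` {0..1} \<subseteq> \<Omega> \<longrightarrow> Ltau X 0 1 \<gamma> \<le> Ltau X 0 1 (G p q)) \<and>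
        Ltau X 0 1 (G p q) = ennreal (\<omega> p q) \<and> ennreal (\<omega> p q) \<le> ltau X p q)"

definition regular_nbhd ::
  "'a lpls \<Rightarrow> 'a set \<Rightarrow> ('a \<Rightarrow> 'a \<Rightarrow> real \<Rightarrow> 'a) \<Rightarrow> bool" where
  "regular_nbhd X \<Omega> G \<longleftrightarrow>
     (\<forall>p\<in>\<Omega>. \<forall>q\<in>\<Omega>. lchron X p q \<longrightarrow>
        timelike_from_to X p q (G p q) \<and>
        (\<forall>\<gamma>. causal_from_to X p q \<gamma> \<and> \<gamma> ` {0..1} \<subseteq> \<Omega> \<and>
             (\<exists>s t. 0 \<le> s \<and> s < t \<and> t \<le> 1 \<and> null_curve X {s..t} \<gamma>) \<longrightarrow>
             Ltau X 0 1 \<gamma> < Ltau X 0 1 (G p q)))"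

definition localizable :: "'a lpls \<Rightarrow> bool" where
  "localizable X \<longleftrightarrow> (\<forall>x\<in>lpts X. \<exists>\<Omega> \<omega> G. x \<in> \<Omega> \<and> localizing_nbhd X \<Omega> \<omega> G)"

definition regularly_localizable :: "'a lpls \<Rightarrow> bool" where
  "regularly_localizable X \<longleftrightarrow>
     (\<forall>x\<in>lpts X. \<exists>\<Omega> \<omega> G. x \<in> \<Omega> \<and> localizing_nbhd X \<Omega> \<omega> G \<and> regular_nbhd X \<Omega> G)"

definition lorentzian_length_space :: "'a lpls \<Rightarrow> bool" where
  "lorentzian_length_space X \<longleftrightarrow> is_lpls X \<and> causally_path_connected X \<and>
     locally_causally_closed X \<and> intrinsic X \<and> localizable X"

definition regular_lorentzian_length_space :: "'a lpls \<Rightarrow> bool" where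
  "regular_lorentzian_length_space X \<longleftrightarrow> lorentzian_length_space X \<and> regularly_localizable X"

definition globally_hyperbolic :: "'a lpls \<Rightarrow> bool" where
  "globally_hyperbolic X \<longleftrightarrow>
     (\<forall>p\<in>lpts X. \<forall>q\<in>lpts X. compactin (ltop X) (caus_diamond X p q)) \<and>
     (\<forall>C. compactin (ltop X) C \<longrightarrow>
        (\<exists>B::real. \<forall>I \<gamma>. causal_curve X I \<gamma> \<and> \<gamma> ` I \<subseteq> C \<longrightarrow> curve_length (lmet X) I \<gamma> \<le> ennreal B))"

text \<open>A distance realiser parametrized by proper time need not be locally Lipschitz, so a
  timelike geodesic on \<open>[0,\<epsilon>)\<close> is a reparametrization \<open>\<sigma> \<circ> \<phi>\<close> of a locally Lipschitz
  distance realiser \<open>\<sigma>\<close>, whose domain can be taken to be \<open>[0,1)\<close>.\<close>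

definition timelike_geodesic :: "'a lpls \<Rightarrow> real \<Rightarrow> (real \<Rightarrow> 'a) \<Rightarrow> bool" where
  "timelike_geodesic X \<epsilon> \<gamma> \<longleftrightarrow>
     (\<exists>\<sigma> \<phi>. causal_curve X {0..<1} \<sigma> \<and>
        (\<forall>s t. 0 \<le> s \<and> s < t \<and> t < 1 \<longrightarrow> Ltau X s t \<sigma> = ltau X (\<sigma> s) (\<sigma> t)) \<and>
        strict_mono_on {0..<\<epsilon>} \<phi> \<and> \<phi> ` {0..<\<epsilon>} = {0..<1} \<and>
        (\<forall>s\<in>{0..<\<epsilon>}. \<gamma> s = \<sigma> (\<phi> s))) \<and>
     (\<forall>s t. 0 \<le> s \<and> s < t \<and> t < \<epsilon> \<longrightarrow> ltau X (\<gamma> s) (\<gamma> t) = ennreal (t - s))"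

definition timelike_nonbranching :: "'a lpls \<Rightarrow> bool" where
  "timelike_nonbranching X \<longleftrightarrow>
     (\<forall>\<epsilon> t \<gamma> \<eta>. 0 < t \<and> t < \<epsilon> \<and> timelike_geodesic X \<epsilon> \<gamma> \<and> timelike_geodesic X \<epsilon> \<eta> \<and>
        (\<forall>s\<in>{0..t}. \<gamma> s = \<eta> s) \<longrightarrow> (\<forall>s\<in>{0..<\<epsilon>}. \<gamma> s = \<eta> s))"


section \<open>Generalized cones\<close>

definition length_space :: "'a metric \<Rightarrow> bool" where
  "length_space Y \<longleftrightarrow> (\<forall>y\<in>mspace Y. \<forall>z\<in>mspace Y.
     ennreal (mdist Y y z) =
       (INF \<beta> \<in> {\<beta>. continuous_map (top_of_set {0..1}) (mtopology_of Y) \<beta> \<and> \<beta> 0 = y \<and> \<beta> 1 = z}.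
          curve_length Y {0..1} \<beta>))"

definition cone_metric :: "real set \<Rightarrow> 'y metric \<Rightarrow> (real \<times> 'y) metric" where
  "cone_metric J Y = metric (J \<times> mspace Y, \<lambda>(t, y) (t', y'). \<bar>t - t'\<bar> + mdist Y y y')"

lemma Metric_space_cone_metric:
  "Metric_space (J \<times> mspace Y) (\<lambda>(t, y) (t', y'). \<bar>t - t'\<bar> + mdist Y y y')"
proof (unfold_locales, goal_cases)
  case (3 x y)
  then show ?case
    by (auto simp: add_nonneg_eq_0_iff)
next
  case (4 x y z)
  then obtain a b c u v w where
    "x = (a, u)" "y = (b, v)" "z = (c, w)" "u \<in> mspace Y" "v \<in> mspace Y" "w \<in> mspace Y"
    by auto
  moreover have "\<bar>a - c\<bar> \<le> \<bar>a - b\<bar> + \<bar>b - c\<bar>" by simp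
  moreover have "mdist Y u w \<le> mdist Y u v + mdist Y v w"
    using calculation mdist_triangle by metis
  ultimately show ?case by simp
qed (auto simp: mdist_commute)

lemma mspace_cone_metric [simp]: "mspace (cone_metric J Y) = J \<times> mspace Y"
  and mdist_cone_metric [simp]:
    "mdist (cone_metric J Y) (t, y) (t', y') = \<bar>t - t'\<bar> + mdist Y y y'"
  using Metric_space_cone_metric[of J Y]
  by (simp_all add: cone_metric_def Metric_space.mspace_metric Metric_space.mdist_metric)

definition abs_continuous :: "'a metric \<Rightarrow> (real \<Rightarrow> 'a) \<Rightarrow> bool" where
  "abs_continuous m \<gamma> \<longleftrightarrow> (\<forall>\<epsilon>>0. \<exists>\<delta>>0. \<forall>(n::nat) u v.
     (\<forall>i<n. 0 \<le> u i \<and> u i \<le> v i \<and> v i \<le> 1) \<longrightarrow>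
     (\<forall>i<n. \<forall>j<n. i \<noteq> j \<longrightarrow> {u i<..<v i} \<inter> {u j<..<v j} = {}) \<longrightarrow>
     (\<Sum>i<n. v i - u i) < \<delta> \<longrightarrow> (\<Sum>i<n. mdist m (\<gamma> (u i)) (\<gamma> (v i))) < \<epsilon>)"

text \<open>Derivatives of absolutely continuous curves exist almost everywhere; the arbitrary values
  of \<open>Lim\<close> and \<open>deriv\<close> elsewhere are irrelevant below.\<close>

definition metric_deriv :: "'a metric \<Rightarrow> (real \<Rightarrow> 'a) \<Rightarrow> real \<Rightarrow> real" where
  "metric_deriv m \<beta> t = Lim (at t) (\<lambda>s. mdist m (\<beta> s) (\<beta> t) / \<bar>s - t\<bar>)"

definition cone_form :: "'y metric \<Rightarrow> (real \<Rightarrow> real) \<Rightarrow> (real \<Rightarrow> real \<times> 'y) \<Rightarrow> real \<Rightarrow> real" where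
  "cone_form Y f \<gamma> t =
     - (deriv (fst \<circ> \<gamma>) t)\<^sup>2 + (f (fst (\<gamma> t)))\<^sup>2 * (metric_deriv Y (snd \<circ> \<gamma>) t)\<^sup>2"

definition cone_curve :: "real set \<Rightarrow> 'y metric \<Rightarrow> (real \<Rightarrow> real \<times> 'y) \<Rightarrow> real \<times> 'y \<Rightarrow> real \<times> 'y \<Rightarrow> bool" where
  "cone_curve J Y \<gamma> x x' \<longleftrightarrow> \<gamma> \<in> {0..1} \<rightarrow> J \<times> mspace Y \<and> abs_continuous (cone_metric J Y) \<gamma> \<and>
     strict_mono_on {0..1} (fst \<circ> \<gamma>) \<and> \<gamma> 0 = x \<and> \<gamma> 1 = x'"

definition cone_timelike ::
  "real set \<Rightarrow> 'y metric \<Rightarrow> (real \<Rightarrow> real) \<Rightarrow> (real \<Rightarrow> real \<times> 'y) \<Rightarrow> real \<times> 'y \<Rightarrow> real \<times> 'y \<Rightarrow> bool" where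
  "cone_timelike J Y f \<gamma> x x' \<longleftrightarrow> cone_curve J Y \<gamma> x x' \<and>
     (AE t in lebesgue_on {0..1}. cone_form Y f \<gamma> t < 0)"

definition cone_causal ::
  "real set \<Rightarrow> 'y metric \<Rightarrow> (real \<Rightarrow> real) \<Rightarrow> (real \<Rightarrow> real \<times> 'y) \<Rightarrow> real \<times> 'y \<Rightarrow> real \<times> 'y \<Rightarrow> bool" where
  "cone_causal J Y f \<gamma> x x' \<longleftrightarrow> cone_curve J Y \<gamma> x x' \<and>
     (AE t in lebesgue_on {0..1}. cone_form Y f \<gamma> t \<le> 0)"

definition cone_length :: "'y metric \<Rightarrow> (real \<Rightarrow> real) \<Rightarrow> (real \<Rightarrow> real \<times> 'y) \<Rightarrow> ennreal" where
  "cone_length Y f \<gamma> = (\<integral>\<^sup>+ t. ennreal (sqrt (- cone_form Y f \<gamma> t)) \<partial>lebesgue_on {0..1})"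

definition generalized_cone :: "real set \<Rightarrow> 'y metric \<Rightarrow> (real \<Rightarrow> real) \<Rightarrow> (real \<times> 'y) lpls" where
  "generalized_cone J Y f =
     \<lparr>lmet = cone_metric J Y,
      lchron = \<lambda>x x'. \<exists>\<gamma>. cone_timelike J Y f \<gamma> x x',
      lcaus = \<lambda>x x'. x = x' \<or> (\<exists>\<gamma>. cone_causal J Y f \<gamma> x x'),
      ltau = \<lambda>x x'. SUP \<gamma> \<in> {\<gamma>. cone_causal J Y f \<gamma> x x'}. cone_length Y f \<gamma>\<rparr>"


section \<open>Model spaces and triangle comparison\<close>

definition model_diam :: "real \<Rightarrow> ennreal" where
  "model_diam k = (if k < 0 then ennreal (pi / sqrt (- k)) else \<top>)"

text \<open>\<open>model_form k\<close> is the inner product of $\mathbb R^3_1$ for \<open>k \<ge> 0\<close> and of $\mathbb R^3_2$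
  for \<open>k < 0\<close>. The underlying manifold of the model space is the plane with coordinates
  \<open>(t, x)\<close>; for \<open>k \<noteq> 0\<close> the map \<open>model_map k\<close> is the universal covering of the
  quadric \<open>model_form k v = 1/k\<close>, for \<open>k = 0\<close> it is the inclusion of the Minkowski
  plane. The metric is the pullback along \<open>model_map k\<close>, and the time orientation is the one for
  which the coordinate \<open>t\<close> increases.\<close>

definition model_form :: "real \<Rightarrow> real \<times> real \<times> real \<Rightarrow> real" where
  "model_form k = (\<lambda>(a, b, c). if k < 0 then - a\<^sup>2 - b\<^sup>2 + c\<^sup>2 else - a\<^sup>2 + b\<^sup>2 + c\<^sup>2)"

definition model_map :: "real \<Rightarrow> real \<times> real \<Rightarrow> real \<times> real \<times> real" where
  "model_map k = (\<lambda>(t, x).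
     if k = 0 then (t, x, 0)
     else if k > 0 then (1 / sqrt k) *\<^sub>R (sinh t, cosh t * cos x, cosh t * sin x)
     else (1 / sqrt (- k)) *\<^sub>R (cosh x * cos t, cosh x * sin t, sinh x))"

lemma model_form_model_map:
  assumes "k \<noteq> 0"
  shows "model_form k (model_map k p) = 1 / k"
proof (cases p)
  case (Pair t x)
  have *: "cosh u ^ 2 = 1 + sinh u ^ 2" "cos u ^ 2 = 1 - sin u ^ 2" for u :: real
    by (simp_all add: cosh_square_eq cos_squared_eq)
  show ?thesis
    using assms Pair
    by (simp add: model_form_def model_map_def power_mult_distrib power_divide * field_simps)
qed

definition model_velocity :: "real \<Rightarrow> (real \<Rightarrow> real \<times> real) \<Rightarrow> real \<Rightarrow> real \<times> real \<times> real" where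
  "model_velocity k \<gamma> u = vector_derivative (model_map k \<circ> \<gamma>) (at u)"

text \<open>Future directed, piecewise continuously differentiable curves whose velocity \<open>v\<close> satisfies
  \<open>P (model_form k v)\<close>.\<close>

definition model_curve ::
  "real \<Rightarrow> (real \<Rightarrow> bool) \<Rightarrow> real \<times> real \<Rightarrow> real \<times> real \<Rightarrow> (real \<Rightarrow> real \<times> real) \<Rightarrow> bool" where
  "model_curve k P p q \<gamma> \<longleftrightarrow> continuous_on {0..1} \<gamma> \<and> \<gamma> 0 = p \<and> \<gamma> 1 = q \<and>
     (\<exists>S. finite S \<and> \<gamma> C1_differentiable_on ({0..1} - S) \<and>
        (\<forall>u\<in>{0..1} - S. 0 < fst (vector_derivative \<gamma> (at u)) \<and>
           P (model_form k (model_velocity k \<gamma> u))))"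

definition model_length :: "real \<Rightarrow> (real \<Rightarrow> real \<times> real) \<Rightarrow> ennreal" where
  "model_length k \<gamma> =
     (\<integral>\<^sup>+ u. ennreal (sqrt (- model_form k (model_velocity k \<gamma> u))) \<partial>lebesgue_on {0..1})"

text \<open>The background metric only enters through the notion of a locally Lipschitz curve, for which
  every metric induced by a Riemannian metric on the plane gives the same result.\<close>

definition model_space :: "real \<Rightarrow> (real \<times> real) lpls" where
  "model_space k =
     \<lparr>lmet = euclidean_metric,
      lchron = \<lambda>p q. \<exists>\<gamma>. model_curve k (\<lambda>r. r < 0) p q \<gamma>,
      lcaus = \<lambda>p q. p = q \<or> (\<exists>\<gamma>. model_curve k (\<lambda>r. r \<le> 0) p q \<gamma>),
      ltau = \<lambda>p q. SUP \<gamma> \<in> {\<gamma>. model_curve k (\<lambda>r. r \<le> 0) p q \<gamma>}. model_length k \<gamma>\<rparr>"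

definition realiser_side :: "'a lpls \<Rightarrow> 'a \<Rightarrow> 'a \<Rightarrow> (real \<Rightarrow> 'a) \<Rightarrow> bool" where
  "realiser_side X p q \<gamma> \<longleftrightarrow>
     (causal_curve X {0..1} \<gamma> \<or> (\<forall>t\<in>{0..1}. \<gamma> t = p)) \<and> \<gamma> 0 = p \<and> \<gamma> 1 = q \<and>
     Ltau X 0 1 \<gamma> = ltau X p q"

definition sides :: "(nat \<times> nat) set" where
  "sides = {(1, 2), (2, 3), (1, 3)}"

text \<open>The vertices are \<open>v 1\<close>, \<open>v 2\<close>, \<open>v 3\<close>; the side from \<open>v i\<close> to \<open>v j\<close>
  is \<open>c i j\<close>, for \<open>(i, j) \<in> sides\<close>.\<close>

definition admissible_triangle :: "'a lpls \<Rightarrow> (nat \<Rightarrow> 'a) \<Rightarrow> (nat \<Rightarrow> nat \<Rightarrow> real \<Rightarrow> 'a) \<Rightarrow> bool" where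
  "admissible_triangle X v c \<longleftrightarrow>
     v 1 \<in> lpts X \<and> v 2 \<in> lpts X \<and> v 3 \<in> lpts X \<and>
     (lchron X (v 1) (v 2) \<and> lcaus X (v 2) (v 3) \<or> lcaus X (v 1) (v 2) \<and> lchron X (v 2) (v 3)) \<and>
     (\<forall>(i, j)\<in>sides. ltau X (v i) (v j) < \<top> \<and> realiser_side X (v i) (v j) (c i j))"

definition comparison_triangle ::
  "real \<Rightarrow> 'a lpls \<Rightarrow> (nat \<Rightarrow> 'a) \<Rightarrow> (nat \<Rightarrow> real \<times> real) \<Rightarrow> (nat \<Rightarrow> nat \<Rightarrow> real \<Rightarrow> real \<times> real) \<Rightarrow> bool" where
  "comparison_triangle k X v v' c' \<longleftrightarrow> admissible_triangle (model_space k) v' c' \<and>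
     (\<forall>(i, j)\<in>sides. ltau (model_space k) (v' i) (v' j) = ltau X (v i) (v j))"

text \<open>\<open>p\<close> lies on a timelike side of the triangle \<open>(v, c)\<close> and corresponds to \<open>p'\<close> on
  the same side of the triangle \<open>(v', c')\<close>.\<close>

definition corresponding ::
  "real \<Rightarrow> 'a lpls \<Rightarrow> (nat \<Rightarrow> 'a) \<Rightarrow> (nat \<Rightarrow> nat \<Rightarrow> real \<Rightarrow> 'a) \<Rightarrow>
   (nat \<Rightarrow> real \<times> real) \<Rightarrow> (nat \<Rightarrow> nat \<Rightarrow> real \<Rightarrow> real \<times> real) \<Rightarrow> 'a \<Rightarrow> real \<times> real \<Rightarrow> bool" where
  "corresponding k X v c v' c' p p' \<longleftrightarrow>
     (\<exists>(i, j)\<in>sides. lchron X (v i) (v j) \<and> p \<in> c i j ` {0..1} \<and> p' \<in> c' i j ` {0..1} \<and>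
        ltau (model_space k) (v' i) p' = ltau X (v i) p)"

definition global_TCBA :: "real \<Rightarrow> 'a lpls \<Rightarrow> bool" where
  "global_TCBA k X \<longleftrightarrow>
     (\<forall>v c v' c' p q p' q'.
        admissible_triangle X v c \<and> (\<forall>(i, j)\<in>sides. ltau X (v i) (v j) < model_diam k) \<and>
        comparison_triangle k X v v' c' \<and>
        corresponding k X v c v' c' p p' \<and> corresponding k X v c v' c' q q' \<longrightarrow>
        ltau (model_space k) p' q' \<le> ltau X p q)"


section \<open>The entropic timelike measure contraction property\<close>

definition borel_of :: "'a topology \<Rightarrow> 'a measure" where
  "borel_of T = sigma (topspace T) {U. openin T U}"

definition radon_measure :: "'a topology \<Rightarrow> 'a measure \<Rightarrow> bool" where
  "radon_measure T m \<longleftrightarrow> sets m = sets (borel_of T) \<and>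
     (\<forall>x\<in>topspace T. \<exists>U. openin T U \<and> x \<in> U \<and> emeasure m U < \<top>) \<and>
     (\<forall>A\<in>sets m. emeasure m A = (SUP C \<in> {C \<in> sets m. compactin T C \<and> C \<subseteq> A}. emeasure m C))"

definition full_support :: "'a topology \<Rightarrow> 'a measure \<Rightarrow> bool" where
  "full_support T m \<longleftrightarrow> (\<forall>U. openin T U \<and> U \<noteq> {} \<longrightarrow> 0 < emeasure m U)"

definition borel_prob :: "'a lpls \<Rightarrow> 'a measure \<Rightarrow> bool" where
  "borel_prob X \<mu> \<longleftrightarrow> sets \<mu> = sets (borel_of (ltop X)) \<and> prob_space \<mu>"

definition compactly_supported :: "'a lpls \<Rightarrow> 'a measure \<Rightarrow> bool" where
  "compactly_supported X \<mu> \<longleftrightarrow> (\<exists>C. compactin (ltop X) C \<and> C \<in> sets \<mu> \<and> emeasure \<mu> (space \<mu> - C) = 0)"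

definition causal_couplings :: "'a lpls \<Rightarrow> 'a measure \<Rightarrow> 'a measure \<Rightarrow> ('a \<times> 'a) measure set" where
  "causal_couplings X \<mu> \<nu> =
     {\<pi>. sets \<pi> = sets (borel_of (prod_topology (ltop X) (ltop X))) \<and>
         distr \<pi> (borel_of (ltop X)) fst = \<mu> \<and> distr \<pi> (borel_of (ltop X)) snd = \<nu> \<and>
         (AE z in \<pi>. lcaus X (fst z) (snd z))}"

text \<open>Used for exponents \<open>a > 0\<close> only.\<close>

definition enn_powr :: "ennreal \<Rightarrow> real \<Rightarrow> ennreal" where
  "enn_powr x a = (if x = \<top> then \<top> else ennreal (enn2real x powr a))"

definition lp_cost :: "'a lpls \<Rightarrow> real \<Rightarrow> 'a measure \<Rightarrow> 'a measure \<Rightarrow> ereal" where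
  "lp_cost X p \<mu> \<nu> = (SUP \<pi> \<in> causal_couplings X \<mu> \<nu>.
     enn2ereal (enn_powr (\<integral>\<^sup>+ z. enn_powr (ltau X (fst z) (snd z)) p \<partial>\<pi>) (1 / p)))"

definition lp_geodesic :: "'a lpls \<Rightarrow> real \<Rightarrow> (real \<Rightarrow> 'a measure) \<Rightarrow> bool" where
  "lp_geodesic X p \<mu> \<longleftrightarrow> (\<forall>t\<in>{0..1}. borel_prob X (\<mu> t)) \<and>
     (\<forall>s t. 0 \<le> s \<and> s < t \<and> t \<le> 1 \<longrightarrow>
        lp_cost X p (\<mu> s) (\<mu> t) = ereal (t - s) * lp_cost X p (\<mu> 0) (\<mu> 1) \<and>
        0 < lp_cost X p (\<mu> s) (\<mu> t) \<and> lp_cost X p (\<mu> s) (\<mu> t) < \<infinity>)"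

text \<open>\<open>density m (RN_deriv m \<mu>) = \<mu>\<close> holds iff \<open>\<mu>\<close> has some density with respect to \<open>m\<close>.\<close>

definition Ent :: "'a measure \<Rightarrow> 'a measure \<Rightarrow> ereal" where
  "Ent m \<mu> =
     (let g = (\<lambda>x. enn2real (RN_deriv m \<mu> x) * ln (enn2real (RN_deriv m \<mu> x)));
          P = (\<integral>\<^sup>+ x. ennreal (g x) \<partial>m);
          Q = (\<integral>\<^sup>+ x. ennreal (- g x) \<partial>m)
      in if density m (RN_deriv m \<mu>) = \<mu> \<and> P < \<top> then enn2ereal P - enn2ereal Q else \<infinity>)"

definition exp_ereal :: "ereal \<Rightarrow> ennreal" where
  "exp_ereal x = (if x = \<infinity> then \<top> else if x = - \<infinity> then 0 else ennreal (exp (real_of_ereal x)))"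

definition entropy_power :: "real \<Rightarrow> 'a measure \<Rightarrow> 'a measure \<Rightarrow> ennreal" where
  "entropy_power N m \<mu> = exp_ereal (- Ent m \<mu> / ereal N)"

definition sigma_coeff :: "real \<Rightarrow> real \<Rightarrow> real \<Rightarrow> ennreal" where
  "sigma_coeff \<kappa> t \<theta> =
     (if \<kappa> * \<theta>\<^sup>2 \<ge> pi\<^sup>2 then \<top>
      else if \<kappa> * \<theta>\<^sup>2 > 0 then ennreal (sin (t * sqrt \<kappa> * \<theta>) / sin (sqrt \<kappa> * \<theta>))
      else if \<kappa> * \<theta>\<^sup>2 = 0 then ennreal t
      else ennreal (sinh (t * sqrt (- \<kappa>) * \<theta>) / sinh (sqrt (- \<kappa>) * \<theta>)))"

text \<open>The $L^2$-norm of \<open>\<tau>(\<cdot>, x)\<close>, for spaces of finite timelike diameter (where it is finite).\<close>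

definition tau_L2 :: "'a lpls \<Rightarrow> 'a measure \<Rightarrow> 'a \<Rightarrow> real" where
  "tau_L2 X \<mu> x = sqrt (enn2real (\<integral>\<^sup>+ y. (ltau X y x)\<^sup>2 \<partial>\<mu>))"

definition TMCPe :: "real \<Rightarrow> real \<Rightarrow> 'a lpls \<Rightarrow> 'a measure \<Rightarrow> bool" where
  "TMCPe K N X m \<longleftrightarrow>
     (\<forall>\<mu>\<^sub>0. \<forall>x\<^sub>1\<in>lpts X.
        borel_prob X \<mu>\<^sub>0 \<and> compactly_supported X \<mu>\<^sub>0 \<and> \<bar>Ent m \<mu>\<^sub>0\<bar> < \<infinity> \<and> (AE x in \<mu>\<^sub>0. lchron X x x\<^sub>1) \<longrightarrow>
        (\<exists>p \<mu>. 0 < p \<and> p < 1 \<and> lp_geodesic X p \<mu> \<and> \<mu> 0 = \<mu>\<^sub>0 \<and> \<mu> 1 = return (borel_of (ltop X)) x\<^sub>1 \<and>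
           (\<forall>t\<in>{0..<1}. sigma_coeff (K / N) (1 - t) (tau_L2 X \<mu>\<^sub>0 x\<^sub>1) * entropy_power N m \<mu>\<^sub>0 \<le> entropy_power N m (\<mu> t))))"


section \<open>Lorentzian Gromov--Hausdorff convergence\<close>

type_synonym 'a covered = "'a lpls \<times> (nat \<Rightarrow> 'a set)"

definition is_covered_lpls :: "'a covered \<Rightarrow> bool" where
  "is_covered_lpls = (\<lambda>(X, U). is_lpls X \<and> (\<forall>k. U k \<subseteq> U (Suc k)) \<and> (\<Union>k. U k) = lpts X)"

text \<open>A family of causal diamonds is represented by its set of pairs of vertices.\<close>

definition vertices :: "('a \<times> 'a) set \<Rightarrow> 'a set" where
  "vertices S = fst ` S \<union> snd ` S"

definition is_net :: "'a lpls \<Rightarrow> 'a set \<Rightarrow> real \<Rightarrow> ('a \<times> 'a) set \<Rightarrow> bool" where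
  "is_net X A \<epsilon> S \<longleftrightarrow> S \<subseteq> lpts X \<times> lpts X \<and>
     (\<forall>(p, q)\<in>S. ltau X p q \<le> ennreal \<epsilon> \<and> A \<inter> caus_diamond X p q \<noteq> {}) \<and>
     A \<subseteq> (\<Union>(p, q)\<in>S. caus_diamond X p q)"

definition correspondence :: "'a set \<Rightarrow> 'b set \<Rightarrow> ('a \<times> 'b) set \<Rightarrow> bool" where
  "correspondence V W R \<longleftrightarrow> R \<subseteq> V \<times> W \<and> fst ` R = V \<and> snd ` R = W"

text \<open>Subtraction on \<^typ>\<open>ennreal\<close> is truncated, and \<open>\<infinity> - \<infinity>\<close> is taken to be \<open>0\<close>.\<close>

definition tau_gap :: "ennreal \<Rightarrow> ennreal \<Rightarrow> ennreal" where
  "tau_gap a b = (if a = b then 0 else max (a - b) (b - a))"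

definition distortion :: "'a lpls \<Rightarrow> 'b lpls \<Rightarrow> ('a \<times> 'b) set \<Rightarrow> ennreal" where
  "distortion X Z R = (SUP ((v, w), (v', w')) \<in> R \<times> R. tau_gap (ltau X v v') (ltau Z w w'))"

text \<open>Equivalently, both nets can be indexed (with repetitions) by a common set such that
  the vertices of diamonds with the same index are related.\<close>

definition matches_diamonds :: "('a \<times> 'a) set \<Rightarrow> ('b \<times> 'b) set \<Rightarrow> ('a \<times> 'b) set \<Rightarrow> bool" where
  "matches_diamonds S T R \<longleftrightarrow>
     (\<forall>(p, q)\<in>S. \<exists>(p', q')\<in>T. (p, p') \<in> R \<and> (q, q') \<in> R) \<and>
     (\<forall>(p', q')\<in>T. \<exists>(p, q)\<in>S. (p, p') \<in> R \<and> (q, q') \<in> R)"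

definition forward_dense :: "'a lpls \<Rightarrow> 'a set \<Rightarrow> 'a set \<Rightarrow> bool" where
  "forward_dense X V A \<longleftrightarrow>
     (\<forall>x\<in>A. \<exists>v :: nat \<Rightarrow> 'a. range v \<subseteq> V \<and> (\<forall>i. lcaus X (v i) (v (Suc i)) \<and> lcaus X (v i) x) \<and>
        limitin (ltop X) v x sequentially)"

text \<open>The index \<open>l\<close> is shifted by one, i.e. the nets with index \<open>l\<close> are \<open>1/(l+1)\<close>-nets.\<close>

definition LGH_converges :: "(nat \<Rightarrow> 'a covered) \<Rightarrow> 'b covered \<Rightarrow> bool" where
  "LGH_converges Xs Z \<longleftrightarrow>
     (\<forall>k. \<exists>(Sn :: nat \<Rightarrow> nat \<Rightarrow> ('a \<times> 'a) set) (S :: nat \<Rightarrow> ('b \<times> 'b) set) (R :: nat \<Rightarrow> nat \<Rightarrow> ('a \<times> 'b) set).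
        (\<forall>l. finite (S l) \<and> is_net (fst Z) (snd Z k) (1 / real (Suc l)) (S l) \<and>
             vertices (S l) \<subseteq> vertices (S (Suc l)) \<and>
             (\<forall>\<^sub>F n in sequentially.
                finite (Sn n l) \<and> is_net (fst (Xs n)) (snd (Xs n) k) (1 / real (Suc l)) (Sn n l) \<and>
                vertices (Sn n l) \<subseteq> vertices (Sn n (Suc l)) \<and>
                correspondence (vertices (Sn n l)) (vertices (S l)) (R n l) \<and>
                R n l \<subseteq> R n (Suc l) \<and>
                matches_diamonds (Sn n l) (S l) (R n l)) \<and>
             (\<lambda>n. distortion (fst (Xs n)) (fst Z) (R n l)) \<longlonglongrightarrow> 0) \<and>
        forward_dense (fst Z) (\<Union>l. vertices (S l)) (snd Z k))"

text \<open>The limit space is realized on a subset of \<open>real\<close>. This is no restriction: in a limit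
  space every point is a limit of a sequence in a fixed countable set of vertices, so that its
  cardinality is at most that of the continuum.\<close>

definition LGH_precompact :: "'a covered set \<Rightarrow> bool" where
  "LGH_precompact \<C> \<longleftrightarrow>
     (\<forall>Xs :: nat \<Rightarrow> 'a covered. range Xs \<subseteq> \<C> \<longrightarrow>
        (\<exists>r (Z :: real covered). strict_mono r \<and> is_covered_lpls Z \<and> LGH_converges (Xs \<circ> r) Z))"

text \<open>The fibres \<open>Y\<close> are arbitrary metric spaces with points in the type \<open>'y\<close>; since countably many
  spaces always embed into a common type, sequences in the class are completely general.
  The sets of the cover, with indices starting at \<open>1\<close> in the literature, are indexed by \<open>Suc n\<close>;
  a diamond \<open>chron_diamond W p q\<close> is empty if \<open>p\<close> or \<open>q\<close> does not belong to \<open>W\<close>.\<close>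

definition cone_diamonds ::
  "real \<Rightarrow> real \<Rightarrow> real \<Rightarrow> real \<Rightarrow> real \<Rightarrow> real \<Rightarrow> (real \<times> 'y) covered set" where
  "cone_diamonds m M k K N \<Lambda> =
     {(X, U). is_covered_lpls (X, U) \<and>
        (\<exists>J (Y :: 'y metric) f s t y. \<exists>\<mm>.
           let W = generalized_cone J Y f in
           length_space Y \<and> open J \<and> is_interval J \<and> continuous_on J f \<and>
           (\<forall>r\<in>J. m \<le> f r \<and> f r \<le> M) \<and>
           regular_lorentzian_length_space W \<and> globally_hyperbolic W \<and> timelike_nonbranching W \<and>
           s \<in> J \<and> t \<in> J \<and> y \<in> mspace Y \<and>
           X = lrestrict W (chron_diamond W (s, y) (t, y)) \<and>
           tau_diam X (lpts X) \<le> ennreal \<Lambda> \<and>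
           global_TCBA k X \<and>
           radon_measure (ltop X) \<mm> \<and> full_support (ltop X) \<mm> \<and>
           TMCPe K N X \<mm> \<and> TMCPe K N (lreverse X) \<mm> \<and>
           U = (\<lambda>n. chron_diamond W (s + 1 / real (Suc n), y) (t - 1 / real (Suc n), y)))}"

end

theory Submission
  imports Defs "HOL-Library.Diagonal_Subsequence"
begin

text \<open>A generalized cone with \<open>m \<le> f \<le> M\<close> is, locally and uniformly, comparable to the product
  \<open>J \<times> Y\<close>. Transporting the normalized measure of a small cylinder to a point straight above it,
  \<open>TMCP\<^sup>e(K, N)\<close> gives a Brunn--Minkowski estimate: a cylinder of half the radius around the target has at
  least a fixed fraction of the measure. Applying this upwards and then, in the causally reversed
  space, downwards yields a doubling inequality for cylinders with the same centre, hence packing bounds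
  for balls in \<open>Y\<close>; as \<open>Y\<close> is a length space these chain to uniform covers of the
  projections of the sets \<open>U\<^sub>k\<close>, and thus to \<open>\<epsilon>\<close>-nets of \<open>U\<^sub>k\<close> of uniformly bounded cardinality
  with vertices in \<open>U\<^sub>k\<^sub>+\<^sub>1\<close>. A diagonal argument makes all time separations and causal relations between
  labelled vertices converge, and the countable set of labels carries the limit structure.\<close>

section \<open>Lebesgue differentiation on the line\<close>

text \<open>Causal curves of a cone are merely absolutely continuous and their lengths involve
  pointwise metric derivatives, so bounds on \<tau> go through differentiation almost everywhere;
  hence the measure theory on the line. The time change \<open>T\<close> then reduces chronology to
  the sign of \<open>slack\<close>, although \<open>f\<close> is only continuous.
  \<open>TMCPe\<close> provides a curve of measures, not a plan on geodesics. That intermediate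
  measures sit near the target is deduced from strict concavity of \<open>r powr p\<close>: a
  coupling charging points at the wrong ratio would lose cost. Two features of LGH convergence shape
  the nets. Vertex sets must grow while diamonds shrink, so each vertex needs partners at
  arbitrarily small time separation whose diamonds still meet the cover set: this is tameness, and
  it is why some vertices are moved to the tips of that set. Also, a cover set may be empty for some
  members of a sequence, which forces a preliminary subsequence.\<close>

lemma set_integrable_of_integrable:
  fixes g :: "real \<Rightarrow> real"
  assumes "integrable lborel g" "A \<in> sets borel"
  shows "set_integrable lborel A g"
  unfolding set_integrable_def using assms by (intro integrable_mult_indicator) auto

text \<open>Intervals on which the average of \<open>g\<close> exceeds \<open>q\<close> are chosen
  disjoint, by Vitali, inside an open \<open>U\<close> around \<open>{g < p}\<close>. If
  \<open>D\<close> is a finite union of them, then \<open>(q - p)\<close> times its length is at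
  most the integral of \<open>g - p\<close> over \<open>D\<close>, to which only the part of
  \<open>D\<close> outside \<open>{g < p}\<close> contributes positively. That part is small because
  \<open>U\<close> is tight.\<close>

lemma dense_interval_set_measure_le:
  fixes g :: "real \<Rightarrow> real" and p q n \<epsilon> :: real
  assumes g: "integrable lborel g" and "p < q" and "0 < \<epsilon>"
  defines "E \<equiv> {x \<in> {-n<..<n}. g x < p \<and> (\<forall>d>0. \<exists>u v. u < v \<and> x \<in> {u..v} \<and> v - u < d \<and>
        q * (v - u) < (LINT z:{u..v}|lborel. g z))}"
  obtains T where "E \<subseteq> T" "T \<in> lmeasurable" "measure lebesgue T \<le> \<epsilon>"
proof -
  have gm[measurable]: "g \<in> borel_measurable borel"
    using borel_measurable_integrable[OF g] by simp
  define B where "B = {x \<in> {-n<..<n}. g x < p}"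
  have Bm[measurable]: "B \<in> sets borel" unfolding B_def by measurable
  \<comment> \<open>Tightness is measured with the weight \<open>\<bar>g - p\<bar>\<close>, not by
    length, since the integral of \<open>g - p\<close> over the excess is what has to be
    small.\<close>
  define \<nu> where "\<nu> = density lborel (\<lambda>x. indicator {-n<..<n} x * ennreal \<bar>g x - p\<bar>)"
  have S: "sets \<nu> = sets borel" by (simp add: \<nu>_def)
  have int1: "set_integrable lborel {-n<..<n} (\<lambda>x. \<bar>g x - p\<bar>)"
  proof -
    have "set_integrable lborel {-n<..<n} (\<lambda>x. p)"
      unfolding set_integrable_def using emeasure_bounded_finite[of "{-n<..<n}"] by (auto intro!: integrable_mult_left integrable_real_indicator)
    from set_integral_diff(1)[OF set_integrable_of_integrable[OF g] this]
    show ?thesis by (intro set_integrable_abs) simp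
  qed
  have fin: "emeasure \<nu> (space \<nu>) \<noteq> \<infinity>"
  proof -
    have "emeasure \<nu> (space \<nu>) = (\<integral>\<^sup>+x. ennreal (indicator {-n<..<n} x * \<bar>g x - p\<bar>) \<partial>lborel)"
      unfolding \<nu>_def by (subst emeasure_density) (auto intro!: nn_integral_cong split: split_indicator)
    also have "\<dots> < \<infinity>"
      using int1 unfolding set_integrable_def real_integrable_def by (auto simp: top.not_eq_extremum)
    finally show ?thesis by simp
  qed
  obtain U0 where U0: "open U0" "B \<subseteq> U0" "emeasure \<nu> (U0 - B) < ennreal ((q - p) * \<epsilon>)"
  proof -
    have "emeasure \<nu> B = (INF U\<in>{U. B \<subseteq> U \<and> open U}. emeasure \<nu> U)"
      using outer_regular[OF S fin] Bm by simp
    moreover have finB: "emeasure \<nu> B \<noteq> \<infinity>"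
      using fin emeasure_space[of \<nu> B] by (auto simp: top_unique)
    moreover have "0 < ennreal ((q - p) * \<epsilon>)" using assms by simp
    ultimately have "(INF U\<in>{U. B \<subseteq> U \<and> open U}. emeasure \<nu> U) < emeasure \<nu> B + ennreal ((q - p) * \<epsilon>)"
      by (metis ennreal_add_left_cancel_less add.right_neutral infinity_ennreal_def)
    then obtain U where U: "B \<subseteq> U" "open U" "emeasure \<nu> U < emeasure \<nu> B + ennreal ((q - p) * \<epsilon>)"
      by (auto simp: INF_less_iff)
    have Us: "U \<in> sets \<nu>" "B \<in> sets \<nu>" using U S by auto
    have "emeasure \<nu> U = emeasure \<nu> B + emeasure \<nu> (U - B)"
      using Us U by (metis Diff_disjoint Un_Diff_cancel plus_emeasure sets.Diff sup.absorb2)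
    with U(3) have "emeasure \<nu> (U - B) < ennreal ((q - p) * \<epsilon>)"
      using finB by (metis ennreal_add_left_cancel_less)
    with U that show ?thesis by blast
  qed
  define U where "U = U0 \<inter> {-n<..<n}"
  have oU: "open U" unfolding U_def using U0 by auto
  have BU: "B \<subseteq> U" using U0 unfolding U_def B_def by auto
  have UB: "emeasure \<nu> (U - B) < ennreal ((q - p) * \<epsilon>)"
  proof -
    have "U0 - B \<in> sets \<nu>" using U0(1) S by auto
    then have "emeasure \<nu> (U - B) \<le> emeasure \<nu> (U0 - B)" by (intro emeasure_mono) (auto simp: U_def)
    with U0(3) show ?thesis by (rule le_less_trans[rotated])
  qed
  define K where "K = {(u, v). u < v \<and> {u..v} \<subseteq> U \<and> q * (v - u) < (LINT z:{u..v}|lborel. g z)}"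
  define a where "a = (\<lambda>(u, v). (u + v) / 2 :: real)"
  define r where "r = (\<lambda>(u, v). (v - u) / 2 :: real)"
  have cb: "cball (a i) (r i) = {fst i..snd i}" for i
  proof -
    have "a i - r i = fst i" "a i + r i = snd i"
      by (simp_all add: a_def r_def case_prod_beta field_simps)
    then show ?thesis by (simp add: cball_eq_atLeastAtMost)
  qed
  obtain C where C: "countable C" "C \<subseteq> K"
     "pairwise (\<lambda>i j. disjnt (cball (a i) (r i)) (cball (a j) (r j))) C"
     "negligible(E - (\<Union>i \<in> C. cball (a i) (r i)))"
  proof (rule Vitali_covering_theorem_cballs[of K r E a])
    show "0 < r i" if "i \<in> K" for i using that by (auto simp: K_def r_def)
    fix x d :: real assume x: "x \<in> E" and d: "0 < d"
    then have "x \<in> U" using BU by (auto simp: E_def B_def)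
    then obtain e where e: "e > 0" "ball x e \<subseteq> U" using oU open_contains_ball by blast
    have "0 < min d e" using d e by simp
    with x obtain u v where uv: "u < v" "x \<in> {u..v}" "v - u < min d e" "q * (v - u) < (LINT z:{u..v}|lborel. g z)"
      unfolding E_def by blast
    have "{u..v} \<subseteq> ball x e" using uv by (auto simp: dist_real_def)
    then show "\<exists>i. i \<in> K \<and> x \<in> cball (a i) (r i) \<and> r i < d"
    proof (intro exI[of _ "(u, v)"] conjI)
      show "(u, v) \<in> K" using uv e \<open>{u..v} \<subseteq> ball x e\<close> by (auto simp: K_def)
      show "x \<in> cball (a (u, v)) (r (u, v))" unfolding cb using uv by simp
      show "r (u, v) < d" using uv by (simp add: r_def)
    qed
  qed blast
  have fb: "measure lborel (\<Union>i\<in>I. {fst i..snd i}) \<le> \<epsilon>" if I: "I \<subseteq> C" "finite I" for I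
  proof -
    let ?D = "\<Union>i\<in>I. {fst i..snd i}"
    have Dm[measurable]: "?D \<in> sets borel" using I by auto
    have DU: "?D \<subseteq> U" using I C(2) by (force simp: K_def)
    have Dn: "?D \<subseteq> {-n<..<n}" using DU by (auto simp: U_def)
    have Df: "emeasure lborel ?D < \<infinity>"
    proof -
      have "emeasure lborel ?D \<le> emeasure lborel {-n<..<n}" using Dn by (intro emeasure_mono) auto
      also have "\<dots> < \<infinity>" by (rule emeasure_bounded_finite) simp
      finally show ?thesis .
    qed
    have disj: "disjoint_family_on (\<lambda>i. {fst i..snd i}) I"
      unfolding disjoint_family_on_def
    proof (intro ballI impI)
      fix i j assume "i \<in> I" "j \<in> I" "i \<noteq> j"
      then show "{fst i..snd i} \<inter> {fst j..snd j} = {}"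
        using C(3) I(1) unfolding pairwise_def disjnt_def cb by blast
    qed
    have const: "set_integrable lborel A (\<lambda>x. c)" if "A \<subseteq> {-n<..<n}" "A \<in> sets borel" for A and c :: real
      by (rule set_integrable_subset[of _ "{-n<..<n}"]) (use that emeasure_bounded_finite[of "{-n<..<n}"] in \<open>auto simp: set_integrable_def intro!: integrable_mult_left integrable_real_indicator\<close>)
    have "q * measure lborel ?D = (LINT z:?D|lborel. q)"
      using Df by (subst set_integral_const) auto
    also have "\<dots> = (\<Sum>i\<in>I. (LINT z:{fst i..snd i}|lborel. q))"
      using I disj Dn by (intro set_integral_finite_Union) (auto intro!: const)
    also have "\<dots> \<le> (\<Sum>i\<in>I. (LINT z:{fst i..snd i}|lborel. g z))"
    proof (rule sum_mono)
      fix i assume "i \<in> I"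
      then have "i \<in> K" using I C by auto
      then have "fst i < snd i" "q * (snd i - fst i) < (LINT z:{fst i..snd i}|lborel. g z)"
        by (auto simp: K_def)
      then show "(LINT z:{fst i..snd i}|lborel. q) \<le> (LINT z:{fst i..snd i}|lborel. g z)"
        by (subst set_integral_const) (auto simp: mult.commute)
    qed
    also have "\<dots> = (LINT z:?D|lborel. g z)"
      using I disj by (intro set_integral_finite_Union[symmetric]) (auto intro!: set_integrable_of_integrable g)
    finally have 1: "q * measure lborel ?D \<le> (LINT z:?D|lborel. g z)" .
    have gpi: "set_integrable lborel ?D (\<lambda>z. g z - p)"
      by (intro set_integral_diff set_integrable_of_integrable g const Dn) auto
    have "(LINT z:?D|lborel. g z) - p * measure lborel ?D = (LINT z:?D|lborel. g z - p)"
      using Df by (subst set_integral_diff(2)) (auto intro!: set_integrable_of_integrable g const Dn simp: set_integral_const)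
    also have "\<dots> \<le> (LINT z:(?D - B)|lborel. \<bar>g z - p\<bar>)"
    proof -
      have "(LINT z:?D|lborel. g z - p) \<le> (LINT z|lborel. indicator (?D - B) z *\<^sub>R \<bar>g z - p\<bar>)"
        unfolding set_lebesgue_integral_def
      proof (rule integral_mono)
        show "integrable lborel (\<lambda>z. indicator ?D z *\<^sub>R (g z - p))" using gpi by (simp add: set_integrable_def)
        show "integrable lborel (\<lambda>z. indicator (?D - B) z *\<^sub>R \<bar>g z - p\<bar>)"
          using set_integrable_subset[OF int1, of "?D - B"] Dn by (auto simp: set_integrable_def)
        show "indicator ?D z *\<^sub>R (g z - p) \<le> indicator (?D - B) z *\<^sub>R \<bar>g z - p\<bar>" for z
          using Dn by (auto simp: B_def split: split_indicator)
      qed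
      then show ?thesis by (simp add: set_lebesgue_integral_def)
    qed
    also have "\<dots> \<le> (q - p) * \<epsilon>"
    proof -
      have "ennreal (LINT z:(?D - B)|lborel. \<bar>g z - p\<bar>) = (\<integral>\<^sup>+z. ennreal (indicator (?D - B) z *\<^sub>R \<bar>g z - p\<bar>) \<partial>lborel)"
        unfolding set_lebesgue_integral_def
        by (rule nn_integral_eq_integral[symmetric])
           (use set_integrable_subset[OF int1, of "?D - B"] Dn in \<open>auto simp: set_integrable_def\<close>)
      also have "\<dots> = emeasure \<nu> (?D - B)"
      proof -
        have *: "emeasure \<nu> A = (\<integral>\<^sup>+z. ennreal (indicator A z *\<^sub>R \<bar>g z - p\<bar>) \<partial>lborel)"
          if "A \<in> sets borel" "A \<subseteq> {-n<..<n}" for A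
          unfolding \<nu>_def using that by (subst emeasure_density) (auto intro!: nn_integral_cong split: split_indicator)
        show ?thesis by (rule *[symmetric]) (use Dn in auto)
      qed
      also have "\<dots> \<le> emeasure \<nu> (U - B)"
        using DU oU by (intro emeasure_mono) (auto simp: S)
      finally have "ennreal (LINT z:(?D - B)|lborel. \<bar>g z - p\<bar>) \<le> ennreal ((q - p) * \<epsilon>)" using UB by simp
      then show ?thesis using assms by (subst (asm) ennreal_le_iff) auto
    qed
    finally have "(q - p) * measure lborel ?D \<le> (q - p) * \<epsilon>" using 1 by (simp add: algebra_simps)
    then show ?thesis using assms by simp
  qed
  define T1 where "T1 = (\<Union>i\<in>C. {fst i..snd i})"
  have T1: "T1 \<in> lmeasurable" "measure lebesgue T1 \<le> \<epsilon>"
    unfolding T1_def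
  proof -
    have fb': "measure lebesgue (\<Union>i\<in>I. {fst i..snd i}) \<le> \<epsilon>" if I: "I \<subseteq> C" "finite I" for I
    proof -
      have "(\<Union>i\<in>I. {fst i..snd i}) \<in> sets lborel" using I by auto
      then show ?thesis using fb[OF I] by (subst measure_completion) auto
    qed
    have lm: "{fst i..snd i} \<in> lmeasurable" for i :: "real \<times> real" by simp
    show "(\<Union>i\<in>C. {fst i..snd i}) \<in> lmeasurable" by (rule fmeasurable_UN_bound[OF C(1) lm fb'])
    show "measure lebesgue (\<Union>i\<in>C. {fst i..snd i}) \<le> \<epsilon>" by (rule measure_UN_bound[OF C(1) lm fb'])
  qed
  show thesis
  proof
    show "E \<subseteq> T1 \<union> (E - T1)" by auto
    have neg: "negligible (E - T1)" using C(4) unfolding T1_def cb .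
    then show "T1 \<union> (E - T1) \<in> lmeasurable" using T1 by (meson fmeasurable.Un negligible_imp_measurable)
    show "measure lebesgue (T1 \<union> (E - T1)) \<le> \<epsilon>" using T1 neg
      by (metis (no_types, lifting) fmeasurableD measure_Un_null_set negligible_iff_null_sets)
  qed
qed

lemma dense_interval_set_negligible:
  fixes g :: "real \<Rightarrow> real" and p q :: real
  assumes g: "integrable lborel g" and "p < q"
  shows "negligible {x. g x < p \<and> (\<forall>d>0. \<exists>u v. u < v \<and> x \<in> {u..v} \<and> v - u < d \<and>
        q * (v - u) < (LINT z:{u..v}|lborel. g z))}" (is "negligible {x. ?P x}")
proof -
  have "negligible {x \<in> {- real n<..<real n}. ?P x}" for n
    unfolding negligible_outer_le
  proof (intro allI impI)
    fix e :: real assume "e > 0"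
    show "\<exists>T. {x \<in> {- real n<..<real n}. ?P x} \<subseteq> T \<and> T \<in> lmeasurable \<and> measure lebesgue T \<le> e"
      by (rule dense_interval_set_measure_le[OF assms \<open>e > 0\<close>, of "real n"]) blast
  qed
  then have "negligible (\<Union>n. {x \<in> {- real n<..<real n}. ?P x})" by (rule negligible_Union_nat)
  moreover have "{x. ?P x} \<subseteq> (\<Union>n. {x \<in> {- real n<..<real n}. ?P x})"
  proof
    fix x assume "x \<in> {x. ?P x}"
    moreover obtain n :: nat where "\<bar>x\<bar> < real n" using reals_Archimedean2 by blast
    then have "x \<in> {- real n<..<real n}" by auto
    ultimately show "x \<in> (\<Union>n. {x \<in> {- real n<..<real n}. ?P x})" by blast
  qed
  ultimately show ?thesis using negligible_subset by blast
qed

text \<open>If averages exceed \<open>g x + e\<close> on arbitrarily short intervals, rational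
  \<open>p < q\<close> between \<open>g x\<close> and \<open>g x + e\<close> put \<open>x\<close>
  into one of countably many negligible sets. The intervals need only contain \<open>x\<close>, so
  one-sided increments are covered.\<close>

lemma lebesgue_upper_derivative:
  fixes g :: "real \<Rightarrow> real"
  assumes g: "integrable lborel g"
  shows "AE x in lebesgue. \<forall>e>0. \<exists>d>0. \<forall>u v. u < v \<and> x \<in> {u..v} \<and> v - u < d \<longrightarrow>
     (LINT z:{u..v}|lborel. g z) \<le> (g x + e) * (v - u)"
proof -
  define N where "N p q = {x. g x < p \<and> (\<forall>d>0. \<exists>u v. u < v \<and> x \<in> {u..v} \<and> v - u < d \<and>
        q * (v - u) < (LINT z:{u..v}|lborel. g z))}" for p q
  have "negligible (\<Union> ((\<lambda>(p, q). N p q) ` {(p, q) \<in> \<rat> \<times> \<rat>. p < q}))"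
  proof (rule negligible_countable_Union)
    have "countable (\<rat> \<times> \<rat> :: (real \<times> real) set)" by (intro countable_SIGMA countable_rat)
    then have "countable {(p, q) \<in> \<rat> \<times> \<rat> :: (real \<times> real) set. p < q}"
      by (rule countable_subset[rotated]) auto
    then show "countable ((\<lambda>(p, q). N p q) ` {(p, q) \<in> \<rat> \<times> \<rat>. p < q})" by (rule countable_image)
    fix S assume "S \<in> (\<lambda>(p, q). N p q) ` {(p, q) \<in> \<rat> \<times> \<rat>. p < q}"
    then obtain p q where "p < q" "S = N p q" by auto
    then show "negligible S" unfolding N_def by (simp only: dense_interval_set_negligible[OF g])
  qed
  then have "AE x in lebesgue. x \<notin> (\<Union>(p, q)\<in>{(p, q) \<in> \<rat> \<times> \<rat>. p < q}. N p q)"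
    using AE_not_in negligible_iff_null_sets by blast
  then show ?thesis
  proof (rule AE_mp, intro AE_I2 impI allI)
    fix x e :: real assume x: "x \<notin> (\<Union>(p, q)\<in>{(p, q) \<in> \<rat> \<times> \<rat>. p < q}. N p q)" and e: "0 < e"
    obtain p where p: "p \<in> \<rat>" "g x < p" "p < g x + e" using Rats_dense_in_real[of "g x" "g x + e"] e by auto
    obtain q where q: "q \<in> \<rat>" "p < q" "q < g x + e" using Rats_dense_in_real[of p "g x + e"] p by auto
    have "x \<notin> N p q" using x p(1) q(1,2) by blast
    then have "\<not> (\<forall>d>0. \<exists>u v. u < v \<and> x \<in> {u..v} \<and> v - u < d \<and> q * (v - u) < (LINT z:{u..v}|lborel. g z))"
      using p(2) unfolding N_def by blast
    then obtain d where d: "d > 0" "\<And>u v. u < v \<Longrightarrow> x \<in> {u..v} \<Longrightarrow> v - u < d \<Longrightarrow> (LINT z:{u..v}|lborel. g z) \<le> q * (v - u)"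
      by (metis not_less)
    show "\<exists>d>0. \<forall>u v. u < v \<and> x \<in> {u..v} \<and> v - u < d \<longrightarrow> (LINT z:{u..v}|lborel. g z) \<le> (g x + e) * (v - u)"
    proof (intro exI conjI allI impI)
      show "d > 0" by fact
      fix u v assume uv: "u < v \<and> x \<in> {u..v} \<and> v - u < d"
      then have "(LINT z:{u..v}|lborel. g z) \<le> q * (v - u)" using d by auto
      also have "\<dots> \<le> (g x + e) * (v - u)" using q uv by (intro mult_right_mono) auto
      finally show "(LINT z:{u..v}|lborel. g z) \<le> (g x + e) * (v - u)" .
    qed
  qed
qed

lemma lebesgue_differentiation:
  fixes g :: "real \<Rightarrow> real"
  assumes g: "integrable lborel g"
  shows "AE x in lebesgue. \<forall>e>0. \<exists>d>0. \<forall>u v. u < v \<and> x \<in> {u..v} \<and> v - u < d \<longrightarrow>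
     \<bar>(LINT z:{u..v}|lborel. g z) - g x * (v - u)\<bar> \<le> e * (v - u)"
proof -
  have "AE x in lebesgue. \<forall>e>0. \<exists>d>0. \<forall>u v. u < v \<and> x \<in> {u..v} \<and> v - u < d \<longrightarrow>
     (LINT z:{u..v}|lborel. - g z) \<le> (- g x + e) * (v - u)"
    using lebesgue_upper_derivative[of "\<lambda>x. - g x"] g by simp
  with lebesgue_upper_derivative[OF g] show ?thesis
  proof eventually_elim
    case (elim x)
    show ?case
    proof (intro allI impI)
      fix e :: real assume "e > 0"
      obtain d1 where d1: "d1 > 0" "\<forall>u v. u < v \<and> x \<in> {u..v} \<and> v - u < d1 \<longrightarrow> (LINT z:{u..v}|lborel. g z) \<le> (g x + e) * (v - u)"
        using elim(1)[rule_format, OF \<open>e > 0\<close>] by (elim exE conjE)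
      obtain d2 where d2: "d2 > 0" "\<forall>u v. u < v \<and> x \<in> {u..v} \<and> v - u < d2 \<longrightarrow> (LINT z:{u..v}|lborel. - g z) \<le> (- g x + e) * (v - u)"
        using elim(2)[rule_format, OF \<open>e > 0\<close>] by (elim exE conjE)
      show "\<exists>d>0. \<forall>u v. u < v \<and> x \<in> {u..v} \<and> v - u < d \<longrightarrow>
          \<bar>(LINT z:{u..v}|lborel. g z) - g x * (v - u)\<bar> \<le> e * (v - u)"
      proof (intro exI[of _ "min d1 d2"] conjI allI impI)
        fix u v assume uv: "u < v \<and> x \<in> {u..v} \<and> v - u < min d1 d2"
        have "(LINT z:{u..v}|lborel. - g z) = - (LINT z:{u..v}|lborel. g z)"
          by (intro set_integral_uminus set_integrable_of_integrable g) auto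
        with d1(2)[rule_format, of u v] d2(2)[rule_format, of u v] uv
        show "\<bar>(LINT z:{u..v}|lborel. g z) - g x * (v - u)\<bar> \<le> e * (v - u)"
          by (simp add: algebra_simps)
      qed (use d1 d2 in auto)
    qed
  qed
qed

section \<open>Absolutely continuous functions and curves\<close>

text \<open>Arbitrary finite index sets replace initial segments of the naturals, because the
  families used below are indexed by components of an open set and by pairs of an interval and a
  node.\<close>

lemma abs_continuous_finite:
  assumes "abs_continuous m \<gamma>" "0 < \<epsilon>"
  shows "\<exists>\<delta>>0. \<forall>(I :: 'i set) u v. finite I \<longrightarrow> (\<forall>i\<in>I. 0 \<le> u i \<and> u i \<le> v i \<and> v i \<le> 1) \<longrightarrow>
     disjoint_family_on (\<lambda>i. {u i<..<v i}) I \<longrightarrow> (\<Sum>i\<in>I. v i - u i) < \<delta> \<longrightarrow>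
     (\<Sum>i\<in>I. mdist m (\<gamma> (u i)) (\<gamma> (v i))) < \<epsilon>"
proof -
  obtain \<delta> where \<delta>: "0 < \<delta>" "\<forall>(n::nat) u v. (\<forall>i<n. 0 \<le> u i \<and> u i \<le> v i \<and> v i \<le> 1) \<longrightarrow>
     (\<forall>i<n. \<forall>j<n. i \<noteq> j \<longrightarrow> {u i<..<v i} \<inter> {u j<..<v j} = {}) \<longrightarrow>
     (\<Sum>i<n. v i - u i) < \<delta> \<longrightarrow> (\<Sum>i<n. mdist m (\<gamma> (u i)) (\<gamma> (v i))) < \<epsilon>"
    using assms(1)[unfolded abs_continuous_def, rule_format, OF assms(2)] by (elim exE conjE)
  show ?thesis
  proof (intro exI[of _ \<delta>] conjI allI impI \<delta>(1))
    fix I :: "'i set" and u v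
    assume I: "finite I" "\<forall>i\<in>I. 0 \<le> u i \<and> u i \<le> v i \<and> v i \<le> 1"
       "disjoint_family_on (\<lambda>i. {u i<..<v i}) I" "(\<Sum>i\<in>I. v i - u i) < \<delta>"
    obtain h where h: "bij_betw h {..<card I} I"
      using ex_bij_betw_nat_finite[OF I(1)] by (auto simp: atLeast0LessThan)
    have hI: "h i \<in> I" if "i < card I" for i using h that by (auto simp: bij_betw_def)
    have hinj: "h i \<noteq> h j" if "i < card I" "j < card I" "i \<noteq> j" for i j
      using h that by (auto simp: bij_betw_def inj_on_def)
    have "(\<Sum>i<card I. mdist m (\<gamma> (u (h i))) (\<gamma> (v (h i)))) < \<epsilon>"
    proof (rule \<delta>(2)[rule_format])
      show "0 \<le> u (h i) \<and> u (h i) \<le> v (h i) \<and> v (h i) \<le> 1" if "i < card I" for i using I(2) hI that by blast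
      show "{u (h i)<..<v (h i)} \<inter> {u (h j)<..<v (h j)} = {}" if "i < card I" "j < card I" "i \<noteq> j" for i j
        using disjoint_family_onD[OF I(3) hI[OF that(1)] hI[OF that(2)] hinj[OF that]] .
      have "(\<Sum>i<card I. v (h i) - u (h i)) = (\<Sum>i\<in>I. v i - u i)"
        by (rule sum.reindex_bij_betw[OF h])
      then show "(\<Sum>i<card I. v (h i) - u (h i)) < \<delta>" using I(4) by simp
    qed
    then show "(\<Sum>i\<in>I. mdist m (\<gamma> (u i)) (\<gamma> (v i))) < \<epsilon>"
      by (subst sum.reindex_bij_betw[OF h, symmetric])
  qed
qed

lemma abs_continuous_imp_uniform:
  assumes "abs_continuous m \<gamma>" "0 < \<epsilon>"
  shows "\<exists>\<delta>>0. \<forall>s\<in>{0..1}. \<forall>t\<in>{0..1}. \<bar>s - t\<bar> < \<delta> \<longrightarrow> mdist m (\<gamma> s) (\<gamma> t) < \<epsilon>"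
proof -
  obtain \<delta> where \<delta>: "0 < \<delta>" "\<forall>(I :: unit set) u v. finite I \<longrightarrow> (\<forall>i\<in>I. 0 \<le> u i \<and> u i \<le> v i \<and> v i \<le> 1) \<longrightarrow>
     disjoint_family_on (\<lambda>i. {u i<..<v i}) I \<longrightarrow> (\<Sum>i\<in>I. v i - u i) < \<delta> \<longrightarrow>
     (\<Sum>i\<in>I. mdist m (\<gamma> (u i)) (\<gamma> (v i))) < \<epsilon>"
    using abs_continuous_finite[OF assms] by (elim exE conjE)
  have *: "mdist m (\<gamma> s) (\<gamma> t) < \<epsilon>" if "s \<in> {0..1}" "t \<in> {0..1}" "\<bar>s - t\<bar> < \<delta>" "s \<le> t" for s t
    using \<delta>(2)[rule_format, of "{()}" "\<lambda>_. s" "\<lambda>_. t"] that by (auto simp: disjoint_family_on_def)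
  show ?thesis
  proof (intro exI[of _ \<delta>] conjI ballI impI \<delta>(1))
    fix s t :: real assume st: "s \<in> {0..1}" "t \<in> {0..1}" "\<bar>s - t\<bar> < \<delta>"
    show "mdist m (\<gamma> s) (\<gamma> t) < \<epsilon>"
      using *[of s t] *[of t s] st by (cases "s \<le> t") (auto simp: mdist_commute)
  qed
qed

lemma abs_continuous_real_continuous_on:
  fixes F :: "real \<Rightarrow> real"
  assumes "abs_continuous euclidean_metric F"
  shows "continuous_on {0..1} F"
  unfolding continuous_on_iff
proof (intro ballI allI impI)
  fix x e :: real assume x: "x \<in> {0..1}" and e: "0 < e"
  obtain \<delta> where "0 < \<delta>" "\<forall>s\<in>{0..1}. \<forall>t\<in>{0..1}. \<bar>s - t\<bar> < \<delta> \<longrightarrow> mdist euclidean_metric (F s) (F t) < e"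
    using abs_continuous_imp_uniform[OF assms e] by (elim exE conjE)
  then show "\<exists>d>0. \<forall>x'\<in>{0..1}. dist x' x < d \<longrightarrow> dist (F x') (F x) < e"
    using x by (auto simp: dist_real_def intro!: exI[of _ \<delta>])
qed

lemma open_connected_real_eq_Ioo:
  fixes C :: "real set"
  assumes "open C" "connected C" "bounded C" "C \<noteq> {}"
  shows "C = {Inf C<..<Sup C}"
proof (intro set_eqI iffI)
  have bb: "bdd_below C" "bdd_above C" using assms(3) by (auto simp: bounded_imp_bdd_below bounded_imp_bdd_above)
  fix x
  { assume x: "x \<in> C"
    then obtain e where e: "e > 0" "ball x e \<subseteq> C" using assms(1) open_contains_ball by blast
    then have "x - e/2 \<in> C" "x + e/2 \<in> C" by (auto simp: dist_real_def subset_eq)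
    then have "Inf C \<le> x - e/2" "x + e/2 \<le> Sup C" using bb by (auto intro: cInf_lower cSup_upper)
    then show "x \<in> {Inf C<..<Sup C}" using e by auto }
  { assume "x \<in> {Inf C<..<Sup C}"
    then obtain c d where "c \<in> C" "c < x" "d \<in> C" "x < d"
      using assms(4) bb by (auto simp: cInf_less_iff less_cSup_iff)
    then show "x \<in> C" using assms(2) connectedD_interval[of C c d x] by auto }
qed

text \<open>A null set is covered by an open set of length below the \<delta> of absolute
  continuity. Its components are countably many disjoint intervals, and any finitely many of them
  have total \<open>F\<close>-increment below \<open>e\<close>. Clamping the argument to
  \<open>{0..1}\<close> extends \<open>F\<close> to the line, as \<open>interval_measure\<close>
  requires, without adding mass outside.\<close>

lemma AC_mono_null_imp_null:
  fixes F :: "real \<Rightarrow> real"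
  assumes mono: "mono_on {0..1} F" and ac: "abs_continuous euclidean_metric F"
  defines "G \<equiv> (\<lambda>x. F (max 0 (min 1 x)))"
  shows "absolutely_continuous lborel (interval_measure G)"
proof -
  have cl: "max 0 (min 1 x) \<in> {0..1}" for x :: real by auto
  have Gmono: "G x \<le> G y" if "x \<le> y" for x y
    unfolding G_def using that by (intro mono_onD[OF mono]) auto
  have Gcont: "continuous_on UNIV G"
    unfolding G_def by (rule continuous_on_compose2[OF abs_continuous_real_continuous_on[OF ac]]) (auto intro!: continuous_intros)
  have Grc: "continuous (at_right a) G" for a
    using Gcont by (simp add: continuous_on_eq_continuous_at continuous_at_imp_continuous_at_within)
  let ?\<mu> = "interval_measure G"
  interpret \<mu>: sigma_finite_measure ?\<mu> by (rule sigma_finite_interval_measure[OF Gmono Grc])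
  have Icc: "emeasure ?\<mu> {a..b} = ennreal (G b - G a)" if "a \<le> b" for a b
    using emeasure_interval_measure_Icc[OF that Gmono Gcont] .
  have bnd: "N \<inter> {- real n<..<real n} \<in> null_sets ?\<mu>" if N: "N \<in> null_sets lborel" for N n
  proof -
    let ?N = "N \<inter> {- real n<..<real n}"
    have Nb: "?N \<in> sets borel" using N by auto
    have "emeasure ?\<mu> ?N \<le> ennreal e" if e: "e > 0" for e :: real
    proof -
      obtain \<delta> where \<delta>: "0 < \<delta>" "\<forall>(I :: real set set) u v. finite I \<longrightarrow> (\<forall>i\<in>I. 0 \<le> u i \<and> u i \<le> v i \<and> v i \<le> 1) \<longrightarrow>
     disjoint_family_on (\<lambda>i. {u i<..<v i}) I \<longrightarrow> (\<Sum>i\<in>I. v i - u i) < \<delta> \<longrightarrow>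
     (\<Sum>i\<in>I. mdist euclidean_metric (F (u i)) (F (v i))) < e"
        using abs_continuous_finite[OF ac e] by (elim exE conjE)
      have N0: "emeasure lborel ?N = 0"
        using N by (metis Int_lower1 Nb emeasure_eq_0 null_setsD1 null_setsD2 sets_lborel)
      obtain U0 where U0: "open U0" "?N \<subseteq> U0" "emeasure lborel (U0 - ?N) < \<delta>"
        using outer_regular_lborel[OF Nb \<delta>(1)] by metis
      define U where "U = U0 \<inter> {- real n<..<real n}"
      have U: "open U" "?N \<subseteq> U" "bounded U" using U0 by (auto simp: U_def intro: bounded_subset[of "{- real n<..<real n}"])
      have "emeasure lborel U \<le> emeasure lborel ((U0 - ?N) \<union> ?N)"
        using U0 Nb by (intro emeasure_mono) (auto simp: U_def)
      also have "\<dots> \<le> emeasure lborel (U0 - ?N) + emeasure lborel ?N"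
        using U0 Nb by (intro emeasure_subadditive) auto
      finally have U\<delta>: "emeasure lborel U < \<delta>" using U0(3) N0 by simp
      have comp: "C = {Inf C<..<Sup C} \<and> C \<subseteq> U \<and> Inf C < Sup C" if "C \<in> components U" for C
      proof -
        have C: "open C" "connected C" "C \<noteq> {}" "C \<subseteq> U" "bounded C"
          using that U open_components in_components_connected in_components_nonempty in_components_subset bounded_subset by metis+
        then have eq: "C = {Inf C<..<Sup C}" using open_connected_real_eq_Ioo by blast
        have "Inf C < Sup C" using C(3) by (subst (asm) eq) simp
        then show ?thesis using C eq by blast
      qed
      have cnt: "countable (components U)"
        using U(1) pairwise_disjoint_components[of U]
        by (intro countable_disjoint_open_subsets) (auto intro: open_components simp: pairwise_def disjnt_def)
      have disj: "disjnt C D" if "C \<in> components U" "D \<in> components U" "C \<noteq> D" for C D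
        using that by (meson components_nonoverlap disjnt_def)
      have subIcc: "C \<subseteq> {Inf C..Sup C}" if "C \<in> components U" for C
        by (rule ord_eq_le_trans[of _ "{Inf C<..<Sup C}"]) (use comp[OF that] in blast, auto)
      have fm: "C \<in> fmeasurable ?\<mu>" if "C \<in> components U" for C
      proof -
        have "emeasure ?\<mu> C \<le> emeasure ?\<mu> {Inf C..Sup C}" using subIcc[OF that] by (intro emeasure_mono) auto
        also have "\<dots> < \<infinity>" using comp[OF that] by (subst Icc) auto
        finally show ?thesis using open_components[OF U(1) that] by (intro fmeasurableI) auto
      qed
      have fin: "measure ?\<mu> (\<Union>C\<in>I. C) \<le> e" if I: "I \<subseteq> components U" "finite I" for I
      proof -
        \<comment> \<open>Absolute continuity concerns subintervals of \<open>{0..1}\<close> only,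
          so the endpoints are clamped; \<open>G\<close> does not notice this, and the clamped
          intervals remain disjoint.\<close>
        let ?u = "\<lambda>C. max 0 (min 1 (Inf C)) :: real" and ?v = "\<lambda>C. max 0 (min 1 (Sup C)) :: real"
        have mC: "measure ?\<mu> C \<le> mdist euclidean_metric (F (?u C)) (F (?v C))" if "C \<in> I" for C
        proof -
          have C: "C = {Inf C<..<Sup C}" "Inf C < Sup C" using comp that I by auto
          have "emeasure ?\<mu> C \<le> emeasure ?\<mu> {Inf C..Sup C}" using subIcc that I by (intro emeasure_mono) auto
          also have "\<dots> = ennreal (G (Sup C) - G (Inf C))" using C by (intro Icc) auto
          finally have "measure ?\<mu> C \<le> G (Sup C) - G (Inf C)"
            unfolding measure_def using C Gmono[of "Inf C" "Sup C"] by (intro enn2real_leI) auto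
          then show ?thesis unfolding G_def by (simp add: dist_real_def)
        qed
        have "measure ?\<mu> (\<Union>C\<in>I. C) \<le> (\<Sum>C\<in>I. measure ?\<mu> C)"
          using I open_components[OF U(1)] by (intro measure_UNION_le) auto
        also have "\<dots> \<le> (\<Sum>C\<in>I. mdist euclidean_metric (F (?u C)) (F (?v C)))" by (rule sum_mono[OF mC])
        also have "\<dots> < e"
        proof (rule \<delta>(2)[rule_format, OF I(2)])
          show "0 \<le> ?u C \<and> ?u C \<le> ?v C \<and> ?v C \<le> 1" if "C \<in> I" for C
          proof -
            have "Inf C < Sup C" using comp that I by blast
            then show ?thesis by auto
          qed
          have sub: "{?u C<..<?v C} \<subseteq> C" if "C \<in> I" for C
          proof -
            have "C = {Inf C<..<Sup C}" using comp that I by auto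
            moreover have "{?u C<..<?v C} \<subseteq> {Inf C<..<Sup C}" by auto
            ultimately show ?thesis by simp
          qed
          show "disjoint_family_on (\<lambda>C. {?u C<..<?v C}) I"
            unfolding disjoint_family_on_def
          proof (intro ballI impI)
            fix C D assume CD: "C \<in> I" "D \<in> I" "C \<noteq> D"
            then have "C \<inter> D = {}" using disj I by (auto simp: disjnt_def)
            then show "{?u C<..<?v C} \<inter> {?u D<..<?v D} = {}" using sub[OF CD(1)] sub[OF CD(2)] by blast
          qed
          have "(\<Sum>C\<in>I. ?v C - ?u C) \<le> (\<Sum>C\<in>I. Sup C - Inf C)"
          proof (rule sum_mono)
            fix C assume "C \<in> I"
            then have "Inf C < Sup C" using comp I by blast
            then show "?v C - ?u C \<le> Sup C - Inf C" by (auto simp: max_def min_def)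
          qed
          also have "\<dots> = (\<Sum>C\<in>I. measure lborel C)"
          proof (rule sum.cong[OF refl])
            fix C assume "C \<in> I"
            then have C: "C = {Inf C<..<Sup C}" "Inf C < Sup C" using comp I by auto
            have "measure lborel {Inf C<..<Sup C} = Sup C - Inf C" using C(2) by simp
            then show "Sup C - Inf C = measure lborel C" using C(1) by simp
          qed
          also have "\<dots> = measure lborel (\<Union>C\<in>I. C)"
          proof (rule measure_finite_Union[symmetric, OF I(2)])
            show "(\<lambda>C. C) ` I \<subseteq> sets lborel" using I(1) U(1) by (auto dest: open_components)
            show "disjoint_family_on (\<lambda>C. C) I" using disj I(1) by (auto simp: disjoint_family_on_def disjnt_def)
            show "emeasure lborel C \<noteq> \<infinity>" if "C \<in> I" for C
            proof -
              have "bounded C" using that I U(3) by (meson bounded_subset in_components_subset subsetD)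
              then show ?thesis using emeasure_bounded_finite by fastforce
            qed
          qed
          also have "\<dots> \<le> measure lborel U"
          proof (rule measure_mono_fmeasurable)
            show "(\<Union>C\<in>I. C) \<subseteq> U" using I in_components_subset by blast
            show "(\<Union>C\<in>I. C) \<in> sets lborel" using I open_components[OF U(1)] by (auto intro!: borel_open open_Union)
            show "U \<in> fmeasurable lborel" using U U\<delta> by (intro fmeasurableI) (auto intro: less_trans)
          qed
          also have "\<dots> < \<delta>"
          proof -
            have "emeasure lborel U = ennreal (measure lborel U)"
              using U\<delta> by (intro emeasure_eq_ennreal_measure) (auto simp: top_unique)
            with U\<delta> show ?thesis by (simp add: ennreal_less_iff)
          qed
          finally show "(\<Sum>C\<in>I. ?v C - ?u C) < \<delta>" .
        qed
        finally show ?thesis by simp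
      qed
      have "(\<Union>C\<in>components U. C) \<in> fmeasurable ?\<mu>" "measure ?\<mu> (\<Union>C\<in>components U. C) \<le> e"
        using fmeasurable_UN_bound[OF cnt fm fin] measure_UN_bound[OF cnt fm fin] by auto
      then have "emeasure ?\<mu> U \<le> ennreal e"
        using emeasure_eq_measure2[of U ?\<mu>] by (auto simp: ennreal_leI)
      moreover have "emeasure ?\<mu> ?N \<le> emeasure ?\<mu> U" using U by (intro emeasure_mono) auto
      ultimately show ?thesis by (rule order_trans[rotated])
    qed
    then have "emeasure ?\<mu> ?N = 0"
      by (metis add_0 ennreal_le_epsilon le_zero_eq)
    then show ?thesis using Nb by (auto intro!: null_setsI)
  qed
  show ?thesis
    unfolding absolutely_continuous_def
  proof
    fix N :: "real set" assume N: "N \<in> null_sets lborel"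
    have "(\<Union>n. N \<inter> {- real n<..<real n}) \<in> null_sets ?\<mu>" using bnd[OF N] by (intro null_sets_UN)
    moreover have "N \<subseteq> (\<Union>n. N \<inter> {- real n<..<real n})"
    proof
      fix x assume "x \<in> N"
      moreover obtain n :: nat where "\<bar>x\<bar> < real n" using reals_Archimedean2 by blast
      then have "x \<in> {- real n<..<real n}" by auto
      ultimately show "x \<in> (\<Union>n. N \<inter> {- real n<..<real n})" by blast
    qed
    ultimately show "N \<in> null_sets ?\<mu>" using N by (metis (no_types, lifting) null_setsD2 null_sets_subset sets_interval_measure sets_lborel)
  qed
qed

text \<open>\<open>F\<close> is the distribution function of a measure that is absolutely continuous
  by the previous lemma; \<open>g\<close> is its Radon-Nikodym density, and Lebesgue differentiation
  identifies \<open>g\<close> with the derivative almost everywhere.\<close>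

lemma AC_mono_FTC:
  fixes F :: "real \<Rightarrow> real"
  assumes mono: "mono_on {0..1} F" and ac: "abs_continuous euclidean_metric F"
  obtains g where "integrable lborel g" "\<And>x. 0 \<le> g x"
    "\<And>s t. 0 \<le> s \<Longrightarrow> s \<le> t \<Longrightarrow> t \<le> 1 \<Longrightarrow> F t - F s = (LINT z:{s..t}|lborel. g z)"
    "AE x in lebesgue. x \<in> {0<..<1} \<longrightarrow> (F has_real_derivative g x) (at x)"
proof -
  define G where "G = (\<lambda>x. F (max 0 (min 1 x)))"
  have Gmono: "G x \<le> G y" if "x \<le> y" for x y
    unfolding G_def using that by (intro mono_onD[OF mono]) auto
  have Gcont: "continuous_on UNIV G"
    unfolding G_def by (rule continuous_on_compose2[OF abs_continuous_real_continuous_on[OF ac]]) (auto intro!: continuous_intros)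
  have Grc: "continuous (at_right a) G" for a
    using Gcont by (simp add: continuous_on_eq_continuous_at continuous_at_imp_continuous_at_within)
  let ?\<mu> = "interval_measure G"
  have Icc: "emeasure ?\<mu> {a..b} = ennreal (G b - G a)" if "a \<le> b" for a b
    using emeasure_interval_measure_Icc[OF that Gmono Gcont] .
  have acm: "absolutely_continuous lborel ?\<mu>" using AC_mono_null_imp_null[OF mono ac] unfolding G_def .
  have "emeasure ?\<mu> {- real n..real n} \<le> ennreal (F 1 - F 0)" for n
  proof -
    have "G (real n) - G (- real n) \<le> F 1 - F 0"
      unfolding G_def by (intro diff_mono mono_onD[OF mono]) auto
    then show ?thesis by (subst Icc) (auto intro: ennreal_leI)
  qed
  then have "(SUP n. emeasure ?\<mu> {- real n..real n}) \<le> ennreal (F 1 - F 0)" by (rule SUP_least)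
  moreover have "(SUP n. emeasure ?\<mu> {- real n..real n}) = emeasure ?\<mu> (\<Union>n. {- real n..real n})"
    by (rule SUP_emeasure_incseq) (auto simp: incseq_def)
  moreover have "(\<Union>n. {- real n..real n}) = UNIV"
  proof -
    have "\<exists>n. x \<in> {- real n..real n}" for x
    proof -
      obtain n :: nat where "\<bar>x\<bar> < real n" using reals_Archimedean2 by blast
      then show ?thesis by (intro exI[of _ n]) auto
    qed
    then show ?thesis by blast
  qed
  ultimately have UNIV_le: "emeasure ?\<mu> UNIV \<le> ennreal (F 1 - F 0)"
    by simp
  then have "finite_measure ?\<mu>" by (intro finite_measureI) (auto simp: top_unique)
  then obtain D where D: "D \<in> borel_measurable lborel"
    "AE x in lborel. RN_deriv lborel ?\<mu> x = ennreal (D x)" "\<And>x. 0 \<le> D x"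
    using sigma_finite_measure.real_RN_deriv[OF sigma_finite_lborel _ acm] by (metis sets_interval_measure sets_lborel)
  have dens: "density lborel (\<lambda>x. ennreal (D x)) = ?\<mu>"
  proof -
    have "density lborel (\<lambda>x. ennreal (D x)) = density lborel (RN_deriv lborel ?\<mu>)"
      using D by (intro density_cong) auto
    then show ?thesis using sigma_finite_measure.density_RN_deriv[OF sigma_finite_lborel acm] by simp
  qed
  have em: "emeasure ?\<mu> A = (\<integral>\<^sup>+x. ennreal (indicator A x *\<^sub>R D x) \<partial>lborel)" if "A \<in> sets borel" for A
    using D that by (subst dens[symmetric], subst emeasure_density) (auto intro!: nn_integral_cong split: split_indicator)
  have Dint: "integrable lborel D"
  proof (rule integrableI_nonneg)
    have "(\<integral>\<^sup>+ x. ennreal (D x) \<partial>lborel) = emeasure ?\<mu> UNIV" by (simp add: em)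
    also have "\<dots> < \<infinity>" using UNIV_le by (simp add: le_less_trans)
    finally show "(\<integral>\<^sup>+ x. ennreal (D x) \<partial>lborel) < \<infinity>" .
  qed (use D in auto)
  have GI: "G t - G s = (LINT z:{s..t}|lborel. D z)" if "s \<le> t" for s t
  proof -
    have "ennreal (G t - G s) = (\<integral>\<^sup>+x. ennreal (indicator {s..t} x *\<^sub>R D x) \<partial>lborel)"
      using Icc[OF that] em[of "{s..t}"] by simp
    also have "\<dots> = ennreal (LINT z:{s..t}|lborel. D z)"
      unfolding set_lebesgue_integral_def
      by (rule nn_integral_eq_integral) (use D set_integrable_of_integrable[OF Dint, of "{s..t}"] in \<open>auto simp: set_integrable_def\<close>)
    finally show ?thesis using Gmono[OF that] D
      by (subst (asm) ennreal_inj) (auto simp: set_lebesgue_integral_def intro!: integral_nonneg_AE)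
  qed
  show thesis
  proof (rule that[OF Dint D(3)])
    show "F t - F s = (LINT z:{s..t}|lborel. D z)" if "0 \<le> s" "s \<le> t" "t \<le> 1" for s t
      using GI[OF that(2)] that by (simp add: G_def)
    show "AE x in lebesgue. x \<in> {0<..<1} \<longrightarrow> (F has_real_derivative D x) (at x)"
      using lebesgue_differentiation[OF Dint]
    proof (rule AE_mp, intro AE_I2 impI)
      fix x assume L: "\<forall>e>0. \<exists>d>0. \<forall>u v. u < v \<and> x \<in> {u..v} \<and> v - u < d \<longrightarrow>
             \<bar>(LINT z:{u..v}|lborel. D z) - D x * (v - u)\<bar> \<le> e * (v - u)" and x: "x \<in> {0<..<1}"
      have "(G has_derivative (\<lambda>h. D x * h)) (at x)"
        unfolding has_derivative_at_alt
      proof (intro conjI allI impI)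
        show "bounded_linear ((*) (D x))" by (rule bounded_linear_mult_right)
        fix e :: real assume "e > 0"
        obtain d where d: "d > 0" "\<forall>u v. u < v \<and> x \<in> {u..v} \<and> v - u < d \<longrightarrow>
             \<bar>(LINT z:{u..v}|lborel. D z) - D x * (v - u)\<bar> \<le> e * (v - u)"
          using L[rule_format, OF \<open>e > 0\<close>] by (elim exE conjE)
        show "\<exists>d>0. \<forall>y. norm (y - x) < d \<longrightarrow> norm (G y - G x - D x * (y - x)) \<le> e * norm (y - x)"
        proof (intro exI[of _ d] conjI allI impI d(1))
          fix y assume y: "norm (y - x) < d"
          show "norm (G y - G x - D x * (y - x)) \<le> e * norm (y - x)"
            using d(2)[rule_format, of x y] d(2)[rule_format, of y x] GI[of x y] GI[of y x] y
            by (cases "y = x"; cases "y < x") (auto simp: abs_if algebra_simps split: if_splits)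
        qed
      qed
      then have "(G has_real_derivative D x) (at x)" by (simp add: has_field_derivative_def)
      then show "(F has_real_derivative D x) (at x)"
      proof (rule has_field_derivative_transform_within[of _ _ _ _ "min x (1 - x)"])
        fix y assume "dist y x < min x (1 - x)"
        then have "0 < y" "y < 1" by (auto simp: dist_real_def abs_if split: if_splits)
        then show "G y = F y" by (simp add: G_def)
      qed (use x in auto)
    qed
  qed
qed

text \<open>Choices at different indices are independent, so the suprema can be pulled out one at a
  time; \<open>c\<close> carries the summands of the indices already fixed.\<close>

lemma sum_SUP_le_ennreal:
  fixes f :: "'i \<Rightarrow> 'x \<Rightarrow> ennreal"
  assumes "finite I" "\<And>i. i \<in> I \<Longrightarrow> A i \<noteq> {}"
    and "\<And>x. (\<And>i. i \<in> I \<Longrightarrow> x i \<in> A i) \<Longrightarrow> c + (\<Sum>i\<in>I. f i (x i)) \<le> e"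
  shows "c + (\<Sum>i\<in>I. SUP x\<in>A i. f i x) \<le> e"
  using assms
proof (induction I arbitrary: c rule: finite_induct)
  case empty
  then show ?case by simp
next
  case (insert j I)
  have *: "(c + f j y) + (\<Sum>i\<in>I. SUP x\<in>A i. f i x) \<le> e" if y: "y \<in> A j" for y
  proof (rule insert.IH)
    show "A i \<noteq> {}" if "i \<in> I" for i using insert that by auto
    fix x assume x: "\<And>i. i \<in> I \<Longrightarrow> x i \<in> A i"
    have "c + (\<Sum>i\<in>insert j I. f i ((x(j := y)) i)) \<le> e"
      using x y by (intro insert.prems(2)) auto
    also have "(\<Sum>i\<in>insert j I. f i ((x(j := y)) i)) = f j y + (\<Sum>i\<in>I. f i (x i))"
      using insert.hyps by (auto intro!: sum.cong arg_cong2[of _ _ _ _ "(+)"])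
    finally show "c + f j y + (\<Sum>i\<in>I. f i (x i)) \<le> e" by (simp add: add.assoc)
  qed
  have "c + (\<Sum>i\<in>insert j I. SUP x\<in>A i. f i x) = (SUP y\<in>A j. f j y) + (c + (\<Sum>i\<in>I. SUP x\<in>A i. f i x))"
    using insert.hyps by (simp add: ac_simps)
  also have "\<dots> = (SUP y\<in>A j. f j y + (c + (\<Sum>i\<in>I. SUP x\<in>A i. f i x)))"
    using insert.prems(1)[of j] by (intro ennreal_SUP_add_left[symmetric]) auto
  also have "\<dots> \<le> e" using * by (intro SUP_least) (simp add: ac_simps)
  finally show ?case .
qed

section \<open>Polygonal approximation, length and variation of curves\<close>

definition partitions :: "real set \<Rightarrow> (nat \<times> (nat \<Rightarrow> real)) set" where
  "partitions I = {(n, t). mono_on {..n} t \<and> t ` {..n} \<subseteq> I}"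

definition polygon_length :: "'a metric \<Rightarrow> (real \<Rightarrow> 'a) \<Rightarrow> nat \<times> (nat \<Rightarrow> real) \<Rightarrow> ennreal" where
  "polygon_length m \<beta> = (\<lambda>(n, t). \<Sum>i<n. ennreal (mdist m (\<beta> (t i)) (\<beta> (t (Suc i)))))"

lemma curve_length_eq: "curve_length m I \<beta> = (SUP z\<in>partitions I. polygon_length m \<beta> z)"
  unfolding curve_length_def partitions_def polygon_length_def by (auto intro!: SUP_cong)

lemma partitions_nonempty: "a \<le> b \<Longrightarrow> partitions {a..b} \<noteq> {}"
proof -
  assume "a \<le> b"
  then have "(0, \<lambda>_. a) \<in> partitions {a..b}" by (auto simp: partitions_def mono_on_def)
  then show ?thesis by blast
qed

lemma mdist_triangle_ennreal:
  assumes "x \<in> mspace m" "y \<in> mspace m" "z \<in> mspace m"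
  shows "ennreal (mdist m x z) \<le> ennreal (mdist m x y) + ennreal (mdist m y z)"
  using mdist_triangle[OF assms] by (simp flip: ennreal_plus add: ennreal_leI)

text \<open>Cutting at \<open>b\<close> by clamping every node with \<open>min\<close> and
  \<open>max\<close> keeps the number of nodes. The triangle inequality is needed only for a segment
  that crosses \<open>b\<close>.\<close>

lemma curve_length_split:
  assumes \<beta>: "\<beta> \<in> {a..c} \<rightarrow> mspace m" and "a \<le> b" "b \<le> c"
  shows "curve_length m {a..c} \<beta> \<le> curve_length m {a..b} \<beta> + curve_length m {b..c} \<beta>"
  unfolding curve_length_eq[of m "{a..c}"]
proof (rule SUP_least, clarify)
  fix n t assume nt: "(n, t) \<in> partitions {a..c}"
  then have t: "\<And>i j. i \<le> j \<Longrightarrow> j \<le> n \<Longrightarrow> t i \<le> t j" "\<And>i. i \<le> n \<Longrightarrow> t i \<in> {a..c}"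
    by (auto simp: partitions_def mono_on_def)
  have 1: "(n, \<lambda>i. min (t i) b) \<in> partitions {a..b}" "(n, \<lambda>i. max (t i) b) \<in> partitions {b..c}"
    using t assms by (fastforce simp: partitions_def mono_on_def min_def max_def)+
  have "polygon_length m \<beta> (n, t) \<le> polygon_length m \<beta> (n, \<lambda>i. min (t i) b) + polygon_length m \<beta> (n, \<lambda>i. max (t i) b)"
    unfolding polygon_length_def prod.case sum.distrib[symmetric]
  proof (rule sum_mono)
    fix i assume "i \<in> {..<n}"
    then have i: "t i \<le> t (Suc i)" "t i \<in> {a..c}" "t (Suc i) \<in> {a..c}" using t(1)[of i "Suc i"] t(2) by auto
    have m: "\<beta> (t i) \<in> mspace m" "\<beta> (t (Suc i)) \<in> mspace m" "\<beta> b \<in> mspace m"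
      using \<beta> i assms by auto
    consider "t (Suc i) \<le> b" | "b \<le> t i" | "t i \<le> b" "b \<le> t (Suc i)" by linarith
    then show "ennreal (mdist m (\<beta> (t i)) (\<beta> (t (Suc i)))) \<le>
       ennreal (mdist m (\<beta> (min (t i) b)) (\<beta> (min (t (Suc i)) b))) + ennreal (mdist m (\<beta> (max (t i) b)) (\<beta> (max (t (Suc i)) b)))"
    proof cases
      case 1 then show ?thesis using i by (simp add: min_absorb1 max_absorb2)
    next
      case 2 then show ?thesis using i by (simp add: min_absorb2 max_absorb1)
    next
      case 3 then show ?thesis using mdist_triangle_ennreal[OF m(1) m(3) m(2)] by (simp add: min_absorb1 min_absorb2 max_absorb1 max_absorb2)
    qed
  qed
  also have "\<dots> \<le> curve_length m {a..b} \<beta> + curve_length m {b..c} \<beta>"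
    unfolding curve_length_eq using 1 by (intro add_mono SUP_upper)
  finally show "polygon_length m \<beta> (n, t) \<le> curve_length m {a..b} \<beta> + curve_length m {b..c} \<beta>" .
qed

lemma curve_length_append:
  assumes "a \<le> b" "b \<le> c"
  shows "curve_length m {a..b} \<beta> + ennreal (mdist m (\<beta> b) (\<beta> c)) \<le> curve_length m {a..c} \<beta>"
  unfolding curve_length_eq[of m "{a..b}"]
proof (subst ennreal_SUP_add_left[symmetric, OF partitions_nonempty[OF assms(1)]], rule SUP_least, clarify)
  fix n t assume nt: "(n, t) \<in> partitions {a..b}"
  then have t: "\<And>i j. i \<le> j \<Longrightarrow> j \<le> n \<Longrightarrow> t i \<le> t j" "\<And>i. i \<le> n \<Longrightarrow> t i \<in> {a..b}"
    by (auto simp: partitions_def mono_on_def)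
  \<comment> \<open>Two nodes are appended: the segment up to \<open>b\<close> can only add length,
    and the one from \<open>b\<close> to \<open>c\<close> is the extra chord.\<close>
  define t' where "t' = (\<lambda>i. if i \<le> n then t i else if i = Suc n then b else c)"
  have "(Suc (Suc n), t') \<in> partitions {a..c}"
    using t assms by (fastforce simp: partitions_def mono_on_def t'_def)
  then have "polygon_length m \<beta> (Suc (Suc n), t') \<le> curve_length m {a..c} \<beta>"
    unfolding curve_length_eq by (rule SUP_upper)
  moreover have "polygon_length m \<beta> (n, t) + ennreal (mdist m (\<beta> b) (\<beta> c)) \<le> polygon_length m \<beta> (Suc (Suc n), t')"
  proof -
    have "polygon_length m \<beta> (n, t) = (\<Sum>i<n. ennreal (mdist m (\<beta> (t' i)) (\<beta> (t' (Suc i)))))"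
      unfolding polygon_length_def prod.case by (rule sum.cong) (auto simp: t'_def)
    moreover have "t' (Suc n) = b" "t' (Suc (Suc n)) = c" by (auto simp: t'_def)
    ultimately show ?thesis
      unfolding polygon_length_def prod.case sum.lessThan_Suc
      by (simp only:) (intro add_right_mono, simp)
  qed
  ultimately show "polygon_length m \<beta> (n, t) + ennreal (mdist m (\<beta> b) (\<beta> c)) \<le> curve_length m {a..c} \<beta>"
    by (rule order_trans[rotated])
qed

text \<open>Partitions of finitely many disjoint intervals together form one finite family of
  disjoint intervals, indexed by interval and node, of no larger total length. Absolute continuity
  bounds its chords uniformly, hence also the suprema over the partitions.\<close>

lemma abs_continuous_curve_length:
  assumes ac: "abs_continuous m \<beta>" and e: "0 < (e :: real)"
  shows "\<exists>\<delta>>0. \<forall>(I :: nat set) u v. finite I \<longrightarrow> (\<forall>i\<in>I. 0 \<le> u i \<and> u i \<le> v i \<and> v i \<le> 1) \<longrightarrow>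
     disjoint_family_on (\<lambda>i. {u i<..<v i}) I \<longrightarrow> (\<Sum>i\<in>I. v i - u i) < \<delta> \<longrightarrow>
     (\<Sum>i\<in>I. curve_length m {u i..v i} \<beta>) \<le> ennreal e"
proof -
  obtain \<delta> where \<delta>: "0 < \<delta>" "\<forall>(I :: (nat \<times> nat) set) u v. finite I \<longrightarrow> (\<forall>i\<in>I. 0 \<le> u i \<and> u i \<le> v i \<and> v i \<le> 1) \<longrightarrow>
     disjoint_family_on (\<lambda>i. {u i<..<v i}) I \<longrightarrow> (\<Sum>i\<in>I. v i - u i) < \<delta> \<longrightarrow>
     (\<Sum>i\<in>I. mdist m (\<beta> (u i)) (\<beta> (v i))) < e"
    using abs_continuous_finite[OF ac e] by (elim exE conjE)
  show ?thesis
  proof (intro exI[of _ \<delta>] conjI allI impI \<delta>(1))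
    fix I :: "nat set" and u v :: "nat \<Rightarrow> real"
    assume I: "finite I" "\<forall>i\<in>I. 0 \<le> u i \<and> u i \<le> v i \<and> v i \<le> 1"
      "disjoint_family_on (\<lambda>i. {u i<..<v i}) I" "(\<Sum>i\<in>I. v i - u i) < \<delta>"
    have "0 + (\<Sum>i\<in>I. SUP z\<in>partitions {u i..v i}. polygon_length m \<beta> z) \<le> ennreal e"
    proof (rule sum_SUP_le_ennreal[OF I(1)])
      show "partitions {u i..v i} \<noteq> {}" if "i \<in> I" for i using I that by (intro partitions_nonempty) auto
      fix x assume x: "\<And>i. i \<in> I \<Longrightarrow> x i \<in> partitions {u i..v i}"
      define n where "n = (\<lambda>i. fst (x i))"
      define t where "t = (\<lambda>i. snd (x i))"
      have t: "t i j \<le> t i k" if "i \<in> I" "j \<le> k" "k \<le> n i" for i j k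
        using x[OF that(1)] that by (auto simp: partitions_def mono_on_def n_def t_def case_prod_beta)
      have tI: "t i j \<in> {u i..v i}" if "i \<in> I" "j \<le> n i" for i j
        using x[OF that(1)] that by (auto simp: partitions_def n_def t_def case_prod_beta)
      let ?K = "SIGMA i:I. {..<n i}"
      have finK: "finite ?K" using I by auto
      have "(\<Sum>z\<in>?K. mdist m (\<beta> (case_prod t z)) (\<beta> (t (fst z) (Suc (snd z))))) < e"
      proof (rule \<delta>(2)[rule_format, OF finK])
        fix z assume z: "z \<in> ?K"
        then have "fst z \<in> I" "snd z < n (fst z)" by auto
        then show "0 \<le> case_prod t z \<and> case_prod t z \<le> t (fst z) (Suc (snd z)) \<and> t (fst z) (Suc (snd z)) \<le> 1"
          using I(2) tI[of "fst z" "snd z"] tI[of "fst z" "Suc (snd z)"] t[of "fst z" "snd z" "Suc (snd z)"]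
          by (force simp: case_prod_beta)
      next
        show "disjoint_family_on (\<lambda>z. {case_prod t z<..<t (fst z) (Suc (snd z))}) ?K"
          unfolding disjoint_family_on_def
        proof (intro ballI impI)
          fix z w assume zw: "z \<in> ?K" "w \<in> ?K" "z \<noteq> w"
          obtain i j where z: "z = (i, j)" by (cases z)
          obtain k l where w: "w = (k, l)" by (cases w)
          have *: "i \<in> I" "j < n i" "k \<in> I" "l < n k" using zw z w by auto
          show "{case_prod t z<..<t (fst z) (Suc (snd z))} \<inter> {case_prod t w<..<t (fst w) (Suc (snd w))} = {}"
          proof (cases "i = k")
            case False
            have "{t i j<..<t i (Suc j)} \<subseteq> {u i<..<v i}" "{t k l<..<t k (Suc l)} \<subseteq> {u k<..<v k}"
              using tI[of i j] tI[of i "Suc j"] tI[of k l] tI[of k "Suc l"] * by auto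
            moreover have "{u i<..<v i} \<inter> {u k<..<v k} = {}" using disjoint_family_onD[OF I(3) *(1) *(3) False] .
            ultimately show ?thesis using z w by fastforce
          next
            case True
            then have "j \<noteq> l" using zw z w by auto
            then consider "Suc j \<le> l" | "Suc l \<le> j" by linarith
            then show ?thesis
            proof cases
              case 1 then have "t i (Suc j) \<le> t i l" using t * True by auto
              then show ?thesis using z w True by auto
            next
              case 2 then have "t i (Suc l) \<le> t i j" using t * True by auto
              then show ?thesis using z w True by auto
            qed
          qed
        qed
      next
        have "(\<Sum>z\<in>?K. t (fst z) (Suc (snd z)) - case_prod t z) = (\<Sum>i\<in>I. \<Sum>j<n i. t i (Suc j) - t i j)"
          using I by (subst sum.Sigma) (auto simp: case_prod_beta)
        also have "\<dots> = (\<Sum>i\<in>I. t i (n i) - t i 0)" by (simp add: sum_lessThan_telescope)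
        also have "\<dots> \<le> (\<Sum>i\<in>I. v i - u i)"
          using tI by (intro sum_mono diff_mono) auto
        finally show "(\<Sum>z\<in>?K. t (fst z) (Suc (snd z)) - case_prod t z) < \<delta>" using I(4) by simp
      qed
      moreover have "(\<Sum>i\<in>I. polygon_length m \<beta> (x i)) = ennreal (\<Sum>z\<in>?K. mdist m (\<beta> (case_prod t z)) (\<beta> (t (fst z) (Suc (snd z)))))"
      proof -
        have "(\<Sum>i\<in>I. polygon_length m \<beta> (x i)) = (\<Sum>i\<in>I. \<Sum>j<n i. ennreal (mdist m (\<beta> (t i j)) (\<beta> (t i (Suc j)))))"
          by (simp add: polygon_length_def n_def t_def case_prod_beta)
        also have "\<dots> = (\<Sum>z\<in>?K. ennreal (mdist m (\<beta> (case_prod t z)) (\<beta> (t (fst z) (Suc (snd z))))))"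
          using I by (subst sum.Sigma) (auto simp: case_prod_beta)
        finally show ?thesis by (simp add: sum_ennreal)
      qed
      ultimately show "0 + (\<Sum>i\<in>I. polygon_length m \<beta> (x i)) \<le> ennreal e" by (simp add: ennreal_leI)
    qed
    then show "(\<Sum>i\<in>I. curve_length m {u i..v i} \<beta>) \<le> ennreal e" by (simp add: curve_length_eq)
  qed
qed

text \<open>\<open>V\<close> is the length of the curve on \<open>{0..t}\<close>. It turns a curve
  in a metric space into a monotone real function whose increments dominate all chords, and it is
  absolutely continuous because the lengths of small families of pieces are small.\<close>

lemma abs_continuous_variation:
  assumes \<beta>: "\<beta> \<in> {0..1} \<rightarrow> mspace m" and ac: "abs_continuous m \<beta>"
  obtains V where "mono_on {0..1} V" "abs_continuous euclidean_metric V"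
    "\<And>s t. 0 \<le> s \<Longrightarrow> s \<le> t \<Longrightarrow> t \<le> 1 \<Longrightarrow> mdist m (\<beta> s) (\<beta> t) \<le> V t - V s"
proof -
  let ?L = "\<lambda>a b. curve_length m {a..b} \<beta>"
  have split: "?L a c \<le> ?L a b + ?L b c" if "0 \<le> a" "a \<le> b" "b \<le> c" "c \<le> 1" for a b c
    using that \<beta> by (intro curve_length_split) auto
  have fin: "?L 0 t < \<top>" if "t \<in> {0..1}" for t
  proof -
    obtain \<delta> where \<delta>: "\<delta> > 0" "\<forall>(I :: nat set) u v. finite I \<longrightarrow> (\<forall>i\<in>I. 0 \<le> u i \<and> u i \<le> v i \<and> v i \<le> 1) \<longrightarrow>
       disjoint_family_on (\<lambda>i. {u i<..<v i}) I \<longrightarrow> (\<Sum>i\<in>I. v i - u i) < \<delta> \<longrightarrow>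
       (\<Sum>i\<in>I. curve_length m {u i..v i} \<beta>) \<le> ennreal 1"
      using abs_continuous_curve_length[OF ac, of 1] by (auto elim!: exE conjE)
    have small: "?L a b \<le> 1" if "0 \<le> a" "a \<le> b" "b \<le> 1" "b - a < \<delta>" for a b
      using \<delta>(2)[rule_format, of "{0}" "\<lambda>_. a" "\<lambda>_. b"] that by (simp add: disjoint_family_on_def)
    \<comment> \<open>Pieces shorter than \<delta> have length at most 1, so finiteness spreads in
      steps of \<open>\<delta> / 2\<close>.\<close>
    have "t \<in> {0..1} \<Longrightarrow> t \<le> real n * (\<delta> / 2) \<Longrightarrow> ?L 0 t < \<top>" for n t
    proof (induction n arbitrary: t)
      case 0
      then have "?L 0 t \<le> 1" using \<delta>(1) by (intro small) auto
      then show ?case by (simp add: le_less_trans)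
    next
      case (Suc n)
      let ?s = "max 0 (t - \<delta> / 2)"
      have s: "?s \<in> {0..1}" "?s \<le> real n * (\<delta> / 2)" "?s \<le> t" "t - ?s < \<delta>"
        using Suc.prems \<delta>(1) by (auto simp: algebra_simps max_def)
      have "?L 0 t \<le> ?L 0 ?s + ?L ?s t" using s Suc.prems by (intro split) auto
      also have "\<dots> \<le> ?L 0 ?s + 1" using s Suc.prems by (intro add_left_mono small) auto
      also have "\<dots> < \<top>" using Suc.IH[OF s(1,2)] by simp
      finally show ?case .
    qed
    moreover obtain n :: nat where "1 \<le> real n * (\<delta> / 2)" using \<delta>(1)
      by (metis half_gt_zero mult.commute ex_less_of_nat_mult less_imp_le)
    ultimately show ?thesis using that by (meson atLeastAtMost_iff order_trans)
  qed
  define V where "V = (\<lambda>t. enn2real (?L 0 t))"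
  have LV: "?L 0 t = ennreal (V t)" if "t \<in> {0..1}" for t using fin[OF that] by (simp add: V_def less_top)
  have Vd: "mdist m (\<beta> s) (\<beta> t) \<le> V t - V s" if "0 \<le> s" "s \<le> t" "t \<le> 1" for s t
  proof -
    have "ennreal (V s) + ennreal (mdist m (\<beta> s) (\<beta> t)) \<le> ennreal (V t)"
      using curve_length_append[of 0 s t m \<beta>] that by (simp add: LV)
    then show ?thesis by (simp flip: ennreal_plus add: V_def ennreal_le_iff)
  qed
  have Vup: "ennreal (V t - V s) \<le> ?L s t" if "0 \<le> s" "s \<le> t" "t \<le> 1" for s t
  proof -
    have "ennreal (V t) \<le> ennreal (V s) + ?L s t" using split[of 0 s t] that by (simp add: LV)
    moreover have "0 \<le> V s" by (simp add: V_def)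
    ultimately show ?thesis
      by (subst ennreal_minus[symmetric]) (auto simp: ennreal_minus_le_iff)
  qed
  have "abs_continuous euclidean_metric V"
    unfolding abs_continuous_def
  proof (intro allI impI)
    fix \<epsilon> :: real assume "\<epsilon> > 0"
    then have "\<epsilon> / 2 > 0" by simp
    obtain \<delta> where \<delta>: "\<delta> > 0" "\<forall>(I :: nat set) u v. finite I \<longrightarrow> (\<forall>i\<in>I. 0 \<le> u i \<and> u i \<le> v i \<and> v i \<le> 1) \<longrightarrow>
       disjoint_family_on (\<lambda>i. {u i<..<v i}) I \<longrightarrow> (\<Sum>i\<in>I. v i - u i) < \<delta> \<longrightarrow>
       (\<Sum>i\<in>I. curve_length m {u i..v i} \<beta>) \<le> ennreal (\<epsilon> / 2)"
      using abs_continuous_curve_length[OF ac \<open>\<epsilon> / 2 > 0\<close>] by (elim exE conjE)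
    show "\<exists>\<delta>>0. \<forall>(n::nat) u v. (\<forall>i<n. 0 \<le> u i \<and> u i \<le> v i \<and> v i \<le> 1) \<longrightarrow>
         (\<forall>i<n. \<forall>j<n. i \<noteq> j \<longrightarrow> {u i<..<v i} \<inter> {u j<..<v j} = {}) \<longrightarrow>
         (\<Sum>i<n. v i - u i) < \<delta> \<longrightarrow> (\<Sum>i<n. mdist euclidean_metric (V (u i)) (V (v i))) < \<epsilon>"
    proof (intro exI[of _ \<delta>] conjI allI impI \<delta>(1))
      fix n :: nat and u v
      assume H: "\<forall>i<n. 0 \<le> u i \<and> u i \<le> v i \<and> v i \<le> 1"
        "\<forall>i<n. \<forall>j<n. i \<noteq> j \<longrightarrow> {u i<..<v i} \<inter> {u j<..<v j} = {}" "(\<Sum>i<n. v i - u i) < \<delta>"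
      have nn: "0 \<le> V (v i) - V (u i)" if "i < n" for i
        using Vd[of "u i" "v i"] H(1)[rule_format, OF that] mdist_nonneg[of m "\<beta> (u i)" "\<beta> (v i)"] by linarith
      have "ennreal (\<Sum>i<n. mdist euclidean_metric (V (u i)) (V (v i))) = (\<Sum>i<n. ennreal (V (v i) - V (u i)))"
        using nn by (subst sum_ennreal[symmetric]) (auto simp: dist_real_def intro!: sum.cong)
      also have "\<dots> \<le> (\<Sum>i<n. ?L (u i) (v i))" using H(1) by (intro sum_mono Vup) auto
      also have "\<dots> \<le> ennreal (\<epsilon> / 2)"
        using \<delta>(2)[rule_format, of "{..<n}" u v] H by (auto simp: disjoint_family_on_def)
      finally have "(\<Sum>i<n. mdist euclidean_metric (V (u i)) (V (v i))) \<le> \<epsilon> / 2"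
        using \<open>\<epsilon> > 0\<close> by (subst (asm) ennreal_le_iff) auto
      then show "(\<Sum>i<n. mdist euclidean_metric (V (u i)) (V (v i))) < \<epsilon>" using \<open>\<epsilon> > 0\<close> by simp
    qed
  qed
  moreover have "mono_on {0..1} V"
  proof (rule mono_onI)
    fix r s :: real assume "r \<in> {0..1}" "s \<in> {0..1}" "r \<le> s"
    then have "mdist m (\<beta> r) (\<beta> s) \<le> V s - V r" by (intro Vd) auto
    then show "V r \<le> V s" using mdist_nonneg[of m "\<beta> r" "\<beta> s"] by linarith
  qed
  ultimately show thesis using Vd by (intro that) auto
qed

lemma abs_continuous_dominated:
  fixes F V :: "real \<Rightarrow> real"
  assumes V: "abs_continuous euclidean_metric V"
    and F: "\<And>s t. 0 \<le> s \<Longrightarrow> s \<le> t \<Longrightarrow> t \<le> 1 \<Longrightarrow> \<bar>F t - F s\<bar> \<le> C * \<bar>V t - V s\<bar>" and "0 < C"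
  shows "abs_continuous euclidean_metric F"
  unfolding abs_continuous_def
proof (intro allI impI)
  fix \<epsilon> :: real assume "\<epsilon> > 0"
  then have "\<epsilon> / C > 0" using \<open>0 < C\<close> by simp
  obtain \<delta> where \<delta>: "\<delta> > 0" "\<forall>(n::nat) u v. (\<forall>i<n. 0 \<le> u i \<and> u i \<le> v i \<and> v i \<le> 1) \<longrightarrow>
     (\<forall>i<n. \<forall>j<n. i \<noteq> j \<longrightarrow> {u i<..<v i} \<inter> {u j<..<v j} = {}) \<longrightarrow>
     (\<Sum>i<n. v i - u i) < \<delta> \<longrightarrow> (\<Sum>i<n. mdist euclidean_metric (V (u i)) (V (v i))) < \<epsilon> / C"
    using V[unfolded abs_continuous_def, rule_format, OF \<open>\<epsilon> / C > 0\<close>] by (elim exE conjE)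
  show "\<exists>\<delta>>0. \<forall>(n::nat) u v. (\<forall>i<n. 0 \<le> u i \<and> u i \<le> v i \<and> v i \<le> 1) \<longrightarrow>
     (\<forall>i<n. \<forall>j<n. i \<noteq> j \<longrightarrow> {u i<..<v i} \<inter> {u j<..<v j} = {}) \<longrightarrow>
     (\<Sum>i<n. v i - u i) < \<delta> \<longrightarrow> (\<Sum>i<n. mdist euclidean_metric (F (u i)) (F (v i))) < \<epsilon>"
  proof (intro exI[of _ \<delta>] conjI allI impI \<delta>(1))
    fix n :: nat and u v
    assume H: "\<forall>i<n. 0 \<le> u i \<and> u i \<le> v i \<and> v i \<le> 1"
      "\<forall>i<n. \<forall>j<n. i \<noteq> j \<longrightarrow> {u i<..<v i} \<inter> {u j<..<v j} = {}" "(\<Sum>i<n. v i - u i) < \<delta>"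
    have "(\<Sum>i<n. mdist euclidean_metric (F (u i)) (F (v i))) \<le> (\<Sum>i<n. C * mdist euclidean_metric (V (u i)) (V (v i)))"
      using F H(1) by (intro sum_mono) (simp add: dist_real_def abs_minus_commute)
    also have "\<dots> = C * (\<Sum>i<n. mdist euclidean_metric (V (u i)) (V (v i)))" by (simp add: sum_distrib_left)
    also have "\<dots> < C * (\<epsilon> / C)" using \<delta>(2)[rule_format, of n u v] H \<open>0 < C\<close> by (intro mult_strict_left_mono) auto
    finally show "(\<Sum>i<n. mdist euclidean_metric (F (u i)) (F (v i))) < \<epsilon>" using \<open>0 < C\<close> by simp
  qed
qed

lemma metric_quotient_tendstoI:
  assumes up: "\<And>e. 0 < e \<Longrightarrow> \<exists>d>0. \<forall>y. y \<noteq> x \<and> \<bar>y - x\<bar> < d \<longrightarrow> mdist m (\<beta> y) (\<beta> x) \<le> (v + e) * \<bar>y - x\<bar>"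
    and low: "\<And>e. 0 < e \<Longrightarrow> \<exists>d>0. \<forall>y. y \<noteq> x \<and> \<bar>y - x\<bar> < d \<longrightarrow> (v - e) * \<bar>y - x\<bar> \<le> mdist m (\<beta> y) (\<beta> x)"
  shows "((\<lambda>s. mdist m (\<beta> s) (\<beta> x) / \<bar>s - x\<bar>) \<longlongrightarrow> v) (at x)"
proof (rule tendstoI)
    fix e :: real assume "e > 0"
    then have e: "e / 2 > 0" by simp
    obtain d1 where d1: "d1 > 0" "\<forall>y. y \<noteq> x \<and> \<bar>y - x\<bar> < d1 \<longrightarrow> mdist m (\<beta> y) (\<beta> x) \<le> (v + e/2) * \<bar>y - x\<bar>"
      using up[OF e] by (elim exE conjE)
    obtain d2 where d2: "d2 > 0" "\<forall>y. y \<noteq> x \<and> \<bar>y - x\<bar> < d2 \<longrightarrow> (v - e/2) * \<bar>y - x\<bar> \<le> mdist m (\<beta> y) (\<beta> x)"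
      using low[OF e] by (elim exE conjE)
    show "\<forall>\<^sub>F y in at x. dist (mdist m (\<beta> y) (\<beta> x) / \<bar>y - x\<bar>) v < e"
      unfolding eventually_at
    proof (intro exI[of _ "min d1 d2"] conjI ballI impI)
      fix y assume y: "y \<noteq> x \<and> dist y x < min d1 d2"
      then have p: "\<bar>y - x\<bar> > 0" and "\<bar>y - x\<bar> < d1" "\<bar>y - x\<bar> < d2" by (auto simp: dist_real_def)
      then have "mdist m (\<beta> y) (\<beta> x) \<le> (v + e/2) * \<bar>y - x\<bar>" "(v - e/2) * \<bar>y - x\<bar> \<le> mdist m (\<beta> y) (\<beta> x)"
        using d1(2) d2(2) y by auto
      then have "mdist m (\<beta> y) (\<beta> x) / \<bar>y - x\<bar> \<le> v + e/2" "v - e/2 \<le> mdist m (\<beta> y) (\<beta> x) / \<bar>y - x\<bar>"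
        using p by (auto simp: divide_le_eq le_divide_eq)
      then show "dist (mdist m (\<beta> y) (\<beta> x) / \<bar>y - x\<bar>) v < e"
        using \<open>e > 0\<close> unfolding dist_real_def by linarith
    qed (use d1 d2 in auto)
qed

lemma DERIV_abs_lower:
  fixes F :: "real \<Rightarrow> real"
  assumes "(F has_real_derivative D) (at x)" "0 < e"
  shows "\<exists>d>0. \<forall>y. y \<noteq> x \<and> \<bar>y - x\<bar> < d \<longrightarrow> \<bar>F y - F x - D * (y - x)\<bar> \<le> e * \<bar>y - x\<bar>"
  using assms unfolding has_field_derivative_def has_derivative_at_alt by (simp only: real_norm_def) blast

lemma metric_deriv_eqI:
  "((\<lambda>s. mdist m (\<beta> s) (\<beta> x) / \<bar>s - x\<bar>) \<longlongrightarrow> v) (at x) \<Longrightarrow> metric_deriv m \<beta> x = v"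
  unfolding metric_deriv_def by (intro tendsto_Lim) auto

text \<open>The metric derivative is the supremum of the speeds of \<beta> seen from a dense
  sequence: \<open>\<phi> n\<close> is the distance to \<open>\<beta> (q n)\<close>. Each
  \<open>\<phi> n\<close> changes by at most the chord, which gives the lower bound on difference
  quotients; the integral bound on chords and Lebesgue differentiation give the upper bound.\<close>

theorem metric_derivative_abs_continuous:
  assumes \<beta>: "\<beta> \<in> {0..1} \<rightarrow> mspace m" and ac: "abs_continuous m \<beta>"
  obtains v where "integrable lborel v" "\<And>x. 0 \<le> v x"
    "AE x in lebesgue. x \<in> {0<..<1} \<longrightarrow> ((\<lambda>s. mdist m (\<beta> s) (\<beta> x) / \<bar>s - x\<bar>) \<longlongrightarrow> v x) (at x)"
    "\<And>s t. 0 \<le> s \<Longrightarrow> s \<le> t \<Longrightarrow> t \<le> 1 \<Longrightarrow> mdist m (\<beta> s) (\<beta> t) \<le> (LINT z:{s..t}|lborel. v z)"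
proof -
  obtain V where V: "mono_on {0..1} V" "abs_continuous euclidean_metric V"
    "\<And>s t. 0 \<le> s \<Longrightarrow> s \<le> t \<Longrightarrow> t \<le> 1 \<Longrightarrow> mdist m (\<beta> s) (\<beta> t) \<le> V t - V s"
    using abs_continuous_variation[OF \<beta> ac] by blast
  have m\<beta>: "\<beta> t \<in> mspace m" if "t \<in> {0..1}" for t using \<beta> that by auto
  obtain gV where gV: "integrable lborel gV" "\<And>x. 0 \<le> gV x"
    "\<And>s t. 0 \<le> s \<Longrightarrow> s \<le> t \<Longrightarrow> t \<le> 1 \<Longrightarrow> V t - V s = (LINT z:{s..t}|lborel. gV z)"
    "AE x in lebesgue. x \<in> {0<..<1} \<longrightarrow> (V has_real_derivative gV x) (at x)"
    using AC_mono_FTC[OF V(1,2)] by blast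
  define Q where "Q = \<rat> \<inter> {0..1::real}"
  have cQ: "countable Q" "Q \<noteq> {}" unfolding Q_def by (auto intro: countable_rat countable_Int1 exI[of _ 0])
  define q where "q = from_nat_into Q"
  have qQ: "q n \<in> Q" for n unfolding q_def by (rule from_nat_into[OF cQ(2)])
  have rq: "\<exists>n. q n = r" if "r \<in> Q" for r
    unfolding q_def by (metis cQ(1) from_nat_into_to_nat_on that)
  define \<phi> where "\<phi> = (\<lambda>n t. mdist m (\<beta> t) (\<beta> (q n)))"
  have \<phi>d: "\<bar>\<phi> n t - \<phi> n s\<bar> \<le> mdist m (\<beta> s) (\<beta> t)" if "s \<in> {0..1}" "t \<in> {0..1}" for n s t
  proof -
    have "q n \<in> {0..1}" using qQ by (auto simp: Q_def)
    then show ?thesis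
      using mdist_triangle[of "\<beta> s" m "\<beta> t" "\<beta> (q n)"] mdist_triangle[of "\<beta> t" m "\<beta> s" "\<beta> (q n)"] m\<beta> that
      by (auto simp: \<phi>_def mdist_commute[of m "\<beta> t" "\<beta> s"])
  qed
  have \<phi>V: "\<bar>\<phi> n t - \<phi> n s\<bar> \<le> V t - V s" if "0 \<le> s" "s \<le> t" "t \<le> 1" for n s t
    using \<phi>d[of s t n] V(3)[OF that] that by auto
  \<comment> \<open>\<open>\<phi> n\<close> is not monotone, but \<open>\<phi> n + V\<close> is,
    since \<open>V\<close> dominates its increments. So the monotone fundamental theorem applies,
    and the density of \<open>V\<close> is subtracted afterwards.\<close>
  define P where "P = (\<lambda>n g. integrable lborel g \<and>
      (\<forall>s t. 0 \<le> s \<longrightarrow> s \<le> t \<longrightarrow> t \<le> 1 \<longrightarrow> (\<phi> n t + V t) - (\<phi> n s + V s) = (LINT z:{s..t}|lborel. g z)) \<and>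
      (AE x in lebesgue. x \<in> {0<..<1} \<longrightarrow> ((\<lambda>t. \<phi> n t + V t) has_real_derivative g x) (at x)))"
  have exP: "\<exists>g. P n g" for n
  proof -
    have 1: "mono_on {0..1} (\<lambda>t. \<phi> n t + V t)"
    proof (rule mono_onI)
      fix r s :: real assume "r \<in> {0..1}" "s \<in> {0..1}" "r \<le> s"
      then show "\<phi> n r + V r \<le> \<phi> n s + V s" using \<phi>V[of r s n] by auto
    qed
    have 2: "abs_continuous euclidean_metric (\<lambda>t. \<phi> n t + V t)"
    proof (rule abs_continuous_dominated[OF V(2), of _ 2])
      fix s t :: real assume "0 \<le> s" "s \<le> t" "t \<le> 1"
      then show "\<bar>\<phi> n t + V t - (\<phi> n s + V s)\<bar> \<le> 2 * \<bar>V t - V s\<bar>" using \<phi>V[of s t n] by auto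
    qed simp
    show ?thesis unfolding P_def by (rule AC_mono_FTC[OF 1 2]) blast
  qed
  obtain g where "\<And>n. P n (g n)" using exP by metis
  then have g: "\<And>n. integrable lborel (g n)"
    "\<And>n s t. 0 \<le> s \<Longrightarrow> s \<le> t \<Longrightarrow> t \<le> 1 \<Longrightarrow> (\<phi> n t + V t) - (\<phi> n s + V s) = (LINT z:{s..t}|lborel. g n z)"
    "\<And>n. AE x in lebesgue. x \<in> {0<..<1} \<longrightarrow> ((\<lambda>t. \<phi> n t + V t) has_real_derivative g n x) (at x)"
    unfolding P_def by blast+
  define h where "h = (\<lambda>n x. g n x - gV x)"
  have hint: "integrable lborel (h n)" for n unfolding h_def using g gV by auto
  have hI: "\<phi> n t - \<phi> n s = (LINT z:{s..t}|lborel. h n z)" if "0 \<le> s" "s \<le> t" "t \<le> 1" for n s t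
  proof -
    have "(LINT z:{s..t}|lborel. h n z) = (LINT z:{s..t}|lborel. g n z) - (LINT z:{s..t}|lborel. gV z)"
      unfolding h_def by (intro set_integral_diff set_integrable_of_integrable g gV) auto
    then show ?thesis using g(2)[OF that, of n] gV(3)[OF that] by simp
  qed
  have hD: "AE x in lebesgue. x \<in> {0<..<1} \<longrightarrow> (\<forall>n. (\<phi> n has_real_derivative h n x) (at x) \<and> \<bar>h n x\<bar> \<le> gV x)"
  proof -
    have "AE x in lebesgue. \<forall>n. x \<in> {0<..<1} \<longrightarrow> ((\<lambda>t. \<phi> n t + V t) has_real_derivative g n x) (at x)"
      unfolding AE_all_countable using g(3) by blast
    with gV(4) show ?thesis
    proof eventually_elim
      case (elim x)
      show ?case
      proof (intro impI allI)
        fix n assume x: "x \<in> {0<..<1}"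
        have D: "(\<phi> n has_real_derivative h n x) (at x)"
          using DERIV_diff[OF elim(2)[rule_format, OF x, of n] elim(1)[rule_format, OF x]] unfolding h_def by simp
        have DV: "(V has_real_derivative gV x) (at x)" using elim(1) x by simp
        have "\<bar>h n x\<bar> \<le> gV x"
        proof (rule tendsto_le[of "at_right x"])
          show "((\<lambda>y. (V y - V x) / (y - x)) \<longlongrightarrow> gV x) (at_right x)"
            using DV unfolding has_field_derivative_iff by (rule filterlim_mono) (auto simp: at_le)
          have "((\<lambda>y. (\<phi> n y - \<phi> n x) / (y - x)) \<longlongrightarrow> h n x) (at_right x)"
            using D unfolding has_field_derivative_iff by (rule filterlim_mono) (auto simp: at_le)
          then show "((\<lambda>y. \<bar>(\<phi> n y - \<phi> n x) / (y - x)\<bar>) \<longlongrightarrow> \<bar>h n x\<bar>) (at_right x)" by (rule tendsto_rabs)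
          have "eventually (\<lambda>y. y \<in> {x<..<1}) (at_right x)" using x by (intro eventually_at_right_real) auto
          then show "eventually (\<lambda>y. \<bar>(\<phi> n y - \<phi> n x) / (y - x)\<bar> \<le> (V y - V x) / (y - x)) (at_right x)"
          proof eventually_elim
            case (elim y)
            then show ?case using \<phi>V[of x y n] x by (simp add: abs_divide divide_right_mono)
          qed
        qed simp
        with D show "(\<phi> n has_real_derivative h n x) (at x) \<and> \<bar>h n x\<bar> \<le> gV x" by simp
      qed
    qed
  qed
  \<comment> \<open>The bound \<open>\<bar>h n x\<bar> \<le> gV x\<close> is known only almost
    everywhere; capping by \<open>gV x\<close> makes the real supremum well defined at every
    point.\<close>
  define v where "v = (\<lambda>x. SUP n. min \<bar>h n x\<bar> (gV x))"
  have bdd: "bdd_above (range (\<lambda>n. min \<bar>h n x\<bar> (gV x)))" for x by (rule bdd_aboveI[of _ "gV x"]) auto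
  have [measurable]: "h n \<in> borel_measurable borel" "gV \<in> borel_measurable borel" for n
    using borel_measurable_integrable[OF hint[of n]] borel_measurable_integrable[OF gV(1)] by auto
  have vm[measurable]: "v \<in> borel_measurable borel"
    unfolding v_def by (rule borel_measurable_cSUP) (use bdd in auto)
  have hv: "min \<bar>h n x\<bar> (gV x) \<le> v x" for n x unfolding v_def by (rule cSUP_upper[OF _ bdd]) simp
  have v0: "0 \<le> v x" for x using hv[of 0 x] gV(2)[of x] by auto
  have vgV: "v x \<le> gV x" for x unfolding v_def by (rule cSUP_least) auto
  have vint: "integrable lborel v"
    by (rule Bochner_Integration.integrable_bound[OF gV(1)]) (use v0 vgV gV(2) in auto)
  have dint: "mdist m (\<beta> s) (\<beta> t) \<le> (LINT z:{s..t}|lborel. v z)" if st: "0 \<le> s" "s \<le> t" "t \<le> 1" for s t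
  proof (rule field_le_epsilon)
    fix e :: real assume "e > 0"
    then have "e / 2 > 0" by simp
    obtain d where d: "d > 0" "\<forall>s\<in>{0..1}. \<forall>t\<in>{0..1}. \<bar>s - t\<bar> < d \<longrightarrow> mdist m (\<beta> s) (\<beta> t) < e/2"
      using abs_continuous_imp_uniform[OF ac \<open>e / 2 > 0\<close>] by (elim exE conjE)
    \<comment> \<open>The distance from \<open>\<beta> r\<close> with \<open>r\<close> close to
      \<open>s\<close> nearly realises the chord, so a single \<open>\<phi> n\<close> suffices up to
      \<open>e\<close>.\<close>
    obtain r where r: "r \<in> Q" "\<bar>r - s\<bar> < d"
    proof -
      define lo where "lo = (if s < 1 then s else max (1 - d) 0)"
      define hi where "hi = (if s < 1 then min 1 (s + d) else 1)"
      have "lo < hi" using st d(1) by (auto simp: lo_def hi_def)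
      then obtain r where "r \<in> \<rat>" "lo < r" "r < hi" using Rats_dense_in_real by blast
      then show ?thesis using st d(1) by (intro that[of r]) (auto simp: Q_def lo_def hi_def split: if_splits)
    qed
    then obtain n where n: "q n = r" using rq by blast
    have r01: "r \<in> {0..1}" using r by (auto simp: Q_def)
    have "mdist m (\<beta> s) (\<beta> r) < e/2" using d(2) r01 r(2) st by (auto simp: abs_minus_commute)
    then have "\<phi> n s < e/2" by (simp add: \<phi>_def n)
    moreover have "mdist m (\<beta> s) (\<beta> t) \<le> \<phi> n s + \<phi> n t"
      using mdist_triangle[of "\<beta> s" m "\<beta> r" "\<beta> t"] m\<beta> r01 st by (simp add: \<phi>_def n mdist_commute)
    ultimately have "mdist m (\<beta> s) (\<beta> t) \<le> \<phi> n t - \<phi> n s + e" by linarith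
    also have "\<phi> n t - \<phi> n s = (LINT z:{s..t}|lborel. h n z)" by (rule hI[OF st])
    also have "\<dots> \<le> (LINT z:{s..t}|lborel. v z)"
    proof (rule set_integral_mono_AE)
      show "set_integrable lborel {s..t} (h n)" "set_integrable lborel {s..t} v"
        using hint vint by (auto intro!: set_integrable_of_integrable)
      have "AE x in lebesgue. x \<in> {0<..<1} \<longrightarrow> h n x \<le> v x"
        using hD by eventually_elim (use hv in \<open>force simp: min_def abs_if split: if_splits\<close>)
      then have "AE x in lborel. x \<in> {0<..<1} \<longrightarrow> h n x \<le> v x" by (subst (asm) AE_completion_iff) auto
      moreover have "AE x in lborel. x \<noteq> (0::real)" "AE x in lborel. x \<noteq> (1::real)" by (rule AE_lborel_singleton)+
      ultimately show "AE x\<in>{s..t} in lborel. h n x \<le> v x"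
        by eventually_elim (use st in auto)
    qed
    finally show "mdist m (\<beta> s) (\<beta> t) \<le> (LINT z:{s..t}|lborel. v z) + e" by simp
  qed
  have "AE x in lebesgue. x \<in> {0<..<1} \<longrightarrow> ((\<lambda>s. mdist m (\<beta> s) (\<beta> x) / \<bar>s - x\<bar>) \<longlongrightarrow> v x) (at x)"
    using hD lebesgue_differentiation[OF vint]
  proof eventually_elim
    case (elim x)
    show ?case
    proof
      assume x: "x \<in> {0<..<1}"
      show "((\<lambda>s. mdist m (\<beta> s) (\<beta> x) / \<bar>s - x\<bar>) \<longlongrightarrow> v x) (at x)"
      proof (rule metric_quotient_tendstoI)
        fix e :: real assume e: "e > 0"
        obtain d where d: "d > 0" "\<forall>u w. u < w \<and> x \<in> {u..w} \<and> w - u < d \<longrightarrow>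
             \<bar>(LINT z:{u..w}|lborel. v z) - v x * (w - u)\<bar> \<le> e * (w - u)"
          using elim(2)[rule_format, OF e] by (elim exE conjE)
        show "\<exists>d>0. \<forall>y. y \<noteq> x \<and> \<bar>y - x\<bar> < d \<longrightarrow> mdist m (\<beta> y) (\<beta> x) \<le> (v x + e) * \<bar>y - x\<bar>"
        proof (intro exI[of _ "min d (min x (1 - x))"] conjI allI impI)
          fix y assume y: "y \<noteq> x \<and> \<bar>y - x\<bar> < min d (min x (1 - x))"
          then have y01: "0 < y" "y < 1" by (auto simp: abs_if split: if_splits)
          show "mdist m (\<beta> y) (\<beta> x) \<le> (v x + e) * \<bar>y - x\<bar>"
            using dint[of x y] dint[of y x] d(2)[rule_format, of x y] d(2)[rule_format, of y x] y y01 x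
            by (cases "y < x") (auto simp: mdist_commute algebra_simps abs_if split: if_splits)
        qed (use d x in auto)
        obtain n where n: "v x - e / 2 < min \<bar>h n x\<bar> (gV x)"
          unfolding v_def using less_cSUP_iff[OF _ bdd, of "(SUP n. min \<bar>h n x\<bar> (gV x)) - e/2" x] e by auto
        have D: "(\<phi> n has_real_derivative h n x) (at x)" using elim(1) x by auto
        obtain d where d: "d > 0" "\<forall>y. y \<noteq> x \<and> \<bar>y - x\<bar> < d \<longrightarrow> \<bar>\<phi> n y - \<phi> n x - h n x * (y - x)\<bar> \<le> e/2 * \<bar>y - x\<bar>"
          using DERIV_abs_lower[OF D, of "e/2"] e by auto
        show "\<exists>d>0. \<forall>y. y \<noteq> x \<and> \<bar>y - x\<bar> < d \<longrightarrow> (v x - e) * \<bar>y - x\<bar> \<le> mdist m (\<beta> y) (\<beta> x)"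
        proof (intro exI[of _ "min d (min x (1 - x))"] conjI allI impI)
          fix y assume y: "y \<noteq> x \<and> \<bar>y - x\<bar> < min d (min x (1 - x))"
          then have y01: "0 < y" "y < 1" by (auto simp: abs_if split: if_splits)
          have "(v x - e/2) * \<bar>y - x\<bar> \<le> \<bar>h n x\<bar> * \<bar>y - x\<bar>" using n by (intro mult_right_mono) auto
          also have "\<dots> = \<bar>h n x * (y - x)\<bar>" by (simp add: abs_mult)
          also have "\<dots> \<le> \<bar>\<phi> n y - \<phi> n x\<bar> + e/2 * \<bar>y - x\<bar>"
            using d(2)[rule_format, of y] y by (simp add: abs_if split: if_splits)
          also have "\<dots> \<le> mdist m (\<beta> y) (\<beta> x) + e/2 * \<bar>y - x\<bar>"
            using \<phi>d[of x y n] x y01 by (auto simp: mdist_commute)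
          finally show "(v x - e) * \<bar>y - x\<bar> \<le> mdist m (\<beta> y) (\<beta> x)" by (simp add: algebra_simps)
        qed (use d x in auto)
      qed
    qed
  qed
  then show thesis using that vint v0 dint by blast
qed

section \<open>Curves in generalized cones\<close>

lemma lipschitz_abs_continuous:
  assumes "\<And>s t. s \<in> {0..1} \<Longrightarrow> t \<in> {0..1} \<Longrightarrow> mdist m (\<gamma> s) (\<gamma> t) \<le> L * \<bar>s - t\<bar>" and "0 \<le> L"
  shows "abs_continuous m \<gamma>"
  unfolding abs_continuous_def
proof (intro allI impI)
  fix \<epsilon> :: real assume "\<epsilon> > 0"
  show "\<exists>\<delta>>0. \<forall>(n::nat) u v. (\<forall>i<n. 0 \<le> u i \<and> u i \<le> v i \<and> v i \<le> 1) \<longrightarrow>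
       (\<forall>i<n. \<forall>j<n. i \<noteq> j \<longrightarrow> {u i<..<v i} \<inter> {u j<..<v j} = {}) \<longrightarrow>
       (\<Sum>i<n. v i - u i) < \<delta> \<longrightarrow> (\<Sum>i<n. mdist m (\<gamma> (u i)) (\<gamma> (v i))) < \<epsilon>"
  proof (intro exI[of _ "\<epsilon> / (L + 1)"] conjI allI impI)
    show "\<epsilon> / (L + 1) > 0" using \<open>\<epsilon> > 0\<close> assms(2) by simp
    fix n :: nat and u v
    assume H: "\<forall>i<n. 0 \<le> u i \<and> u i \<le> v i \<and> v i \<le> 1" "(\<Sum>i<n. v i - u i) < \<epsilon> / (L + 1)"
    have "(\<Sum>i<n. mdist m (\<gamma> (u i)) (\<gamma> (v i))) \<le> (\<Sum>i<n. (L + 1) * (v i - u i))"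
    proof (rule sum_mono)
      fix i assume "i \<in> {..<n}"
      then have "0 \<le> u i" "u i \<le> v i" "v i \<le> 1" using H by auto
      then have "mdist m (\<gamma> (u i)) (\<gamma> (v i)) \<le> L * \<bar>u i - v i\<bar>" by (intro assms(1)) auto
      also have "\<dots> \<le> (L + 1) * (v i - u i)" using \<open>u i \<le> v i\<close> by (simp add: algebra_simps)
      finally show "mdist m (\<gamma> (u i)) (\<gamma> (v i)) \<le> (L + 1) * (v i - u i)" .
    qed
    also have "\<dots> = (L + 1) * (\<Sum>i<n. v i - u i)" by (simp add: sum_distrib_left)
    also have "\<dots> < (L + 1) * (\<epsilon> / (L + 1))" using H assms(2) by (intro mult_strict_left_mono) auto
    finally show "(\<Sum>i<n. mdist m (\<gamma> (u i)) (\<gamma> (v i))) < \<epsilon>" using assms(2) by simp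
  qed
qed

text \<open>A curve of length below \<open>L\<close> is reparametrized by \<open>\<phi>\<close>, its
  length up to \<open>t\<close> plus a linear term. The argument does not go through continuity of
  \<phi>: it uses the generalized inverse \<psi> of \<phi>, together with continuity of the curve
  itself.\<close>

lemma length_space_lipschitz_curve:
  assumes Y: "length_space Y" and w: "w \<in> mspace Y" "w' \<in> mspace Y" and L: "mdist Y w w' < L"
  obtains \<beta> where "\<beta> \<in> {0..1} \<rightarrow> mspace Y" "\<beta> 0 = w" "\<beta> 1 = w'"
    "\<And>u v. u \<in> {0..1} \<Longrightarrow> v \<in> {0..1} \<Longrightarrow> mdist Y (\<beta> u) (\<beta> v) \<le> L * \<bar>u - v\<bar>"
proof -
  have L0: "0 < L" using L mdist_nonneg[of Y w w'] by linarith
  have "(INF \<beta>\<in>{\<beta>. continuous_map (top_of_set {0..1}) (mtopology_of Y) \<beta> \<and> \<beta> 0 = w \<and> \<beta> 1 = w'}. curve_length Y {0..1} \<beta>) < ennreal L"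
    using ennreal_lessI[OF L0 L] Y w unfolding length_space_def by simp
  then obtain b where b: "continuous_map (top_of_set {0..1}) (mtopology_of Y) b" "b 0 = w" "b 1 = w'"
    "curve_length Y {0..1} b < ennreal L"
    by (auto simp: INF_less_iff)
  have bY: "b u \<in> mspace Y" if "u \<in> {0..1}" for u
    using b(1) that unfolding continuous_map_def by auto
  have bcont: "\<exists>d>0. \<forall>v\<in>{0..1}. \<bar>v - u\<bar> < d \<longrightarrow> mdist Y (b u) (b v) < e" if "u \<in> {0..1}" "0 < e" for u e
  proof -
    from b(1) that obtain U where U: "openin (top_of_set {0..1}) U" "u \<in> U" "\<forall>v\<in>U. b v \<in> Metric_space.mball (mspace Y) (mdist Y) (b u) e"
      unfolding mtopology_of_def Metric_space.continuous_map_to_metric[OF Metric_space_mspace_mdist]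
      by (metis topspace_euclidean_subtopology)
    then obtain d where d: "d > 0" "ball u d \<inter> {0..1} \<subseteq> U" unfolding openin_contains_ball by auto
    show ?thesis
    proof (intro exI[of _ d] conjI ballI impI d(1))
      fix v assume "v \<in> {0..1}" "\<bar>v - u\<bar> < d"
      then have "v \<in> U" using d(2) by (auto simp: dist_real_def abs_minus_commute)
      then show "mdist Y (b u) (b v) < e" using U(3) by (auto simp: Metric_space.in_mball[OF Metric_space_mspace_mdist])
    qed
  qed
  let ?l = "\<lambda>t. curve_length Y {0..t} b"
  have lmono: "?l s + ennreal (mdist Y (b s) (b t)) \<le> ?l t" if "0 \<le> s" "s \<le> t" for s t
    using curve_length_append[of 0 s t Y b] that by auto
  have lfin: "?l t < \<top>" if "t \<in> {0..1}" for t
  proof -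
    have "?l t \<le> ?l t + ennreal (mdist Y (b t) (b 1))" by (rule add_increasing2) auto
    also have "\<dots> \<le> ?l 1" using that by (intro lmono) auto
    also have "\<dots> < \<top>" using b(4) by (rule less_trans) simp
    finally show ?thesis .
  qed
  define l where "l = (\<lambda>t. enn2real (?l t))"
  have leq: "?l t = ennreal (l t)" if "t \<in> {0..1}" for t using lfin[OF that] by (simp add: l_def less_top)
  have ld: "mdist Y (b s) (b t) \<le> l t - l s" if "0 \<le> s" "s \<le> t" "t \<le> 1" for s t
  proof -
    have "ennreal (l s) + ennreal (mdist Y (b s) (b t)) \<le> ennreal (l t)" using lmono[of s t] leq that by auto
    then show ?thesis by (simp flip: ennreal_plus add: l_def ennreal_le_iff)
  qed
  have l0: "0 \<le> l t" for t by (simp add: l_def)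
  have "ennreal (l 1) < ennreal L" using b(4) leq[of 1] by simp
  then have l1: "l 1 < L" using l0[of 1] ennreal_less_iff by blast
  have l00: "l 0 = 0"
  proof -
    have "curve_length Y {0..0} b = 0"
      unfolding curve_length_eq
    proof (rule antisym[OF SUP_least], clarify)
      fix n t assume "(n, t) \<in> partitions {0..0}"
      then have t0: "t i = 0" if "i \<le> n" for i using that by (auto simp: partitions_def)
      have "polygon_length Y b (n, t) = (\<Sum>i<n. 0)"
        unfolding polygon_length_def prod.case
      proof (rule sum.cong[OF refl])
        fix i assume "i \<in> {..<n}"
        then have "t i = 0" "t (Suc i) = 0" using t0 by auto
        moreover have "mdist Y (b 0) (b 0) = 0" using bY[of 0] by simp
        ultimately show "ennreal (mdist Y (b (t i)) (b (t (Suc i)))) = 0" by simp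
      qed
      then show "polygon_length Y b (n, t) \<le> 0" by simp
    qed simp
    then show ?thesis by (simp add: l_def)
  qed
  define \<eta> where "\<eta> = L - l 1"
  have \<eta>: "\<eta> > 0" using l1 by (simp add: \<eta>_def)
  define \<phi> where "\<phi> = (\<lambda>t. l t + \<eta> * t)"
  have \<phi>d: "mdist Y (b s) (b t) \<le> \<phi> t - \<phi> s" if "0 \<le> s" "s \<le> t" "t \<le> 1" for s t
  proof -
    have "\<eta> * s \<le> \<eta> * t" using that \<eta> by (intro mult_left_mono) auto
    then show ?thesis using ld[OF that] by (simp add: \<phi>_def)
  qed
  have \<phi>1: "\<phi> 1 = L" by (simp add: \<phi>_def \<eta>_def)
  have \<phi>0: "\<phi> 0 = 0" by (simp add: \<phi>_def l00)
  define A where "A = (\<lambda>u. {t \<in> {0..1}. \<phi> t \<le> u * L})"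
  define \<psi> where "\<psi> = (\<lambda>u. Sup (A u))"
  have A0: "0 \<in> A u" if "u \<in> {0..1}" for u using that L0 \<phi>0 by (auto simp: A_def)
  have Ab: "bdd_above (A u)" for u by (rule bdd_aboveI[of _ 1]) (auto simp: A_def)
  have \<psi>01: "\<psi> u \<in> {0..1}" if "u \<in> {0..1}" for u
    using A0[OF that] Ab[of u] unfolding \<psi>_def by (auto intro!: cSup_upper cSup_least simp: A_def)
  have \<psi>0: "\<psi> 0 = 0"
  proof -
    have "A 0 \<subseteq> {0}"
    proof
      fix t assume "t \<in> A 0"
      then have "t \<in> {0..1}" "l t + \<eta> * t \<le> 0" by (auto simp: A_def \<phi>_def)
      then have "\<eta> * t \<le> 0" using l0[of t] by linarith
      then show "t \<in> {0}" using \<eta> \<open>t \<in> {0..1}\<close> by (auto simp: mult_le_0_iff)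
    qed
    then have "A 0 = {0}" using A0[of 0] by auto
    then show ?thesis by (simp add: \<psi>_def)
  qed
  have \<psi>1: "\<psi> 1 = 1"
  proof -
    have "1 \<in> A 1" by (auto simp: A_def \<phi>1)
    then show ?thesis using \<psi>01[of 1] cSup_upper[OF _ Ab] unfolding \<psi>_def by fastforce
  qed
  have main: "mdist Y (b (\<psi> u)) (b (\<psi> v)) \<le> L * (v - u)" if uv: "u \<in> {0..1}" "v \<in> {0..1}" "u \<le> v" for u v
  proof -
    have "u * L \<le> v * L" using uv L0 by (intro mult_right_mono) auto
    then have "A u \<subseteq> A v" by (auto simp: A_def)
    then have le: "\<psi> u \<le> \<psi> v" unfolding \<psi>_def using A0[OF uv(1)] Ab by (intro cSup_subset_mono) auto
    show ?thesis
    proof (cases "\<psi> u = \<psi> v")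
      case True
      moreover have "0 \<le> L * (v - u)" using uv L0 by simp
      moreover have "mdist Y (b (\<psi> v)) (b (\<psi> v)) = 0" using bY[OF \<psi>01[OF uv(2)]] by simp
      ultimately show ?thesis by simp
    next
      case False
      then have lt: "\<psi> u < \<psi> v" using le by simp
      show ?thesis
      proof (rule field_le_epsilon)
        fix e :: real assume e: "e > 0"
        then have e2: "e / 2 > 0" by simp
        obtain d1 where d1: "d1 > 0" "\<forall>x\<in>{0..1}. \<bar>x - \<psi> u\<bar> < d1 \<longrightarrow> mdist Y (b (\<psi> u)) (b x) < e / 2"
          using bcont[OF \<psi>01[OF uv(1)] e2] by (elim exE conjE)
        obtain d2 where d2: "d2 > 0" "\<forall>x\<in>{0..1}. \<bar>x - \<psi> v\<bar> < d2 \<longrightarrow> mdist Y (b (\<psi> v)) (b x) < e / 2"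
          using bcont[OF \<psi>01[OF uv(2)] e2] by (elim exE conjE)
        \<comment> \<open>Possible jumps of \<phi> at \<open>\<psi> u\<close> and
          \<open>\<psi> v\<close> are avoided: a point \<open>a\<close> just after the first and a
          point \<open>c\<close> at or just before the second have \<phi>-values on the right sides
          of \<open>u * L\<close> and \<open>v * L\<close>. Continuity of \<open>b\<close> pays for
          the replacement.\<close>
        obtain a where a: "\<psi> u < a" "a < \<psi> v" "a < \<psi> u + d1"
          using dense[of "\<psi> u" "min (\<psi> v) (\<psi> u + d1)"] lt d1(1) by auto
        have "max a (\<psi> v - d2) < \<psi> v" using a d2(1) by auto
        then obtain c where c: "c \<in> A v" "max a (\<psi> v - d2) < c"
          unfolding \<psi>_def using less_cSup_iff[OF _ Ab] A0[OF uv(2)] by (metis empty_iff)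
        have cv: "c \<le> \<psi> v" unfolding \<psi>_def by (rule cSup_upper[OF c(1) Ab])
        have a01: "a \<in> {0..1}" using a \<psi>01[OF uv(1)] \<psi>01[OF uv(2)] by auto
        have c01: "c \<in> {0..1}" using c by (auto simp: A_def)
        have "a \<notin> A u" using a(1) cSup_upper[OF _ Ab, of a u] unfolding \<psi>_def by fastforce
        then have "u * L < \<phi> a" using a01 by (auto simp: A_def)
        moreover have "\<phi> c \<le> v * L" using c by (auto simp: A_def)
        moreover have "mdist Y (b a) (b c) \<le> \<phi> c - \<phi> a" using a01 c01 c(2) by (intro \<phi>d) auto
        ultimately have 1: "mdist Y (b a) (b c) \<le> L * (v - u)" by (simp add: algebra_simps)
        have 2: "mdist Y (b (\<psi> u)) (b a) < e / 2" using d1(2) a01 a by auto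
        have 3: "mdist Y (b (\<psi> v)) (b c) < e / 2" using d2(2) c01 c cv by auto
        have "mdist Y (b (\<psi> u)) (b (\<psi> v)) \<le> mdist Y (b (\<psi> u)) (b a) + mdist Y (b a) (b (\<psi> v))"
          by (intro mdist_triangle bY \<psi>01 uv a01)
        also have "mdist Y (b a) (b (\<psi> v)) \<le> mdist Y (b a) (b c) + mdist Y (b c) (b (\<psi> v))"
          by (intro mdist_triangle bY \<psi>01 uv a01 c01)
        finally show "mdist Y (b (\<psi> u)) (b (\<psi> v)) \<le> L * (v - u) + e"
          using 1 2 3 by (simp add: mdist_commute)
      qed
    qed
  qed
  show thesis
  proof (rule that[of "b \<circ> \<psi>"])
    show "b \<circ> \<psi> \<in> {0..1} \<rightarrow> mspace Y" using bY \<psi>01 by auto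
    show "(b \<circ> \<psi>) 0 = w" "(b \<circ> \<psi>) 1 = w'" using \<psi>0 \<psi>1 b by auto
    show "mdist Y ((b \<circ> \<psi>) u) ((b \<circ> \<psi>) v) \<le> L * \<bar>u - v\<bar>" if "u \<in> {0..1}" "v \<in> {0..1}" for u v
      using main[of u v] main[of v u] that by (cases "u \<le> v") (auto simp: mdist_commute)
  qed
qed

lemma AE_lebesgue_on_unit:
  assumes "AE x in lebesgue. x \<in> {0<..<1} \<longrightarrow> P x"
  shows "AE x in lebesgue_on {0..1::real}. P x"
proof -
  have "AE x in lborel. x \<noteq> (0::real)" "AE x in lborel. x \<noteq> (1::real)" by (rule AE_lborel_singleton)+
  then have "AE x in lebesgue. x \<noteq> (0::real)" "AE x in lebesgue. x \<noteq> (1::real)" by (auto intro: AE_completion)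
  with assms have "AE x in lebesgue. x \<in> {0..1} \<longrightarrow> P x" by eventually_elim auto
  then show ?thesis by (subst AE_restrict_space_iff) auto
qed

lemma AE_unit_lebesgue_on:
  assumes "AE x in lebesgue_on {0..1::real}. P x"
  shows "AE x in lebesgue. x \<in> {0<..<1} \<longrightarrow> P x"
proof -
  have "AE x in lebesgue. x \<in> {0..1} \<longrightarrow> P x" using assms by (subst (asm) AE_restrict_space_iff) auto
  then show ?thesis by eventually_elim auto
qed

text \<open>One comparison curve serves two ends: with \<open>T \<circ> \<alpha>\<close> affine it
  decides chronology sharply, with \<alpha> affine it gives explicit lower bounds on \<tau>. The
  metric derivative of \<beta> is at most \<open>L\<close>, so
  \<open>f (\<alpha> u) * L < \<alpha>' u\<close> makes the form negative.\<close>

lemma cone_curve_of_lipschitz: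
  assumes \<alpha>: "\<And>u. u \<in> {0..1} \<Longrightarrow> \<alpha> u \<in> J" "strict_mono_on {0..1} \<alpha>"
      "\<And>u v. u \<in> {0..1} \<Longrightarrow> v \<in> {0..1} \<Longrightarrow> \<bar>\<alpha> u - \<alpha> v\<bar> \<le> A * \<bar>u - v\<bar>"
      "\<And>u. u \<in> {0<..<1} \<Longrightarrow> (\<alpha> has_real_derivative \<alpha>' u) (at u)"
    and \<beta>: "\<beta> \<in> {0..1} \<rightarrow> mspace Y"
      "\<And>u v. u \<in> {0..1} \<Longrightarrow> v \<in> {0..1} \<Longrightarrow> mdist Y (\<beta> u) (\<beta> v) \<le> L * \<bar>u - v\<bar>"
    and f: "\<And>u. u \<in> {0<..<1} \<Longrightarrow> 0 \<le> f (\<alpha> u) \<and> f (\<alpha> u) * L < \<alpha>' u"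
    and AL: "0 \<le> A" "0 \<le> L"
  shows "cone_timelike J Y f (\<lambda>u. (\<alpha> u, \<beta> u)) (\<alpha> 0, \<beta> 0) (\<alpha> 1, \<beta> 1)"
    and "cone_causal J Y f (\<lambda>u. (\<alpha> u, \<beta> u)) (\<alpha> 0, \<beta> 0) (\<alpha> 1, \<beta> 1)"
    and "(\<And>u. u \<in> {0<..<1} \<Longrightarrow> c \<le> sqrt ((\<alpha>' u)\<^sup>2 - (f (\<alpha> u) * L)\<^sup>2)) \<Longrightarrow> 0 \<le> c \<Longrightarrow>
      ennreal c \<le> cone_length Y f (\<lambda>u. (\<alpha> u, \<beta> u))"
proof -
  let ?\<gamma> = "\<lambda>u. (\<alpha> u, \<beta> u)"
  have ac\<beta>: "abs_continuous Y \<beta>" by (rule lipschitz_abs_continuous[OF \<beta>(2) AL(2)])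
  have ac: "abs_continuous (cone_metric J Y) ?\<gamma>"
  proof (rule lipschitz_abs_continuous[of _ _ "A + L"])
    fix s t :: real assume "s \<in> {0..1}" "t \<in> {0..1}"
    then show "mdist (cone_metric J Y) (?\<gamma> s) (?\<gamma> t) \<le> (A + L) * \<bar>s - t\<bar>"
      using \<alpha>(3)[of s t] \<beta>(2)[of s t] by (simp add: distrib_right)
  qed (use AL in auto)
  have cc: "cone_curve J Y ?\<gamma> (\<alpha> 0, \<beta> 0) (\<alpha> 1, \<beta> 1)"
    unfolding cone_curve_def comp_def fst_conv using ac \<alpha>(1,2) \<beta>(1) by (intro conjI) auto
  obtain v where v: "integrable lborel v" "\<And>x. 0 \<le> v x"
    "AE x in lebesgue. x \<in> {0<..<1} \<longrightarrow> ((\<lambda>s. mdist Y (\<beta> s) (\<beta> x) / \<bar>s - x\<bar>) \<longlongrightarrow> v x) (at x)"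
    by (rule metric_derivative_abs_continuous[OF \<beta>(1) ac\<beta>]) (rule that)
  have form: "AE u in lebesgue. u \<in> {0<..<1} \<longrightarrow> cone_form Y f ?\<gamma> u \<le> - ((\<alpha>' u)\<^sup>2 - (f (\<alpha> u) * L)\<^sup>2)"
    using v(3)
  proof eventually_elim
    case (elim x)
    show ?case
    proof
      assume x: "x \<in> {0<..<1}"
      then have lim: "((\<lambda>s. mdist Y (\<beta> s) (\<beta> x) / \<bar>s - x\<bar>) \<longlongrightarrow> v x) (at x)" using elim by simp
      have "v x \<le> L"
      proof (rule tendsto_upperbound[OF lim])
        have "eventually (\<lambda>s. s \<in> {0<..<1}) (at x)" using x by (intro eventually_at_in_open') auto
        moreover have "eventually (\<lambda>s. s \<noteq> x) (at x)" by (rule eventually_neq_at_within)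
        ultimately show "eventually (\<lambda>s. mdist Y (\<beta> s) (\<beta> x) / \<bar>s - x\<bar> \<le> L) (at x)"
        proof eventually_elim
          case (elim s)
          then show ?case using \<beta>(2)[of s x] x by (auto simp: divide_le_eq)
        qed
      qed simp
      moreover have md: "metric_deriv Y \<beta> x = v x" by (rule metric_deriv_eqI[OF lim])
      moreover have dd: "deriv \<alpha> x = \<alpha>' x" by (rule DERIV_imp_deriv[OF \<alpha>(4)[OF x]])
      moreover have "(f (\<alpha> x))\<^sup>2 * (v x)\<^sup>2 \<le> (f (\<alpha> x) * L)\<^sup>2"
        unfolding power_mult_distrib using \<open>v x \<le> L\<close> v(2)[of x] by (intro mult_left_mono power_mono) auto
      ultimately show "cone_form Y f ?\<gamma> x \<le> - ((\<alpha>' x)\<^sup>2 - (f (\<alpha> x) * L)\<^sup>2)"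
        unfolding cone_form_def by (simp add: comp_def)
    qed
  qed
  have pos: "0 < (\<alpha>' u)\<^sup>2 - (f (\<alpha> u) * L)\<^sup>2" if "u \<in> {0<..<1}" for u
    using f[OF that] AL by (auto intro!: power_strict_mono)
  have neg: "AE u in lebesgue. u \<in> {0<..<1} \<longrightarrow> cone_form Y f ?\<gamma> u < 0"
    using form by eventually_elim (use pos in fastforce)
  show "cone_timelike J Y f ?\<gamma> (\<alpha> 0, \<beta> 0) (\<alpha> 1, \<beta> 1)"
    unfolding cone_timelike_def using cc AE_lebesgue_on_unit[OF neg] by blast
  have "AE u in lebesgue. u \<in> {0<..<1} \<longrightarrow> cone_form Y f ?\<gamma> u \<le> 0"
    using neg by eventually_elim auto
  then show "cone_causal J Y f ?\<gamma> (\<alpha> 0, \<beta> 0) (\<alpha> 1, \<beta> 1)"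
    unfolding cone_causal_def by (intro conjI cc AE_lebesgue_on_unit)
  assume c: "\<And>u. u \<in> {0<..<1} \<Longrightarrow> c \<le> sqrt ((\<alpha>' u)\<^sup>2 - (f (\<alpha> u) * L)\<^sup>2)" "0 \<le> c"
  have "AE u in lebesgue. u \<in> {0<..<1} \<longrightarrow> ennreal c \<le> ennreal (sqrt (- cone_form Y f ?\<gamma> u))"
    using form
  proof eventually_elim
    case (elim u)
    show ?case
    proof
      assume u: "u \<in> {0<..<1}"
      have "c \<le> sqrt ((\<alpha>' u)\<^sup>2 - (f (\<alpha> u) * L)\<^sup>2)" by (rule c(1)[OF u])
      also have "\<dots> \<le> sqrt (- cone_form Y f ?\<gamma> u)" using elim u by (intro real_sqrt_le_mono) auto
      finally show "ennreal c \<le> ennreal (sqrt (- cone_form Y f ?\<gamma> u))" by (rule ennreal_leI)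
    qed
  qed
  then have "AE u in lebesgue_on {0..1}. ennreal c \<le> ennreal (sqrt (- cone_form Y f ?\<gamma> u))"
    by (rule AE_lebesgue_on_unit)
  then have "(\<integral>\<^sup>+u. ennreal c \<partial>lebesgue_on {0..1::real}) \<le> cone_length Y f ?\<gamma>"
    unfolding cone_length_def by (rule nn_integral_mono_AE)
  moreover have "(\<integral>\<^sup>+u. ennreal c \<partial>lebesgue_on {0..1::real}) = ennreal c"
    by (simp add: emeasure_restrict_space)
  ultimately show "ennreal c \<le> cone_length Y f ?\<gamma>" by (metis (no_types))
qed

section \<open>Slabs of generalized cones\<close>

lemma is_lplsD:
  assumes "is_lpls X" "p \<in> lpts X" "q \<in> lpts X"
  shows "lchron X p q \<Longrightarrow> lcaus X p q" "lcaus X p p" "0 < ltau X p q \<longleftrightarrow> lchron X p q"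
    "r \<in> lpts X \<Longrightarrow> lchron X p q \<Longrightarrow> lchron X q r \<Longrightarrow> lchron X p r"
    "r \<in> lpts X \<Longrightarrow> lcaus X p q \<Longrightarrow> lcaus X q r \<Longrightarrow> lcaus X p r"
    "r \<in> lpts X \<Longrightarrow> lcaus X p q \<Longrightarrow> lcaus X q r \<Longrightarrow> ltau X p q + ltau X q r \<le> ltau X p r"
proof -
  note L = assms(1)[unfolded is_lpls_def]
  show "lchron X p q \<Longrightarrow> lcaus X p q" using L[THEN conjunct2, THEN conjunct2, THEN conjunct1] assms(2,3) by blast
  show "lcaus X p p" using L[THEN conjunct2, THEN conjunct2, THEN conjunct2, THEN conjunct1] assms(2) by blast
  show "0 < ltau X p q \<longleftrightarrow> lchron X p q"
    using L[THEN conjunct2, THEN conjunct2, THEN conjunct2, THEN conjunct2, THEN conjunct2, THEN conjunct2] assms(2,3) by blast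
  show "r \<in> lpts X \<Longrightarrow> lchron X p q \<Longrightarrow> lchron X q r \<Longrightarrow> lchron X p r" using L[THEN conjunct1] assms(2,3) by blast
  show "r \<in> lpts X \<Longrightarrow> lcaus X p q \<Longrightarrow> lcaus X q r \<Longrightarrow> lcaus X p r"
    using L[THEN conjunct2, THEN conjunct1] assms(2,3) by blast
  show "r \<in> lpts X \<Longrightarrow> lcaus X p q \<Longrightarrow> lcaus X q r \<Longrightarrow> ltau X p q + ltau X q r \<le> ltau X p r"
    using L[THEN conjunct2, THEN conjunct2, THEN conjunct2, THEN conjunct2, THEN conjunct2, THEN conjunct1] assms(2,3) by blast
qed

lemma convex_step_real:
  fixes a b u :: real
  assumes "a \<le> b" "0 \<le> u" "u \<le> 1"
  shows "a \<le> a + u * (b - a)" "a + u * (b - a) \<le> b"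
proof -
  have "u * (b - a) \<le> 1 * (b - a)" using assms by (intro mult_right_mono) auto
  then show "a + u * (b - a) \<le> b" by (simp add: algebra_simps)
qed (use assms in simp)

lemma four_mult_le_square_add: "4 * a * b \<le> (a + b)\<^sup>2" for a b :: real
  using zero_le_power2[of "a - b"] by (simp add: power2_eq_square algebra_simps)

locale cone_slab =
  fixes J :: "real set" and Y :: "'y metric" and f :: "real \<Rightarrow> real" and s0 t0 m M :: real
  assumes Ysp: "length_space Y" and Jo: "open J" and Ji: "is_interval J" and fc: "continuous_on J f"
    and fb: "\<And>r. r \<in> J \<Longrightarrow> m \<le> f r \<and> f r \<le> M" and m0: "0 < m"
    and s0J: "s0 \<in> J" and t0J: "t0 \<in> J" and s0t0: "s0 < t0"
begin

text \<open>In the coordinates \<open>(T r, w)\<close> the null cones are those of the product with \<open>f = 1\<close>, so the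
  sign of \<open>slack\<close> decides chronology.\<close>

definition "W = generalized_cone J Y f"
definition "T r = integral {s0..r} (\<lambda>x. 1 / f x)"
definition "slack x x' = T (fst x') - T (fst x) - mdist Y (snd x) (snd x')"
definition "slab = {s0..t0} \<times> mspace Y"

lemma slabJ: "{s0..t0} \<subseteq> J"
  using Ji s0J t0J unfolding is_interval_1 by (meson atLeastAtMost_iff subsetI)

lemma f_pos: "r \<in> J \<Longrightarrow> 0 < f r" using fb m0 by fastforce

lemma mM: "m \<le> M" using fb[OF s0J] by linarith

lemma M0: "0 < M" using mM m0 by linarith

lemma continuous_inverse_f: "continuous_on {s0..t0} (\<lambda>x. 1 / f x)"
  using slabJ f_pos by (intro continuous_intros continuous_on_subset[OF fc]) fastforce+

lemma T_diff: "s0 \<le> r \<Longrightarrow> r \<le> r' \<Longrightarrow> r' \<le> t0 \<Longrightarrow> T r' - T r = integral {r..r'} (\<lambda>x. 1 / f x)"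
proof -
  assume r: "s0 \<le> r" "r \<le> r'" "r' \<le> t0"
  have "(\<lambda>x. 1 / f x) integrable_on {s0..r'}"
    using r by (intro integrable_continuous_real continuous_on_subset[OF continuous_inverse_f]) auto
  then show ?thesis
    unfolding T_def using Henstock_Kurzweil_Integration.integral_combine[of s0 r r' "\<lambda>x. 1 / f x"] r by simp
qed

lemma T_bounds:
  assumes "s0 \<le> r" "r \<le> r'" "r' \<le> t0"
  shows "(r' - r) / M \<le> T r' - T r" "T r' - T r \<le> (r' - r) / m"
proof -
  have int: "(\<lambda>x. 1 / f x) integrable_on {r..r'}"
    using assms by (intro integrable_continuous_real continuous_on_subset[OF continuous_inverse_f]) auto
  have b: "1 / M \<le> 1 / f x" "1 / f x \<le> 1 / m" if "x \<in> {r..r'}" for x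
  proof -
    have "x \<in> J" using that assms slabJ by auto
    then show "1 / M \<le> 1 / f x" "1 / f x \<le> 1 / m"
      using fb[of x] m0 f_pos[of x] M0 by (auto intro!: divide_left_mono)
  qed
  have "integral {r..r'} (\<lambda>x. 1 / M) \<le> integral {r..r'} (\<lambda>x. 1 / f x)"
    using b by (intro integral_le int) auto
  then show "(r' - r) / M \<le> T r' - T r" using T_diff[OF assms] assms by simp
  have "integral {r..r'} (\<lambda>x. 1 / f x) \<le> integral {r..r'} (\<lambda>x. 1 / m)"
    using b by (intro integral_le int) auto
  then show "T r' - T r \<le> (r' - r) / m" using T_diff[OF assms] assms by simp
qed

lemma T_mono: "s0 \<le> r \<Longrightarrow> r \<le> r' \<Longrightarrow> r' \<le> t0 \<Longrightarrow> T r \<le> T r'"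
  using T_bounds(1)[of r r'] M0 by (smt (verit) divide_nonneg_pos)

lemma T_strict_mono: "s0 \<le> r \<Longrightarrow> r < r' \<Longrightarrow> r' \<le> t0 \<Longrightarrow> T r < T r'"
  using T_bounds(1)[of r r'] M0 by (smt (verit) divide_pos_pos)

lemma T_less_iff: "r \<in> {s0..t0} \<Longrightarrow> r' \<in> {s0..t0} \<Longrightarrow> T r < T r' \<longleftrightarrow> r < r'"
  using T_strict_mono[of r r'] T_mono[of r' r] by (auto simp: not_le[symmetric])

lemma T_lipschitz: "r \<in> {s0..t0} \<Longrightarrow> r' \<in> {s0..t0} \<Longrightarrow> \<bar>T r - T r'\<bar> \<le> 1 / m * \<bar>r - r'\<bar>"
  using T_bounds[of r r'] T_bounds[of r' r] T_mono[of r r'] T_mono[of r' r] by (cases "r \<le> r'") (auto simp: field_simps)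

lemma T_lipschitz_below: "r \<in> {s0..t0} \<Longrightarrow> r' \<in> {s0..t0} \<Longrightarrow> \<bar>r - r'\<bar> \<le> M * \<bar>T r - T r'\<bar>"
  using T_bounds[of r r'] T_bounds[of r' r] T_mono[of r r'] T_mono[of r' r] M0 by (cases "r \<le> r'") (auto simp: field_simps)

lemma T_continuous: "continuous_on {s0..t0} T"
  unfolding T_def by (rule indefinite_integral_continuous_1) (rule integrable_continuous_real[OF continuous_inverse_f])

lemma T_deriv: "r \<in> {s0<..<t0} \<Longrightarrow> (T has_real_derivative 1 / f r) (at r)"
proof -
  assume r: "r \<in> {s0<..<t0}"
  have "(T has_real_derivative 1 / f r) (at r within {s0..t0})"
    unfolding T_def using r by (intro integral_has_real_derivative continuous_inverse_f) auto
  then show ?thesis using r at_within_interior[of r "{s0..t0}"] by (simp add: interior_atLeastAtMost_real)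
qed

definition "Tinv = the_inv_into {s0..t0} T"

lemma T_inj: "inj_on T {s0..t0}"
  by (rule inj_onI) (metis T_less_iff less_irrefl linorder_neqE_linordered_idom)

lemma Tinv_T: "r \<in> {s0..t0} \<Longrightarrow> Tinv (T r) = r"
  unfolding Tinv_def by (rule the_inv_into_f_f[OF T_inj])

lemma T_Tinv:
  assumes "r \<in> {s0..t0}" "r' \<in> {s0..t0}" "T r \<le> c" "c \<le> T r'"
  shows "T (Tinv c) = c" "Tinv c \<in> {r..r'}"
proof -
  have "r \<le> r'" using assms T_less_iff[of r' r] by auto
  moreover have "continuous_on {r..r'} T" by (rule continuous_on_subset[OF T_continuous]) (use assms in auto)
  ultimately obtain x where x: "x \<in> {r..r'}" "T x = c" using IVT'[of T r c r'] assms by auto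
  then have "Tinv c = x" using Tinv_T[of x] assms by auto
  then show "T (Tinv c) = c" "Tinv c \<in> {r..r'}" using x by auto
qed

text \<open>The curve has constant speed in the time \<open>T\<close>. Paired with a fibre curve of
  speed at most \<open>L\<close> it is timelike as soon as \<open>L < T r' - T r\<close>, however
  \<open>f\<close> varies on the way.\<close>

lemma null_speed_curve:
  assumes r: "r \<in> {s0..t0}" "r' \<in> {s0..t0}" "r < r'"
  defines "\<alpha> \<equiv> (\<lambda>u. Tinv (T r + u * (T r' - T r)))"
  shows "\<alpha> 0 = r" "\<alpha> 1 = r'" "\<And>u. u \<in> {0..1} \<Longrightarrow> \<alpha> u \<in> {r..r'}"
    "\<And>u. u \<in> {0..1} \<Longrightarrow> T (\<alpha> u) = T r + u * (T r' - T r)"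
    "strict_mono_on {0..1} \<alpha>"
    "\<And>u v. u \<in> {0..1} \<Longrightarrow> v \<in> {0..1} \<Longrightarrow> \<bar>\<alpha> u - \<alpha> v\<bar> \<le> M * (T r' - T r) * \<bar>u - v\<bar>"
    "\<And>u. u \<in> {0<..<1} \<Longrightarrow> (\<alpha> has_real_derivative f (\<alpha> u) * (T r' - T r)) (at u)"
proof -
  have D: "0 < T r' - T r" using T_less_iff r by auto
  have c: "T r \<le> T r + u * (T r' - T r)" "T r + u * (T r' - T r) \<le> T r'" if "u \<in> {0..1}" for u
    using that D convex_step_real[of "T r" "T r'" u] by auto
  show \<alpha>r: "\<alpha> u \<in> {r..r'}" if "u \<in> {0..1}" for u
    unfolding \<alpha>_def by (rule T_Tinv(2)[OF r(1,2) c[OF that]])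
  show T\<alpha>: "T (\<alpha> u) = T r + u * (T r' - T r)" if "u \<in> {0..1}" for u
    unfolding \<alpha>_def by (rule T_Tinv(1)[OF r(1,2) c[OF that]])
  show "\<alpha> 0 = r" "\<alpha> 1 = r'" unfolding \<alpha>_def using Tinv_T r by auto
  have \<alpha>s: "\<alpha> u \<in> {s0..t0}" if "u \<in> {0..1}" for u using \<alpha>r[OF that] r by auto
  show sm: "strict_mono_on {0..1} \<alpha>"
  proof (rule strict_mono_onI)
    fix u v :: real assume "u \<in> {0..1}" "v \<in> {0..1}" "u < v"
    then show "\<alpha> u < \<alpha> v" using T_less_iff[OF \<alpha>s \<alpha>s, of u v] T\<alpha>[of u] T\<alpha>[of v] D by auto
  qed
  show lip: "\<bar>\<alpha> u - \<alpha> v\<bar> \<le> M * (T r' - T r) * \<bar>u - v\<bar>" if "u \<in> {0..1}" "v \<in> {0..1}" for u v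
  proof -
    have "\<bar>\<alpha> u - \<alpha> v\<bar> \<le> M * \<bar>T (\<alpha> u) - T (\<alpha> v)\<bar>" by (intro T_lipschitz_below \<alpha>s that)
    also have "T (\<alpha> u) - T (\<alpha> v) = (T r' - T r) * (u - v)" by (simp add: T\<alpha>[OF that(1)] T\<alpha>[OF that(2)] algebra_simps)
    finally show ?thesis using D by (simp add: abs_mult)
  qed
  show "(\<alpha> has_real_derivative f (\<alpha> u) * (T r' - T r)) (at u)" if u: "u \<in> {0<..<1}" for u
  proof -
    have u01: "u \<in> {0..1}" using u by auto
    have "\<alpha> 0 < \<alpha> u" "\<alpha> u < \<alpha> 1" using u sm by (auto simp: strict_mono_on_def)
    then have "\<alpha> u \<in> {r<..<r'}" using \<open>\<alpha> 0 = r\<close> \<open>\<alpha> 1 = r'\<close> by auto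
    then have \<alpha>u: "\<alpha> u \<in> {s0<..<t0}" using r by auto
    have "((\<lambda>x. (T x - T r) / (T r' - T r)) has_real_derivative (1 / f (\<alpha> u)) / (T r' - T r)) (at (\<alpha> u))"
      by (rule DERIV_cdivide) (auto intro!: derivative_eq_intros T_deriv[OF \<alpha>u])
    then have "(\<alpha> has_real_derivative inverse ((1 / f (\<alpha> u)) / (T r' - T r))) (at u)"
    proof (rule DERIV_inverse_function)
      show "(1 / f (\<alpha> u)) / (T r' - T r) \<noteq> 0"
      proof -
        have "f (\<alpha> u) \<noteq> 0" using f_pos[of "\<alpha> u"] slabJ \<alpha>s[OF u01] by auto
        moreover have "T r' - T r \<noteq> 0" using D by linarith
        ultimately show ?thesis by simp
      qed
      show "0 < u" "u < 1" using u by auto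
      show "(T (\<alpha> y) - T r) / (T r' - T r) = y" if "0 < y" "y < 1" for y
        using T\<alpha>[of y] that D by simp
      have "continuous_on {0..1} \<alpha>"
        unfolding continuous_on_iff
      proof (intro ballI allI impI)
        fix x e :: real assume x: "x \<in> {0..1}" and e: "0 < e"
        show "\<exists>d>0. \<forall>x'\<in>{0..1}. dist x' x < d \<longrightarrow> dist (\<alpha> x') (\<alpha> x) < e"
        proof (intro exI[of _ "e / (M * (T r' - T r))"] conjI ballI impI)
          show "0 < e / (M * (T r' - T r))" using e D M0 by simp
          fix y assume "y \<in> {0..1}" "dist y x < e / (M * (T r' - T r))"
          then show "dist (\<alpha> y) (\<alpha> x) < e"
            using lip[of y x] x D M0 by (simp add: dist_real_def field_simps)
        qed
      qed
      then show "isCont \<alpha> u" using u by (intro continuous_on_interior[of "{0..1}"]) (auto simp: interior_atLeastAtMost_real)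
    qed
    then show ?thesis by simp
  qed
qed

lemma slack_pos_imp:
  assumes x: "x \<in> slab" "x' \<in> slab" and s: "0 < slack x x'"
  shows "lchron W x x'" "lcaus W x x'" "fst x < fst x'"
proof -
  obtain r w r' w' where eq: "x = (r, w)" "x' = (r', w')" by (metis surj_pair)
  have r: "r \<in> {s0..t0}" "r' \<in> {s0..t0}" and w: "w \<in> mspace Y" "w' \<in> mspace Y" using x eq by (auto simp: slab_def)
  have "T r < T r'" using s mdist_nonneg[of Y w w'] unfolding slack_def eq fst_conv snd_conv by linarith
  then have rr: "r < r'" using T_less_iff r by auto
  then show "fst x < fst x'" by (simp add: eq)
  have "mdist Y w w' < T r' - T r" using s by (simp add: slack_def eq)
  then obtain L where L: "mdist Y w w' < L" "L < T r' - T r" using dense by blast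
  have L0: "0 < L" using L mdist_nonneg[of Y w w'] by linarith
  obtain \<beta> where \<beta>: "\<beta> \<in> {0..1} \<rightarrow> mspace Y" "\<beta> 0 = w" "\<beta> 1 = w'"
    "\<And>u v. u \<in> {0..1} \<Longrightarrow> v \<in> {0..1} \<Longrightarrow> mdist Y (\<beta> u) (\<beta> v) \<le> L * \<bar>u - v\<bar>"
    using length_space_lipschitz_curve[OF Ysp w L(1)] by blast
  note \<alpha> = null_speed_curve[OF r rr]
  let ?\<alpha> = "\<lambda>u. Tinv (T r + u * (T r' - T r))"
  have aJ: "?\<alpha> u \<in> J" if "u \<in> {0..1}" for u using \<alpha>(3)[OF that] r slabJ by auto
  note * = cone_curve_of_lipschitz[of ?\<alpha> J "M * (T r' - T r)" "\<lambda>u. f (?\<alpha> u) * (T r' - T r)" \<beta> Y L f]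
  have "cone_timelike J Y f (\<lambda>u. (?\<alpha> u, \<beta> u)) (?\<alpha> 0, \<beta> 0) (?\<alpha> 1, \<beta> 1)"
    "cone_causal J Y f (\<lambda>u. (?\<alpha> u, \<beta> u)) (?\<alpha> 0, \<beta> 0) (?\<alpha> 1, \<beta> 1)"
    using L L0 M0 f_pos aJ less_imp_le[OF f_pos[OF aJ]] \<beta> \<alpha>(5,6,7) by (intro *; force intro!: mult_strict_left_mono)+
  then show "lchron W x x'" "lcaus W x x'"
    unfolding W_def generalized_cone_def using \<beta> \<alpha>(1,2) eq by auto
qed

text \<open>Affine time and a fibre curve of speed at most \<open>L\<close> make the integrand at
  least this constant. \<open>L\<close> is strictly larger than the distance because a length space
  need not contain shortest curves.\<close>

lemma tau_ge:
  assumes x: "(r, w) \<in> slab" "(r', w') \<in> slab" and L: "mdist Y w w' < L" "M * L < r' - r"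
  shows "ennreal (sqrt ((r' - r)\<^sup>2 - (M * L)\<^sup>2)) \<le> ltau W (r, w) (r', w')"
    and "lchron W (r, w) (r', w')"
proof -
  have r: "r \<in> {s0..t0}" "r' \<in> {s0..t0}" and w: "w \<in> mspace Y" "w' \<in> mspace Y" using x by (auto simp: slab_def)
  have L0: "0 < L" using L mdist_nonneg[of Y w w'] by linarith
  then have "0 < M * L" using M0 by simp
  then have rr: "r < r'" using L by linarith
  obtain \<beta> where \<beta>: "\<beta> \<in> {0..1} \<rightarrow> mspace Y" "\<beta> 0 = w" "\<beta> 1 = w'"
    "\<And>u v. u \<in> {0..1} \<Longrightarrow> v \<in> {0..1} \<Longrightarrow> mdist Y (\<beta> u) (\<beta> v) \<le> L * \<bar>u - v\<bar>"
    using length_space_lipschitz_curve[OF Ysp w L(1)] by blast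
  define \<alpha> where "\<alpha> = (\<lambda>u. r + u * (r' - r))"
  have \<alpha>r: "\<alpha> u \<in> {r..r'}" if "u \<in> {0..1}" for u
    using that rr convex_step_real[of r r' u] by (auto simp: \<alpha>_def)
  have aJ: "\<alpha> u \<in> J" if "u \<in> {0..1}" for u using \<alpha>r[OF that] r slabJ by auto
  have \<alpha>sm: "strict_mono_on {0..1} \<alpha>" using rr by (auto simp: strict_mono_on_def \<alpha>_def)
  have \<alpha>l: "\<bar>\<alpha> u - \<alpha> v\<bar> \<le> (r' - r) * \<bar>u - v\<bar>" for u v
  proof -
    have "\<alpha> u - \<alpha> v = (r' - r) * (u - v)" by (simp add: \<alpha>_def algebra_simps)
    then show ?thesis using rr by (simp add: abs_mult)
  qed
  have \<alpha>d: "(\<alpha> has_real_derivative r' - r) (at u)" for u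
    unfolding \<alpha>_def by (auto intro!: derivative_eq_intros)
  have fL: "0 \<le> f (\<alpha> u) \<and> f (\<alpha> u) * L < r' - r" "f (\<alpha> u) * L \<le> M * L" if "u \<in> {0<..<1}" for u
  proof -
    have "\<alpha> u \<in> J" using aJ that by auto
    then have "f (\<alpha> u) \<le> M" "0 < f (\<alpha> u)" using fb f_pos by auto
    moreover from this show "f (\<alpha> u) * L \<le> M * L" using L0 by (intro mult_right_mono) auto
    ultimately show "0 \<le> f (\<alpha> u) \<and> f (\<alpha> u) * L < r' - r" using L by linarith
  qed
  note * = cone_curve_of_lipschitz[of \<alpha> J "r' - r" "\<lambda>_. r' - r" \<beta> Y L f, OF aJ \<alpha>sm \<alpha>l \<alpha>d \<beta>(1) \<beta>(4) fL(1)]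
  have ends: "(\<alpha> 0, \<beta> 0) = (r, w)" "(\<alpha> 1, \<beta> 1) = (r', w')" using \<beta> by (auto simp: \<alpha>_def)
  have 1: "cone_timelike J Y f (\<lambda>u. (\<alpha> u, \<beta> u)) (r, w) (r', w')"
    "cone_causal J Y f (\<lambda>u. (\<alpha> u, \<beta> u)) (r, w) (r', w')"
    using *(1,2) rr L0 unfolding ends by auto
  then show "lchron W (r, w) (r', w')" unfolding W_def generalized_cone_def by auto
  have "ennreal (sqrt ((r' - r)\<^sup>2 - (M * L)\<^sup>2)) \<le> cone_length Y f (\<lambda>u. (\<alpha> u, \<beta> u))"
  proof (rule *(3))
    show "0 \<le> sqrt ((r' - r)\<^sup>2 - (M * L)\<^sup>2)" using \<open>0 < M * L\<close> L(2) by (simp add: power_mono)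
    fix u :: real assume u: "u \<in> {0<..<1}"
    have "(f (\<alpha> u) * L)\<^sup>2 \<le> (M * L)\<^sup>2" using fL[OF u] L0 by (intro power_mono) auto
    then show "sqrt ((r' - r)\<^sup>2 - (M * L)\<^sup>2) \<le> sqrt ((r' - r)\<^sup>2 - (f (\<alpha> u) * L)\<^sup>2)" by simp
  qed (use rr L0 in auto)
  also have "\<dots> \<le> ltau W (r, w) (r', w')"
    unfolding W_def generalized_cone_def using 1(2) by (auto intro: SUP_upper)
  finally show "ennreal (sqrt ((r' - r)\<^sup>2 - (M * L)\<^sup>2)) \<le> ltau W (r, w) (r', w')" .
qed

text \<open>Let \<open>g\<close>, \<open>h\<close>, \<open>v\<close> be the speeds of time, of
  \<open>T\<close>-time and in the fibre. Causality says \<open>v \<le> h\<close>, where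
  \<open>g = f * h\<close>; integrating gives the sign of the slack. For the last bound, minus the
  form equals \<open>(h - v) * f * (g + f * v)\<close>, at most \<open>(h - v) * 2 * M * g\<close>.
  The arithmetic-geometric mean inequality with weight \<kappa> splits the root, and
  \<open>h - v\<close> integrates to at most the slack.\<close>

lemma causal_curve_bounds:
  assumes x: "x \<in> slab" "x' \<in> slab" and c: "cone_causal J Y f \<gamma> x x'"
  shows "fst x < fst x'" "0 \<le> slack x x'"
    "cone_length Y f \<gamma> \<le> ennreal (fst x' - fst x)"
    "0 < \<kappa> \<Longrightarrow> cone_length Y f \<gamma> \<le> ennreal (\<kappa> / 2 * slack x x' + M / \<kappa> * (fst x' - fst x))"
proof -
  define \<alpha> where "\<alpha> = fst \<circ> \<gamma>"
  define \<beta> where "\<beta> = snd \<circ> \<gamma>"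
  have cc: "\<gamma> \<in> {0..1} \<rightarrow> J \<times> mspace Y" "abs_continuous (cone_metric J Y) \<gamma>"
     "strict_mono_on {0..1} \<alpha>" "\<gamma> 0 = x" "\<gamma> 1 = x'"
    and form: "AE t in lebesgue_on {0..1}. cone_form Y f \<gamma> t \<le> 0"
    using c unfolding cone_causal_def cone_curve_def \<alpha>_def by auto
  have ends: "\<alpha> 0 = fst x" "\<alpha> 1 = fst x'" "\<beta> 0 = snd x" "\<beta> 1 = snd x'" using cc by (auto simp: \<alpha>_def \<beta>_def)
  have rs: "fst x \<in> {s0..t0}" "fst x' \<in> {s0..t0}" using x by (auto simp: slab_def)
  show lt: "fst x < fst x'" using cc(3) unfolding strict_mono_on_def ends[symmetric] by auto
  have \<alpha>mono: "mono_on {0..1} \<alpha>" using cc(3) by (rule strict_mono_on_imp_mono_on)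
  have \<alpha>r: "\<alpha> u \<in> {fst x..fst x'}" if "u \<in> {0..1}" for u
    using mono_onD[OF \<alpha>mono, of 0 u] mono_onD[OF \<alpha>mono, of u 1] that ends by auto
  have \<alpha>s: "\<alpha> u \<in> {s0..t0}" if "u \<in> {0..1}" for u using \<alpha>r[OF that] rs by auto
  have dD: "mdist (cone_metric J Y) (\<gamma> u) (\<gamma> v) = \<bar>\<alpha> u - \<alpha> v\<bar> + mdist Y (\<beta> u) (\<beta> v)" for u v
    unfolding \<alpha>_def \<beta>_def by (cases "\<gamma> u"; cases "\<gamma> v") simp
  have acD: "abs_continuous m' h" if "\<And>u v. mdist m' (h u) (h v) \<le> mdist (cone_metric J Y) (\<gamma> u) (\<gamma> v)" for m' :: "'z metric" and h
    unfolding abs_continuous_def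
  proof (intro allI impI)
    fix \<epsilon> :: real assume "\<epsilon> > 0"
    obtain \<delta> where \<delta>: "\<delta> > 0" "\<forall>(n::nat) u v. (\<forall>i<n. 0 \<le> u i \<and> u i \<le> v i \<and> v i \<le> 1) \<longrightarrow>
       (\<forall>i<n. \<forall>j<n. i \<noteq> j \<longrightarrow> {u i<..<v i} \<inter> {u j<..<v j} = {}) \<longrightarrow>
       (\<Sum>i<n. v i - u i) < \<delta> \<longrightarrow> (\<Sum>i<n. mdist (cone_metric J Y) (\<gamma> (u i)) (\<gamma> (v i))) < \<epsilon>"
      using cc(2)[unfolded abs_continuous_def, rule_format, OF \<open>\<epsilon> > 0\<close>] by (elim exE conjE)
    show "\<exists>\<delta>>0. \<forall>(n::nat) u v. (\<forall>i<n. 0 \<le> u i \<and> u i \<le> v i \<and> v i \<le> 1) \<longrightarrow>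
       (\<forall>i<n. \<forall>j<n. i \<noteq> j \<longrightarrow> {u i<..<v i} \<inter> {u j<..<v j} = {}) \<longrightarrow>
       (\<Sum>i<n. v i - u i) < \<delta> \<longrightarrow> (\<Sum>i<n. mdist m' (h (u i)) (h (v i))) < \<epsilon>"
    proof (intro exI[of _ \<delta>] conjI allI impI \<delta>(1))
      fix n :: nat and u v
      assume H: "\<forall>i<n. 0 \<le> u i \<and> u i \<le> v i \<and> v i \<le> 1"
        "\<forall>i<n. \<forall>j<n. i \<noteq> j \<longrightarrow> {u i<..<v i} \<inter> {u j<..<v j} = {}" "(\<Sum>i<n. v i - u i) < \<delta>"
      have "(\<Sum>i<n. mdist m' (h (u i)) (h (v i))) \<le> (\<Sum>i<n. mdist (cone_metric J Y) (\<gamma> (u i)) (\<gamma> (v i)))"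
        by (intro sum_mono that)
      also have "\<dots> < \<epsilon>" using \<delta>(2)[rule_format, of n u v] H by blast
      finally show "(\<Sum>i<n. mdist m' (h (u i)) (h (v i))) < \<epsilon>" .
    qed
  qed
  have ac\<alpha>: "abs_continuous euclidean_metric \<alpha>" by (rule acD) (simp add: dD dist_real_def)
  have ac\<beta>: "abs_continuous Y \<beta>" by (rule acD) (simp add: dD)
  have \<beta>Y: "\<beta> \<in> {0..1} \<rightarrow> mspace Y" using cc(1) by (auto simp: \<beta>_def mem_Times_iff Pi_iff)
  obtain v where v: "integrable lborel v" "\<And>x. 0 \<le> v x"
    "AE x in lebesgue. x \<in> {0<..<1} \<longrightarrow> ((\<lambda>s. mdist Y (\<beta> s) (\<beta> x) / \<bar>s - x\<bar>) \<longlongrightarrow> v x) (at x)"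
    "\<And>s t. 0 \<le> s \<Longrightarrow> s \<le> t \<Longrightarrow> t \<le> 1 \<Longrightarrow> mdist Y (\<beta> s) (\<beta> t) \<le> (LINT z:{s..t}|lborel. v z)"
    by (rule metric_derivative_abs_continuous[OF \<beta>Y ac\<beta>]) (rule that)
  obtain g where g: "integrable lborel g" "\<And>x. 0 \<le> g x"
    "\<And>s t. 0 \<le> s \<Longrightarrow> s \<le> t \<Longrightarrow> t \<le> 1 \<Longrightarrow> \<alpha> t - \<alpha> s = (LINT z:{s..t}|lborel. g z)"
    "AE x in lebesgue. x \<in> {0<..<1} \<longrightarrow> (\<alpha> has_real_derivative g x) (at x)"
    by (rule AC_mono_FTC[OF \<alpha>mono ac\<alpha>]) (rule that)
  have T\<alpha>mono: "mono_on {0..1} (T \<circ> \<alpha>)"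
  proof (rule mono_onI)
    fix u w :: real assume "u \<in> {0..1}" "w \<in> {0..1}" "u \<le> w"
    then show "(T \<circ> \<alpha>) u \<le> (T \<circ> \<alpha>) w"
      using mono_onD[OF \<alpha>mono, of u w] \<alpha>s[of u] \<alpha>s[of w] T_mono[of "\<alpha> u" "\<alpha> w"] by auto
  qed
  have acT: "abs_continuous euclidean_metric (T \<circ> \<alpha>)"
  proof (rule abs_continuous_dominated[OF ac\<alpha>, of _ "1 / m"])
    fix s t :: real assume "0 \<le> s" "s \<le> t" "t \<le> 1"
    then show "\<bar>(T \<circ> \<alpha>) t - (T \<circ> \<alpha>) s\<bar> \<le> 1 / m * \<bar>\<alpha> t - \<alpha> s\<bar>"
      unfolding comp_def by (intro T_lipschitz \<alpha>s) auto
  qed (use m0 in simp)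
  obtain h where h: "integrable lborel h" "\<And>x. 0 \<le> h x"
    "\<And>s t. 0 \<le> s \<Longrightarrow> s \<le> t \<Longrightarrow> t \<le> 1 \<Longrightarrow> (T \<circ> \<alpha>) t - (T \<circ> \<alpha>) s = (LINT z:{s..t}|lborel. h z)"
    "AE x in lebesgue. x \<in> {0<..<1} \<longrightarrow> ((T \<circ> \<alpha>) has_real_derivative h x) (at x)"
    by (rule AC_mono_FTC[OF T\<alpha>mono acT]) (rule that)
  have pointwise: "AE u in lebesgue. u \<in> {0<..<1} \<longrightarrow> v u \<le> h u \<and> g u = f (\<alpha> u) * h u \<and> \<alpha> u \<in> J \<and>
      cone_form Y f \<gamma> u = - (g u)\<^sup>2 + (f (\<alpha> u))\<^sup>2 * (v u)\<^sup>2"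
    using v(3) g(4) h(4) AE_unit_lebesgue_on[OF form]
  proof eventually_elim
    case (elim u)
    show ?case
    proof
      assume u: "u \<in> {0<..<1}"
      have u01: "u \<in> {0..1}" using u by auto
      have \<alpha>u: "\<alpha> u \<in> {s0<..<t0}"
      proof -
        have "\<alpha> 0 < \<alpha> u" "\<alpha> u < \<alpha> 1" using cc(3) u by (auto simp: strict_mono_on_def)
        then show ?thesis using rs ends by auto
      qed
      then have \<alpha>J: "\<alpha> u \<in> J" using slabJ by auto
      have "((T \<circ> \<alpha>) has_real_derivative (1 / f (\<alpha> u)) * g u) (at u)"
        using elim(2) u by (intro DERIV_chain T_deriv[OF \<alpha>u]) auto
      moreover have "((T \<circ> \<alpha>) has_real_derivative h u) (at u)" using elim(3) u by auto
      ultimately have hu: "h u = (1 / f (\<alpha> u)) * g u" by (metis DERIV_unique)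
      then have gu: "g u = f (\<alpha> u) * h u" using f_pos[OF \<alpha>J] by simp
      have md: "metric_deriv Y \<beta> u = v u" using elim(1) u by (intro metric_deriv_eqI) auto
      have da: "deriv \<alpha> u = g u" using elim(2) u by (auto intro: DERIV_imp_deriv)
      have cf: "cone_form Y f \<gamma> u = - (g u)\<^sup>2 + (f (\<alpha> u))\<^sup>2 * (v u)\<^sup>2"
        using md da unfolding cone_form_def \<alpha>_def \<beta>_def by (simp add: comp_def)
      then have "(f (\<alpha> u) * v u)\<^sup>2 \<le> (g u)\<^sup>2" using elim(4) u by (simp add: power_mult_distrib)
      then have "f (\<alpha> u) * v u \<le> g u" using g(2) by (rule power2_le_imp_le)
      then have "v u \<le> h u" using f_pos[OF \<alpha>J] unfolding gu by simp
      with gu cf \<alpha>J show "v u \<le> h u \<and> g u = f (\<alpha> u) * h u \<and> \<alpha> u \<in> J \<and>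
         cone_form Y f \<gamma> u = - (g u)\<^sup>2 + (f (\<alpha> u))\<^sup>2 * (v u)\<^sup>2" by blast
    qed
  qed
  have I01: "(LINT z:{0..1}|lborel. v z) \<le> (LINT z:{0..1}|lborel. h z)"
  proof (rule set_integral_mono_AE)
    have "AE u in lebesgue. u \<in> {0<..<1} \<longrightarrow> v u \<le> h u" using pointwise by eventually_elim auto
    moreover have "v \<in> borel_measurable borel" "h \<in> borel_measurable borel"
      using borel_measurable_integrable[OF v(1)] borel_measurable_integrable[OF h(1)] by auto
    ultimately have "AE u in lborel. u \<in> {0<..<1} \<longrightarrow> v u \<le> h u" by (subst (asm) AE_completion_iff) auto
    moreover have "AE x in lborel. x \<noteq> (0::real)" "AE x in lborel. x \<noteq> (1::real)" by (rule AE_lborel_singleton)+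
    ultimately show "AE u\<in>{0..1} in lborel. v u \<le> h u" by eventually_elim auto
  qed (auto intro!: set_integrable_of_integrable v h)
  have slv: "T (fst x') - T (fst x) = (LINT z:{0..1}|lborel. h z)" "mdist Y (snd x) (snd x') \<le> (LINT z:{0..1}|lborel. v z)"
    "fst x' - fst x = (LINT z:{0..1}|lborel. g z)"
    using h(3)[of 0 1] v(4)[of 0 1] g(3)[of 0 1] ends by auto
  then show "0 \<le> slack x x'" unfolding slack_def using I01 by linarith
  have len: "cone_length Y f \<gamma> \<le> ennreal (LINT z:{0..1}|lborel. k z)"
    if k: "integrable lborel k" and le: "AE u in lebesgue. u \<in> {0<..<1} \<longrightarrow> sqrt (- cone_form Y f \<gamma> u) \<le> k u \<and> 0 \<le> k u" for k
  proof -
    have km[measurable]: "k \<in> borel_measurable borel" using borel_measurable_integrable[OF k] by simp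
    have "AE u in lebesgue_on {0..1}. ennreal (sqrt (- cone_form Y f \<gamma> u)) \<le> ennreal (k u)"
      by (rule AE_lebesgue_on_unit) (use le in eventually_elim, auto intro: ennreal_leI)
    then have "cone_length Y f \<gamma> \<le> (\<integral>\<^sup>+ u. ennreal (k u) \<partial>lebesgue_on {0..1})"
      unfolding cone_length_def by (rule nn_integral_mono_AE)
    also have "\<dots> = (\<integral>\<^sup>+ u. ennreal (k u) * indicator {0..1} u \<partial>lebesgue)"
      by (rule nn_integral_restrict_space) auto
    also have "\<dots> = (\<integral>\<^sup>+ u. ennreal (k u) * indicator {0..1} u \<partial>lborel)"
      by (rule nn_integral_completion)
    also have "\<dots> = (\<integral>\<^sup>+ u. ennreal (indicator {0..1} u *\<^sub>R k u) \<partial>lborel)"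
      by (intro nn_integral_cong) (auto split: split_indicator)
    also have "\<dots> = ennreal (LINT z:{0..1}|lborel. k z)"
      unfolding set_lebesgue_integral_def
    proof (rule nn_integral_eq_integral)
      show "integrable lborel (\<lambda>u. indicator {0..1} u *\<^sub>R k u)"
        using set_integrable_of_integrable[OF k, of "{0..1}"] by (simp add: set_integrable_def)
      have "AE u in lebesgue. u \<in> {0<..<1} \<longrightarrow> 0 \<le> k u" using le by eventually_elim auto
      then have "AE u in lborel. u \<in> {0<..<1} \<longrightarrow> 0 \<le> k u" by (subst (asm) AE_completion_iff) auto
      moreover have "AE x in lborel. x \<noteq> (0::real)" "AE x in lborel. x \<noteq> (1::real)" by (rule AE_lborel_singleton)+
      ultimately show "AE u in lborel. 0 \<le> indicator {0..1} u *\<^sub>R k u"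
        by eventually_elim (auto split: split_indicator)
    qed
    finally show ?thesis .
  qed
  show "cone_length Y f \<gamma> \<le> ennreal (fst x' - fst x)"
    unfolding slv(3)
  proof (rule len[OF g(1)])
    show "AE u in lebesgue. u \<in> {0<..<1} \<longrightarrow> sqrt (- cone_form Y f \<gamma> u) \<le> g u \<and> 0 \<le> g u"
      using pointwise
    proof eventually_elim
      case (elim u)
      show ?case
      proof
        assume "u \<in> {0<..<1}"
        then have "- cone_form Y f \<gamma> u \<le> (g u)\<^sup>2" using elim by simp
        then have "sqrt (- cone_form Y f \<gamma> u) \<le> sqrt ((g u)\<^sup>2)" by (rule real_sqrt_le_mono)
        then show "sqrt (- cone_form Y f \<gamma> u) \<le> g u \<and> 0 \<le> g u" using g(2)[of u] by simp
      qed
    qed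
  qed
  assume l: "0 < \<kappa>"
  define k where "k = (\<lambda>u. \<kappa> / 2 * (h u - v u) + M / \<kappa> * g u)"
  have kint: "integrable lborel k" unfolding k_def using h(1) v(1) g(1) by auto
  have "AE u in lebesgue. u \<in> {0<..<1} \<longrightarrow> sqrt (- cone_form Y f \<gamma> u) \<le> k u \<and> 0 \<le> k u"
    using pointwise
  proof eventually_elim
    case (elim u)
    show ?case
    proof
      assume u: "u \<in> {0<..<1}"
      then have e: "v u \<le> h u" "g u = f (\<alpha> u) * h u" "\<alpha> u \<in> J" "cone_form Y f \<gamma> u = - (g u)\<^sup>2 + (f (\<alpha> u))\<^sup>2 * (v u)\<^sup>2"
        using elim by auto
      have fM: "f (\<alpha> u) \<le> M" "0 < f (\<alpha> u)" using fb[OF e(3)] f_pos[OF e(3)] by auto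
      let ?a = "h u - v u"
      have a0: "0 \<le> ?a" using e by simp
      have k0: "0 \<le> k u" unfolding k_def using a0 l M0 g(2)[of u] by (intro add_nonneg_nonneg mult_nonneg_nonneg) auto
      have "- cone_form Y f \<gamma> u = ?a * (f (\<alpha> u) * (g u + f (\<alpha> u) * v u))"
        unfolding e(4) e(2) by (simp add: power2_eq_square algebra_simps)
      also have "\<dots> \<le> ?a * (M * (2 * g u))"
      proof (intro mult_left_mono mult_mono a0)
        have "f (\<alpha> u) * v u \<le> f (\<alpha> u) * h u" using e fM by (intro mult_left_mono) auto
        then show "g u + f (\<alpha> u) * v u \<le> 2 * g u" using e(2) by linarith
      qed (use fM M0 g(2)[of u] v(2)[of u] in auto)
      also have "\<dots> \<le> (k u)\<^sup>2"
      proof -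
        have "4 * (\<kappa> / 2 * ?a) * (M / \<kappa> * g u) \<le> (k u)\<^sup>2" unfolding k_def by (rule four_mult_le_square_add)
        moreover have "4 * (\<kappa> / 2 * ?a) * (M / \<kappa> * g u) = ?a * (M * (2 * g u))" using l by (simp add: field_simps)
        ultimately show ?thesis by simp
      qed
      finally have "sqrt (- cone_form Y f \<gamma> u) \<le> sqrt ((k u)\<^sup>2)" by (rule real_sqrt_le_mono)
      then show "sqrt (- cone_form Y f \<gamma> u) \<le> k u \<and> 0 \<le> k u" using k0 by simp
    qed
  qed
  from len[OF kint this] have "cone_length Y f \<gamma> \<le> ennreal (LINT z:{0..1}|lborel. k z)" .
  also have "(LINT z:{0..1}|lborel. k z) = \<kappa> / 2 * ((LINT z:{0..1}|lborel. h z) - (LINT z:{0..1}|lborel. v z)) + M / \<kappa> * (LINT z:{0..1}|lborel. g z)"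
    unfolding k_def using set_integrable_of_integrable[OF h(1), of "{0..1}"] set_integrable_of_integrable[OF v(1), of "{0..1}"]
      set_integrable_of_integrable[OF g(1), of "{0..1}"]
    by (subst set_integral_add(2)) auto
  also have "ennreal \<dots> \<le> ennreal (\<kappa> / 2 * slack x x' + M / \<kappa> * (fst x' - fst x))"
    using l slv M0 unfolding slack_def by (intro ennreal_leI add_mono mult_left_mono) auto
  finally show "cone_length Y f \<gamma> \<le> ennreal (\<kappa> / 2 * slack x x' + M / \<kappa> * (fst x' - fst x))" .
qed

lemma caus_bounds:
  assumes "x \<in> slab" "x' \<in> slab" "lcaus W x x'"
  shows "fst x \<le> fst x'" "0 \<le> slack x x'"
proof -
  have "mdist Y (snd x) (snd x) = 0" using assms by (auto simp: slab_def)
  then show "fst x \<le> fst x'" "0 \<le> slack x x'"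
    using assms(3) causal_curve_bounds(1,2)[OF assms(1,2)] less_imp_le unfolding W_def generalized_cone_def
    by (auto simp: slack_def)
qed

lemma tau_le_height:
  assumes "x \<in> slab" "x' \<in> slab"
  shows "ltau W x x' \<le> ennreal (fst x' - fst x)"
  unfolding W_def generalized_cone_def using causal_curve_bounds(3)[OF assms] by (auto intro!: SUP_least)

lemma tau_le_slack:
  assumes "x \<in> slab" "x' \<in> slab" "0 < \<kappa>"
  shows "ltau W x x' \<le> ennreal (\<kappa> / 2 * slack x x' + M / \<kappa> * (fst x' - fst x))"
  unfolding W_def generalized_cone_def using causal_curve_bounds(4)[OF assms(1,2) _ assms(3)] by (auto intro!: SUP_least)

lemma lpts_W: "lpts W = J \<times> mspace Y"
  unfolding W_def generalized_cone_def by simp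

lemma ldist_W: "ldist W = mdist (cone_metric J Y)"
  unfolding W_def generalized_cone_def by simp

lemma slab_lpts: "slab \<subseteq> lpts W"
  unfolding lpts_W slab_def using slabJ by auto

text \<open>Chronology implies causality, hence nonnegative slack. Slack 0 is excluded because
  \<open>tau_le_slack\<close> with large \<kappa> would force \<tau> to vanish, while in a
  Lorentzian pre-length space chronologically related points have positive \<tau>.\<close>

lemma chron_iff_slack:
  assumes W: "is_lpls W" and x: "x \<in> slab" "x' \<in> slab"
  shows "lchron W x x' \<longleftrightarrow> 0 < slack x x'"
proof
  assume c: "lchron W x x'"
  have lp: "x \<in> lpts W" "x' \<in> lpts W" using x slab_lpts by auto
  then have "0 < ltau W x x'" "lcaus W x x'" using is_lplsD[OF W lp] c by blast+
  then have sl: "0 \<le> slack x x'" using caus_bounds(2)[OF x] by simp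
  show "0 < slack x x'"
  proof (rule ccontr)
    assume "\<not> 0 < slack x x'"
    then have s0: "slack x x' = 0" using sl by simp
    have "ltau W x x' \<le> ennreal e" if e: "e > 0" for e :: real
    proof -
      \<comment> \<open>With zero slack only the second term of \<open>tau_le_slack\<close>
        survives, and \<open>M * d / e\<close> in place of \<kappa> makes it at most
        \<open>e\<close>. The maximum with 1 keeps this value positive.\<close>
      define d where "d = max 1 (fst x' - fst x)"
      have d: "0 < d" "fst x' - fst x \<le> d" by (auto simp: d_def)
      have l: "0 < M * d / e" using M0 d e by simp
      have "M / (M * d / e) * (fst x' - fst x) = e / d * (fst x' - fst x)" using M0 d e by (simp add: field_simps)
      also have "\<dots> \<le> e / d * d" using d e by (intro mult_left_mono) auto
      also have "\<dots> = e" using d by simp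
      finally have "M / (M * d / e) * (fst x' - fst x) \<le> e" .
      then have "ennreal (M * d / e / 2 * slack x x' + M / (M * d / e) * (fst x' - fst x)) \<le> ennreal e"
        unfolding s0 by (intro ennreal_leI) simp
      then show ?thesis by (rule order_trans[OF tau_le_slack[OF x l]])
    qed
    then have "ltau W x x' \<le> 0" by (metis add_0 ennreal_le_epsilon)
    then show False using \<open>0 < ltau W x x'\<close> by simp
  qed
qed (rule slack_pos_imp(1)[OF x])

lemma slack_triangle:
  assumes "snd x \<in> mspace Y" "snd y \<in> mspace Y" "snd z \<in> mspace Y"
  shows "slack x y + slack y z \<le> slack x z"
  using mdist_triangle[OF assms] by (simp add: slack_def)

end

section \<open>Brunn--Minkowski inequality for transport to a point\<close>

text \<open>The graph of a strictly concave power lies below its tangent at \<open>c\<close>. With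
  \<open>x = c * exp y\<close> this is a weighted sum of \<open>1 + z < exp z\<close> at
  \<open>z = - p * y\<close> and \<open>z = (1 - p) * y\<close>; the case \<open>x = 0\<close> is
  separate because it has no logarithm.\<close>

lemma powr_tangent_strict:
  fixes x c p :: real
  assumes "0 < p" "p < 1" "0 \<le> x" "0 < c" "x \<noteq> c"
  shows "x powr p < c powr p + p * c powr (p - 1) * (x - c)"
proof -
  have cp: "c powr (p - 1) = c powr p / c" using assms by (simp add: powr_diff)
  show ?thesis
  proof (cases "x = 0")
    case True
    have "0 < (1 - p) * c powr p" using assms by simp
    then show ?thesis using True assms unfolding cp by (simp add: algebra_simps)
  next
    case False
    define y where "y = ln (x / c)"
    have xc: "x = c * exp y" using False assms by (simp add: y_def)
    then have y0: "y \<noteq> 0" using assms by auto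
    have strict: "1 + z < exp z" if "z \<noteq> 0" for z :: real
    proof -
      have "exp z \<noteq> 1 + z"
      proof
        assume eq: "exp z = 1 + z"
        have h: "1 + z / 2 \<le> exp (z / 2)" by (rule exp_ge_add_one_self)
        have "exp z = (exp (z / 2))\<^sup>2" by (simp add: power2_eq_square flip: exp_add)
        moreover have "\<bar>1 + z / 2\<bar> \<le> exp (z / 2) \<or> 1 + z / 2 < 0" using h by auto
        moreover have "(1 + z / 2)\<^sup>2 = 1 + z + z\<^sup>2 / 4" by (simp add: power2_eq_square algebra_simps)
        moreover have "0 < z\<^sup>2" using that by simp
        moreover have "0 < exp z" by simp
        ultimately show False
          using eq h power_mono[OF h, of 2] by (cases "1 + z / 2 < 0") auto
      qed
      then show ?thesis using exp_ge_add_one_self[of z] by linarith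
    qed
    have "(1 - p) * (1 + (- p * y)) + p * (1 + (1 - p) * y) < (1 - p) * exp (- p * y) + p * exp ((1 - p) * y)"
      using strict[of "- p * y"] strict[of "(1 - p) * y"] assms y0 by (intro add_strict_mono mult_strict_left_mono) auto
    then have "1 < (1 - p) * exp (- p * y) + p * exp ((1 - p) * y)" by (simp add: algebra_simps)
    then have "exp (p * y) * 1 < exp (p * y) * ((1 - p) * exp (- p * y) + p * exp ((1 - p) * y))"
      by (intro mult_strict_left_mono) auto
    also have "\<dots> = (1 - p) + p * exp y"
      by (simp add: algebra_simps flip: exp_add)
    finally have "exp (p * y) < 1 - p + p * exp y" by simp
    then have "c powr p * exp (p * y) < c powr p * (1 - p + p * exp y)" using assms by (intro mult_strict_left_mono) auto
    moreover have "x powr p = c powr p * exp (p * y)"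
    proof -
      have "x powr p = c powr p * exp y powr p" unfolding xc by (rule powr_mult)
      then show ?thesis by (simp add: powr_def[of "exp y"])
    qed
    moreover have "c powr p + p * c powr (p - 1) * (x - c) = c powr p * (1 - p + p * exp y)"
      unfolding cp xc using assms by (simp add: field_simps)
    ultimately show ?thesis by simp
  qed
qed

text \<open>Tangents at \<open>c\<close> are applied to \<open>a / t\<close> and
  \<open>b / (1 - t)\<close>, whose mean with weights \<open>t\<close> and \<open>1 - t\<close> is
  \<open>c\<close>, so the linear terms cancel. Only \<open>a = t * c\<close>, the exact
  intermediate ratio, escapes strictness.\<close>

lemma powr_interpolation_strict:
  fixes a b c p t :: real
  assumes p: "0 < p" "p < 1" and t: "0 < t" "t < 1" and abc: "0 \<le> a" "0 \<le> b" "a + b = c"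
  shows "t powr (1 - p) * a powr p + (1 - t) powr (1 - p) * b powr p \<le> c powr p"
    and "a \<noteq> t * c \<Longrightarrow> t powr (1 - p) * a powr p + (1 - t) powr (1 - p) * b powr p < c powr p"
proof -
  have e1: "t powr (1 - p) * a powr p = t * (a / t) powr p"
    using t abc by (simp add: powr_divide powr_diff)
  have e2: "(1 - t) powr (1 - p) * b powr p = (1 - t) * (b / (1 - t)) powr p"
    using t abc by (simp add: powr_divide powr_diff)
  have strict: "t powr (1 - p) * a powr p + (1 - t) powr (1 - p) * b powr p < c powr p" if ne: "a \<noteq> t * c"
  proof -
    have c0: "0 < c"
    proof (rule ccontr)
      assume "\<not> 0 < c"
      then have "a = 0" "c = 0" using abc by auto
      then show False using ne by simp
    qed
    have n1: "a / t \<noteq> c" using ne t by (auto simp: field_simps)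
    have n2: "b / (1 - t) \<noteq> c"
    proof
      assume "b / (1 - t) = c"
      then have "b = (1 - t) * c" using t by (simp add: field_simps)
      then show False using ne abc by (simp add: algebra_simps)
    qed
    have "t * (a / t) powr p < t * (c powr p + p * c powr (p - 1) * (a / t - c))"
      using t p abc c0 n1 by (intro mult_strict_left_mono powr_tangent_strict) auto
    moreover have "(1 - t) * (b / (1 - t)) powr p < (1 - t) * (c powr p + p * c powr (p - 1) * (b / (1 - t) - c))"
      using t p abc c0 n2 by (intro mult_strict_left_mono powr_tangent_strict) auto
    moreover have "t * (c powr p + p * c powr (p - 1) * (a / t - c)) + (1 - t) * (c powr p + p * c powr (p - 1) * (b / (1 - t) - c)) = c powr p"
    proof -
      have alg: "t * (A + B * X) + (1 - t) * (A + B * Z) = A + B * (t * X + (1 - t) * Z)" for A B X Z :: real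
        by (simp add: algebra_simps)
      have "t * (a / t - c) = a - t * c" "(1 - t) * (b / (1 - t) - c) = b - (1 - t) * c"
        using t by (auto simp: right_diff_distrib)
      moreover have "(1 - t) * c = c - t * c" by (simp add: algebra_simps)
      ultimately have "t * (a / t - c) + (1 - t) * (b / (1 - t) - c) = 0" using abc by linarith
      then show ?thesis unfolding alg by simp
    qed
    ultimately show ?thesis unfolding e1 e2 by linarith
  qed
  then show "a \<noteq> t * c \<Longrightarrow> t powr (1 - p) * a powr p + (1 - t) powr (1 - p) * b powr p < c powr p" .
  show "t powr (1 - p) * a powr p + (1 - t) powr (1 - p) * b powr p \<le> c powr p"
  proof (cases "a = t * c")
    case True
    then have "b = (1 - t) * c" using abc by (simp add: algebra_simps)
    then have "a / t = c" "b / (1 - t) = c" using True t by auto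
    then show ?thesis unfolding e1 e2 by (simp add: algebra_simps)
  qed (use strict in auto)
qed

lemma powr_interpolation_le:
  fixes a b c p t :: real
  assumes p: "0 < p" "p < 1" and t: "0 < t" "t < 1" and abc: "0 \<le> a" "0 \<le> b" "a + b \<le> c"
  shows "t powr (1 - p) * a powr p + (1 - t) powr (1 - p) * b powr p \<le> c powr p"
proof -
  have "(1 - t) powr (1 - p) * b powr p \<le> (1 - t) powr (1 - p) * (c - a) powr p"
    using abc p by (intro mult_left_mono powr_mono2) auto
  then show ?thesis using powr_interpolation_strict(1)[OF p t abc(1), of "c - a" c] abc by simp
qed

text \<open>Quantifies, by compactness, how a point \<open>z\<close> with \<open>\<tau>(x, z)\<close> too small misses being an intermediate
  point at ratio \<open>t\<close> for the cost \<open>\<tau>\<^sup>p\<close>; an \<open>\<ell>\<^sub>p\<close>-geodesic cannot charge such points.\<close>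

lemma powr_interpolation_gap:
  fixes p t \<Lambda> \<delta> :: real
  assumes p: "0 < p" "p < 1" and t: "0 < t" "t < 1" and \<delta>: "0 < \<delta>"
  obtains e where "0 < e" "\<And>a b c. 0 \<le> a \<Longrightarrow> 0 \<le> b \<Longrightarrow> a + b \<le> c \<Longrightarrow> c \<le> \<Lambda> \<Longrightarrow> a \<le> t * c - \<delta> \<Longrightarrow>
     e \<le> c powr p - (t powr (1 - p) * a powr p + (1 - t) powr (1 - p) * b powr p)"
proof -
  \<comment> \<open>The worst admissible \<open>b\<close> is \<open>c - a\<close>. This leaves two
    parameters in a compact set, on which the strict inequality has a positive minimum.\<close>
  define S where "S = {(a, c). 0 \<le> a \<and> a \<le> t * c - \<delta> \<and> c \<le> \<Lambda>}"
  define \<psi> where "\<psi> = (\<lambda>(a, c). c powr p - (t powr (1 - p) * a powr p + (1 - t) powr (1 - p) * (c - a) powr p))"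
  have Sc: "0 < c \<and> a < c" if "(a, c) \<in> S" for a c
  proof -
    have "0 < t * c" using that \<delta> by (auto simp: S_def)
    then have "0 < c" using t by (simp add: zero_less_mult_iff)
    moreover have "t * c < c" using t \<open>0 < c\<close> by simp
    moreover have "a \<le> t * c - \<delta>" using that by (simp add: S_def)
    ultimately show ?thesis using \<delta> by linarith
  qed
  have S0: "0 \<le> fst z \<and> 0 \<le> snd z \<and> 0 \<le> snd z - fst z" if "z \<in> S" for z
    using Sc[of "fst z" "snd z"] that by (auto simp: S_def)
  have "closed S"
  proof -
    have eq: "S = {z. 0 \<le> fst z} \<inter> {z. fst z \<le> t * snd z - \<delta>} \<inter> {z. snd z \<le> \<Lambda>}" by (auto simp: S_def)
    show ?thesis unfolding eq by (intro closed_Int closed_Collect_le continuous_intros)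
  qed
  moreover have "bounded S"
  proof (rule bounded_subset[of "cbox (0, 0) (\<Lambda>, \<Lambda>)"])
    show "S \<subseteq> cbox (0, 0) (\<Lambda>, \<Lambda>)"
      using Sc by (fastforce simp: S_def cbox_Pair_eq)
  qed simp
  ultimately have comp: "compact S" by (simp add: compact_eq_bounded_closed)
  have cont: "continuous_on S \<psi>"
    unfolding \<psi>_def case_prod_beta
    by (intro continuous_on_diff continuous_on_add continuous_on_mult continuous_on_const continuous_on_powr'
        continuous_on_fst continuous_on_snd continuous_on_id ballI) (use S0 p in auto)
  obtain e where e: "0 < e" "\<And>z. z \<in> S \<Longrightarrow> e \<le> \<psi> z"
  proof (cases "S = {}")
    case True then show ?thesis using that[of 1] by auto
  next
    case False
    obtain z where z: "z \<in> S" "\<And>w. w \<in> S \<Longrightarrow> \<psi> z \<le> \<psi> w"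
      using continuous_attains_inf[OF comp False cont] by blast
    obtain a c where ac: "z = (a, c)" by (cases z)
    have "0 < \<psi> z"
      using powr_interpolation_strict(2)[OF p t, of a "c - a" c] z(1) Sc[of a c] \<delta>
      unfolding ac \<psi>_def by (auto simp: S_def)
    then show ?thesis using that z(2) by blast
  qed
  show thesis
  proof (rule that[OF e(1)])
    fix a b c assume h: "0 \<le> a" "0 \<le> b" "a + b \<le> c" "c \<le> \<Lambda>" "a \<le> t * c - \<delta>"
    then have "e \<le> \<psi> (a, c)" by (intro e(2)) (auto simp: S_def)
    moreover have "(1 - t) powr (1 - p) * b powr p \<le> (1 - t) powr (1 - p) * (c - a) powr p"
      using h p by (intro mult_left_mono powr_mono2) auto
    ultimately show "e \<le> c powr p - (t powr (1 - p) * a powr p + (1 - t) powr (1 - p) * b powr p)"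
      by (simp add: \<psi>_def)
  qed
qed

lemma sin_scale_ge:
  assumes "0 \<le> u" "u \<le> 1" "0 \<le> x" "x \<le> pi"
  shows "u * sin x \<le> sin (u * x)"
proof -
  have "concave_on {0..pi} sin"
  proof (rule f''_le0_imp_concave)
    show "convex {0..pi}" by simp
    show "(sin has_real_derivative cos y) (at y)" for y by (rule DERIV_sin)
    show "(cos has_real_derivative - sin y) (at y)" for y by (rule DERIV_cos)
    show "- sin y \<le> 0" if "y \<in> {0..pi}" for y using that sin_ge_zero by auto
  qed
  from concave_onD[OF this, of u 0 x] assms show ?thesis by auto
qed

text \<open>One bound for all signs of \<kappa>: for positive \<kappa> concavity of the sine gives
  at least \<open>u\<close>; for negative \<kappa> the estimates
  \<open>sinh (u * x) \<ge> u * x\<close> and \<open>sinh x \<le> x * cosh x\<close> cost the factor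
  \<open>cosh\<close>. The bound no longer depends on \<theta>, hence not on the transported
  measure.\<close>

lemma sigma_coeff_ge:
  assumes u: "0 \<le> u" "u \<le> 1" and \<theta>: "0 \<le> \<theta>" "\<theta> \<le> \<Lambda>"
  shows "ennreal (u / cosh (sqrt \<bar>\<kappa>\<bar> * \<Lambda>)) \<le> sigma_coeff \<kappa> u \<theta>"
proof -
  have c1: "1 \<le> cosh (sqrt \<bar>\<kappa>\<bar> * \<Lambda>)" by (rule cosh_real_ge_1)
  have le_u: "u / cosh (sqrt \<bar>\<kappa>\<bar> * \<Lambda>) \<le> u"
    using c1 u by (simp add: divide_le_eq mult_left_le mult_right_mono[of 1 _ u] mult.commute) (metis mult.commute mult_left_mono mult.right_neutral)
  consider "\<kappa> * \<theta>\<^sup>2 \<ge> pi\<^sup>2" | "\<kappa> * \<theta>\<^sup>2 < pi\<^sup>2" "\<kappa> * \<theta>\<^sup>2 > 0" | "\<kappa> * \<theta>\<^sup>2 = 0" | "\<kappa> * \<theta>\<^sup>2 < 0" by linarith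
  then show ?thesis
  proof cases
    case 1 then show ?thesis by (simp add: sigma_coeff_def)
  next
    case 2
    then have k: "0 < \<kappa>" "\<theta> \<noteq> 0" by (auto simp: zero_less_mult_iff)
    define x where "x = sqrt \<kappa> * \<theta>"
    have x0: "0 < x" using k \<theta> by (simp add: x_def)
    have "x\<^sup>2 < pi\<^sup>2" using 2 k by (simp add: x_def power_mult_distrib)
    then have xpi: "x < pi" by (rule power2_less_imp_less) simp
    have "0 < sin x" using x0 xpi by (rule sin_gt_zero)
    moreover have "u * sin x \<le> sin (u * x)" using u x0 xpi by (intro sin_scale_ge) auto
    ultimately have "u \<le> sin (u * x) / sin x" by (simp add: le_divide_eq)
    then have "u / cosh (sqrt \<bar>\<kappa>\<bar> * \<Lambda>) \<le> sin (u * sqrt \<kappa> * \<theta>) / sin (sqrt \<kappa> * \<theta>)"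
      using le_u unfolding x_def by (simp add: mult.assoc)
    then show ?thesis using 2 by (simp add: sigma_coeff_def ennreal_leI)
  next
    case 3
    then have "sigma_coeff \<kappa> u \<theta> = ennreal u" unfolding sigma_coeff_def 3 by (simp add: not_le)
    then show ?thesis using le_u by (simp add: ennreal_leI)
  next
    case 4
    then have k: "\<kappa> < 0" "\<theta> \<noteq> 0" by (auto simp: mult_less_0_iff)
    define x where "x = sqrt (- \<kappa>) * \<theta>"
    have x0: "0 < x" using k \<theta> by (simp add: x_def)
    have xL: "x \<le> sqrt \<bar>\<kappa>\<bar> * \<Lambda>" unfolding x_def using k \<theta> by (intro mult_mono) auto
    have sx: "0 < sinh x" using x0 by simp
    have sinh_le: "sinh x \<le> x * cosh x"
    proof -
      have "\<exists>z>0. z < x \<and> sinh x - sinh 0 = (x - 0) * cosh z"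
        by (rule MVT2[OF x0]) (auto intro!: derivative_eq_intros)
      then obtain z where z: "0 < z" "z < x" "sinh x = x * cosh z" by auto
      have "cosh z \<le> cosh x" using z x0 by (subst cosh_real_nonneg_le_iff) auto
      then show ?thesis using z x0 by simp
    qed
    have sinh_ge: "u * x \<le> sinh (u * x)"
    proof (cases "u * x = 0")
      case False
      then have "0 < u * x" using u x0 by auto
      then have "\<exists>z>0. z < u * x \<and> sinh (u * x) - sinh 0 = (u * x - 0) * cosh z"
        by (intro MVT2) (auto intro!: derivative_eq_intros)
      then obtain z where z: "sinh (u * x) = u * x * cosh z" by auto
      have "u * x * 1 \<le> u * x * cosh z" using \<open>0 < u * x\<close> cosh_real_ge_1 by (intro mult_left_mono) auto
      then show ?thesis using z by simp
    next
      case True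
      show ?thesis unfolding True by simp
    qed
    have "u / cosh (sqrt \<bar>\<kappa>\<bar> * \<Lambda>) \<le> u / cosh x"
      using xL x0 u cosh_real_pos[of x] by (intro divide_left_mono) (auto simp: cosh_real_nonneg_le_iff)
    also have "\<dots> = (u * x) / (x * cosh x)" using x0 by simp
    also have "\<dots> \<le> sinh (u * x) / sinh x"
      using sinh_le sinh_ge sx x0 u by (intro frac_le) auto
    finally show ?thesis using 4 k unfolding sigma_coeff_def x_def
      by (simp add: mult.assoc ennreal_leI not_le)
  qed
qed

section \<open>Borel sets of a topology, entropy of uniform and of concentrated measures\<close>

lemma borel_of_subset: "{U. openin T U} \<subseteq> Pow (topspace T)"
  using openin_subset by blast

lemma space_borel_of [simp]: "space (borel_of T) = topspace T"
  unfolding borel_of_def by (rule space_measure_of[OF borel_of_subset])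

lemma openin_sets_borel_of: "openin T U \<Longrightarrow> U \<in> sets (borel_of T)"
  unfolding borel_of_def by (subst sets_measure_of[OF borel_of_subset]) (auto intro: sigma_sets.Basic)

lemma closedin_sets_borel_of: "closedin T C \<Longrightarrow> C \<in> sets (borel_of T)"
proof -
  assume C: "closedin T C"
  then have "topspace T - C \<in> sets (borel_of T)" by (intro openin_sets_borel_of) auto
  then have "space (borel_of T) - (topspace T - C) \<in> sets (borel_of T)" by (rule sets.compl_sets)
  moreover have "space (borel_of T) - (topspace T - C) = C" using closedin_subset[OF C] by auto
  ultimately show ?thesis by simp
qed

lemma continuous_map_measurable_borel_of:
  assumes "continuous_map T T' h"
  shows "h \<in> measurable (borel_of T) (borel_of T')"
  unfolding borel_of_def[of T']
proof (rule measurable_measure_of[OF borel_of_subset])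
  show "h \<in> space (borel_of T) \<rightarrow> topspace T'" using assms by (auto simp: continuous_map_def)
  fix U assume "U \<in> {U. openin T' U}"
  then have "openin T {x \<in> topspace T. h x \<in> U}" using assms by (auto simp: continuous_map_def)
  moreover have "h -` U \<inter> space (borel_of T) = {x \<in> topspace T. h x \<in> U}" by auto
  ultimately show "h -` U \<inter> space (borel_of T) \<in> sets (borel_of T)" by (simp add: openin_sets_borel_of)
qed

lemma lower_semicontinuous_measurable:
  fixes h :: "'a \<Rightarrow> ennreal"
  assumes "\<And>c. openin T {x \<in> topspace T. c < h x}"
  shows "h \<in> borel_measurable (borel_of T)"
  by (rule borel_measurableI_greater) (simp add: assms openin_sets_borel_of)

lemma exp_ereal_mono:
  assumes "x \<le> ereal y"
  shows "exp_ereal x \<le> ennreal (exp y)"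
  using assms by (cases x) (auto simp: exp_ereal_def intro: ennreal_leI)

text \<open>The left-hand side is the tangent at \<open>a\<close> of the convex function
  \<open>x * ln x\<close>.\<close>

lemma x_ln_x_ge:
  fixes x a :: real
  assumes "0 \<le> x" "0 < a"
  shows "x * ln a + x - a \<le> x * ln x"
proof (cases "x = 0")
  case False
  then have x: "0 < x" using assms by simp
  have "ln (a / x) \<le> a / x - 1" using x assms by (intro ln_le_minus_one) auto
  then have "ln a - ln x \<le> a / x - 1" using x assms by (simp add: ln_div)
  then have "x * (ln a - ln x) \<le> x * (a / x - 1)" using x by (intro mult_left_mono) auto
  then show ?thesis using x by (simp add: algebra_simps)
qed (use assms in simp)

text \<open>The density is constant on \<open>A\<close>, so the entropy is \<open>- ln\<close> of
  the measure of \<open>A\<close>. The positive and the negative part in \<open>Ent\<close> are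
  computed separately because the sign of this number is open.\<close>

lemma entropy_power_uniform:
  assumes A: "A \<in> sets m" "0 < emeasure m A" "emeasure m A < \<top>" and N: "0 < N"
  shows "entropy_power N m (uniform_measure m A) = ennreal (measure m A powr (1 / N))"
    and "\<bar>Ent m (uniform_measure m A)\<bar> < \<infinity>"
proof -
  define c where "c = measure m A"
  have emA: "emeasure m A = ennreal c" using A(3) by (simp add: c_def emeasure_eq_ennreal_measure)
  have c0: "0 < c" using A(2) emA by simp
  define h :: "'a \<Rightarrow> ennreal" where "h = (\<lambda>x. indicator A x / emeasure m A)"
  have hm[measurable]: "h \<in> borel_measurable m" unfolding h_def using A(1) by measurable
  have um: "uniform_measure m A = density m h" unfolding uniform_measure_def h_def ..
  have dens: "density m (RN_deriv m (uniform_measure m A)) = uniform_measure m A"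
    unfolding um by (rule density_RN_deriv_density[OF hm])
  have AE: "AE x in m. RN_deriv m (uniform_measure m A) x = h x"
  proof -
    have "(\<integral>\<^sup>+x. h x \<partial>m) = emeasure m A / emeasure m A"
      unfolding h_def using A(1) by (subst nn_integral_divide) auto
    then have fin: "(\<integral>\<^sup>+x. h x \<partial>m) \<noteq> \<infinity>" using emA c0 by (simp add: divide_ennreal)
    have "AE x in m. h x = RN_deriv m (uniform_measure m A) x"
      using finite_density_unique[OF hm borel_measurable_RN_deriv _ _ fin, of "uniform_measure m A"] dens um by auto
    then show ?thesis by eventually_elim simp
  qed
  have hA: "enn2real (h x) = indicator A x / c" for x
    unfolding h_def emA using c0 by (auto simp: indicator_def divide_ennreal[of 1 c, simplified])
  define k where "k = (1 / c) * ln (1 / c)"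
  have gk: "AE x in m. enn2real (RN_deriv m (uniform_measure m A) x) * ln (enn2real (RN_deriv m (uniform_measure m A) x)) = indicator A x * k"
    using AE by eventually_elim (simp add: hA k_def indicator_def)
  have P: "(\<integral>\<^sup>+ x. ennreal (enn2real (RN_deriv m (uniform_measure m A) x) * ln (enn2real (RN_deriv m (uniform_measure m A) x))) \<partial>m) = ennreal k * emeasure m A"
  proof -
    have "(\<integral>\<^sup>+ x. ennreal (enn2real (RN_deriv m (uniform_measure m A) x) * ln (enn2real (RN_deriv m (uniform_measure m A) x))) \<partial>m) = (\<integral>\<^sup>+ x. ennreal k * indicator A x \<partial>m)"
      by (rule nn_integral_cong_AE) (use gk in eventually_elim, auto split: split_indicator)
    then show ?thesis using A(1) by (simp add: nn_integral_cmult_indicator)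
  qed
  have Q: "(\<integral>\<^sup>+ x. ennreal (- (enn2real (RN_deriv m (uniform_measure m A) x) * ln (enn2real (RN_deriv m (uniform_measure m A) x)))) \<partial>m) = ennreal (- k) * emeasure m A"
  proof -
    have "(\<integral>\<^sup>+ x. ennreal (- (enn2real (RN_deriv m (uniform_measure m A) x) * ln (enn2real (RN_deriv m (uniform_measure m A) x)))) \<partial>m) = (\<integral>\<^sup>+ x. ennreal (- k) * indicator A x \<partial>m)"
      by (rule nn_integral_cong_AE) (use gk in eventually_elim, auto split: split_indicator)
    then show ?thesis using A(1) by (simp add: nn_integral_cmult_indicator)
  qed
  have "Ent m (uniform_measure m A) = enn2ereal (ennreal k * emeasure m A) - enn2ereal (ennreal (- k) * emeasure m A)"
    unfolding Ent_def Let_def P Q using dens A(3) by (simp add: ennreal_mult_less_top)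
  also have "\<dots> = ereal (k * c)"
  proof (cases "0 \<le> k")
    case True
    then have "ennreal k * ennreal c = ennreal (k * c)" "ennreal (- k) = 0" "0 \<le> k * c"
      using c0 by (auto simp: ennreal_mult ennreal_neg)
    then show ?thesis unfolding emA by (simp add: zero_ennreal.rep_eq)
  next
    case False
    then have k: "0 \<le> - k" "k \<le> 0" by auto
    then have "ennreal (- k) * ennreal c = ennreal (- k * c)"
      using c0 by (intro ennreal_mult[symmetric]) auto
    moreover have "ennreal k = 0" "0 \<le> - k * c" using k c0 by (auto simp: ennreal_neg mult_nonpos_nonneg)
    ultimately show ?thesis unfolding emA by (simp add: zero_ennreal.rep_eq)
  qed
  also have "k * c = - ln c" using c0 by (simp add: k_def ln_div)
  finally have E: "Ent m (uniform_measure m A) = ereal (- ln c)" .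
  then show "\<bar>Ent m (uniform_measure m A)\<bar> < \<infinity>" by simp
  show "entropy_power N m (uniform_measure m A) = ennreal (measure m A powr (1 / N))"
    unfolding entropy_power_def E c_def[symmetric] using c0 N by (simp add: exp_ereal_def powr_def)
qed

text \<open>This is Jensen's inequality: the tangent of \<open>x * ln x\<close> at
  \<open>1 / measure m B\<close>, integrated over \<open>B\<close>, bounds the entropy from below by
  \<open>- ln\<close> of the measure of \<open>B\<close>. Infinite entropy means entropy power
  0.\<close>

lemma entropy_power_concentrated:
  assumes \<mu>: "sets \<mu> = sets m" "prob_space \<mu>" and B: "B \<in> sets m" "emeasure m B < \<top>"
    and conc: "emeasure \<mu> (space \<mu> - B) = 0" and N: "0 < N"
  shows "entropy_power N m \<mu> \<le> ennreal (measure m B powr (1 / N))"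
proof (cases "Ent m \<mu> = \<infinity>")
  case True
  then show ?thesis using N by (simp add: entropy_power_def exp_ereal_def)
next
  case False
  interpret prob_space \<mu> by (rule \<mu>(2))
  define R where "R = RN_deriv m \<mu>"
  have Rm[measurable]: "R \<in> borel_measurable m" by (simp add: R_def)
  define \<phi> where "\<phi> = (\<lambda>x. enn2real (R x))"
  define g where "g = (\<lambda>x. \<phi> x * ln (\<phi> x))"
  have [measurable]: "\<phi> \<in> borel_measurable m" "g \<in> borel_measurable m" unfolding g_def \<phi>_def by measurable
  define P where "P = (\<integral>\<^sup>+ x. ennreal (g x) \<partial>m)"
  define Q where "Q = (\<integral>\<^sup>+ x. ennreal (- g x) \<partial>m)"
  have D: "density m R = \<mu>" and Pfin: "P < \<top>" and E: "Ent m \<mu> = enn2ereal P - enn2ereal Q"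
    using False unfolding Ent_def Let_def R_def[symmetric] \<phi>_def[symmetric] g_def[symmetric] P_def[symmetric] Q_def[symmetric]
    by (auto split: if_splits simp: g_def P_def Q_def \<phi>_def)
  have sp: "space \<mu> = space m" using \<mu>(1) by (rule sets_eq_imp_space_eq)
  have R1: "(\<integral>\<^sup>+ x. R x \<partial>m) = 1"
  proof -
    have "emeasure (density m R) (space m) = (\<integral>\<^sup>+ x. R x \<partial>m)" by (subst emeasure_density) (auto intro!: nn_integral_cong)
    then show ?thesis unfolding D using emeasure_space_1 sp by simp
  qed
  have Rfin: "AE x in m. R x < \<top>"
    using nn_integral_PInf_AE[OF Rm] R1 by (auto simp: less_top)
  have R\<phi>: "AE x in m. R x = ennreal (\<phi> x)" using Rfin by eventually_elim (simp add: \<phi>_def)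
  have \<phi>1: "(\<integral>\<^sup>+ x. ennreal (\<phi> x) \<partial>m) = 1"
    unfolding R1[symmetric] by (rule nn_integral_cong_AE) (use R\<phi> in eventually_elim, simp)
  have \<phi>int: "integrable m \<phi>"
  proof (rule integrableI_nonneg)
    show "(\<integral>\<^sup>+ x. ennreal (\<phi> x) \<partial>m) < \<infinity>" using \<phi>1 by simp
  qed (auto simp: \<phi>_def)
  have \<phi>I: "(\<integral>x. \<phi> x \<partial>m) = 1"
    using nn_integral_eq_integral[OF \<phi>int] \<phi>1 by (auto simp: \<phi>_def)
  have out: "AE x in m. x \<notin> B \<longrightarrow> \<phi> x = 0"
  proof -
    have "(\<integral>\<^sup>+ x. R x * indicator (space m - B) x \<partial>m) = 0"
      using conc B(1) unfolding D[symmetric] by (subst (asm) emeasure_density) auto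
    then have "AE x in m. R x * indicator (space m - B) x = 0"
      using B(1) by (subst (asm) nn_integral_0_iff_AE) auto
    moreover have "AE x in m. x \<in> space m" by (rule AE_space)
    ultimately show ?thesis by eventually_elim (auto simp: \<phi>_def split: split_indicator_asm)
  qed
  define b where "b = measure m B"
  have emB: "emeasure m B = ennreal b" using B(2) by (simp add: b_def emeasure_eq_ennreal_measure)
  have Bint: "integrable m (indicator B :: _ \<Rightarrow> real)" using B by (intro integrable_real_indicator) auto
  have b0: "0 < b"
  proof (rule ccontr)
    assume "\<not> 0 < b"
    then have "b = 0" using measure_nonneg[of m B] by (simp add: b_def)
    then have "emeasure m B = 0" using emB by simp
    then have "AE x in m. x \<notin> B" using B(1) by (intro AE_not_in) auto
    with out have "AE x in m. \<phi> x = 0" by eventually_elim auto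
    then have "(\<integral>x. \<phi> x \<partial>m) = (\<integral>x. 0 \<partial>m)" by (intro integral_cong_AE) auto
    then show False using \<phi>I by simp
  qed
  have Qfin: "Q < \<top>"
  proof -
    have "Q \<le> (\<integral>\<^sup>+ x. indicator B x \<partial>m)"
      unfolding Q_def
    proof (rule nn_integral_mono_AE)
      show "AE x in m. ennreal (- g x) \<le> indicator B x"
        using out
      proof eventually_elim
        case (elim x)
        have "- g x \<le> 1"
        proof -
          have "0 \<le> \<phi> x" by (simp add: \<phi>_def)
          moreover from this have "\<phi> x - 1 \<le> g x" using x_ln_x_ge[of "\<phi> x" 1] by (simp add: g_def)
          ultimately show ?thesis by linarith
        qed
        then have "ennreal (- g x) \<le> 1" by (metis ennreal_1 ennreal_leI)
        then show ?case using elim by (cases "x \<in> B") (auto simp: g_def)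
      qed
    qed
    also have "\<dots> = emeasure m B" using B(1) by simp
    finally show ?thesis using B(2) by (rule le_less_trans)
  qed
  have gint: "integrable m g"
    unfolding real_integrable_def using Pfin Qfin by (auto simp: P_def Q_def less_top)
  have gI: "(\<integral>x. g x \<partial>m) = enn2real P - enn2real Q"
    unfolding P_def Q_def by (rule real_lebesgue_integral_def[OF gint])
  have EntI: "Ent m \<mu> = ereal (\<integral>x. g x \<partial>m)"
    unfolding E gI using Pfin Qfin by (cases P; cases Q) auto
  have "(\<integral>x. \<phi> x * ln (1 / b) + \<phi> x - (1 / b) * indicator B x \<partial>m) \<le> (\<integral>x. g x \<partial>m)"
  proof (rule integral_mono_AE[OF _ gint])
    show "integrable m (\<lambda>x. \<phi> x * ln (1 / b) + \<phi> x - (1 / b) * indicator B x)"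
      using \<phi>int Bint by auto
    show "AE x in m. \<phi> x * ln (1 / b) + \<phi> x - (1 / b) * indicator B x \<le> g x"
      using out
    proof eventually_elim
      case (elim x)
      show ?case
        using x_ln_x_ge[of "\<phi> x" "1 / b"] b0 elim by (cases "x \<in> B") (auto simp: g_def \<phi>_def)
    qed
  qed
  moreover have "(\<integral>x. \<phi> x * ln (1 / b) + \<phi> x - (1 / b) * indicator B x \<partial>m) = - ln b"
    using \<phi>int Bint B b0 \<phi>I sets.sets_into_space[OF B(1)] by (simp add: ln_div b_def Int_absorb2)
  ultimately have "- ln b \<le> (\<integral>x. g x \<partial>m)" by simp
  then have "- Ent m \<mu> / ereal N \<le> ereal (ln b / N)"
    unfolding EntI using N by (simp add: divide_right_mono field_simps)
  then have "exp_ereal (- Ent m \<mu> / ereal N) \<le> ennreal (exp (ln b / N))" by (rule exp_ereal_mono)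
  also have "exp (ln b / N) = b powr (1 / N)" using b0 by (simp add: powr_def)
  finally show ?thesis unfolding entropy_power_def b_def .
qed

section \<open>Couplings and transport to a Dirac mass\<close>

lemma ltau_measurable_prod:
  assumes "is_lpls X"
  shows "(\<lambda>z. ltau X (fst z) (snd z)) \<in> borel_measurable (borel_of (prod_topology (ltop X) (ltop X)))"
proof (rule lower_semicontinuous_measurable)
  fix c
  have "openin (prod_topology (ltop X) (ltop X)) {(p, q) \<in> lpts X \<times> lpts X. c < ltau X p q}"
    using assms unfolding is_lpls_def by (elim conjE) (erule allE)
  moreover have "{(p, q) \<in> lpts X \<times> lpts X. c < ltau X p q} = {z \<in> topspace (prod_topology (ltop X) (ltop X)). c < ltau X (fst z) (snd z)}"
    by auto
  ultimately show "openin (prod_topology (ltop X) (ltop X)) {z \<in> topspace (prod_topology (ltop X) (ltop X)). c < ltau X (fst z) (snd z)}"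
    by simp
qed

lemma ltau_measurable_left:
  assumes "is_lpls X" "x1 \<in> lpts X"
  shows "(\<lambda>z. ltau X z x1) \<in> borel_measurable (borel_of (ltop X))"
proof -
  have "continuous_map (ltop X) (prod_topology (ltop X) (ltop X)) (\<lambda>z. (z, x1))"
    using assms(2) by (auto simp: continuous_map_pairwise comp_def)
  then have "(\<lambda>z. (z, x1)) \<in> measurable (borel_of (ltop X)) (borel_of (prod_topology (ltop X) (ltop X)))"
    by (rule continuous_map_measurable_borel_of)
  from measurable_comp[OF this ltau_measurable_prod[OF assms(1)]] show ?thesis by (simp add: comp_def)
qed

lemma fst_snd_measurable_borel_of:
  "fst \<in> measurable (borel_of (prod_topology T T')) (borel_of T)"
  "snd \<in> measurable (borel_of (prod_topology T T')) (borel_of T')"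
  by (auto intro!: continuous_map_measurable_borel_of simp: continuous_map_fst continuous_map_snd)

lemma sing_sets_borel_of_ltop: "x \<in> lpts X \<Longrightarrow> {x} \<in> sets (borel_of (ltop X))"
proof -
  assume "x \<in> lpts X"
  then have "closedin (ltop X) {x}"
    unfolding mtopology_of_def by (intro closedin_Hausdorff_singleton Metric_space.Hausdorff_space_mtopology)
      (auto simp: Metric_space.topspace_mtopology[OF Metric_space_mspace_mdist])
  then show ?thesis by (rule closedin_sets_borel_of)
qed

lemma coupling_marginals:
  assumes \<pi>: "\<pi> \<in> causal_couplings X \<mu> \<nu>"
  shows "fst \<in> measurable \<pi> (borel_of (ltop X))" "snd \<in> measurable \<pi> (borel_of (ltop X))"
    "distr \<pi> (borel_of (ltop X)) fst = \<mu>" "distr \<pi> (borel_of (ltop X)) snd = \<nu>"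
    "AE z in \<pi>. lcaus X (fst z) (snd z)"
    "sets \<pi> = sets (borel_of (prod_topology (ltop X) (ltop X)))"
proof -
  show s: "sets \<pi> = sets (borel_of (prod_topology (ltop X) (ltop X)))"
    using \<pi> by (simp add: causal_couplings_def)
  show "fst \<in> measurable \<pi> (borel_of (ltop X))" "snd \<in> measurable \<pi> (borel_of (ltop X))"
    using fst_snd_measurable_borel_of[of "ltop X" "ltop X"] measurable_cong_sets[OF s refl] by auto
qed (use \<pi> in \<open>auto simp: causal_couplings_def\<close>)

text \<open>The second marginal forces \<open>snd z = x1\<close> almost surely, so all couplings
  have the same cost. Positivity of the cost excludes the value \<open>- \<infinity>\<close> and
  thus provides a coupling; its causality passes to the first marginal because the past of
  \<open>x1\<close> is measurable.\<close>

lemma coupling_with_dirac: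
  assumes X: "is_lpls X" and x1: "x1 \<in> lpts X" and past: "{z \<in> lpts X. lcaus X z x1} \<in> sets (borel_of (ltop X))"
    and pos: "0 < lp_cost X p \<nu> (return (borel_of (ltop X)) x1)"
  shows "lp_cost X p \<nu> (return (borel_of (ltop X)) x1) =
      enn2ereal (enn_powr (\<integral>\<^sup>+ x. enn_powr (ltau X x x1) p \<partial>\<nu>) (1 / p))"
    and "AE z in \<nu>. lcaus X z x1"
proof -
  let ?S = "borel_of (ltop X)"
  let ?C = "causal_couplings X \<nu> (return ?S x1)"
  have snd_eq: "AE z in \<pi>. snd z = x1" if "\<pi> \<in> ?C" for \<pi>
  proof -
    note c = coupling_marginals[OF that]
    have "{y \<in> space ?S. y \<in> {x1}} = {x1}" using x1 by auto
    then have "Measurable.pred ?S (\<lambda>y. y \<in> {x1})"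
      unfolding pred_def using sing_sets_borel_of_ltop[OF x1] by simp
    then have "AE y in return ?S x1. y \<in> {x1}"
      using x1 by (subst AE_return) auto
    then have "AE y in distr \<pi> ?S snd. y = x1" unfolding c(4) by simp
    then show ?thesis using c(2) by (rule AE_distrD[rotated])
  qed
  have tm: "(\<lambda>x. enn_powr (ltau X x x1) p) \<in> borel_measurable ?S"
  proof -
    have [measurable]: "(\<lambda>z. ltau X z x1) \<in> borel_measurable ?S" by (rule ltau_measurable_left[OF X x1])
    show ?thesis unfolding enn_powr_def by measurable
  qed
  have cost: "(\<integral>\<^sup>+ z. enn_powr (ltau X (fst z) (snd z)) p \<partial>\<pi>) = (\<integral>\<^sup>+ x. enn_powr (ltau X x x1) p \<partial>\<nu>)"
    if "\<pi> \<in> ?C" for \<pi>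
  proof -
    note c = coupling_marginals[OF that]
    have "(\<integral>\<^sup>+ z. enn_powr (ltau X (fst z) (snd z)) p \<partial>\<pi>) = (\<integral>\<^sup>+ z. enn_powr (ltau X (fst z) x1) p \<partial>\<pi>)"
      by (rule nn_integral_cong_AE) (use snd_eq[OF that] in eventually_elim, simp)
    also have "\<dots> = (\<integral>\<^sup>+ x. enn_powr (ltau X x x1) p \<partial>distr \<pi> ?S fst)"
      using c(1) tm by (subst nn_integral_distr) auto
    finally show ?thesis unfolding c(3) .
  qed
  have ne: "?C \<noteq> {}"
  proof
    assume "?C = {}"
    then have "lp_cost X p \<nu> (return ?S x1) = - \<infinity>" by (simp add: lp_cost_def bot_ereal_def)
    then show False using pos by simp
  qed
  have "lp_cost X p \<nu> (return ?S x1) = (SUP \<pi> \<in> ?C. enn2ereal (enn_powr (\<integral>\<^sup>+ x. enn_powr (ltau X x x1) p \<partial>\<nu>) (1 / p)))"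
    unfolding lp_cost_def using cost by (intro SUP_cong) auto
  then show "lp_cost X p \<nu> (return ?S x1) = enn2ereal (enn_powr (\<integral>\<^sup>+ x. enn_powr (ltau X x x1) p \<partial>\<nu>) (1 / p))"
    using ne by simp
  obtain \<pi> where \<pi>: "\<pi> \<in> ?C" using ne by blast
  note c = coupling_marginals[OF \<pi>]
  have "AE z in \<pi>. lcaus X (fst z) x1"
    using c(5) snd_eq[OF \<pi>] by eventually_elim simp
  moreover have "(AE y in distr \<pi> ?S fst. lcaus X y x1) \<longleftrightarrow> (AE z in \<pi>. lcaus X (fst z) x1)"
    using c(1) past by (intro AE_distr_iff) auto
  ultimately show "AE z in \<nu>. lcaus X z x1" unfolding c(3) by blast
qed

text \<open>Take a nearly optimal coupling of \<open>\<mu> 0\<close> and \<open>\<mu> t\<close>, and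
  let \<open>a\<close>, \<open>b\<close>, \<open>d\<close> be the time separations from
  \<open>x\<close> to \<open>z\<close>, from \<open>z\<close> to \<open>x1\<close> and from
  \<open>x\<close> to \<open>x1\<close>. As the target is a Dirac mass, the integrals of
  \<open>b powr p\<close> and \<open>d powr p\<close> are known exactly without gluing couplings.
  The nonnegative deficit \<open>D\<close> in the interpolation inequality then has an integral of
  order \<epsilon>, while outside \<open>B\<close> it is at least a fixed \<open>e\<close>.\<close>

lemma lp_geodesic_to_dirac_concentrated:
  fixes X :: "'a lpls"
  assumes X: "is_lpls X" and x1: "x1 \<in> lpts X"
    and bnd: "\<And>p q. p \<in> lpts X \<Longrightarrow> q \<in> lpts X \<Longrightarrow> ltau X p q \<le> ennreal \<Lambda>"
    and past: "{z \<in> lpts X. lcaus X z x1} \<in> sets (borel_of (ltop X))"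
    and p: "0 < p" "p < 1" and geo: "lp_geodesic X p \<mu>" and \<mu>1: "\<mu> 1 = return (borel_of (ltop X)) x1"
    and A: "A \<in> sets (borel_of (ltop X))" "AE x in \<mu> 0. x \<in> A"
    and t: "0 < t" "t < 1" and \<delta>: "0 < \<delta>" and B: "B \<in> sets (borel_of (ltop X))"
    and AB: "\<And>x z. x \<in> A \<Longrightarrow> z \<in> lpts X \<Longrightarrow> lcaus X x z \<Longrightarrow> lcaus X z x1 \<Longrightarrow>
       t * enn2real (ltau X x x1) - \<delta> < enn2real (ltau X x z) \<Longrightarrow> z \<in> B"
  shows "emeasure (\<mu> t) (space (\<mu> t) - B) = 0"
proof -
  let ?S = "borel_of (ltop X)"
  have bp: "sets (\<mu> s) = sets ?S" "prob_space (\<mu> s)" if "s \<in> {0..1}" for s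
    using geo that unfolding lp_geodesic_def borel_prob_def by auto
  have geoD: "lp_cost X p (\<mu> s) (\<mu> r) = ereal (r - s) * lp_cost X p (\<mu> 0) (\<mu> 1)" "0 < lp_cost X p (\<mu> s) (\<mu> r)"
    if "0 \<le> s" "s < r" "r \<le> 1" for s r
    using geo[unfolded lp_geodesic_def, THEN conjunct2, rule_format, of s r] that by blast+
  have sp: "space (\<mu> s) = lpts X" if "s \<in> {0..1}" for s
    using sets_eq_imp_space_eq[OF bp(1)[OF that]] by simp
  interpret P0: prob_space "\<mu> 0" by (rule bp) simp
  interpret Pt: prob_space "\<mu> t" by (rule bp) (use t in simp)
  define T where "T = (\<lambda>x y. enn2real (ltau X x y))"
  have T: "ltau X x y = ennreal (T x y)" "0 \<le> T x y" "T x y \<le> max 0 \<Lambda>" if "x \<in> lpts X" "y \<in> lpts X" for x y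
  proof -
    have le: "ltau X x y \<le> ennreal \<Lambda>" by (rule bnd[OF that])
    then have lt: "ltau X x y < \<top>" by (rule le_less_trans) simp
    then show eq: "ltau X x y = ennreal (T x y)" by (simp add: T_def)
    show "0 \<le> T x y" by (simp add: T_def)
    have "ltau X x y \<le> ennreal (max 0 \<Lambda>)" using le by (cases "0 \<le> \<Lambda>") (simp_all add: max_def ennreal_neg)
    then show "T x y \<le> max 0 \<Lambda>" unfolding T_def by (intro enn2real_leI) auto
  qed
  define I where "I = (\<lambda>\<nu>. \<integral>x. T x x1 powr p \<partial>\<nu>)"
  have costI: "lp_cost X p (\<mu> s) (\<mu> 1) = ereal (I (\<mu> s) powr (1 / p))" "AE z in \<mu> s. lcaus X z x1"
     "integrable (\<mu> s) (\<lambda>x. T x x1 powr p)" "0 \<le> I (\<mu> s)"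
    if s: "0 \<le> s" "s < 1" for s
  proof -
    interpret Ps: prob_space "\<mu> s" by (rule bp) (use s in simp)
    have pos: "0 < lp_cost X p (\<mu> s) (\<mu> 1)" by (rule geoD(2)) (use s in auto)
    note d = coupling_with_dirac[OF X x1 past pos[unfolded \<mu>1]]
    show "AE z in \<mu> s. lcaus X z x1" by (rule d(2))
    have m: "(\<lambda>x. T x x1 powr p) \<in> borel_measurable (\<mu> s)"
      using ltau_measurable_left[OF X x1] bp(1)[of s] s unfolding T_def
      by (subst measurable_cong_sets[OF _ refl, of _ ?S]) auto
    show int: "integrable (\<mu> s) (\<lambda>x. T x x1 powr p)"
      by (rule Ps.integrable_const_bound[of _ "max 0 \<Lambda> powr p"])
         (use m s sp[of s] T x1 p in \<open>auto intro!: powr_mono2\<close>)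
    show "0 \<le> I (\<mu> s)" unfolding I_def by (rule integral_nonneg_AE) auto
    have "(\<integral>\<^sup>+ x. enn_powr (ltau X x x1) p \<partial>\<mu> s) = (\<integral>\<^sup>+ x. ennreal (T x x1 powr p) \<partial>\<mu> s)"
    proof (rule nn_integral_cong)
      fix x assume "x \<in> space (\<mu> s)"
      then have "ltau X x x1 = ennreal (T x x1)" "0 \<le> T x x1" using s sp[of s] T(1,2)[OF _ x1] by auto
      then show "enn_powr (ltau X x x1) p = ennreal (T x x1 powr p)" by (simp add: enn_powr_def)
    qed
    also have "\<dots> = ennreal (I (\<mu> s))" unfolding I_def by (rule nn_integral_eq_integral[OF int]) auto
    finally show "lp_cost X p (\<mu> s) (\<mu> 1) = ereal (I (\<mu> s) powr (1 / p))"
      unfolding d(1)[folded \<mu>1] using \<open>0 \<le> I (\<mu> s)\<close> by (simp add: enn_powr_def)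
  qed
  define L where "L = I (\<mu> 0) powr (1 / p)"
  have L: "lp_cost X p (\<mu> 0) (\<mu> 1) = ereal L" using costI(1)[of 0] by (simp add: L_def)
  have L0: "0 < L"
  proof -
    have "0 < lp_cost X p (\<mu> 0) (\<mu> 1)" by (rule geoD(2)) auto
    then show ?thesis using L by simp
  qed
  have I0: "I (\<mu> 0) = L powr p" unfolding L_def using costI(4)[of 0] p by (simp add: powr_powr)
  have It: "I (\<mu> t) = ((1 - t) * L) powr p"
  proof -
    have "lp_cost X p (\<mu> t) (\<mu> 1) = ereal (1 - t) * lp_cost X p (\<mu> 0) (\<mu> 1)"
      by (rule geoD(1)) (use t in auto)
    then have "I (\<mu> t) powr (1 / p) = (1 - t) * L" using costI(1)[of t] L t by simp
    then have "(I (\<mu> t) powr (1 / p)) powr p = ((1 - t) * L) powr p" by simp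
    then show ?thesis using costI(4)[of t] t p by (simp add: powr_powr)
  qed
  have cost0t: "lp_cost X p (\<mu> 0) (\<mu> t) = ereal (t * L)"
  proof -
    have "lp_cost X p (\<mu> 0) (\<mu> t) = ereal (t - 0) * lp_cost X p (\<mu> 0) (\<mu> 1)"
      by (rule geoD(1)) (use t in auto)
    then show ?thesis using L by simp
  qed
  obtain e where e: "0 < e" "\<And>a b c. 0 \<le> a \<Longrightarrow> 0 \<le> b \<Longrightarrow> a + b \<le> c \<Longrightarrow> c \<le> max 0 \<Lambda> \<Longrightarrow> a \<le> t * c - \<delta> \<Longrightarrow>
     e \<le> c powr p - (t powr (1 - p) * a powr p + (1 - t) powr (1 - p) * b powr p)"
    using powr_interpolation_gap[OF p t \<delta>, of "max 0 \<Lambda>"] by blast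
  have Bt: "B \<in> sets (\<mu> t)" using B bp(1)[of t] t by auto
  have BcS: "space (\<mu> t) - B \<in> sets ?S" using sets.compl_sets[OF Bt] bp(1)[of t] t by auto
  \<comment> \<open>The supremum in \<open>lp_cost\<close> need not be attained, so the coupling is
    optimal only up to \<epsilon>. Its second marginal is \<open>\<mu> t\<close> for every
    \<epsilon>, hence the bound survives the limit.\<close>
  have small: "measure (\<mu> t) (space (\<mu> t) - B) \<le> t powr (1 - p) * \<epsilon> / e" if \<epsilon>: "0 < \<epsilon>" "\<epsilon> < (t * L) powr p" for \<epsilon>
  proof -
    define \<eta> where "\<eta> = (t * L) powr p - \<epsilon>"
    have \<eta>: "0 < \<eta>" "\<eta> < (t * L) powr p" using \<epsilon> by (auto simp: \<eta>_def)
    have "\<eta> powr (1 / p) < ((t * L) powr p) powr (1 / p)" using \<eta> p by (intro powr_less_mono2) auto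
    also have "\<dots> = t * L" using t L0 p by (simp add: powr_powr)
    finally have "ereal (\<eta> powr (1 / p)) < lp_cost X p (\<mu> 0) (\<mu> t)" unfolding cost0t by simp
    then obtain \<pi> where \<pi>: "\<pi> \<in> causal_couplings X (\<mu> 0) (\<mu> t)"
      "ereal (\<eta> powr (1 / p)) < enn2ereal (enn_powr (\<integral>\<^sup>+ z. enn_powr (ltau X (fst z) (snd z)) p \<partial>\<pi>) (1 / p))"
      unfolding lp_cost_def by (auto simp: less_SUP_iff)
    note c = coupling_marginals[OF \<pi>(1)]
    have spi: "space \<pi> = lpts X \<times> lpts X" using sets_eq_imp_space_eq[OF c(6)] by simp
    have pp: "prob_space \<pi>"
      by (rule prob_space_distrD[OF c(1)]) (simp add: c(3) P0.prob_space_axioms)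
    interpret \<pi>: prob_space \<pi> by (rule pp)
    define a where "a = (\<lambda>z :: 'a \<times> 'a. T (fst z) (snd z))"
    define b where "b = (\<lambda>z :: 'a \<times> 'a. T (snd z) x1)"
    define d where "d = (\<lambda>z :: 'a \<times> 'a. T (fst z) x1)"
    have am: "a \<in> borel_measurable \<pi>"
      unfolding a_def T_def using ltau_measurable_prod[OF X] by (subst measurable_cong_sets[OF c(6) refl]) auto
    have tm: "(\<lambda>x. T x x1) \<in> borel_measurable ?S" unfolding T_def using ltau_measurable_left[OF X x1] by measurable
    have bm: "b \<in> borel_measurable \<pi>" unfolding b_def using measurable_comp[OF c(2) tm] by (simp add: comp_def)
    have dm: "d \<in> borel_measurable \<pi>" unfolding d_def using measurable_comp[OF c(1) tm] by (simp add: comp_def)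
    have rng: "0 \<le> a z" "0 \<le> b z" "0 \<le> d z" "a z \<le> max 0 \<Lambda>" "b z \<le> max 0 \<Lambda>" "d z \<le> max 0 \<Lambda>" if "z \<in> space \<pi>" for z
      using that T x1 unfolding spi a_def b_def d_def by auto
    have int: "integrable \<pi> (\<lambda>z. a z powr p)" "integrable \<pi> (\<lambda>z. b z powr p)" "integrable \<pi> (\<lambda>z. d z powr p)"
      using am bm dm rng p
      by (auto intro!: \<pi>.integrable_const_bound[of _ "max 0 \<Lambda> powr p"] powr_mono2 AE_I2)
    have Ib: "(\<integral>z. b z powr p \<partial>\<pi>) = I (\<mu> t)"
      unfolding I_def c(4)[symmetric] b_def using c(2) tm by (subst integral_distr) auto
    have Id: "(\<integral>z. d z powr p \<partial>\<pi>) = I (\<mu> 0)"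
      unfolding I_def c(3)[symmetric] d_def using c(1) tm by (subst integral_distr) auto
    have Ia: "\<eta> < (\<integral>z. a z powr p \<partial>\<pi>)"
    proof -
      have n: "0 \<le> (\<integral>z. a z powr p \<partial>\<pi>)" by (rule integral_nonneg_AE) auto
      have "(\<integral>\<^sup>+ z. enn_powr (ltau X (fst z) (snd z)) p \<partial>\<pi>) = (\<integral>\<^sup>+ z. ennreal (a z powr p) \<partial>\<pi>)"
      proof (rule nn_integral_cong)
        fix z assume "z \<in> space \<pi>"
        then have "ltau X (fst z) (snd z) = ennreal (a z)" "0 \<le> a z" using spi T(1,2) by (auto simp: a_def)
        then show "enn_powr (ltau X (fst z) (snd z)) p = ennreal (a z powr p)" by (simp add: enn_powr_def)
      qed
      also have "\<dots> = ennreal (\<integral>z. a z powr p \<partial>\<pi>)" by (rule nn_integral_eq_integral[OF int(1)]) auto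
      finally have "\<eta> powr (1 / p) < (\<integral>z. a z powr p \<partial>\<pi>) powr (1 / p)"
        using \<pi>(2) n by (simp add: enn_powr_def)
      then show ?thesis using n p \<eta> powr_mono2[of "1 / p" "\<integral>z. a z powr p \<partial>\<pi>" \<eta>] by (auto simp: not_less[symmetric])
    qed
    define D where "D = (\<lambda>z. d z powr p - (t powr (1 - p) * a z powr p + (1 - t) powr (1 - p) * b z powr p))"
    have Dint: "integrable \<pi> D" unfolding D_def using int by auto
    have ID: "(\<integral>z. D z \<partial>\<pi>) = L powr p - (t powr (1 - p) * (\<integral>z. a z powr p \<partial>\<pi>) + (1 - t) powr (1 - p) * ((1 - t) * L) powr p)"
      unfolding D_def using int by (simp add: Ib Id I0 It)
    also have "\<dots> \<le> L powr p - (t powr (1 - p) * \<eta> + (1 - t) powr (1 - p) * ((1 - t) * L) powr p)"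
      using Ia t by (intro diff_left_mono add_right_mono mult_left_mono) auto
    \<comment> \<open>The weights satisfy \<open>t powr (1 - p) * t powr p = t\<close>, and likewise
      for \<open>1 - t\<close>, so the main terms add up to \<open>L powr p\<close> and only the
      optimality gap remains.\<close>
    also have "\<dots> = t powr (1 - p) * \<epsilon>"
    proof -
      have "t powr (1 - p) * (t * L) powr p = t * L powr p" "(1 - t) powr (1 - p) * ((1 - t) * L) powr p = (1 - t) * L powr p"
        using t L0 by (simp_all add: powr_mult powr_diff)
      then show ?thesis unfolding \<eta>_def by (simp add: algebra_simps)
    qed
    finally have IDle: "(\<integral>z. D z \<partial>\<pi>) \<le> t powr (1 - p) * \<epsilon>" .
    let ?bad = "snd -` (space (\<mu> t) - B) \<inter> space \<pi>"
    have badm: "?bad \<in> sets \<pi>"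
      by (rule measurable_sets[OF c(2) BcS])
    have "AE z in \<pi>. fst z \<in> A"
    proof (rule AE_distrD[OF c(1)])
      show "AE x in distr \<pi> ?S fst. x \<in> A" unfolding c(3) by (rule A(2))
    qed
    moreover have "AE z in \<pi>. lcaus X (snd z) x1"
    proof (rule AE_distrD[OF c(2)])
      show "AE x in distr \<pi> ?S snd. lcaus X x x1" unfolding c(4) using costI(2)[of t] t by simp
    qed
    moreover have "AE z in \<pi>. z \<in> space \<pi>" by (rule AE_space)
    ultimately have "AE z in \<pi>. e * indicator ?bad z \<le> D z"
      using c(5)
    proof eventually_elim
      case (elim z)
      have pts: "fst z \<in> lpts X" "snd z \<in> lpts X" using elim(3) unfolding spi by (auto simp: mem_Times_iff)
      have le: "a z + b z \<le> d z"
      proof -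
        have "ltau X (fst z) (snd z) + ltau X (snd z) x1 \<le> ltau X (fst z) x1"
          by (rule is_lplsD(6)[OF X pts x1]) (use elim(2,4) in blast)+
        then have "ennreal (a z) + ennreal (b z) \<le> ennreal (d z)"
          using T(1)[OF pts] T(1)[OF pts(1) x1] T(1)[OF pts(2) x1] by (simp add: a_def b_def d_def)
        moreover have "0 \<le> a z" "0 \<le> b z" "0 \<le> d z" using rng[OF elim(3)] by blast+
        ultimately show ?thesis by (simp flip: ennreal_plus add: ennreal_le_iff)
      qed
      show "e * indicator ?bad z \<le> D z"
      proof (cases "z \<in> ?bad")
        case True
        then have "snd z \<notin> B" by auto
        then have "a z \<le> t * d z - \<delta>"
          using AB[OF elim(1) pts(2) elim(4) elim(2)] unfolding a_def d_def T_def by (meson not_le)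
        then have "e \<le> D z" unfolding D_def using rng[OF elim(3)] le by (intro e(2)) auto
        then show ?thesis using True by simp
      next
        case False
        have "t powr (1 - p) * a z powr p + (1 - t) powr (1 - p) * b z powr p \<le> d z powr p"
          using rng[OF elim(3)] le by (intro powr_interpolation_le p t) auto
        then show ?thesis using False by (simp add: D_def)
      qed
    qed
    moreover have "integrable \<pi> (indicator ?bad :: _ \<Rightarrow> real)"
      using badm by (intro integrable_real_indicator) (auto simp: \<pi>.emeasure_eq_measure)
    ultimately have "(\<integral>z. e * indicator ?bad z \<partial>\<pi>) \<le> (\<integral>z. D z \<partial>\<pi>)"
      by (intro integral_mono_AE Dint) auto
    moreover have "(\<integral>z. e * indicator ?bad z \<partial>\<pi>) = e * measure \<pi> ?bad" using badm by simp
    moreover have "measure \<pi> ?bad = measure (\<mu> t) (space (\<mu> t) - B)"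
      using measure_distr[OF c(2) BcS] unfolding c(4) by simp
    ultimately show ?thesis using IDle e(1) by (simp add: field_simps)
  qed
  have "measure (\<mu> t) (space (\<mu> t) - B) \<le> 0"
  proof (rule field_le_epsilon)
    fix r :: real assume "0 < r"
    have tp: "0 < t powr (1 - p)" using t by simp
    define \<epsilon> where "\<epsilon> = min ((t * L) powr p / 2) (r * e / t powr (1 - p))"
    have pos: "0 < (t * L) powr p" using t L0 by simp
    have "\<epsilon> \<le> (t * L) powr p / 2" unfolding \<epsilon>_def by (rule min.cobounded1)
    then have \<epsilon>: "\<epsilon> < (t * L) powr p" using pos by linarith
    have \<epsilon>0: "0 < \<epsilon>" unfolding \<epsilon>_def using \<open>0 < r\<close> e(1) tp pos by (intro min_less_iff_conj[THEN iffD2] conjI) auto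
    have "t powr (1 - p) * \<epsilon> / e \<le> t powr (1 - p) * (r * e / t powr (1 - p)) / e"
      using e(1) tp by (intro divide_right_mono mult_left_mono) (auto simp: \<epsilon>_def)
    also have "\<dots> = r" using e(1) tp by simp
    finally show "measure (\<mu> t) (space (\<mu> t) - B) \<le> 0 + r" using small[OF \<epsilon>0 \<epsilon>] by simp
  qed
  then have "measure (\<mu> t) (space (\<mu> t) - B) = 0" using measure_nonneg[of "\<mu> t" "space (\<mu> t) - B"] by simp
  then show ?thesis by (simp add: Pt.emeasure_eq_measure)
qed

text \<open>The curvature inequality is applied to the normalized measure on \<open>A\<close>, whose
  entropy power is \<open>measure m A powr (1 / N)\<close>. At time \<open>t\<close> the measure
  lives on \<open>B\<close>, so its entropy power is at most
  \<open>measure m B powr (1 / N)\<close>.\<close>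

theorem TMCPe_contraction:
  assumes X: "is_lpls X" and TM: "TMCPe K N X m" and N: "0 < N" and m: "sets m = sets (borel_of (ltop X))"
    and x1: "x1 \<in> lpts X" and \<Lambda>: "0 \<le> \<Lambda>"
    and bnd: "\<And>p q. p \<in> lpts X \<Longrightarrow> q \<in> lpts X \<Longrightarrow> ltau X p q \<le> ennreal \<Lambda>"
    and past: "{z \<in> lpts X. lcaus X z x1} \<in> sets (borel_of (ltop X))"
    and A: "compactin (ltop X) A" "A \<in> sets m" "emeasure m A < \<top>" "\<And>x. x \<in> A \<Longrightarrow> lchron X x x1"
    and t: "0 < t" "t < 1" and \<delta>: "0 < \<delta>" and B: "B \<in> sets m" "emeasure m B < \<top>"
    and AB: "\<And>x z. x \<in> A \<Longrightarrow> z \<in> lpts X \<Longrightarrow> lcaus X x z \<Longrightarrow> lcaus X z x1 \<Longrightarrow>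
       t * enn2real (ltau X x x1) - \<delta> < enn2real (ltau X x z) \<Longrightarrow> z \<in> B"
  shows "((1 - t) / cosh (sqrt \<bar>K / N\<bar> * \<Lambda>)) powr N * measure m A \<le> measure m B"
proof (cases "emeasure m A = 0")
  case True
  then show ?thesis by (simp add: measure_def)
next
  case False
  let ?S = "borel_of (ltop X)"
  let ?\<mu>0 = "uniform_measure m A"
  have A0: "0 < emeasure m A" using False by (simp add: zero_less_iff_neq_zero)
  have ent: "entropy_power N m ?\<mu>0 = ennreal (measure m A powr (1 / N))" "\<bar>Ent m ?\<mu>0\<bar> < \<infinity>"
    using entropy_power_uniform[OF A(2) A0 A(3) N] by auto
  have ps: "prob_space ?\<mu>0" using False A(3) by (intro prob_space_uniform_measure) auto
  have AEA: "AE x in ?\<mu>0. x \<in> A" using A(2,3) False by (intro AE_uniform_measureI) auto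
  have spm: "space m = lpts X" using sets_eq_imp_space_eq[OF m] by simp
  have "borel_prob X ?\<mu>0" unfolding borel_prob_def using ps m by simp
  moreover have "compactly_supported X ?\<mu>0"
    unfolding compactly_supported_def
  proof (intro exI[of _ A] conjI)
    have "emeasure ?\<mu>0 (space m - A) = 0"
      using A(2) by (subst emeasure_uniform_measure) auto
    then show "emeasure ?\<mu>0 (space ?\<mu>0 - A) = 0" by simp
  qed (use A in auto)
  moreover have "AE x in ?\<mu>0. lchron X x x1" using AEA by eventually_elim (rule A(4))
  ultimately obtain p \<mu> where \<mu>: "0 < p" "p < 1" "lp_geodesic X p \<mu>" "\<mu> 0 = ?\<mu>0" "\<mu> 1 = return ?S x1"
    "\<forall>t\<in>{0..<1}. sigma_coeff (K / N) (1 - t) (tau_L2 X ?\<mu>0 x1) * entropy_power N m ?\<mu>0 \<le> entropy_power N m (\<mu> t)"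
    using TM x1 ent(2) unfolding TMCPe_def by blast
  have conc: "emeasure (\<mu> t) (space (\<mu> t) - B) = 0"
  proof (rule lp_geodesic_to_dirac_concentrated[OF X x1 bnd past \<mu>(1,2,3,5) _ _ t \<delta> _ AB])
    show "AE x in \<mu> 0. x \<in> A" unfolding \<mu>(4) by (rule AEA)
  qed (use A(2) B(1) m in auto)
  have bpt: "sets (\<mu> t) = sets m" "prob_space (\<mu> t)"
    using \<mu>(3) t m unfolding lp_geodesic_def borel_prob_def by auto
  have up: "entropy_power N m (\<mu> t) \<le> ennreal (measure m B powr (1 / N))"
    by (rule entropy_power_concentrated[OF bpt B conc N])
  have L2: "tau_L2 X ?\<mu>0 x1 \<le> \<Lambda>"
  proof -
    interpret prob_space ?\<mu>0 by (rule ps)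
    have "(\<integral>\<^sup>+ y. (ltau X y x1)\<^sup>2 \<partial>?\<mu>0) \<le> (\<integral>\<^sup>+ y. (ennreal \<Lambda>)\<^sup>2 \<partial>?\<mu>0)"
      using bnd x1 spm by (intro nn_integral_mono power_mono) auto
    also have "\<dots> = ennreal (\<Lambda>\<^sup>2)" using emeasure_space_1 \<Lambda> by (simp add: ennreal_power)
    finally have "enn2real (\<integral>\<^sup>+ y. (ltau X y x1)\<^sup>2 \<partial>?\<mu>0) \<le> \<Lambda>\<^sup>2" by (intro enn2real_leI) auto
    then show ?thesis unfolding tau_L2_def using \<Lambda> by (intro real_le_lsqrt) auto
  qed
  define q where "q = (1 - t) / cosh (sqrt \<bar>K / N\<bar> * \<Lambda>)"
  have q0: "0 < q" using t cosh_real_pos by (simp add: q_def)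
  have "ennreal q \<le> sigma_coeff (K / N) (1 - t) (tau_L2 X ?\<mu>0 x1)"
    unfolding q_def using t L2 by (intro sigma_coeff_ge) (auto simp: tau_L2_def)
  then have "ennreal q * ennreal (measure m A powr (1 / N)) \<le> sigma_coeff (K / N) (1 - t) (tau_L2 X ?\<mu>0 x1) * entropy_power N m ?\<mu>0"
    unfolding ent(1) by (rule mult_right_mono) simp
  also have "\<dots> \<le> entropy_power N m (\<mu> t)" using \<mu>(6) t by auto
  also note up
  finally have "ennreal (q * measure m A powr (1 / N)) \<le> ennreal (measure m B powr (1 / N))"
    using q0 by (simp add: ennreal_mult)
  then have le: "q * measure m A powr (1 / N) \<le> measure m B powr (1 / N)"
    by (subst (asm) ennreal_le_iff) auto
  then have "(q * measure m A powr (1 / N)) powr N \<le> (measure m B powr (1 / N)) powr N"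
    using q0 N by (intro powr_mono2) auto
  then show ?thesis unfolding q_def[symmetric] using q0 N by (simp add: powr_mult powr_powr)
qed

section \<open>Doubling in diamonds of cones\<close>

lemma nonexpansive_continuous_map:
  fixes h :: "'a \<Rightarrow> real"
  assumes "\<And>x y. x \<in> mspace m \<Longrightarrow> y \<in> mspace m \<Longrightarrow> \<bar>h x - h y\<bar> \<le> mdist m x y"
  shows "continuous_map (mtopology_of m) euclideanreal h"
proof -
  have "continuous_map (mtopology_of m) (mtopology_of euclidean_metric) h"
    by (rule Lipschitz_continuous_imp_continuous_map)
       (auto simp: Lipschitz_continuous_map_def dist_real_def intro!: exI[of _ 1] assms)
  then show ?thesis by simp
qed

lemma radon_measure_compact_finite:
  assumes "radon_measure T m" "compactin T C"
  shows "emeasure m C < \<top>"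
proof -
  have sm: "sets m = sets (borel_of T)" using assms(1) by (simp add: radon_measure_def)
  let ?\<U> = "{U. openin T U \<and> emeasure m U < \<top>}"
  have "C \<subseteq> \<Union>?\<U>"
    using assms compactin_subset_topspace[OF assms(2)] unfolding radon_measure_def by blast
  moreover have "\<forall>U\<in>?\<U>. openin T U" by auto
  ultimately obtain \<F> where F: "finite \<F>" "\<F> \<subseteq> ?\<U>" "C \<subseteq> \<Union>\<F>"
    using assms(2) unfolding compactin_def by meson
  have Fs: "\<F> \<subseteq> sets m" using F(2) by (auto simp: sm openin_sets_borel_of)
  have "emeasure m C \<le> emeasure m (\<Union>\<F>)" using F Fs by (intro emeasure_mono) auto
  also have "\<dots> \<le> (\<Sum>U\<in>\<F>. emeasure m U)"
    using emeasure_subadditive_finite[of \<F> "\<lambda>U. U" m] F Fs by simp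
  also have "\<dots> < \<top>" using F by (subst ennreal_sum_less_top) auto
  finally show ?thesis .
qed

lemma lreverse_simps [simp]:
  "lmet (lreverse X) = lmet X" "lchron (lreverse X) p q = lchron X q p"
  "lcaus (lreverse X) p q = lcaus X q p" "ltau (lreverse X) p q = ltau X q p"
  by (simp_all add: lreverse_def)

lemma lrestrict_simps [simp]:
  "lmet (lrestrict X A) = submetric (lmet X) A" "lchron (lrestrict X A) = lchron X"
  "lcaus (lrestrict X A) = lcaus X" "ltau (lrestrict X A) = ltau X"
  by (simp_all add: lrestrict_def)

lemma is_lpls_lreverse:
  assumes X: "is_lpls X"
  shows "is_lpls (lreverse X)"
proof -
  have op: "openin (prod_topology (ltop X) (ltop X)) {(p, q) \<in> lpts X \<times> lpts X. c < ltau X q p}" for c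
  proof -
    have "continuous_map (prod_topology (ltop X) (ltop X)) (prod_topology (ltop X) (ltop X)) (\<lambda>z. (snd z, fst z))"
      by (auto simp: continuous_map_pairwise comp_def intro: continuous_map_fst continuous_map_snd)
    moreover have "openin (prod_topology (ltop X) (ltop X)) {(p, q) \<in> lpts X \<times> lpts X. c < ltau X p q}"
      using X unfolding is_lpls_def by (elim conjE) (erule allE)
    ultimately have "openin (prod_topology (ltop X) (ltop X))
        {z \<in> topspace (prod_topology (ltop X) (ltop X)). (snd z, fst z) \<in> {(p, q) \<in> lpts X \<times> lpts X. c < ltau X p q}}"
      by (rule openin_continuous_map_preimage)
    moreover have "{z \<in> topspace (prod_topology (ltop X) (ltop X)). (snd z, fst z) \<in> {(p, q) \<in> lpts X \<times> lpts X. c < ltau X p q}}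
        = {(p, q) \<in> lpts X \<times> lpts X. c < ltau X q p}" by auto
    ultimately show ?thesis by simp
  qed
  note D = is_lplsD[OF X]
  show ?thesis
    unfolding is_lpls_def lreverse_simps
  proof (intro conjI ballI allI impI op)
    fix p q r assume "p \<in> lpts X" "q \<in> lpts X" "r \<in> lpts X" "lchron X q p" "lchron X r q"
    then show "lchron X r p" using D(4)[of r q p] by blast
  next
    fix p q r assume "p \<in> lpts X" "q \<in> lpts X" "r \<in> lpts X" "lcaus X q p" "lcaus X r q"
    then show "lcaus X r p" using D(5)[of r q p] by blast
  next
    fix p q assume "p \<in> lpts X" "q \<in> lpts X" "lchron X q p"
    then show "lcaus X q p" using D(1)[of q p] by blast
  next
    fix p assume "p \<in> lpts X" then show "lcaus X p p" using D(2)[of p p] by blast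
  next
    fix p q r assume "p \<in> lpts X" "q \<in> lpts X" "r \<in> lpts X" "lcaus X q p" "lcaus X r q"
    then show "ltau X q p + ltau X r q \<le> ltau X r p" using D(6)[of r q p] by (simp add: add.commute)
  next
    fix p q assume "p \<in> lpts X" "q \<in> lpts X"
    then show "0 < ltau X q p \<longleftrightarrow> lchron X q p" using D(3)[of q p] by blast
  qed
qed

text \<open>A geodesic from a point of a cylinder of radius \<open>\<rho>\<close> towards a point lying \<open>H * \<rho>\<close> above its centre has, for
  \<open>1 - t = min 1 m / (6 * (H + 1))\<close>, at ratio \<open>t\<close> already entered the cylinder of radius \<open>\<rho> / 2\<close> around the
  target; the constant is the resulting Brunn--Minkowski factor.\<close>

definition contraction_const :: "real \<Rightarrow> real \<Rightarrow> real \<Rightarrow> real \<Rightarrow> real \<Rightarrow> real" where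
  "contraction_const m K N \<Lambda> H = ((min 1 m / (6 * (H + 1))) / cosh (sqrt \<bar>K / N\<bar> * \<Lambda>)) powr N"

text \<open>For \<open>H\<close> at least this value, \<open>2 * M < H - 1\<close> makes the target
  chronologically later than the whole cylinder, and
  \<open>24 * M\<^sup>2 / min 1 m \<le> H - 1\<close> keeps the loss of time separation due to fibre
  displacement below or equal to \<open>min 1 m * \<rho> / 6\<close>.\<close>

definition contraction_height :: "real \<Rightarrow> real \<Rightarrow> real" where
  "contraction_height m M = 2 + 2 * M + 24 * M\<^sup>2 / min 1 m"

lemma sqrt_diff_ge:
  fixes h e :: real
  assumes "0 < h" "0 \<le> e" "e \<le> h\<^sup>2"
  shows "h - e / h \<le> sqrt (h\<^sup>2 - e)"
proof (rule real_le_rsqrt)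
  have "(h - e / h)\<^sup>2 = h\<^sup>2 - 2 * e + (e / h)\<^sup>2" using assms by (simp add: power2_diff)
  also have "(e / h)\<^sup>2 = e * (e / h\<^sup>2)" by (simp add: power2_eq_square)
  also have "\<dots> \<le> e * 1" using assms by (intro mult_left_mono) auto
  finally show "(h - e / h)\<^sup>2 \<le> h\<^sup>2 - e" by simp
qed

lemma contraction_height_bounds:
  fixes m M :: real
  assumes m0: "0 < m" and M0: "0 < M" and H: "contraction_height m M \<le> H"
  shows "24 * M\<^sup>2 / min 1 m \<le> H - 1" "2 * M < H - 1" "1 < H - 1"
proof -
  have "0 \<le> 24 * M\<^sup>2 / min 1 m" using m0 by simp
  then show "24 * M\<^sup>2 / min 1 m \<le> H - 1" "2 * M < H - 1" "1 < H - 1"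
    using H M0 unfolding contraction_height_def by linarith+
qed

text \<open>With \<open>\<mu> = min 1 m\<close>, three errors of size at most
  \<open>\<mu> * \<rho> / 6\<close> add up: the height \<open>(1 - t) * h\<close> still to go, the
  defect of the time separation from \<open>h\<close>, and the tolerance in \<open>g\<close>. So
  \<open>l \<le> \<mu> * \<rho> / 2\<close>; the bound \<open>\<mu> \<le> m\<close> absorbs the
  division by \<open>m\<close> in the fibre direction.\<close>

lemma contraction_geometry:
  fixes m M :: real
  assumes m0: "0 < m" and M0: "0 < M" and \<rho>: "0 < \<rho>" and H: "contraction_height m M \<le> H"
    and hx: "(H - 1) * \<rho> \<le> h" "h \<le> (H + 1) * \<rho>" and t: "t = 1 - min 1 m / (6 * (H + 1))"
    and tau: "ennreal (sqrt (h\<^sup>2 - (M * (2 * \<rho>))\<^sup>2)) \<le> \<tau>x" "\<tau>x < \<top>"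
    and g: "t * enn2real \<tau>x - min 1 m * \<rho> / 6 < a" "a = h - l"
    and l: "d \<le> l / m"
  shows "l \<le> \<rho> / 2" "d \<le> \<rho> / 2"
proof -
  define \<mu> where "\<mu> = min 1 m"
  have \<mu>: "0 < \<mu>" "\<mu> \<le> 1" "\<mu> \<le> m" using m0 by (auto simp: \<mu>_def)
  have H1: "24 * M\<^sup>2 / \<mu> \<le> H - 1" "2 * M < H - 1" "1 < H - 1"
    using contraction_height_bounds[OF m0 M0 H] by (simp_all add: \<mu>_def)
  have "0 < (H - 1) * \<rho>" using H1 \<rho> by (intro mult_pos_pos) auto
  then have h0: "0 < h" using hx by linarith
  let ?e = "(M * (2 * \<rho>))\<^sup>2"
  have "2 * M * \<rho> \<le> (H - 1) * \<rho>" using H1 \<rho> by (intro mult_right_mono) auto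
  then have "M * (2 * \<rho>) \<le> h" using hx by (simp add: mult.commute mult.left_commute)
  then have eh: "?e \<le> h\<^sup>2" using M0 \<rho> by (intro power_mono) auto
  have "?e / h \<le> ?e / ((H - 1) * \<rho>)" using hx \<open>0 < (H - 1) * \<rho>\<close> by (intro divide_left_mono) auto
  also have "\<dots> = 4 * M\<^sup>2 / (H - 1) * \<rho>" using \<rho> H1 by (simp add: power2_eq_square field_simps)
  also have "\<dots> \<le> \<mu> / 6 * \<rho>"
  proof (rule mult_right_mono)
    have "24 * M\<^sup>2 \<le> (H - 1) * \<mu>" using H1(1) \<mu> by (simp add: divide_le_eq)
    then show "4 * M\<^sup>2 / (H - 1) \<le> \<mu> / 6" using H1 by (simp add: divide_le_eq) (simp add: field_simps)
  qed (use \<rho> in auto)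
  finally have e: "?e / h \<le> \<mu> * \<rho> / 6" by simp
  have T: "h - \<mu> * \<rho> / 6 \<le> enn2real \<tau>x"
  proof -
    have "h - \<mu> * \<rho> / 6 \<le> h - ?e / h" using e by simp
    also have "\<dots> \<le> sqrt (h\<^sup>2 - ?e)" by (rule sqrt_diff_ge[OF h0 _ eh]) simp
    also have "\<dots> \<le> enn2real \<tau>x"
    proof -
      have "enn2real (ennreal (sqrt (h\<^sup>2 - ?e))) \<le> enn2real \<tau>x" using tau by (intro enn2real_mono) auto
      then show ?thesis using eh by simp
    qed
    finally show ?thesis .
  qed
  have H6: "0 < 6 * (H + 1)" using H1(3) by simp
  have t1: "1 - t = \<mu> / (6 * (H + 1))" using t by (simp add: \<mu>_def)
  have t0: "0 \<le> t" "t \<le> 1"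
  proof -
    have "\<mu> \<le> 6 * (H + 1)" using \<mu>(2) H1(3) by simp
    then have "\<mu> / (6 * (H + 1)) \<le> 1" "0 \<le> \<mu> / (6 * (H + 1))" using \<mu> H6 by (auto simp: divide_le_eq_1)
    then show "0 \<le> t" "t \<le> 1" using t1 by linarith+
  qed
  have "t * (h - \<mu> * \<rho> / 6) \<le> t * enn2real \<tau>x" using T t0 by (intro mult_left_mono) auto
  then have "t * (h - \<mu> * \<rho> / 6) - \<mu> * \<rho> / 6 < h - l" using g by (simp add: \<mu>_def)
  moreover have "t * (\<mu> * \<rho> / 6) \<le> 1 * (\<mu> * \<rho> / 6)" using t0 \<mu> \<rho> by (intro mult_right_mono) auto
  ultimately have "l < (1 - t) * h + \<mu> * \<rho> / 3" by (simp add: algebra_simps)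
  also have "(1 - t) * h \<le> (1 - t) * ((H + 1) * \<rho>)" using t0 hx by (intro mult_left_mono) auto
  also have "\<dots> = \<mu> * \<rho> / 6" unfolding t1 using H6 by (simp add: field_simps)
  finally have ll: "l \<le> \<mu> * \<rho> / 2" by simp
  also have "\<dots> \<le> 1 * \<rho> / 2" using \<mu> \<rho> by (intro divide_right_mono mult_right_mono) auto
  finally show "l \<le> \<rho> / 2" by simp
  have "l / m \<le> (\<mu> * \<rho> / 2) / m" using ll m0 by (intro divide_right_mono) auto
  also have "\<dots> \<le> (m * \<rho> / 2) / m" using \<mu> \<rho> m0 by (intro divide_right_mono mult_right_mono) auto
  also have "\<dots> = \<rho> / 2" using m0 by simp
  finally show "d \<le> \<rho> / 2" using l by linarith
qed

lemma chron_imp_fst_less: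
  assumes "lchron (generalized_cone J Y f) x x'"
  shows "fst x < fst x'"
proof -
  obtain \<gamma> where "strict_mono_on {0..1::real} (fst \<circ> \<gamma>)" "\<gamma> 0 = x" "\<gamma> 1 = x'"
    using assms unfolding generalized_cone_def by (auto simp: cone_timelike_def cone_curve_def)
  then show ?thesis using strict_mono_onD[of "{0..1}" "fst \<circ> \<gamma>" 0 1] by auto
qed

locale cone_diamond = cone_slab J Y f s0 t0 m M
  for J :: "real set" and Y :: "'y metric" and f s0 t0 m M +
  fixes y :: 'y and X :: "(real \<times> 'y) lpls"
  assumes WL: "is_lpls W" and gh: "globally_hyperbolic W" and yY: "y \<in> mspace Y"
    and XW: "X = lrestrict W (chron_diamond W (s0, y) (t0, y))" and XL: "is_lpls X"
begin

text \<open>Time is not cut off at the boundary of \<open>J\<close> or of \<open>X\<close>. An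
  inclusion of \<open>cyl x \<rho>\<close> in \<open>lpts X\<close> therefore says that
  \<open>X\<close> leaves room \<rho> around \<open>x\<close>, which is how clearance is expressed
  below.\<close>

definition "cyl x \<rho> = {z. \<bar>fst z - fst x\<bar> \<le> \<rho> \<and> snd z \<in> mspace Y \<and> mdist Y (snd z) (snd x) \<le> \<rho>}"

lemma base_slab: "(s0, y) \<in> slab" "(t0, y) \<in> slab"
  using yY s0t0 by (auto simp: slab_def)

lemma chron_diamond_slab:
  assumes "p \<in> slab" "q \<in> slab"
  shows "chron_diamond W p q = {x \<in> slab. 0 < slack p x \<and> 0 < slack x q}"
proof (intro set_eqI iffI)
  fix x assume "x \<in> chron_diamond W p q"
  then have x: "x \<in> lpts W" "lchron W p x" "lchron W x q" by (auto simp: chron_diamond_def chron_future_def chron_past_def)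
  have "fst p < fst x" "fst x < fst q" using x chron_imp_fst_less unfolding W_def by blast+
  then have "x \<in> slab" using x(1) assms unfolding lpts_W slab_def by auto
  then show "x \<in> {x \<in> slab. 0 < slack p x \<and> 0 < slack x q}"
    using x chron_iff_slack[OF WL] assms by auto
next
  fix x assume "x \<in> {x \<in> slab. 0 < slack p x \<and> 0 < slack x q}"
  then show "x \<in> chron_diamond W p q"
    using slab_lpts assms chron_iff_slack[OF WL] by (auto simp: chron_diamond_def chron_future_def chron_past_def)
qed

lemma lpts_X: "lpts X = {x \<in> slab. 0 < slack (s0, y) x \<and> 0 < slack x (t0, y)}"
  using chron_diamond_slab[OF base_slab] slab_lpts by (auto simp: XW)

lemma X_slab: "lpts X \<subseteq> slab"
  unfolding lpts_X by auto

lemma X_simps: "lchron X = lchron W" "lcaus X = lcaus W" "ltau X = ltau W"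
  by (simp_all add: XW)

lemma ltop_X: "ltop X = subtopology (ltop W) (lpts X)"
proof -
  have "ltop X = subtopology (ltop W) (chron_diamond W (s0, y) (t0, y))"
    by (simp add: XW mtopology_of_submetric)
  also have "chron_diamond W (s0, y) (t0, y) = lpts X"
    using chron_diamond_slab[OF base_slab] lpts_X by simp
  finally show ?thesis .
qed

lemma caus_diamond_closedin:
  assumes "p \<in> lpts W" "q \<in> lpts W"
  shows "compactin (ltop W) (caus_diamond W p q)" "closedin (ltop W) (caus_diamond W p q)"
proof -
  show c: "compactin (ltop W) (caus_diamond W p q)" using gh assms by (auto simp: globally_hyperbolic_def)
  have "Hausdorff_space (ltop W)"
    unfolding mtopology_of_def by (rule Metric_space.Hausdorff_space_mtopology) simp
  then show "closedin (ltop W) (caus_diamond W p q)" using c by (rule compactin_imp_closedin)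
qed

text \<open>All of \<open>X\<close> lies in the future of the lower tip, a point of \<open>W\<close>
  outside \<open>X\<close>. So inside \<open>X\<close> the past of \<open>x1\<close> is the trace of
  a causal diamond of \<open>W\<close>, which global hyperbolicity makes compact and hence
  closed.\<close>

lemma past_measurable: "x1 \<in> lpts X \<Longrightarrow> {z \<in> lpts X. lcaus X z x1} \<in> sets (borel_of (ltop X))"
proof -
  assume x1: "x1 \<in> lpts X"
  have "{z \<in> lpts X. lcaus X z x1} = caus_diamond W (s0, y) x1 \<inter> lpts X"
  proof (intro set_eqI iffI)
    fix z assume z: "z \<in> {z \<in> lpts X. lcaus X z x1}"
    then have "lcaus W (s0, y) z" using slack_pos_imp(2)[OF base_slab(1), of z] by (auto simp: lpts_X)
    then show "z \<in> caus_diamond W (s0, y) x1 \<inter> lpts X"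
      using z x1 X_slab slab_lpts base_slab by (auto simp: caus_diamond_def caus_future_def caus_past_def X_simps)
  qed (auto simp: caus_diamond_def caus_future_def caus_past_def X_simps)
  moreover have "closedin (ltop X) (caus_diamond W (s0, y) x1 \<inter> lpts X)"
    unfolding ltop_X using caus_diamond_closedin(2)[of "(s0, y)" x1] x1 X_slab slab_lpts base_slab
    unfolding closedin_subtopology by blast
  ultimately show ?thesis by (simp add: closedin_sets_borel_of)
qed

lemma future_measurable: "x1 \<in> lpts X \<Longrightarrow> {z \<in> lpts X. lcaus X x1 z} \<in> sets (borel_of (ltop X))"
proof -
  assume x1: "x1 \<in> lpts X"
  have "{z \<in> lpts X. lcaus X x1 z} = caus_diamond W x1 (t0, y) \<inter> lpts X"
  proof (intro set_eqI iffI)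
    fix z assume z: "z \<in> {z \<in> lpts X. lcaus X x1 z}"
    then have "lcaus W z (t0, y)" using slack_pos_imp(2)[OF _ base_slab(2), of z] by (auto simp: lpts_X)
    then show "z \<in> caus_diamond W x1 (t0, y) \<inter> lpts X"
      using z x1 X_slab slab_lpts base_slab by (auto simp: caus_diamond_def caus_future_def caus_past_def X_simps)
  qed (auto simp: caus_diamond_def caus_future_def caus_past_def X_simps)
  moreover have "closedin (ltop X) (caus_diamond W x1 (t0, y) \<inter> lpts X)"
    unfolding ltop_X using caus_diamond_closedin(2)[of x1 "(t0, y)"] x1 X_slab slab_lpts base_slab
    unfolding closedin_subtopology by blast
  ultimately show ?thesis by (simp add: closedin_sets_borel_of)
qed

lemma fst_nonexpansive: "\<bar>fst x - fst z\<bar> \<le> mdist (cone_metric J Y) x z"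
  by (cases x; cases z) simp

lemma snd_nonexpansive: "mdist Y (snd x) (snd z) \<le> mdist (cone_metric J Y) x z"
  by (cases x; cases z) simp

lemma closedin_cyl:
  assumes "snd x \<in> mspace Y"
  shows "closedin (ltop W) (cyl x \<rho> \<inter> lpts W)"
proof -
  have 1: "continuous_map (ltop W) euclideanreal (\<lambda>z. \<bar>fst z - fst x\<bar>)"
  proof (rule nonexpansive_continuous_map)
    fix z z' show "\<bar>\<bar>fst z - fst x\<bar> - \<bar>fst z' - fst x\<bar>\<bar> \<le> ldist W z z'"
      using fst_nonexpansive[of z z'] unfolding ldist_W by linarith
  qed
  have 2: "continuous_map (ltop W) euclideanreal (\<lambda>z. mdist Y (snd z) (snd x))"
  proof (rule nonexpansive_continuous_map)
    fix z z' assume "z \<in> lpts W" "z' \<in> lpts W"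
    then have "snd z \<in> mspace Y" "snd z' \<in> mspace Y" unfolding lpts_W by auto
    then show "\<bar>mdist Y (snd z) (snd x) - mdist Y (snd z') (snd x)\<bar> \<le> ldist W z z'"
      using snd_nonexpansive[of z z'] assms mdist_triangle[of "snd z" Y "snd z'" "snd x"] mdist_triangle[of "snd z'" Y "snd z" "snd x"]
      unfolding ldist_W by (simp add: mdist_commute)
  qed
  have "cyl x \<rho> \<inter> lpts W = {z \<in> topspace (ltop W). \<bar>fst z - fst x\<bar> \<in> {..\<rho>}} \<inter> {z \<in> topspace (ltop W). mdist Y (snd z) (snd x) \<in> {..\<rho>}}"
    by (auto simp: cyl_def lpts_W)
  then show ?thesis
    using closedin_continuous_map_preimage[OF 1, of "{..\<rho>}"] closedin_continuous_map_preimage[OF 2, of "{..\<rho>}"]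
    by (simp add: closedin_Int)
qed

lemma cyl_mono: "snd x \<in> mspace Y \<Longrightarrow> snd x' \<in> mspace Y \<Longrightarrow> \<bar>fst x' - fst x\<bar> + \<rho>' \<le> \<rho> \<Longrightarrow> mdist Y (snd x') (snd x) + \<rho>' \<le> \<rho> \<Longrightarrow>
   cyl x' \<rho>' \<subseteq> cyl x \<rho>"
proof
  fix z assume x: "snd x \<in> mspace Y" "snd x' \<in> mspace Y" "\<bar>fst x' - fst x\<bar> + \<rho>' \<le> \<rho>" "mdist Y (snd x') (snd x) + \<rho>' \<le> \<rho>"
    and z: "z \<in> cyl x' \<rho>'"
  then have "mdist Y (snd z) (snd x) \<le> mdist Y (snd z) (snd x') + mdist Y (snd x') (snd x)"
    by (intro mdist_triangle) (auto simp: cyl_def)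
  then show "z \<in> cyl x \<rho>" using x z by (auto simp: cyl_def)
qed

text \<open>The cylinder fits between the points at heights \<open>(2 * M + 2) * \<rho>\<close>
  below and above its centre: time differences are at least \<open>(2 * M + 1) * \<rho>\<close> and
  so exceed \<open>M * (2 * \<rho>)\<close>, as \<open>tau_ge\<close> asks. Closed subsets of the
  resulting causal diamond are compact.\<close>

lemma cyl_compact:
  assumes w: "w \<in> mspace Y" and \<rho>: "0 < \<rho>" and sub: "cyl (r, w) ((2 * M + 2) * \<rho>) \<subseteq> lpts X"
  shows "cyl (r, w) \<rho> \<subseteq> lpts X" "compactin (ltop X) (cyl (r, w) \<rho>)" "closedin (ltop X) (cyl (r, w) \<rho>)"
proof -
  have M\<rho>: "0 < M * \<rho>" using M0 \<rho> by simp
  have ww: "mdist Y w w = 0" using w by simp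
  have C0: "0 \<le> (2 * M + 2) * \<rho>" using M0 \<rho> by simp
  have "cyl (r, w) \<rho> \<subseteq> cyl (r, w) ((2 * M + 2) * \<rho>)"
    using M\<rho> \<rho> w by (intro cyl_mono) (auto simp: algebra_simps ww)
  then show bX: "cyl (r, w) \<rho> \<subseteq> lpts X" using sub by blast
  have p: "(r - (2 * M + 2) * \<rho>, w) \<in> lpts X" "(r + (2 * M + 2) * \<rho>, w) \<in> lpts X"
    using C0 w by (auto intro!: subsetD[OF sub] simp: cyl_def ww)
  then have ps: "(r - (2 * M + 2) * \<rho>, w) \<in> slab" "(r + (2 * M + 2) * \<rho>, w) \<in> slab" using X_slab by auto
  have "cyl (r, w) \<rho> \<subseteq> caus_diamond W (r - (2 * M + 2) * \<rho>, w) (r + (2 * M + 2) * \<rho>, w)"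
  proof
    fix z assume z: "z \<in> cyl (r, w) \<rho>"
    obtain r' w' where zz: "z = (r', w')" by (cases z)
    have zs: "(r', w') \<in> slab" using z bX X_slab zz by auto
    have d: "mdist Y w w' < 2 * \<rho>" "mdist Y w' w < 2 * \<rho>" "\<bar>r' - r\<bar> \<le> \<rho>"
      using z \<rho> by (auto simp: cyl_def zz mdist_commute)
    have "M * (2 * \<rho>) < r' - (r - (2 * M + 2) * \<rho>)" "M * (2 * \<rho>) < r + (2 * M + 2) * \<rho> - r'"
      using d(3) \<rho> by (auto simp: algebra_simps abs_le_iff)
    then have "lchron W (r - (2 * M + 2) * \<rho>, w) (r', w')" "lchron W (r', w') (r + (2 * M + 2) * \<rho>, w)"
      using tau_ge(2)[OF ps(1) zs d(1)] tau_ge(2)[OF zs ps(2) d(2)] by auto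
    then have "lcaus W (r - (2 * M + 2) * \<rho>, w) (r', w')" "lcaus W (r', w') (r + (2 * M + 2) * \<rho>, w)"
      using is_lplsD(1)[OF WL] ps zs slab_lpts by blast+
    then show "z \<in> caus_diamond W (r - (2 * M + 2) * \<rho>, w) (r + (2 * M + 2) * \<rho>, w)"
      using ps zs slab_lpts zz by (auto simp: caus_diamond_def caus_future_def caus_past_def)
  qed
  then have sub2: "cyl (r, w) \<rho> \<inter> lpts W \<subseteq> caus_diamond W (r - (2 * M + 2) * \<rho>, w) (r + (2 * M + 2) * \<rho>, w)" by auto
  have bW: "cyl (r, w) \<rho> \<inter> lpts W = cyl (r, w) \<rho>" using bX X_slab slab_lpts by auto
  have cl: "closedin (ltop W) (cyl (r, w) \<rho> \<inter> lpts W)" by (rule closedin_cyl) (simp add: w)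
  have "compactin (ltop W) (caus_diamond W (r - (2 * M + 2) * \<rho>, w) (r + (2 * M + 2) * \<rho>, w))"
    using ps slab_lpts by (intro caus_diamond_closedin) auto
  then have "compactin (ltop W) (cyl (r, w) \<rho>)"
    using closed_compactin[OF _ sub2 cl] bW by simp
  then show "compactin (ltop X) (cyl (r, w) \<rho>)" unfolding ltop_X using bX by (simp add: compactin_subtopology)
  show "closedin (ltop X) (cyl (r, w) \<rho>)" unfolding ltop_X using cl bX unfolding bW
    by (metis closedin_subset_topspace)
qed

lemma tau_X_le:
  assumes "tau_diam X (lpts X) \<le> ennreal \<Lambda>" "p \<in> lpts X" "q \<in> lpts X"
  shows "ltau X p q \<le> ennreal \<Lambda>"
proof -
  have "ltau X p q \<le> tau_diam X (lpts X)"
    unfolding tau_diam_def using assms by (intro SUP_upper2[of "(p, q)"]) auto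
  then show ?thesis using assms(1) by (rule order_trans)
qed

text \<open>The sign \<sigma> treats \<open>X\<close> and its causal reversal at once. The room in
  \<open>sub\<close> makes both cylinders compact, the second one being centred
  \<open>H * \<rho>\<close> away, and \<open>contraction_geometry\<close> shows that the
  intermediate points lie in it.\<close>

lemma contraction:
  fixes \<mm> :: "(real \<times> 'y) measure"
  assumes \<Lambda>: "0 \<le> \<Lambda>" "tau_diam X (lpts X) \<le> ennreal \<Lambda>" and rad: "radon_measure (ltop X) \<mm>"
    and N: "0 < N" and TM: "TMCPe K N X' \<mm>" and X': "X' = X \<and> \<sigma> = 1 \<or> X' = lreverse X \<and> \<sigma> = - 1"
    and w: "w \<in> mspace Y" and \<rho>: "0 < \<rho>" and H: "contraction_height m M \<le> H"
    and sub: "cyl (r, w) ((H + 2 * M + 3) * \<rho>) \<subseteq> lpts X"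
  shows "contraction_const m K N \<Lambda> H * measure \<mm> (cyl (r, w) \<rho>) \<le> measure \<mm> (cyl (r + \<sigma> * (H * \<rho>), w) (\<rho> / 2))"
proof -
  note Hb = contraction_height_bounds[OF m0 M0 H]
  have \<sigma>: "\<bar>\<sigma>\<bar> = 1" "\<sigma> * \<sigma> = 1" using X' by auto
  have ww: "mdist Y w w = 0" using w by simp
  have pos: "0 < M * \<rho>" "0 < H * \<rho>" using M0 \<rho> Hb by auto
  define r1 where "r1 = r + \<sigma> * (H * \<rho>)"
  have r1: "\<bar>r1 - r\<bar> = H * \<rho>" unfolding r1_def using abs_mult[of \<sigma> "H * \<rho>"] \<sigma>(1) pos(2) by simp
  have "cyl (r, w) ((2 * M + 2) * \<rho>) \<subseteq> lpts X"
    by (rule order_trans[OF cyl_mono sub]) (use w pos \<rho> in \<open>auto simp: algebra_simps ww\<close>)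
  note A = cyl_compact[OF w \<rho> this]
  have "cyl (r1, w) ((2 * M + 2) * (\<rho> / 2)) \<subseteq> lpts X"
    by (rule order_trans[OF cyl_mono sub]) (use w pos \<rho> r1 in \<open>auto simp: algebra_simps ww\<close>)
  note B = cyl_compact[OF w half_gt_zero[OF \<rho>] this]
  have x1: "(r1, w) \<in> lpts X" by (rule subsetD[OF B(1)]) (use w \<rho> in \<open>auto simp: cyl_def ww\<close>)
  have x1s: "(r1, w) \<in> slab" using x1 X_slab by auto
  have sm: "sets \<mm> = sets (borel_of (ltop X))" using rad by (simp add: radon_measure_def)
  have As: "cyl (r, w) \<rho> \<in> sets \<mm>" unfolding sm by (rule closedin_sets_borel_of[OF A(3)])
  have Bs: "cyl (r1, w) (\<rho> / 2) \<in> sets \<mm>" unfolding sm by (rule closedin_sets_borel_of[OF B(3)])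
  have Xr: "is_lpls X'" "lmet X' = lmet X" using X' XL is_lpls_lreverse[OF XL] by auto
  define t where "t = 1 - min 1 m / (6 * (H + 1))"
  have "0 < min 1 m / (6 * (H + 1))" "min 1 m / (6 * (H + 1)) < 1"
  proof -
    have "0 < 6 * (H + 1)" "min 1 m < 6 * (H + 1)" "0 < min 1 m" using Hb(3) m0 by auto
    then show "0 < min 1 m / (6 * (H + 1))" "min 1 m / (6 * (H + 1)) < 1" by (auto simp: divide_less_eq_1)
  qed
  then have t: "0 < t" "t < 1" by (auto simp: t_def)
  have geo: "(H - 1) * \<rho> \<le> \<sigma> * (r1 - fst x)" "\<sigma> * (r1 - fst x) \<le> (H + 1) * \<rho>" "lchron X' x (r1, w)"
      "ennreal (sqrt ((\<sigma> * (r1 - fst x))\<^sup>2 - (M * (2 * \<rho>))\<^sup>2)) \<le> ltau X' x (r1, w)"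
    if x: "x \<in> cyl (r, w) \<rho>" for x
  proof -
    obtain rx wx where xx: "x = (rx, wx)" by (cases x)
    have xs: "(rx, wx) \<in> slab" using x A(1) X_slab xx by auto
    have "\<sigma> * (r1 - rx) = H * \<rho> + \<sigma> * (r - rx)" using \<sigma>(2) unfolding r1_def by algebra
    moreover have "\<bar>\<sigma> * (r - rx)\<bar> \<le> \<rho>" using x \<sigma>(1) by (simp add: cyl_def xx abs_mult abs_minus_commute)
    ultimately show h: "(H - 1) * \<rho> \<le> \<sigma> * (r1 - fst x)" "\<sigma> * (r1 - fst x) \<le> (H + 1) * \<rho>"
      unfolding xx by (auto simp: algebra_simps abs_le_iff)
    have d: "mdist Y wx w < 2 * \<rho>" "mdist Y w wx < 2 * \<rho>" using x \<rho> by (auto simp: cyl_def xx mdist_commute)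
    have "2 * M * \<rho> < (H - 1) * \<rho>" using Hb(2) \<rho> by (intro mult_strict_right_mono) auto
    then have MH: "M * (2 * \<rho>) < \<sigma> * (r1 - rx)" using h(1) by (simp add: xx algebra_simps)
    show "lchron X' x (r1, w)" "ennreal (sqrt ((\<sigma> * (r1 - fst x))\<^sup>2 - (M * (2 * \<rho>))\<^sup>2)) \<le> ltau X' x (r1, w)"
      using X' tau_ge[OF xs x1s d(1)] tau_ge[OF x1s xs d(2)] MH by (auto simp: xx X_simps)
  qed
  have lt: "ltau X' p q \<le> ennreal \<Lambda>" if "p \<in> lpts X" "q \<in> lpts X" for p q
    using X' tau_X_le[OF \<Lambda>(2), of p q] tau_X_le[OF \<Lambda>(2), of q p] that by auto
  have AB: "z \<in> cyl (r1, w) (\<rho> / 2)"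
    if x: "x \<in> cyl (r, w) \<rho>" and z: "z \<in> lpts X'" "lcaus X' x z" "lcaus X' z (r1, w)"
      "t * enn2real (ltau X' x (r1, w)) - min 1 m * \<rho> / 6 < enn2real (ltau X' x z)" for x z
  proof -
    have zX: "z \<in> lpts X" using z Xr(2) by simp
    have sl: "x \<in> slab" "z \<in> slab" using zX x A(1) X_slab by auto
    \<comment> \<open>\<open>l\<close> is the height still missing to the target and
      \<open>a\<close> the height already gained, both in the direction of \<sigma>. Causality
      bounds the fibre distance to the axis by \<open>l / m\<close> and the time separation by
      \<open>a\<close>.\<close>
    define l where "l = \<sigma> * (r1 - fst z)"
    define a where "a = \<sigma> * (fst z - fst x)"
    have al: "a = \<sigma> * (r1 - fst x) - l" by (simp add: a_def l_def algebra_simps)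
    have zs: "snd z \<in> mspace Y" using sl by (auto simp: slab_def)
    have a0: "0 \<le> a" "ltau X' x z \<le> ennreal a" and l0: "0 \<le> l" "mdist Y (snd z) w \<le> l / m"
    proof -
      show "0 \<le> a" "ltau X' x z \<le> ennreal a"
        using X' z(2) caus_bounds(1)[OF sl] caus_bounds(1)[OF sl(2,1)] tau_le_height[OF sl] tau_le_height[OF sl(2,1)]
        by (auto simp: a_def X_simps)
      have zr: "fst z \<in> {s0..t0}" "r1 \<in> {s0..t0}" using sl x1s by (auto simp: slab_def)
      show "0 \<le> l" "mdist Y (snd z) w \<le> l / m"
        using X' z(3) caus_bounds[OF sl(2) x1s] caus_bounds[OF x1s sl(2)] T_bounds(2)[of "fst z" r1] T_bounds(2)[of r1 "fst z"] zr
        by (auto simp: l_def X_simps slack_def mdist_commute)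
    qed
    have "enn2real (ltau X' x z) \<le> a" using a0 by (intro enn2real_leI)
    then have g: "t * enn2real (ltau X' x (r1, w)) - min 1 m * \<rho> / 6 < a" using z(4) by linarith
    have fin: "ltau X' x (r1, w) < \<top>" using lt[OF subsetD[OF A(1) x] x1] by (rule le_less_trans) simp
    note G = contraction_geometry[OF m0 M0 \<rho> H geo(1)[OF x] geo(2)[OF x] t_def geo(4)[OF x] fin g al l0(2)]
    have "\<bar>fst z - r1\<bar> = l" using l0(1) \<sigma>(1) X' by (auto simp: l_def)
    then show ?thesis using G zs by (simp add: cyl_def)
  qed
  have "((1 - t) / cosh (sqrt \<bar>K / N\<bar> * \<Lambda>)) powr N * measure \<mm> (cyl (r, w) \<rho>) \<le> measure \<mm> (cyl (r1, w) (\<rho> / 2))"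
  proof (rule TMCPe_contraction[OF Xr(1) TM N _ _ \<Lambda>(1) _ _ _ As _ _ t _ Bs _ AB])
    show "sets \<mm> = sets (borel_of (ltop X'))" "(r1, w) \<in> lpts X'" using sm x1 Xr(2) by auto
    show "ltau X' p q \<le> ennreal \<Lambda>" if "p \<in> lpts X'" "q \<in> lpts X'" for p q using lt that Xr(2) by simp
    show "{z \<in> lpts X'. lcaus X' z (r1, w)} \<in> sets (borel_of (ltop X'))"
      using X' past_measurable[OF x1] future_measurable[OF x1] by auto
    show "compactin (ltop X') (cyl (r, w) \<rho>)" using A(2) Xr(2) by simp
    show "emeasure \<mm> (cyl (r, w) \<rho>) < \<top>" by (rule radon_measure_compact_finite[OF rad A(2)])
    show "emeasure \<mm> (cyl (r1, w) (\<rho> / 2)) < \<top>" by (rule radon_measure_compact_finite[OF rad B(2)])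
    show "0 < min 1 m * \<rho> / 6" using m0 \<rho> by simp
  qed (use geo(3) in auto)
  then show ?thesis unfolding contraction_const_def t_def r1_def by simp
qed

end

text \<open>A contraction upwards by \<open>H * \<rho>\<close>, followed by one downwards which starts at radius \<open>\<rho> / 2\<close> and hence
  needs \<open>2 * H\<close>, returns to the original centre.\<close>

definition doubling_const :: "real \<Rightarrow> real \<Rightarrow> real \<Rightarrow> real \<Rightarrow> real \<Rightarrow> real" where
  "doubling_const m M K N \<Lambda> = contraction_const m K N \<Lambda> (contraction_height m M) *
     contraction_const m K N \<Lambda> (2 * contraction_height m M)"

text \<open>Let \<open>H = contraction_height m M\<close>. The upward contraction needs
  \<open>H + 2 * M + 3\<close> radii of room; the downward one, centred \<open>H\<close> radii
  higher and starting with half the radius, reaches \<open>H + (2 * H + 2 * M + 3) / 2\<close>. The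
  value covers both.\<close>

definition doubling_clearance :: "real \<Rightarrow> real \<Rightarrow> real" where
  "doubling_clearance m M = 2 * contraction_height m M + 2 * M + 5"

lemma doubling_const_pos:
  assumes "0 < m" "0 < M"
  shows "0 < doubling_const m M K N \<Lambda>"
proof -
  have H: "0 < contraction_height m M" using contraction_height_bounds(3)[OF assms order_refl] by simp
  have *: "0 < contraction_const m K N \<Lambda> h" if "0 < h" for h
  proof -
    have "0 < min 1 m / (6 * (h + 1)) / cosh (sqrt \<bar>K / N\<bar> * \<Lambda>)" using that assms cosh_real_pos by simp
    then show ?thesis unfolding contraction_const_def by (metis powr_gt_zero less_irrefl)
  qed
  show ?thesis unfolding doubling_const_def using *[of "contraction_height m M"] *[of "2 * contraction_height m M"] H by simp
qed

context cone_diamond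
begin

context
  fixes \<mm> :: "(real \<times> 'y) measure" and K N \<Lambda> :: real
  assumes \<Lambda>: "0 \<le> \<Lambda>" "tau_diam X (lpts X) \<le> ennreal \<Lambda>" and rad: "radon_measure (ltop X) \<mm>" and full: "full_support (ltop X) \<mm>"
    and N: "0 < N" and TM: "TMCPe K N X \<mm>" and TMr: "TMCPe K N (lreverse X) \<mm>"
begin

lemma doubling:
  assumes w: "w \<in> mspace Y" and \<rho>: "0 < \<rho>" and sub: "cyl (r, w) (doubling_clearance m M * \<rho>) \<subseteq> lpts X"
  shows "doubling_const m M K N \<Lambda> * measure \<mm> (cyl (r, w) \<rho>) \<le> measure \<mm> (cyl (r, w) (\<rho> / 4))"
proof -
  define H where "H = contraction_height m M"
  have Hb: "contraction_height m M \<le> H" "contraction_height m M \<le> 2 * H" "0 < H"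
    using contraction_height_bounds(3)[OF m0 M0, of H] by (auto simp: H_def)
  have ww: "mdist Y w w = 0" using w by simp
  have pos: "0 < M * \<rho>" "0 < H * \<rho>" using M0 \<rho> Hb by auto
  have s1: "cyl (r, w) ((H + 2 * M + 3) * \<rho>) \<subseteq> lpts X"
    by (rule order_trans[OF cyl_mono sub]) (use w pos \<rho> in \<open>auto simp: algebra_simps ww doubling_clearance_def H_def[symmetric]\<close>)
  have s2: "cyl (r + 1 * (H * \<rho>), w) ((2 * H + 2 * M + 3) * (\<rho> / 2)) \<subseteq> lpts X"
    by (rule order_trans[OF cyl_mono sub]) (use w pos \<rho> in \<open>auto simp: algebra_simps ww doubling_clearance_def H_def[symmetric]\<close>)
  have u: "contraction_const m K N \<Lambda> H * measure \<mm> (cyl (r, w) \<rho>) \<le> measure \<mm> (cyl (r + 1 * (H * \<rho>), w) (\<rho> / 2))"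
    by (rule contraction[OF \<Lambda> rad N TM _ w \<rho> Hb(1) s1]) auto
  have d: "contraction_const m K N \<Lambda> (2 * H) * measure \<mm> (cyl (r + 1 * (H * \<rho>), w) (\<rho> / 2)) \<le>
      measure \<mm> (cyl (r + 1 * (H * \<rho>) + (- 1) * ((2 * H) * (\<rho> / 2)), w) (\<rho> / 2 / 2))"
    by (rule contraction[OF \<Lambda> rad N TMr _ w half_gt_zero[OF \<rho>] Hb(2) s2]) auto
  have "contraction_const m K N \<Lambda> (2 * H) * (contraction_const m K N \<Lambda> H * measure \<mm> (cyl (r, w) \<rho>)) \<le>
      contraction_const m K N \<Lambda> (2 * H) * measure \<mm> (cyl (r + 1 * (H * \<rho>), w) (\<rho> / 2))"
    using u by (intro mult_left_mono) (auto simp: contraction_const_def)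
  with d show ?thesis unfolding doubling_const_def H_def[symmetric] by (simp add: ac_simps)
qed

lemma doubling_iterate:
  assumes w: "w \<in> mspace Y" and \<rho>: "0 < \<rho>" and sub: "cyl (r, w) (doubling_clearance m M * \<rho>) \<subseteq> lpts X"
  shows "doubling_const m M K N \<Lambda> ^ j * measure \<mm> (cyl (r, w) \<rho>) \<le> measure \<mm> (cyl (r, w) (\<rho> / 4 ^ j))"
proof (induction j)
  case (Suc j)
  have C0: "0 \<le> doubling_clearance m M" using M0 contraction_height_bounds(3)[OF m0 M0 order_refl] by (simp add: doubling_clearance_def)
  have \<rho>j: "0 < \<rho> / 4 ^ j" "\<rho> / 4 ^ j \<le> \<rho>" using \<rho> by (auto simp: divide_le_eq)
  have ww: "mdist Y w w = 0" using w by simp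
  have "doubling_clearance m M * (\<rho> / 4 ^ j) \<le> doubling_clearance m M * \<rho>" using \<rho>j C0 by (intro mult_left_mono) auto
  then have "cyl (r, w) (doubling_clearance m M * (\<rho> / 4 ^ j)) \<subseteq> lpts X"
    using w by (intro order_trans[OF cyl_mono sub]) (auto simp: ww)
  note D = doubling[OF w \<rho>j(1) this]
  have "doubling_const m M K N \<Lambda> ^ Suc j * measure \<mm> (cyl (r, w) \<rho>) \<le> doubling_const m M K N \<Lambda> * measure \<mm> (cyl (r, w) (\<rho> / 4 ^ j))"
    using Suc doubling_const_pos[OF m0 M0, of K N \<Lambda>] by (simp add: mult.assoc mult_left_mono)
  also have "\<dots> \<le> measure \<mm> (cyl (r, w) (\<rho> / 4 ^ j / 4))" by (rule D)
  finally show ?case by (simp add: ac_simps)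
qed simp

text \<open>Around each \<open>w\<close> in \<open>F\<close> the cylinder of radius
  \<open>3 * \<rho>\<close> contains the common cylinder \<open>?S\<close> of radius
  \<open>2 * \<rho>\<close>, so \<open>j\<close> doublings show that the cylinder of radius
  \<open>3 * \<rho> / 4 ^ j\<close> has at least the fraction \<open>D ^ j\<close> of the measure of
  \<open>?S\<close>. Separation by twice that radius makes these small cylinders disjoint, and
  \<open>1 \<le> j\<close> keeps them inside \<open>?S\<close>, whose measure is positive by full
  support.\<close>

lemma packing:
  assumes w0: "w0 \<in> mspace Y" and \<rho>: "0 < \<rho>" and sub: "cyl (r, w0) ((3 * doubling_clearance m M + 1) * \<rho>) \<subseteq> lpts X"
    and F: "finite F" "F \<subseteq> {w \<in> mspace Y. mdist Y w w0 \<le> \<rho>}" and j: "1 \<le> j"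
    and sep: "\<And>v w. v \<in> F \<Longrightarrow> w \<in> F \<Longrightarrow> v \<noteq> w \<Longrightarrow> 6 * \<rho> / 4 ^ j < mdist Y v w"
  shows "real (card F) \<le> (1 / doubling_const m M K N \<Lambda>) ^ j"
proof -
  define D where "D = doubling_const m M K N \<Lambda>"
  have D0: "0 < D" unfolding D_def by (rule doubling_const_pos[OF m0 M0])
  have C: "5 \<le> doubling_clearance m M" using M0 contraction_height_bounds(3)[OF m0 M0 order_refl] by (simp add: doubling_clearance_def)
  have Cl: "2 * M + 2 \<le> doubling_clearance m M" using M0 contraction_height_bounds(3)[OF m0 M0 order_refl] by (simp add: doubling_clearance_def)
  have C\<rho>: "5 * \<rho> \<le> doubling_clearance m M * \<rho>" "(2 * M + 2) * \<rho> \<le> doubling_clearance m M * \<rho>" using C Cl \<rho> by (auto intro: mult_right_mono)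
  have ww: "mdist Y w0 w0 = 0" using w0 by simp
  have sm: "sets \<mm> = sets (borel_of (ltop X))" using rad by (simp add: radon_measure_def)
  have FY: "w \<in> mspace Y" "mdist Y w w0 \<le> \<rho>" if "w \<in> F" for w using F that by auto
  let ?S = "cyl (r, w0) (2 * \<rho>)"
  let ?e = "3 * \<rho> / 4 ^ j"
  have e: "0 < ?e" "?e \<le> \<rho>"
  proof -
    have "(4::real) ^ 1 \<le> 4 ^ j" using j by (intro power_increasing) auto
    then have "3 * \<rho> \<le> \<rho> * 4 ^ j" using \<rho> mult_left_mono[of 4 "4 ^ j" \<rho>] by simp
    then show "?e \<le> \<rho>" by (simp add: divide_le_eq)
  qed (use \<rho> in simp)
  have C2: "(2 * M + 2) * (2 * \<rho>) \<le> (3 * doubling_clearance m M + 1) * \<rho>"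
  proof -
    have "(2 * M + 2) * (2 * \<rho>) = 2 * ((2 * M + 2) * \<rho>)" by simp
    also have "\<dots> \<le> 2 * (doubling_clearance m M * \<rho>)" using C\<rho>(2) by simp
    also have "\<dots> = (2 * doubling_clearance m M) * \<rho>" by simp
    also have "\<dots> \<le> (3 * doubling_clearance m M + 1) * \<rho>" using C \<rho> by (intro mult_right_mono) auto
    finally show ?thesis .
  qed
  have "cyl (r, w0) ((2 * M + 2) * (2 * \<rho>)) \<subseteq> lpts X"
    by (rule order_trans[OF cyl_mono sub]) (use w0 C2 in \<open>simp_all add: ww\<close>)
  then have S: "?S \<subseteq> lpts X" "compactin (ltop X) ?S" "closedin (ltop X) ?S"
    using cyl_compact[OF w0, of "2 * \<rho>" r] \<rho> by auto
  have Ss: "?S \<in> sets \<mm>" unfolding sm by (rule closedin_sets_borel_of[OF S(3)])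
  have Sfin: "emeasure \<mm> ?S < \<top>" by (rule radon_measure_compact_finite[OF rad S(2)])
  have Spos: "0 < measure \<mm> ?S"
  proof -
    have rwX: "(r, w0) \<in> lpts X" by (rule subsetD[OF S(1)]) (use \<rho> w0 in \<open>auto simp: cyl_def ww\<close>)
    let ?U = "{z \<in> lpts X. mdist (cone_metric J Y) (r, w0) z < \<rho>}"
    have "openin (ltop W) {z \<in> lpts W. mdist (cone_metric J Y) (r, w0) z < \<rho>}"
    proof -
      have "(r, w0) \<in> lpts W" using rwX X_slab slab_lpts by auto
      then have "{z \<in> lpts W. ldist W (r, w0) z < \<rho>} = Metric_space.mball (lpts W) (ldist W) (r, w0) \<rho>"
        by (auto simp: Metric_space.in_mball[OF Metric_space_mspace_mdist])
      then show ?thesis unfolding ldist_W[symmetric] mtopology_of_def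
        by (simp add: Metric_space.openin_mball[OF Metric_space_mspace_mdist])
    qed
    moreover have "?U = lpts X \<inter> {z \<in> lpts W. mdist (cone_metric J Y) (r, w0) z < \<rho>}" using X_slab slab_lpts by auto
    ultimately have Uo: "openin (ltop X) ?U" unfolding ltop_X by (auto simp: openin_subtopology)
    have "(r, w0) \<in> ?U" using rwX \<rho> by (simp add: ww)
    then have "0 < emeasure \<mm> ?U" using full Uo unfolding full_support_def by blast
    also have "emeasure \<mm> ?U \<le> emeasure \<mm> ?S"
    proof (rule emeasure_mono[OF _ Ss])
      show "?U \<subseteq> ?S"
        using X_slab by (auto simp: cyl_def slab_def mdist_commute subset_iff) (smt (verit) mdist_nonneg)+
    qed
    finally show ?thesis using Sfin by (simp add: measure_def enn2real_positive_iff)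
  qed
  have low: "D ^ j * measure \<mm> ?S \<le> measure \<mm> (cyl (r, w) ?e)" and cs: "cyl (r, w) ?e \<subseteq> ?S" and cm: "cyl (r, w) ?e \<in> sets \<mm>"
    if "w \<in> F" for w
  proof -
    have w: "w \<in> mspace Y" "mdist Y w w0 \<le> \<rho>" using FY that by auto
    have wsub: "cyl (r, w) (doubling_clearance m M * (3 * \<rho>)) \<subseteq> lpts X"
      using w w0 \<rho> by (intro order_trans[OF cyl_mono sub]) (auto simp: algebra_simps)
    show "cyl (r, w) ?e \<subseteq> ?S" using w w0 e by (intro cyl_mono) auto
    have "cyl (r, w) ((2 * M + 2) * (3 * \<rho>)) \<subseteq> cyl (r, w) (doubling_clearance m M * (3 * \<rho>))"
    proof (rule cyl_mono)
      have "mdist Y w w = 0" using w by simp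
      moreover have "(2 * M + 2) * (3 * \<rho>) \<le> doubling_clearance m M * (3 * \<rho>)" using Cl \<rho> by (intro mult_right_mono) auto
      ultimately show "\<bar>fst (r, w) - fst (r, w)\<bar> + (2 * M + 2) * (3 * \<rho>) \<le> doubling_clearance m M * (3 * \<rho>)"
        "mdist Y (snd (r, w)) (snd (r, w)) + (2 * M + 2) * (3 * \<rho>) \<le> doubling_clearance m M * (3 * \<rho>)" by (simp_all del: mdist_zero)
    qed (use w in auto)
    then have 3: "cyl (r, w) (3 * \<rho>) \<subseteq> lpts X" "compactin (ltop X) (cyl (r, w) (3 * \<rho>))" "closedin (ltop X) (cyl (r, w) (3 * \<rho>))"
      using cyl_compact[OF w(1), of "3 * \<rho>" r] \<rho> wsub by auto
    have "closedin (ltop X) (cyl (r, w) ?e)"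
    proof -
      have "cyl (r, w) ?e \<subseteq> lpts X" using \<open>cyl (r, w) ?e \<subseteq> ?S\<close> S(1) by blast
      then have "cyl (r, w) ?e = (cyl (r, w) ?e \<inter> lpts W) \<inter> lpts X" using X_slab slab_lpts by auto
      moreover have "closedin (ltop W) (cyl (r, w) ?e \<inter> lpts W)" using w by (intro closedin_cyl) auto
      ultimately show ?thesis unfolding ltop_X closedin_subtopology by blast
    qed
    then show "cyl (r, w) ?e \<in> sets \<mm>" unfolding sm by (rule closedin_sets_borel_of)
    have "measure \<mm> ?S \<le> measure \<mm> (cyl (r, w) (3 * \<rho>))"
    proof (rule measure_mono_fmeasurable[OF _ Ss])
      show "?S \<subseteq> cyl (r, w) (3 * \<rho>)" using w w0 \<rho> by (intro cyl_mono) (auto simp: mdist_commute)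
      show "cyl (r, w) (3 * \<rho>) \<in> fmeasurable \<mm>"
        using radon_measure_compact_finite[OF rad 3(2)] closedin_sets_borel_of[OF 3(3)] sm by (intro fmeasurableI) auto
    qed
    then have "D ^ j * measure \<mm> ?S \<le> D ^ j * measure \<mm> (cyl (r, w) (3 * \<rho>))" using D0 by (intro mult_left_mono) auto
    also have "\<dots> \<le> measure \<mm> (cyl (r, w) ?e)"
      unfolding D_def using doubling_iterate[OF w(1), of "3 * \<rho>" r j] \<rho> wsub by auto
    finally show "D ^ j * measure \<mm> ?S \<le> measure \<mm> (cyl (r, w) ?e)" .
  qed
  have "real (card F) * (D ^ j * measure \<mm> ?S) = (\<Sum>w\<in>F. D ^ j * measure \<mm> ?S)" by simp
  also have "\<dots> \<le> (\<Sum>w\<in>F. measure \<mm> (cyl (r, w) ?e))" using low by (rule sum_mono)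
  also have "\<dots> = measure \<mm> (\<Union>w\<in>F. cyl (r, w) ?e)"
  proof (rule measure_finite_Union[symmetric, OF F(1)])
    show "(\<lambda>w. cyl (r, w) ?e) ` F \<subseteq> sets \<mm>" using cm by auto
    show "emeasure \<mm> (cyl (r, w) ?e) \<noteq> \<infinity>" if "w \<in> F" for w
      using emeasure_mono[OF cs[OF that] Ss] Sfin by (auto simp: top_unique)
    show "disjoint_family_on (\<lambda>w. cyl (r, w) ?e) F"
      unfolding disjoint_family_on_def
    proof (intro ballI impI)
      fix v w assume vw: "v \<in> F" "w \<in> F" "v \<noteq> w"
      show "cyl (r, v) ?e \<inter> cyl (r, w) ?e = {}"
      proof (rule ccontr)
        assume "cyl (r, v) ?e \<inter> cyl (r, w) ?e \<noteq> {}"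
        then obtain z where z: "snd z \<in> mspace Y" "mdist Y (snd z) v \<le> ?e" "mdist Y (snd z) w \<le> ?e" by (auto simp: cyl_def)
        have "mdist Y v w \<le> mdist Y v (snd z) + mdist Y (snd z) w" using z FY vw by (intro mdist_triangle) auto
        then have "mdist Y v w \<le> 6 * \<rho> / 4 ^ j" using z by (simp add: mdist_commute)
        then show False using sep[OF vw] by simp
      qed
    qed
  qed
  also have "\<dots> \<le> measure \<mm> ?S"
    using cs cm F(1) Sfin Ss by (intro measure_mono_fmeasurable fmeasurableI) auto
  finally have "real (card F) * D ^ j * measure \<mm> ?S \<le> 1 * measure \<mm> ?S" by (simp add: mult.assoc)
  then have "real (card F) * D ^ j \<le> 1" using Spos by (simp add: mult_le_cancel_right)
  then show ?thesis unfolding D_def[symmetric] using D0 by (simp add: power_divide le_divide_eq)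
qed

end

end

section \<open>Uniform nets\<close>

text \<open>A separated subset of maximal cardinality is a net, since a point far from it could be
  added. The maximum exists because the attainable cardinalities \<open>Q\<close> are bounded by
  \<open>P\<close>.\<close>

lemma maximal_separated_cover:
  fixes d :: "'a \<Rightarrow> 'a \<Rightarrow> real" and P :: nat
  assumes bound: "\<And>F. finite F \<Longrightarrow> F \<subseteq> S \<Longrightarrow> (\<And>v w. v \<in> F \<Longrightarrow> w \<in> F \<Longrightarrow> v \<noteq> w \<Longrightarrow> e < d v w) \<Longrightarrow> card F \<le> P"
    and sym: "\<And>v w. d v w = d w v" and zero: "\<And>v. v \<in> S \<Longrightarrow> d v v \<le> e"
  obtains F where "finite F" "F \<subseteq> S" "card F \<le> P" "\<And>v. v \<in> S \<Longrightarrow> \<exists>u\<in>F. d v u \<le> e"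
proof -
  define Q where "Q = (\<lambda>n. \<exists>F. finite F \<and> F \<subseteq> S \<and> (\<forall>v\<in>F. \<forall>w\<in>F. v \<noteq> w \<longrightarrow> e < d v w) \<and> card F = n)"
  have "Q 0" unfolding Q_def by (intro exI[of _ "{}"]) auto
  moreover have Qb: "n \<le> P" if Qn: "Q n" for n
  proof -
    obtain F where F: "finite F" "F \<subseteq> S" "\<forall>v\<in>F. \<forall>w\<in>F. v \<noteq> w \<longrightarrow> e < d v w" "card F = n"
      using Qn unfolding Q_def by (elim exE conjE)
    have "card F \<le> P" by (rule bound[OF F(1,2)]) (use F(3) in simp)
    then show ?thesis using F(4) by simp
  qed
  ultimately have QG: "Q (Greatest Q)" and G: "\<And>n. Q n \<Longrightarrow> n \<le> Greatest Q"
    by (auto intro: GreatestI_nat[of Q 0 P] Greatest_le_nat[of Q _ P])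
  obtain F where F: "finite F" "F \<subseteq> S" "\<forall>v\<in>F. \<forall>w\<in>F. v \<noteq> w \<longrightarrow> e < d v w" "card F = Greatest Q"
    using QG unfolding Q_def by (elim exE conjE)
  show thesis
  proof (rule that[OF F(1,2)])
    show "card F \<le> P" using Qb[OF QG] F(4) by simp
    fix v assume v: "v \<in> S"
    show "\<exists>u\<in>F. d v u \<le> e"
    proof (rule ccontr)
      assume "\<not> (\<exists>u\<in>F. d v u \<le> e)"
      then have far: "\<And>u. u \<in> F \<Longrightarrow> e < d v u" by auto
      then have "v \<notin> F" using zero[OF v] by fastforce
      then have "Q (card (insert v F))"
        unfolding Q_def using F far v sym by (intro exI[of _ "insert v F"]) (auto; metis)
      then show False using G F(1,4) \<open>v \<notin> F\<close> by fastforce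
    qed
  qed
qed

lemma card_UN_le_mult:
  assumes "finite F" "card F \<le> n" "\<And>u. u \<in> F \<Longrightarrow> finite (G u) \<and> card (G u) \<le> p"
  shows "finite (\<Union>u\<in>F. G u) \<and> card (\<Union>u\<in>F. G u) \<le> n * p"
proof -
  have "card (\<Union>u\<in>F. G u) \<le> (\<Sum>u\<in>F. card (G u))" by (rule card_UN_le[OF assms(1)])
  also have "\<dots> \<le> (\<Sum>u\<in>F. p)" using assms by (intro sum_mono) auto
  also have "\<dots> \<le> n * p" using assms(2) by simp
  finally show ?thesis using assms by auto
qed

text \<open>Going back \<open>\<rho> / 4\<close> along an almost shortest curve from
  \<open>y\<close> leads to a point already covered, within \<open>\<rho> / 2\<close>, by some
  \<open>v\<close>. So \<open>w\<close> is within \<rho> of \<open>v\<close>, and the local cover at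
  \<open>v\<close> improves this to \<open>\<rho> / 2\<close>. All points are kept in the open ball
  of radius \<open>R\<close>, where alone local covers are available.\<close>

lemma length_space_chain_cover:
  assumes Y: "length_space Y" and y: "y \<in> mspace Y" and \<rho>: "0 < \<rho>" and R: "0 < R"
    and loc: "\<And>u. u \<in> mspace Y \<Longrightarrow> mdist Y y u < R \<Longrightarrow> \<exists>F\<subseteq>{w \<in> mspace Y. mdist Y y w < R \<and> mdist Y w u \<le> \<rho>}. finite F \<and> card F \<le> P \<and>
       (\<forall>w\<in>mspace Y. mdist Y y w < R \<and> mdist Y w u \<le> \<rho> \<longrightarrow> (\<exists>v\<in>F. mdist Y w v \<le> \<rho> / 2))"
  shows "\<exists>F\<subseteq>{w \<in> mspace Y. mdist Y y w < R}. finite F \<and> card F \<le> P ^ n \<and>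
       (\<forall>w\<in>mspace Y. mdist Y y w < R \<and> mdist Y y w < real (Suc n) * (\<rho> / 4) \<longrightarrow> (\<exists>v\<in>F. mdist Y w v \<le> \<rho> / 2))"
proof (induction n)
  case 0
  have "mdist Y y y = 0" using y by simp
  then show ?case using \<rho> R y by (intro exI[of _ "{y}"]) (auto simp: mdist_commute simp del: mdist_zero)
next
  case (Suc n)
  then obtain F where F: "F \<subseteq> {w \<in> mspace Y. mdist Y y w < R}" "finite F" "card F \<le> P ^ n"
    "\<And>w. w \<in> mspace Y \<Longrightarrow> mdist Y y w < R \<Longrightarrow> mdist Y y w < real (Suc n) * (\<rho> / 4) \<Longrightarrow> \<exists>v\<in>F. mdist Y w v \<le> \<rho> / 2"
    by blast
  define B where "B = (\<lambda>u G. G \<subseteq> {w \<in> mspace Y. mdist Y y w < R \<and> mdist Y w u \<le> \<rho>} \<and> finite G \<and> card G \<le> P \<and>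
       (\<forall>w\<in>mspace Y. mdist Y y w < R \<and> mdist Y w u \<le> \<rho> \<longrightarrow> (\<exists>v\<in>G. mdist Y w v \<le> \<rho> / 2)))"
  have "\<exists>G. B u G" if "u \<in> F" for u using loc[of u] F(1) that unfolding B_def by blast
  then obtain G where G: "\<And>u. u \<in> F \<Longrightarrow> B u (G u)" by metis
  have fc: "finite (\<Union>u\<in>F. G u) \<and> card (\<Union>u\<in>F. G u) \<le> P ^ n * P"
    using G by (intro card_UN_le_mult F) (auto simp: B_def)
  show ?case
  proof (intro exI[of _ "\<Union>u\<in>F. G u"] conjI ballI impI)
    show "(\<Union>u\<in>F. G u) \<subseteq> {w \<in> mspace Y. mdist Y y w < R}" using G by (auto simp: B_def)
    show "finite (\<Union>u\<in>F. G u)" "card (\<Union>u\<in>F. G u) \<le> P ^ Suc n" using fc by (auto simp: mult.commute)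
    fix w assume w: "w \<in> mspace Y" "mdist Y y w < R \<and> mdist Y y w < real (Suc (Suc n)) * (\<rho> / 4)"
    then have "mdist Y y w < min R (real (Suc (Suc n)) * (\<rho> / 4))" by simp
    then obtain L where L: "mdist Y y w < L" "L < min R (real (Suc (Suc n)) * (\<rho> / 4))" using dense by blast
    have L0: "0 < L" using L mdist_nonneg[of Y y w] by linarith
    obtain \<beta> where \<beta>: "\<beta> \<in> {0..1} \<rightarrow> mspace Y" "\<beta> 0 = y" "\<beta> 1 = w"
      "\<And>u v. u \<in> {0..1} \<Longrightarrow> v \<in> {0..1} \<Longrightarrow> mdist Y (\<beta> u) (\<beta> v) \<le> L * \<bar>u - v\<bar>"
      using length_space_lipschitz_curve[OF Y y w(1) L(1)] by blast
    \<comment> \<open>The curve has speed at most \<open>L\<close>, so this parameter lies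
      \<open>\<rho> / 4\<close> before the end; the maximum with 0 handles points that close to
      \<open>y\<close>.\<close>
    define u where "u = max 0 (1 - \<rho> / (4 * L))"
    have u01: "u \<in> {0..1}" using L0 \<rho> by (auto simp: u_def)
    have Lu: "L * u = max 0 (L - \<rho> / 4)" unfolding u_def using L0 by (simp add: max_def field_simps)
    have "mdist Y (\<beta> 0) (\<beta> u) \<le> L * \<bar>0 - u\<bar>" by (rule \<beta>(4)) (use u01 in auto)
    then have 1: "mdist Y y (\<beta> u) \<le> L * u" using u01 \<beta>(2) by simp
    have "mdist Y (\<beta> u) (\<beta> 1) \<le> L * \<bar>u - 1\<bar>" by (rule \<beta>(4)) (use u01 in auto)
    also have "\<dots> = L - L * u" using u01 by (simp add: algebra_simps)
    also have "\<dots> \<le> \<rho> / 4" unfolding Lu by (simp add: max_def)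
    finally have 2: "mdist Y (\<beta> u) w \<le> \<rho> / 4" using \<beta>(3) by simp
    have \<beta>Y: "\<beta> u \<in> mspace Y" using \<beta>(1) u01 by auto
    have "0 < real (Suc n) * (\<rho> / 4)" using \<rho> by simp
    moreover have "L - \<rho> / 4 < real (Suc n) * (\<rho> / 4)" using L(2) by (simp add: algebra_simps)
    ultimately have "L * u < real (Suc n) * (\<rho> / 4)" unfolding Lu max_less_iff_conj by blast
    moreover have "L * u < R" unfolding Lu using L(2) \<rho> R by (auto simp: max_def)
    ultimately obtain v where v: "v \<in> F" "mdist Y (\<beta> u) v \<le> \<rho> / 2"
      using F(4)[OF \<beta>Y] 1 by (meson le_less_trans)
    have vY: "v \<in> mspace Y" using v F by auto
    have "mdist Y w v \<le> mdist Y w (\<beta> u) + mdist Y (\<beta> u) v" by (intro mdist_triangle w \<beta>Y vY)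
    then have "mdist Y w v \<le> \<rho>" using 2 v \<rho> by (simp add: mdist_commute)
    then obtain v' where "v' \<in> G v" "mdist Y w v' \<le> \<rho> / 2" using G[OF v(1)] w unfolding B_def by blast
    then show "\<exists>v\<in>\<Union>u\<in>F. G u. mdist Y w v \<le> \<rho> / 2" using v by blast
  qed
qed

text \<open>\<open>p\<close> need not lie in \<open>A\<close>. The points \<open>x\<close> are
  partners that make \<open>p\<close> the past vertex of arbitrarily short diamonds meeting
  \<open>A\<close>.\<close>

definition past_tame :: "'a lpls \<Rightarrow> 'a set \<Rightarrow> 'a \<Rightarrow> bool" where
  "past_tame X A p \<longleftrightarrow> (\<forall>e>0. \<exists>x\<in>A. lcaus X p x \<and> ltau X p x \<le> ennreal e)"

definition future_tame :: "'a lpls \<Rightarrow> 'a set \<Rightarrow> 'a \<Rightarrow> bool" where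
  "future_tame X A q \<longleftrightarrow> (\<forall>e>0. \<exists>x\<in>A. lcaus X x q \<and> ltau X x q \<le> ennreal e)"

context cone_diamond
begin

definition "U \<alpha> = chron_diamond W (s0 + \<alpha>, y) (t0 - \<alpha>, y)"

lemma tips_slab:
  assumes "0 \<le> \<alpha>" "s0 + \<alpha> < t0 - \<alpha>"
  shows "(s0 + \<alpha>, y) \<in> slab" "(t0 - \<alpha>, y) \<in> slab"
  using assms yY by (auto simp: slab_def)

lemma mem_U:
  assumes "0 \<le> \<alpha>" "s0 + \<alpha> < t0 - \<alpha>"
  shows "x \<in> U \<alpha> \<longleftrightarrow> x \<in> slab \<and> 0 < slack (s0 + \<alpha>, y) x \<and> 0 < slack x (t0 - \<alpha>, y)"
  unfolding U_def chron_diamond_slab[OF tips_slab[OF assms]] by simp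

lemma U_slab: "0 \<le> \<alpha> \<Longrightarrow> s0 + \<alpha> < t0 - \<alpha> \<Longrightarrow> x \<in> U \<alpha> \<Longrightarrow> x \<in> slab"
  using mem_U by blast

lemma U_zero: "U 0 = lpts X"
  unfolding U_def XW using chron_diamond_slab[OF base_slab] slab_lpts by auto

lemma mdist_base: "mdist Y y y = 0"
  using yY by simp

text \<open>Moving by \<open>c\<close> changes \<open>T\<close> by at most \<open>c / m\<close> and
  the fibre distance by at most \<open>c\<close>, whereas the tips of \<open>U \<alpha>\<close> and
  \<open>U \<beta>\<close> differ in \<open>T\<close> by at least
  \<open>(\<alpha> - \<beta>) / M\<close>. The condition \<open>c < \<alpha> - \<beta>\<close> keeps
  the times inside the slab, where the estimates on \<open>T\<close> hold.\<close>

lemma clearance: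
  assumes \<beta>: "0 \<le> \<beta>" "\<beta> < \<alpha>" "s0 + \<alpha> < t0 - \<alpha>" and x: "x \<in> U \<alpha>"
    and c: "0 < c" "c / m + c < (\<alpha> - \<beta>) / M" "c < \<alpha> - \<beta>"
  shows "cyl x c \<subseteq> U \<beta>"
proof
  fix z assume z: "z \<in> cyl x c"
  have U: "x \<in> slab" "0 < slack (s0 + \<alpha>, y) x" "0 < slack x (t0 - \<alpha>, y)" using x mem_U \<beta> by auto
  have xY: "snd x \<in> mspace Y" using U by (auto simp: slab_def)
  have zc: "\<bar>fst z - fst x\<bar> \<le> c" "snd z \<in> mspace Y" "mdist Y (snd z) (snd x) \<le> c" using z by (auto simp: cyl_def)
  have sx: "s0 + \<alpha> < fst x" "fst x < t0 - \<alpha>"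
    using slack_pos_imp(3)[OF tips_slab(1) U(1,2)] slack_pos_imp(3)[OF U(1) tips_slab(2) U(3)] \<beta> by auto
  have zr: "s0 + \<beta> < fst z" "fst z < t0 - \<beta>" using sx zc(1) c by auto
  then have zs: "z \<in> slab" using zc \<beta> by (cases z) (auto simp: slab_def)
  have r: "s0 \<le> fst x" "fst x \<le> t0" "s0 \<le> fst z" "fst z \<le> t0" using sx zr \<beta> by auto
  have "\<bar>T (fst z) - T (fst x)\<bar> \<le> 1 / m * \<bar>fst z - fst x\<bar>" using r by (intro T_lipschitz) auto
  also have "\<dots> \<le> 1 / m * c" using zc m0 by (intro mult_left_mono) auto
  finally have Tz: "\<bar>T (fst z) - T (fst x)\<bar> \<le> c / m" by simp
  have T1: "(\<alpha> - \<beta>) / M \<le> T (s0 + \<alpha>) - T (s0 + \<beta>)" "(\<alpha> - \<beta>) / M \<le> T (t0 - \<beta>) - T (t0 - \<alpha>)"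
    using T_bounds(1)[of "s0 + \<beta>" "s0 + \<alpha>"] T_bounds(1)[of "t0 - \<alpha>" "t0 - \<beta>"] \<beta> by auto
  have d: "mdist Y y (snd z) \<le> mdist Y y (snd x) + c" "mdist Y (snd z) y \<le> mdist Y (snd x) y + c"
    using mdist_triangle[OF yY xY zc(2)] mdist_triangle[OF zc(2) xY yY] zc(3) by (auto simp: mdist_commute)
  have "0 < slack (s0 + \<beta>, y) z" "0 < slack z (t0 - \<beta>, y)"
    using U(2,3) Tz T1 d c unfolding slack_def by (auto simp: abs_le_iff)
  then show "z \<in> U \<beta>" using zs \<beta> mem_U[of \<beta> z] by auto
qed

lemma U_antimono: "0 \<le> \<beta> \<Longrightarrow> \<beta> < \<alpha> \<Longrightarrow> s0 + \<alpha> < t0 - \<alpha> \<Longrightarrow> U \<alpha> \<subseteq> U \<beta>"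
proof
  fix x assume \<beta>: "0 \<le> \<beta>" "\<beta> < \<alpha>" "s0 + \<alpha> < t0 - \<alpha>" and x: "x \<in> U \<alpha>"
  have "T (s0 + \<beta>) < T (s0 + \<alpha>)" "T (t0 - \<alpha>) < T (t0 - \<beta>)" using \<beta> by (auto intro!: T_strict_mono)
  then show "x \<in> U \<beta>" using x \<beta> mem_U[of \<alpha> x] mem_U[of \<beta> x] by (auto simp: slack_def)
qed

definition "Rad \<alpha> = (T (t0 - \<alpha>) - T (s0 + \<alpha>)) / 2"

text \<open>At the \<open>T\<close>-midpoint of the two tips both slack conditions become the same
  inequality \<open>mdist Y y w < Rad \<alpha>\<close>; conversely, adding the two conditions gives
  it. So the projection is a ball, to which chaining along curves applies.\<close>

lemma snd_U:
  assumes \<alpha>: "0 \<le> \<alpha>" "s0 + \<alpha> < t0 - \<alpha>"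
  shows "snd ` U \<alpha> = {w \<in> mspace Y. mdist Y y w < Rad \<alpha>}"
proof (intro set_eqI iffI)
  fix w assume "w \<in> snd ` U \<alpha>"
  then obtain x where x: "x \<in> U \<alpha>" "w = snd x" by auto
  then show "w \<in> {w \<in> mspace Y. mdist Y y w < Rad \<alpha>}"
    using mem_U[OF \<alpha>, of x] by (auto simp: slack_def Rad_def slab_def mdist_commute)
next
  fix w assume w: "w \<in> {w \<in> mspace Y. mdist Y y w < Rad \<alpha>}"
  define r where "r = Tinv ((T (t0 - \<alpha>) + T (s0 + \<alpha>)) / 2)"
  have "T (s0 + \<alpha>) < T (t0 - \<alpha>)" using \<alpha> by (intro T_strict_mono) auto
  then have r: "T r = (T (t0 - \<alpha>) + T (s0 + \<alpha>)) / 2" "r \<in> {s0 + \<alpha>..t0 - \<alpha>}"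
    unfolding r_def using T_Tinv[of "s0 + \<alpha>" "t0 - \<alpha>"] \<alpha> by auto
  have "(r, w) \<in> U \<alpha>"
    using w r \<alpha> by (subst mem_U[OF \<alpha>]) (auto simp: slack_def slab_def Rad_def field_simps mdist_commute)
  then show "w \<in> snd ` U \<alpha>" by force
qed

text \<open>Along the axis over \<open>y\<close> the time separation comes arbitrarily close to the
  height, and slightly shortened axis segments have both ends in \<open>X\<close>.\<close>

lemma height_le:
  assumes \<Lambda>: "0 \<le> \<Lambda>" "tau_diam X (lpts X) \<le> ennreal \<Lambda>"
  shows "t0 - s0 \<le> \<Lambda>"
proof (rule ccontr)
  assume "\<not> t0 - s0 \<le> \<Lambda>"
  then obtain h where h: "\<Lambda> < h" "h < t0 - s0" using dense[of \<Lambda> "t0 - s0"] by auto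
  define e where "e = (t0 - s0 - h) / 2"
  have e: "0 < e" "(t0 - e) - (s0 + e) = h" using h by (auto simp: e_def field_simps)
  have se: "(s0 + e, y) \<in> slab" "(t0 - e, y) \<in> slab" using e h \<Lambda> yY by (auto simp: slab_def)
  have "T s0 < T (s0 + e)" "T (t0 - e) < T t0" "T (s0 + e) < T (t0 - e)" using e h \<Lambda> by (auto intro!: T_strict_mono)
  then have pX: "(s0 + e, y) \<in> lpts X" "(t0 - e, y) \<in> lpts X" using se by (auto simp: lpts_X slack_def mdist_base)
  have hL: "0 < h\<^sup>2 - \<Lambda>\<^sup>2" using h \<Lambda> by (simp add: power_strict_mono)
  \<comment> \<open>\<open>tau_ge\<close> asks for a positive \<open>L\<close> even between points
    on the axis; this one loses only a quarter of the gap
    \<open>h\<^sup>2 - \<Lambda>\<^sup>2\<close>.\<close>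
  define L where "L = sqrt (h\<^sup>2 - \<Lambda>\<^sup>2) / (2 * M)"
  have L0: "0 < L" using hL M0 by (simp add: L_def)
  have mL: "M * L = sqrt (h\<^sup>2 - \<Lambda>\<^sup>2) / 2" using M0 by (simp add: L_def)
  have "sqrt (h\<^sup>2 - \<Lambda>\<^sup>2) \<le> sqrt (h\<^sup>2)" by (intro real_sqrt_le_mono) simp
  then have mLh: "M * L < h" using h \<Lambda> mL by simp
  have "ennreal (sqrt (h\<^sup>2 - (M * L)\<^sup>2)) \<le> ltau W (s0 + e, y) (t0 - e, y)"
    using tau_ge(1)[OF se, of L] L0 mLh e mdist_base by simp
  also have "\<dots> \<le> ennreal \<Lambda>" using tau_X_le[OF \<Lambda>(2) pX] by (simp add: X_simps)
  finally have "sqrt (h\<^sup>2 - (M * L)\<^sup>2) \<le> \<Lambda>" using \<Lambda> by (simp add: ennreal_le_iff)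
  then have "h\<^sup>2 - (M * L)\<^sup>2 \<le> \<Lambda>\<^sup>2" by (simp add: sqrt_le_D)
  moreover have "(M * L)\<^sup>2 = (h\<^sup>2 - \<Lambda>\<^sup>2) / 4" unfolding mL using hL by (simp add: power_divide)
  moreover have "False" if "a - d \<le> b" "d = (a - b) / 4" "0 < a - b" for a b d :: real
    using that by (simp add: field_simps)
  ultimately show False using hL by blast
qed

text \<open>Follow a timelike curve between the lower tip and \<open>x\<close>, which stays in
  \<open>U \<alpha>\<close> except at the tip. The slack from \<open>p\<close> is nonpositive at the
  tip and positive at \<open>x\<close>, so by continuity it takes a small positive value in between;
  there causality holds and \<open>tau_le_slack\<close> makes \<tau> small.\<close>

lemma tame_past_vertex:
  assumes \<alpha>: "0 \<le> \<alpha>" "s0 + \<alpha> < t0 - \<alpha>" and p: "p \<in> slab" and x: "x \<in> U \<alpha>" "0 < slack p x"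
    and na: "slack p (s0 + \<alpha>, y) \<le> 0"
  shows "past_tame X (U \<alpha>) p"
  unfolding past_tame_def
proof (intro allI impI)
  fix e :: real assume e: "0 < e"
  note tips = tips_slab[OF \<alpha>]
  have U: "x \<in> slab" "0 < slack (s0 + \<alpha>, y) x" "0 < slack x (t0 - \<alpha>, y)" using x mem_U[OF \<alpha>] by auto
  obtain rx wx where xx: "x = (rx, wx)" by (cases x)
  have wx: "wx \<in> mspace Y" and rx: "rx \<in> {s0..t0}" using U xx by (auto simp: slab_def)
  have pY: "snd p \<in> mspace Y" using p by (auto simp: slab_def)
  have ra: "s0 + \<alpha> \<in> {s0..t0}" using \<alpha> by auto
  have lt: "s0 + \<alpha> < rx" using slack_pos_imp(3)[OF tips(1) U(1,2)] xx by simp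
  define \<Delta> where "\<Delta> = T rx - T (s0 + \<alpha>)"
  have "mdist Y y wx < \<Delta>" using U(2) by (simp add: slack_def xx \<Delta>_def)
  then obtain L where L: "mdist Y y wx < L" "L < \<Delta>" using dense by blast
  have L0: "0 < L" using L mdist_nonneg[of Y y wx] by linarith
  obtain \<beta> where \<beta>: "\<beta> \<in> {0..1} \<rightarrow> mspace Y" "\<beta> 0 = y" "\<beta> 1 = wx"
    "\<And>u v. u \<in> {0..1} \<Longrightarrow> v \<in> {0..1} \<Longrightarrow> mdist Y (\<beta> u) (\<beta> v) \<le> L * \<bar>u - v\<bar>"
    using length_space_lipschitz_curve[OF Ysp yY wx L(1)] by blast
  define a where "a u = Tinv (T (s0 + \<alpha>) + u * \<Delta>)" for u
  note N = null_speed_curve[OF ra rx lt, folded \<Delta>_def, folded a_def]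
  define \<gamma> where "\<gamma> = (\<lambda>u. (a u, \<beta> u))"
  have \<beta>Y: "\<beta> u \<in> mspace Y" if "u \<in> {0..1}" for u using \<beta>(1) that by auto
  have \<gamma>s: "\<gamma> u \<in> slab" if "u \<in> {0..1}" for u
    using N(3)[OF that] \<beta>Y[OF that] ra rx by (auto simp: \<gamma>_def slab_def)
  have ends: "\<gamma> 0 = (s0 + \<alpha>, y)" "\<gamma> 1 = x" using N(1,2) \<beta> by (auto simp: \<gamma>_def xx)
  have sl1: "u * (\<Delta> - L) \<le> slack (s0 + \<alpha>, y) (\<gamma> u)" "(1 - u) * (\<Delta> - L) \<le> slack (\<gamma> u) x" if u: "u \<in> {0..1}" for u
  proof -
    have d: "mdist Y y (\<beta> u) \<le> L * u" "mdist Y (\<beta> u) wx \<le> L * (1 - u)"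
      using \<beta>(4)[of 0 u] \<beta>(4)[of u 1] u \<beta>(2,3) by auto
    show "u * (\<Delta> - L) \<le> slack (s0 + \<alpha>, y) (\<gamma> u)"
      using d N(4)[OF u] by (simp add: slack_def \<gamma>_def algebra_simps)
    show "(1 - u) * (\<Delta> - L) \<le> slack (\<gamma> u) x"
      using d N(4)[OF u] by (simp add: slack_def \<gamma>_def xx \<Delta>_def algebra_simps)
  qed
  have \<gamma>U: "\<gamma> u \<in> U \<alpha>" if u: "0 < u" "u \<le> 1" for u
  proof -
    have u01: "u \<in> {0..1}" using u by auto
    have "0 < u * (\<Delta> - L)" using u L by simp
    then have 1: "0 < slack (s0 + \<alpha>, y) (\<gamma> u)" using sl1(1)[OF u01] by linarith
    have "0 \<le> (1 - u) * (\<Delta> - L)" using u L by simp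
    then have "0 < slack (\<gamma> u) x + slack x (t0 - \<alpha>, y)" using sl1(2)[OF u01] U(3) by linarith
    also have "\<dots> \<le> slack (\<gamma> u) (t0 - \<alpha>, y)" using \<beta>Y[OF u01] wx yY by (intro slack_triangle) (auto simp: \<gamma>_def xx)
    finally show ?thesis using 1 \<gamma>s[OF u01] mem_U[OF \<alpha>] by blast
  qed
  define F where "F = (\<lambda>u. slack p (\<gamma> u))"
  have F: "F 0 \<le> 0" "0 < F 1" using na x(2) by (auto simp: F_def ends)
  have cont: "continuous_on {0..1} F"
  proof -
    have "L-lipschitz_on {0..1} (\<lambda>u. mdist Y (snd p) (\<beta> u))"
    proof (rule lipschitz_onI)
      fix u v :: real assume uv: "u \<in> {0..1}" "v \<in> {0..1}"
      have "\<bar>mdist Y (snd p) (\<beta> u) - mdist Y (snd p) (\<beta> v)\<bar> \<le> mdist Y (\<beta> u) (\<beta> v)"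
        using mdist_triangle[OF pY \<beta>Y[OF uv(1)] \<beta>Y[OF uv(2)]] mdist_triangle[OF pY \<beta>Y[OF uv(2)] \<beta>Y[OF uv(1)]]
        by (simp add: mdist_commute[of Y "\<beta> v" "\<beta> u"])
      also have "\<dots> \<le> L * \<bar>u - v\<bar>" by (rule \<beta>(4)[OF uv])
      finally show "dist (mdist Y (snd p) (\<beta> u)) (mdist Y (snd p) (\<beta> v)) \<le> L * dist u v" by (simp add: dist_real_def)
    qed (use L0 in simp)
    then have "continuous_on {0..1} (\<lambda>u. mdist Y (snd p) (\<beta> u))" by (rule lipschitz_on_continuous_on)
    then have "continuous_on {0..1} (\<lambda>u. T (s0 + \<alpha>) + u * \<Delta> - T (fst p) - mdist Y (snd p) (\<beta> u))"
      by (intro continuous_intros)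
    then show ?thesis
      by (rule continuous_on_eq) (use N(4) in \<open>auto simp: F_def slack_def \<gamma>_def\<close>)
  qed
  define h where "h = t0 - s0"
  have h0: "0 < h" using s0t0 by (simp add: h_def)
  \<comment> \<open>This value makes the height term \<open>M / \<kappa> * h\<close> equal to
    \<open>e / 2\<close>; the slack \<open>c\<close> is then chosen so that the other term is at
    most \<open>e / 2\<close>.\<close>
  define \<kappa> where "\<kappa> = 2 * M * h / e"
  have \<kappa>0: "0 < \<kappa>" using M0 h0 e by (simp add: \<kappa>_def)
  define c where "c = min (F 1) (e / \<kappa>)"
  have c: "0 < c" "c \<le> F 1" "\<kappa> / 2 * c \<le> e / 2"
  proof -
    show "0 < c" "c \<le> F 1" using F e \<kappa>0 by (auto simp: c_def)
    have "\<kappa> / 2 * c \<le> \<kappa> / 2 * (e / \<kappa>)" using \<kappa>0 by (intro mult_left_mono) (auto simp: c_def)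
    then show "\<kappa> / 2 * c \<le> e / 2" using \<kappa>0 by simp
  qed
  obtain u where u: "0 \<le> u" "u \<le> 1" "F u = c"
    using IVT'[of F 0 c 1, OF _ c(2) _ cont] F(1) c(1) by auto
  have "u \<noteq> 0" using u(3) F(1) c(1) by auto
  then have u0: "0 < u" using u by simp
  have sp: "slack p (\<gamma> u) = c" using u by (simp add: F_def)
  have gs: "\<gamma> u \<in> slab" using \<gamma>s u by auto
  have "ltau W p (\<gamma> u) \<le> ennreal (\<kappa> / 2 * slack p (\<gamma> u) + M / \<kappa> * (fst (\<gamma> u) - fst p))" by (rule tau_le_slack[OF p gs \<kappa>0])
  also have "\<dots> \<le> ennreal e"
  proof (rule ennreal_leI)
    have "fst (\<gamma> u) - fst p \<le> h" using p gs by (auto simp: slab_def h_def)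
    then have "M / \<kappa> * (fst (\<gamma> u) - fst p) \<le> M / \<kappa> * h" using M0 \<kappa>0 by (intro mult_left_mono) auto
    also have "\<dots> = e / 2" using M0 h0 e by (simp add: \<kappa>_def)
    finally show "\<kappa> / 2 * slack p (\<gamma> u) + M / \<kappa> * (fst (\<gamma> u) - fst p) \<le> e" unfolding sp using c(3) by linarith
  qed
  finally show "\<exists>x\<in>U \<alpha>. lcaus X p x \<and> ltau X p x \<le> ennreal e"
    using \<gamma>U[OF u0 u(2)] slack_pos_imp(2)[OF p gs] sp c(1) by (auto simp: X_simps)
qed

text \<open>The time dual of \<open>tame_past_vertex\<close>: the curve runs from \<open>x\<close>
  to the upper tip, where the slack towards \<open>p\<close> is nonpositive.\<close>

lemma tame_future_vertex:
  assumes \<alpha>: "0 \<le> \<alpha>" "s0 + \<alpha> < t0 - \<alpha>" and p: "p \<in> slab" and x: "x \<in> U \<alpha>" "0 < slack x p"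
    and na: "slack (t0 - \<alpha>, y) p \<le> 0"
  shows "future_tame X (U \<alpha>) p"
  unfolding future_tame_def
proof (intro allI impI)
  fix e :: real assume e: "0 < e"
  note tips = tips_slab[OF \<alpha>]
  have U: "x \<in> slab" "0 < slack (s0 + \<alpha>, y) x" "0 < slack x (t0 - \<alpha>, y)" using x mem_U[OF \<alpha>] by auto
  obtain rx wx where xx: "x = (rx, wx)" by (cases x)
  have wx: "wx \<in> mspace Y" and rx: "rx \<in> {s0..t0}" using U xx by (auto simp: slab_def)
  have pY: "snd p \<in> mspace Y" using p by (auto simp: slab_def)
  have rb: "t0 - \<alpha> \<in> {s0..t0}" using \<alpha> by auto
  have lt: "rx < t0 - \<alpha>" using slack_pos_imp(3)[OF U(1) tips(2) U(3)] xx by simp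
  define \<Delta> where "\<Delta> = T (t0 - \<alpha>) - T rx"
  have "mdist Y wx y < \<Delta>" using U(3) by (simp add: slack_def xx \<Delta>_def)
  then obtain L where L: "mdist Y wx y < L" "L < \<Delta>" using dense by blast
  have L0: "0 < L" using L mdist_nonneg[of Y wx y] by linarith
  obtain \<beta> where \<beta>: "\<beta> \<in> {0..1} \<rightarrow> mspace Y" "\<beta> 0 = wx" "\<beta> 1 = y"
    "\<And>u v. u \<in> {0..1} \<Longrightarrow> v \<in> {0..1} \<Longrightarrow> mdist Y (\<beta> u) (\<beta> v) \<le> L * \<bar>u - v\<bar>"
    using length_space_lipschitz_curve[OF Ysp wx yY L(1)] by blast
  define a where "a u = Tinv (T rx + u * \<Delta>)" for u
  note N = null_speed_curve[OF rx rb lt, folded \<Delta>_def, folded a_def]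
  define \<gamma> where "\<gamma> = (\<lambda>u. (a u, \<beta> u))"
  have \<beta>Y: "\<beta> u \<in> mspace Y" if "u \<in> {0..1}" for u using \<beta>(1) that by auto
  have \<gamma>s: "\<gamma> u \<in> slab" if "u \<in> {0..1}" for u
    using N(3)[OF that] \<beta>Y[OF that] rb rx by (auto simp: \<gamma>_def slab_def)
  have ends: "\<gamma> 1 = (t0 - \<alpha>, y)" "\<gamma> 0 = x" using N(1,2) \<beta> by (auto simp: \<gamma>_def xx)
  have sl1: "u * (\<Delta> - L) \<le> slack x (\<gamma> u)" "(1 - u) * (\<Delta> - L) \<le> slack (\<gamma> u) (t0 - \<alpha>, y)" if u: "u \<in> {0..1}" for u
  proof -
    have d: "mdist Y wx (\<beta> u) \<le> L * u" "mdist Y (\<beta> u) y \<le> L * (1 - u)"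
      using \<beta>(4)[of 0 u] \<beta>(4)[of u 1] u \<beta>(2,3) by auto
    show "u * (\<Delta> - L) \<le> slack x (\<gamma> u)"
      using d N(4)[OF u] by (simp add: slack_def \<gamma>_def xx algebra_simps)
    show "(1 - u) * (\<Delta> - L) \<le> slack (\<gamma> u) (t0 - \<alpha>, y)"
      using d N(4)[OF u] by (simp add: slack_def \<gamma>_def \<Delta>_def algebra_simps)
  qed
  have \<gamma>U: "\<gamma> u \<in> U \<alpha>" if u: "0 \<le> u" "u < 1" for u
  proof -
    have u01: "u \<in> {0..1}" using u by auto
    have "0 < (1 - u) * (\<Delta> - L)" using u L by simp
    then have 1: "0 < slack (\<gamma> u) (t0 - \<alpha>, y)" using sl1(2)[OF u01] by linarith
    have "0 \<le> u * (\<Delta> - L)" using u L by simp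
    then have "0 < slack (s0 + \<alpha>, y) x + slack x (\<gamma> u)" using sl1(1)[OF u01] U(2) by linarith
    also have "\<dots> \<le> slack (s0 + \<alpha>, y) (\<gamma> u)" using \<beta>Y[OF u01] wx yY by (intro slack_triangle) (auto simp: \<gamma>_def xx)
    finally show ?thesis using 1 \<gamma>s[OF u01] mem_U[OF \<alpha>] by blast
  qed
  define F where "F = (\<lambda>u. slack (\<gamma> u) p)"
  have F: "F 1 \<le> 0" "0 < F 0" using na x(2) by (auto simp: F_def ends)
  have cont: "continuous_on {0..1} F"
  proof -
    have "L-lipschitz_on {0..1} (\<lambda>u. mdist Y (\<beta> u) (snd p))"
    proof (rule lipschitz_onI)
      fix u v :: real assume uv: "u \<in> {0..1}" "v \<in> {0..1}"
      have "\<bar>mdist Y (\<beta> u) (snd p) - mdist Y (\<beta> v) (snd p)\<bar> \<le> mdist Y (\<beta> u) (\<beta> v)"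
        using mdist_triangle[OF \<beta>Y[OF uv(1)] \<beta>Y[OF uv(2)] pY] mdist_triangle[OF \<beta>Y[OF uv(2)] \<beta>Y[OF uv(1)] pY]
        by (simp add: mdist_commute[of Y "\<beta> v" "\<beta> u"])
      also have "\<dots> \<le> L * \<bar>u - v\<bar>" by (rule \<beta>(4)[OF uv])
      finally show "dist (mdist Y (\<beta> u) (snd p)) (mdist Y (\<beta> v) (snd p)) \<le> L * dist u v" by (simp add: dist_real_def)
    qed (use L0 in simp)
    then have "continuous_on {0..1} (\<lambda>u. mdist Y (\<beta> u) (snd p))" by (rule lipschitz_on_continuous_on)
    then have "continuous_on {0..1} (\<lambda>u. T (fst p) - (T rx + u * \<Delta>) - mdist Y (\<beta> u) (snd p))"
      by (intro continuous_intros)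
    then show ?thesis
      by (rule continuous_on_eq) (use N(4) in \<open>auto simp: F_def slack_def \<gamma>_def\<close>)
  qed
  define h where "h = t0 - s0"
  have h0: "0 < h" using s0t0 by (simp add: h_def)
  define \<kappa> where "\<kappa> = 2 * M * h / e"
  have \<kappa>0: "0 < \<kappa>" using M0 h0 e by (simp add: \<kappa>_def)
  define c where "c = min (F 0) (e / \<kappa>)"
  have c: "0 < c" "c \<le> F 0" "\<kappa> / 2 * c \<le> e / 2"
  proof -
    show "0 < c" "c \<le> F 0" using F e \<kappa>0 by (auto simp: c_def)
    have "\<kappa> / 2 * c \<le> \<kappa> / 2 * (e / \<kappa>)" using \<kappa>0 by (intro mult_left_mono) (auto simp: c_def)
    then show "\<kappa> / 2 * c \<le> e / 2" using \<kappa>0 by simp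
  qed
  obtain u where u: "0 \<le> u" "u \<le> 1" "F u = c"
    using IVT2'[of F 1 c 0, OF _ c(2) _ cont] F(1) c(1) by auto
  have "u \<noteq> 1" using u(3) F(1) c(1) by auto
  then have u1: "u < 1" using u by simp
  have sp: "slack (\<gamma> u) p = c" using u by (simp add: F_def)
  have gs: "\<gamma> u \<in> slab" using \<gamma>s u by auto
  have "ltau W (\<gamma> u) p \<le> ennreal (\<kappa> / 2 * slack (\<gamma> u) p + M / \<kappa> * (fst p - fst (\<gamma> u)))" by (rule tau_le_slack[OF gs p \<kappa>0])
  also have "\<dots> \<le> ennreal e"
  proof (rule ennreal_leI)
    have "fst p - fst (\<gamma> u) \<le> h" using p gs by (auto simp: slab_def h_def)
    then have "M / \<kappa> * (fst p - fst (\<gamma> u)) \<le> M / \<kappa> * h" using M0 \<kappa>0 by (intro mult_left_mono) auto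
    also have "\<dots> = e / 2" using M0 h0 e by (simp add: \<kappa>_def)
    finally show "\<kappa> / 2 * slack (\<gamma> u) p + M / \<kappa> * (fst p - fst (\<gamma> u)) \<le> e" unfolding sp using c(3) by linarith
  qed
  finally show "\<exists>x\<in>U \<alpha>. lcaus X x p \<and> ltau X x p \<le> ennreal e"
    using \<gamma>U[OF u(1) u1] slack_pos_imp(2)[OF gs p] sp c(1) by (auto simp: X_simps)
qed

end

lemma exists_clearance:
  fixes m M \<delta> :: real
  assumes m: "0 < m" and M: "0 < M" and \<delta>: "0 < \<delta>"
  shows "\<exists>c>0. c / m + c < \<delta> / M \<and> c < \<delta>"
proof -
  define c where "c = min (\<delta> / 2) (\<delta> / (4 * M * (1 / m + 1)))"
  have D0: "0 < 4 * M * (1 / m + 1)" using m M by (simp add: add_pos_pos)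
  have "0 < c" using \<delta> D0 by (simp add: c_def)
  moreover have "c \<le> \<delta> / 2" by (simp add: c_def)
  moreover have "c / m + c < \<delta> / M"
  proof -
    have "c \<le> \<delta> / (4 * M * (1 / m + 1))" by (simp add: c_def)
    then have "c * (4 * M * (1 / m + 1)) \<le> \<delta>" using D0 by (simp add: le_divide_eq)
    then have "4 * (M * (c / m + c)) \<le> \<delta>" by (simp add: algebra_simps)
    then have "M * (c / m + c) < \<delta>" using \<delta> by linarith
    then show ?thesis using M by (simp add: less_divide_eq mult.commute)
  qed
  ultimately show ?thesis using \<delta> by (intro exI[of _ c]) auto
qed

text \<open>\<open>P\<close> is fixed before the space and depends on the numerical bounds only.
  Packing holds around every point of \<open>U \<alpha>\<close> at a scale \<rho> dictated by the
  clearance to the boundary of \<open>X\<close>. Chaining spreads covers by balls of radius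
  \<open>\<rho> / 2\<close> over the whole projection, and one further packing refines them to
  \<eta>.\<close>

theorem uniform_base_cover:
  fixes m M K N \<Lambda> \<alpha> \<eta> :: real
  assumes mM: "0 < m" "m \<le> M" and N: "0 < N" and \<Lambda>: "0 \<le> \<Lambda>" and \<alpha>: "0 < \<alpha>" and \<eta>: "0 < \<eta>"
  shows "\<exists>P::nat. \<forall>J (Y :: 'y metric) f s0 t0 y X \<mm>. cone_diamond J Y f s0 t0 m M y X \<longrightarrow> tau_diam X (lpts X) \<le> ennreal \<Lambda> \<longrightarrow>
     radon_measure (ltop X) \<mm> \<longrightarrow> full_support (ltop X) \<mm> \<longrightarrow> TMCPe K N X \<mm> \<longrightarrow> TMCPe K N (lreverse X) \<mm> \<longrightarrow> s0 + \<alpha> < t0 - \<alpha> \<longrightarrow>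
     (\<exists>F. finite F \<and> card F \<le> P \<and> F \<subseteq> mspace Y \<and> (\<forall>x\<in>chron_diamond (generalized_cone J Y f) (s0 + \<alpha>, y) (t0 - \<alpha>, y). \<exists>v\<in>F. mdist Y (snd x) v \<le> \<eta>))"
proof -
  have M0: "0 < M" using mM by simp
  obtain c where c: "0 < c" "c / m + c < (\<alpha> - 0) / M" "c < \<alpha> - 0"
    using exists_clearance[OF mM(1) M0, of "\<alpha> - 0"] \<alpha> by auto
  \<comment> \<open>The room that packing at scale \<rho> requires is \<open>C * \<rho>\<close>,
    which the choice of \<rho> makes equal to the clearance \<open>c\<close>.\<close>
  define C where "C = 3 * doubling_clearance m M + 1"
  have C0: "0 < C" using M0 contraction_height_bounds(3)[OF mM(1) M0 order_refl] by (simp add: C_def doubling_clearance_def)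
  define \<rho> where "\<rho> = c / C"
  have \<rho>: "0 < \<rho>" "C * \<rho> = c" using c C0 by (auto simp: \<rho>_def)
  define D where "D = 1 / doubling_const m M K N \<Lambda>"
  \<comment> \<open>Exponent 2 in the packing bound is enough for chaining, as
    \<open>6 / 4 ^ 2 \<le> 1 / 2\<close>.\<close>
  define P1 where "P1 = nat \<lfloor>D ^ 2\<rfloor>"
  obtain j0 :: nat where j0: "6 * \<rho> / \<eta> < 4 ^ j0" using real_arch_pow[of 4 "6 * \<rho> / \<eta>"] by auto
  define j where "j = Suc j0"
  have "6 * \<rho> / \<eta> < 4 ^ j" using j0 by (simp add: j_def) (smt (verit) zero_less_power)
  then have j: "6 * \<rho> / 4 ^ j \<le> \<eta>" using \<eta> by (simp add: field_simps)
  define P2 where "P2 = nat \<lfloor>D ^ j\<rfloor>"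
  \<comment> \<open>Enough chain steps of length \<open>\<rho> / 4\<close> to exhaust the
    projection, a ball of radius at most \<open>\<Lambda> / (2 * m)\<close> by
    \<open>height_le\<close>.\<close>
  obtain n :: nat where n: "\<Lambda> / (2 * m) / (\<rho> / 4) < real n" using reals_Archimedean2 by blast
  have nR: "\<Lambda> / (2 * m) < real (Suc n) * (\<rho> / 4)"
  proof -
    have "\<Lambda> / (2 * m) < real n * (\<rho> / 4)" using n \<rho> by (subst (asm) pos_divide_less_eq) auto
    also have "\<dots> \<le> real (Suc n) * (\<rho> / 4)" using \<rho> by (intro mult_right_mono) auto
    finally show ?thesis .
  qed
  show ?thesis
  proof (intro exI[of _ "P1 ^ n * P2"] allI impI)
    fix J Y f s0 t0 y X and \<mm> :: "(real \<times> 'y) measure"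
    assume loc: "cone_diamond J (Y :: 'y metric) f s0 t0 m M y X" and td: "tau_diam X (lpts X) \<le> ennreal \<Lambda>"
      and rad: "radon_measure (ltop X) \<mm>" and full: "full_support (ltop X) \<mm>" and TM: "TMCPe K N X \<mm>" "TMCPe K N (lreverse X) \<mm>"
      and st: "s0 + \<alpha> < t0 - \<alpha>"
    interpret cone_diamond J Y f s0 t0 m M y X by (rule loc)
    note \<alpha>' = less_imp_le[OF \<alpha>] st
    have RadR: "0 < Rad \<alpha>" "Rad \<alpha> < real (Suc n) * (\<rho> / 4)"
    proof -
      have "T (s0 + \<alpha>) < T (t0 - \<alpha>)" using \<alpha> st by (intro T_strict_mono) auto
      then show "0 < Rad \<alpha>" by (simp add: Rad_def)
      have "T (t0 - \<alpha>) - T (s0 + \<alpha>) \<le> ((t0 - \<alpha>) - (s0 + \<alpha>)) / m" using \<alpha> st by (intro T_bounds) auto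
      also have "\<dots> \<le> \<Lambda> / m" using height_le[OF \<Lambda> td] \<alpha> m0 by (intro divide_right_mono) auto
      finally have "Rad \<alpha> \<le> \<Lambda> / (2 * m)" by (simp add: Rad_def)
      then show "Rad \<alpha> < real (Suc n) * (\<rho> / 4)" using nR by linarith
    qed
    have local: "\<exists>F\<subseteq>{w \<in> mspace Y. mdist Y y w < Rad \<alpha> \<and> mdist Y w u \<le> \<rho>}. finite F \<and> card F \<le> nat \<lfloor>D ^ i\<rfloor> \<and>
       (\<forall>w\<in>mspace Y. mdist Y y w < Rad \<alpha> \<and> mdist Y w u \<le> \<rho> \<longrightarrow> (\<exists>v\<in>F. mdist Y w v \<le> 6 * \<rho> / 4 ^ i))"
      if u: "u \<in> mspace Y" "mdist Y y u < Rad \<alpha>" and i: "1 \<le> i" for u i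
    proof -
      let ?S = "{w \<in> mspace Y. mdist Y y w < Rad \<alpha> \<and> mdist Y w u \<le> \<rho>}"
      have "u \<in> snd ` U \<alpha>" using u snd_U[OF \<alpha>'] by auto
      then obtain r where r: "(r, u) \<in> U \<alpha>" by auto
      have "cyl (r, u) c \<subseteq> U 0" by (rule clearance[OF _ \<alpha> st r c]) simp
      then have sub: "cyl (r, u) ((3 * doubling_clearance m M + 1) * \<rho>) \<subseteq> lpts X"
        using \<rho>(2) U_zero by (simp add: C_def)
      have bound: "card F \<le> nat \<lfloor>D ^ i\<rfloor>"
        if F: "finite F" "F \<subseteq> ?S" "\<And>v w. v \<in> F \<Longrightarrow> w \<in> F \<Longrightarrow> v \<noteq> w \<Longrightarrow> 6 * \<rho> / 4 ^ i < mdist Y v w" for F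
      proof -
        have "real (card F) \<le> D ^ i"
          unfolding D_def by (rule packing[OF \<Lambda> td rad full N TM u(1) \<rho>(1) sub F(1) _ i F(3)]) (use F(2) in auto)
        then show ?thesis by (simp add: le_nat_floor)
      qed
      show ?thesis
      proof (rule maximal_separated_cover[of ?S "6 * \<rho> / 4 ^ i" "mdist Y", OF bound])
        show "mdist Y v w = mdist Y w v" for v w by (rule mdist_commute)
        show "mdist Y v v \<le> 6 * \<rho> / 4 ^ i" if "v \<in> ?S" for v
        proof -
          have "mdist Y v v = 0" using that by simp
          then show ?thesis using \<rho> by (simp del: mdist_zero)
        qed
        fix F assume "finite F" "F \<subseteq> ?S" "card F \<le> nat \<lfloor>D ^ i\<rfloor>" "\<And>v. v \<in> ?S \<Longrightarrow> \<exists>u\<in>F. mdist Y v u \<le> 6 * \<rho> / 4 ^ i"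
        then show ?thesis by (intro exI[of _ F]) blast
      qed
    qed
    have "\<exists>F\<subseteq>{w \<in> mspace Y. mdist Y y w < Rad \<alpha>}. finite F \<and> card F \<le> P1 ^ n \<and>
       (\<forall>w\<in>mspace Y. mdist Y y w < Rad \<alpha> \<and> mdist Y y w < real (Suc n) * (\<rho> / 4) \<longrightarrow> (\<exists>v\<in>F. mdist Y w v \<le> \<rho> / 2))"
    proof (rule length_space_chain_cover[OF Ysp yY \<rho>(1) RadR(1)])
      fix u assume u: "u \<in> mspace Y" "mdist Y y u < Rad \<alpha>"
      obtain F where F: "F \<subseteq> {w \<in> mspace Y. mdist Y y w < Rad \<alpha> \<and> mdist Y w u \<le> \<rho>}" "finite F" "card F \<le> P1"
        "\<forall>w\<in>mspace Y. mdist Y y w < Rad \<alpha> \<and> mdist Y w u \<le> \<rho> \<longrightarrow> (\<exists>v\<in>F. mdist Y w v \<le> 6 * \<rho> / 4 ^ 2)"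
        using local[OF u, of 2] unfolding P1_def by auto
      have "6 * \<rho> / 4 ^ 2 \<le> \<rho> / 2" using \<rho> by simp
      then have "\<forall>w\<in>mspace Y. mdist Y y w < Rad \<alpha> \<and> mdist Y w u \<le> \<rho> \<longrightarrow> (\<exists>v\<in>F. mdist Y w v \<le> \<rho> / 2)"
        using F(4) by (meson order_trans)
      then show "\<exists>F\<subseteq>{w \<in> mspace Y. mdist Y y w < Rad \<alpha> \<and> mdist Y w u \<le> \<rho>}. finite F \<and> card F \<le> P1 \<and>
          (\<forall>w\<in>mspace Y. mdist Y y w < Rad \<alpha> \<and> mdist Y w u \<le> \<rho> \<longrightarrow> (\<exists>v\<in>F. mdist Y w v \<le> \<rho> / 2))"
        using F(1-3) by (intro exI[of _ F]) blast
    qed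
    then obtain F where F: "F \<subseteq> {w \<in> mspace Y. mdist Y y w < Rad \<alpha>}" "finite F" "card F \<le> P1 ^ n"
       "\<And>w. w \<in> mspace Y \<Longrightarrow> mdist Y y w < Rad \<alpha> \<Longrightarrow> \<exists>v\<in>F. mdist Y w v \<le> \<rho> / 2"
      using RadR(2) by (metis (no_types, lifting) less_trans)
    define B where "B = (\<lambda>u G. G \<subseteq> {w \<in> mspace Y. mdist Y y w < Rad \<alpha> \<and> mdist Y w u \<le> \<rho>} \<and> finite G \<and> card G \<le> P2 \<and>
       (\<forall>w\<in>mspace Y. mdist Y y w < Rad \<alpha> \<and> mdist Y w u \<le> \<rho> \<longrightarrow> (\<exists>v\<in>G. mdist Y w v \<le> 6 * \<rho> / 4 ^ j)))"
    have "\<exists>G. B u G" if "u \<in> F" for u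
      using local[of u j] F(1) that unfolding B_def P2_def by (auto simp: j_def)
    then obtain G where G: "\<And>u. u \<in> F \<Longrightarrow> B u (G u)" by metis
    have fc: "finite (\<Union>u\<in>F. G u) \<and> card (\<Union>u\<in>F. G u) \<le> P1 ^ n * P2"
      using G by (intro card_UN_le_mult F) (auto simp: B_def)
    show "\<exists>F. finite F \<and> card F \<le> P1 ^ n * P2 \<and> F \<subseteq> mspace Y \<and>
       (\<forall>x\<in>chron_diamond (generalized_cone J Y f) (s0 + \<alpha>, y) (t0 - \<alpha>, y). \<exists>v\<in>F. mdist Y (snd x) v \<le> \<eta>)"
    proof (intro exI[of _ "\<Union>u\<in>F. G u"] conjI ballI)
      show "finite (\<Union>u\<in>F. G u)" "card (\<Union>u\<in>F. G u) \<le> P1 ^ n * P2" using fc by auto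
      show "(\<Union>u\<in>F. G u) \<subseteq> mspace Y" using G by (auto simp: B_def)
      fix x assume "x \<in> chron_diamond (generalized_cone J Y f) (s0 + \<alpha>, y) (t0 - \<alpha>, y)"
      then have "snd x \<in> snd ` U \<alpha>" unfolding U_def W_def by blast
      then have w: "snd x \<in> mspace Y" "mdist Y y (snd x) < Rad \<alpha>" using snd_U[OF \<alpha>'] by auto
      obtain u where u: "u \<in> F" "mdist Y (snd x) u \<le> \<rho> / 2" using F(4)[OF w] by blast
      then have "mdist Y (snd x) u \<le> \<rho>" using \<rho> by simp
      then obtain v where "v \<in> G u" "mdist Y (snd x) v \<le> 6 * \<rho> / 4 ^ j" using G[OF u(1)] w unfolding B_def by blast
      then show "\<exists>v\<in>\<Union>u\<in>F. G u. mdist Y (snd x) v \<le> \<eta>" using u(1) j by force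
    qed
  qed
qed

text \<open>Diamonds are spanned by points above and below a grid of times over a net of the fibre.
  Their height is three grid steps, which bounds their time separation; moving some vertices to the
  tips of \<open>U \<alpha>\<close> makes all of them tame without enlarging \<tau>.\<close>

theorem uniform_net:
  fixes m M K N \<Lambda> \<alpha> \<beta> \<epsilon> :: real
  assumes mM: "0 < m" "m \<le> M" and N: "0 < N" and \<Lambda>: "0 \<le> \<Lambda>" and \<beta>: "0 < \<beta>" "\<beta> < \<alpha>" and \<epsilon>: "0 < \<epsilon>"
  shows "\<exists>P::nat. \<forall>J (Y :: 'y metric) f s0 t0 y X \<mm>. cone_diamond J Y f s0 t0 m M y X \<longrightarrow> tau_diam X (lpts X) \<le> ennreal \<Lambda> \<longrightarrow>
     radon_measure (ltop X) \<mm> \<longrightarrow> full_support (ltop X) \<mm> \<longrightarrow> TMCPe K N X \<mm> \<longrightarrow> TMCPe K N (lreverse X) \<mm> \<longrightarrow> s0 + \<alpha> < t0 - \<alpha> \<longrightarrow>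
     (\<exists>S. finite S \<and> card S \<le> P \<and>
       S \<subseteq> chron_diamond (generalized_cone J Y f) (s0 + \<beta>, y) (t0 - \<beta>, y) \<times> chron_diamond (generalized_cone J Y f) (s0 + \<beta>, y) (t0 - \<beta>, y) \<and>
       is_net X (chron_diamond (generalized_cone J Y f) (s0 + \<alpha>, y) (t0 - \<alpha>, y)) \<epsilon> S \<and>
       (\<forall>(p, q)\<in>S. past_tame X (chron_diamond (generalized_cone J Y f) (s0 + \<alpha>, y) (t0 - \<alpha>, y)) p \<and>
          future_tame X (chron_diamond (generalized_cone J Y f) (s0 + \<alpha>, y) (t0 - \<alpha>, y)) q))"
proof -
  have M0: "0 < M" and \<alpha>0: "0 < \<alpha>" using mM \<beta> by auto
  obtain c where c: "0 < c" "c / m + c < (\<alpha> - \<beta>) / M" "c < \<alpha> - \<beta>"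
    using exists_clearance[OF mM(1) M0, of "\<alpha> - \<beta>"] \<beta> by auto
  \<comment> \<open>The grid step: \<open>3 * g \<le> \<epsilon>\<close> bounds the height of a
    diamond, and \<open>2 * g \<le> c\<close> keeps its vertices within the clearance of the point
    that it covers. The fibre mesh \<eta> below is so fine that \<open>M * (2 * \<eta>) < g\<close>,
    hence a time gap of \<open>g\<close> suffices for chronology.\<close>
  define g where "g = min (\<epsilon> / 3) (c / 2)"
  have g: "0 < g" "3 * g \<le> \<epsilon>" "2 * g \<le> c" using c \<epsilon> by (auto simp: g_def)
  define \<eta> where "\<eta> = min (g / (4 * M)) c"
  have \<eta>: "0 < \<eta>" "\<eta> \<le> c" using g c M0 by (auto simp: \<eta>_def)
  have M\<eta>: "M * (2 * \<eta>) < g"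
  proof -
    have "\<eta> \<le> g / (4 * M)" by (simp add: \<eta>_def)
    then have "\<eta> * (4 * M) \<le> g" using M0 by (subst (asm) pos_le_divide_eq) auto
    then show ?thesis using g M0 \<eta> by (simp add: algebra_simps)
  qed
  obtain P0 :: nat where P0: "\<forall>J (Y :: 'y metric) f s0 t0 y X \<mm>. cone_diamond J Y f s0 t0 m M y X \<longrightarrow> tau_diam X (lpts X) \<le> ennreal \<Lambda> \<longrightarrow>
     radon_measure (ltop X) \<mm> \<longrightarrow> full_support (ltop X) \<mm> \<longrightarrow> TMCPe K N X \<mm> \<longrightarrow> TMCPe K N (lreverse X) \<mm> \<longrightarrow> s0 + \<alpha> < t0 - \<alpha> \<longrightarrow>
     (\<exists>F. finite F \<and> card F \<le> P0 \<and> F \<subseteq> mspace Y \<and> (\<forall>x\<in>chron_diamond (generalized_cone J Y f) (s0 + \<alpha>, y) (t0 - \<alpha>, y). \<exists>v\<in>F. mdist Y (snd x) v \<le> \<eta>))"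
    using uniform_base_cover[OF mM N \<Lambda> \<alpha>0 \<eta>(1), of K, where ?'y = 'y] by (elim exE)
  define n where "n = nat \<lfloor>\<Lambda> / g\<rfloor>"
  show ?thesis
  proof (intro exI[of _ "Suc n * P0"] allI impI)
    fix J Y f s0 t0 y X and \<mm> :: "(real \<times> 'y) measure"
    assume loc: "cone_diamond J (Y :: 'y metric) f s0 t0 m M y X" and td: "tau_diam X (lpts X) \<le> ennreal \<Lambda>"
      and rad: "radon_measure (ltop X) \<mm>" and full: "full_support (ltop X) \<mm>" and TM: "TMCPe K N X \<mm>" "TMCPe K N (lreverse X) \<mm>"
      and st: "s0 + \<alpha> < t0 - \<alpha>"
    interpret cone_diamond J Y f s0 t0 m M y X by (rule loc)
    note \<alpha>' = less_imp_le[OF \<alpha>0] st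
    have \<beta>': "0 \<le> \<beta>" "s0 + \<beta> < t0 - \<beta>" using \<beta> st by auto
    have UX: "U \<beta> \<subseteq> lpts X" using U_antimono[OF _ \<beta>(1) \<beta>'(2)] U_zero by simp
    obtain F where F: "finite F" "card F \<le> P0" "F \<subseteq> mspace Y" "\<forall>x\<in>U \<alpha>. \<exists>v\<in>F. mdist Y (snd x) v \<le> \<eta>"
      using P0[rule_format, OF loc td rad full TM st] unfolding U_def W_def by (elim exE conjE)
    define a where "a = (s0 + \<alpha>, y)"
    define b where "b = (t0 - \<alpha>, y)"
    have ab: "a \<in> slab" "b \<in> slab" unfolding a_def b_def by (rule tips_slab[OF \<alpha>'])+
    have Tab: "T (s0 + \<beta>) < T (s0 + \<alpha>)" "T (s0 + \<alpha>) < T (t0 - \<alpha>)" "T (t0 - \<alpha>) < T (t0 - \<beta>)"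
      using \<beta> st by (auto intro!: T_strict_mono)
    have abU: "a \<in> U \<beta>" "b \<in> U \<beta>"
      using ab Tab by (auto simp: mem_U[OF \<beta>'] a_def b_def slack_def mdist_base)
    \<comment> \<open>A point at height between \<open>i * g\<close> and \<open>(i + 1) * g\<close>
      is at least \<open>g\<close> and at most \<open>2 * g\<close> away in time from both
      vertices.\<close>
    define pt where "pt = (\<lambda>(i :: nat, v :: 'y). (s0 + (real i - 1) * g, v))"
    define qt where "qt = (\<lambda>(i :: nat, v :: 'y). (s0 + (real i + 2) * g, v))"
    \<comment> \<open>A vertex chronologically before the lower tip has time separation at least its
      positive distance to the tip from every point of \<open>U \<alpha>\<close>, so it cannot be
      tame; the tip replaces it. The upper vertices are treated dually.\<close>
    define pa where "pa = (\<lambda>z. if 0 < slack (pt z) a then a else pt z)"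
    define qa where "qa = (\<lambda>z. if 0 < slack b (qt z) then b else qt z)"
    define v where "v = (\<lambda>x :: real \<times> 'y. SOME v. v \<in> F \<and> mdist Y (snd x) v \<le> \<eta>)"
    have v: "v x \<in> F" "mdist Y (snd x) (v x) \<le> \<eta>" if "x \<in> U \<alpha>" for x
      using someI_ex[of "\<lambda>v. v \<in> F \<and> mdist Y (snd x) v \<le> \<eta>"] F(4) that unfolding v_def by blast+
    define ix where "ix = (\<lambda>x :: real \<times> 'y. (nat \<lfloor>(fst x - s0) / g\<rfloor>, v x))"
    have facts: "ix x \<in> {..n} \<times> F" "pt (ix x) \<in> U \<beta>" "qt (ix x) \<in> U \<beta>" "0 < slack (pt (ix x)) x" "0 < slack x (qt (ix x))"
      if x: "x \<in> U \<alpha>" for x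
    proof -
      have xs: "x \<in> slab" using U_slab[OF \<alpha>' x] .
      obtain r w where xx: "x = (r, w)" by (cases x)
      have r: "s0 \<le> r" "r \<le> t0" and w: "w \<in> mspace Y" using xs by (auto simp: slab_def xx)
      define i where "i = nat \<lfloor>(r - s0) / g\<rfloor>"
      have fl: "real i = of_int \<lfloor>(r - s0) / g\<rfloor>" using r g by (simp add: i_def)
      have "real i \<le> (r - s0) / g" "(r - s0) / g < real i + 1" unfolding fl by linarith+
      then have i: "real i * g \<le> r - s0" "r - s0 < (real i + 1) * g" using g by (auto simp: le_divide_eq divide_less_eq)
      have "i \<le> n"
      proof -
        have "(r - s0) / g \<le> \<Lambda> / g" using r height_le[OF \<Lambda> td] g by (intro divide_right_mono) auto
        then show ?thesis unfolding i_def n_def by (intro nat_mono floor_mono)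
      qed
      then show "ix x \<in> {..n} \<times> F" using v(1)[OF x] by (simp add: ix_def xx i_def)
      have vY: "v x \<in> mspace Y" and dv: "mdist Y w (v x) \<le> \<eta>" "mdist Y (v x) w \<le> \<eta>"
        using v[OF x] F(3) by (auto simp: xx mdist_commute)
      have pe: "pt (ix x) = (s0 + (real i - 1) * g, v x)" and qe: "qt (ix x) = (s0 + (real i + 2) * g, v x)"
        by (auto simp: pt_def qt_def ix_def i_def xx)
      have dp: "g \<le> r - (s0 + (real i - 1) * g)" "r - (s0 + (real i - 1) * g) \<le> 2 * g"
        and dq: "g \<le> (s0 + (real i + 2) * g) - r" "(s0 + (real i + 2) * g) - r \<le> 2 * g"
        using i by (auto simp: algebra_simps)
      have cyl: "cyl x c \<subseteq> U \<beta>" by (rule clearance[OF \<beta>'(1) \<beta>(2) st x c])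
      have "pt (ix x) \<in> cyl x c" "qt (ix x) \<in> cyl x c"
        unfolding pe qe using dp dq g \<eta> vY dv by (auto simp: cyl_def xx)
      then show pq: "pt (ix x) \<in> U \<beta>" "qt (ix x) \<in> U \<beta>" using cyl by auto
      then have pqs: "pt (ix x) \<in> slab" "qt (ix x) \<in> slab" using U_slab[OF \<beta>'] by auto
      have d2: "mdist Y (v x) w < 2 * \<eta>" "mdist Y w (v x) < 2 * \<eta>" using dv \<eta> by auto
      have pqs': "(s0 + (real i - 1) * g, v x) \<in> slab" "(s0 + (real i + 2) * g, v x) \<in> slab" "(r, w) \<in> slab"
        using pqs xs unfolding pe qe by (simp_all add: xx)
      have "lchron W (s0 + (real i - 1) * g, v x) (r, w)"
        by (rule tau_ge(2)[OF pqs'(1,3) d2(1)]) (use M\<eta> dp in auto)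
      then have "lchron W (pt (ix x)) x" unfolding pe by (simp add: xx)
      then show "0 < slack (pt (ix x)) x" using chron_iff_slack[OF WL pqs(1) xs] by simp
      have "lchron W (r, w) (s0 + (real i + 2) * g, v x)"
        by (rule tau_ge(2)[OF pqs'(3,2) d2(2)]) (use M\<eta> dq in auto)
      then have "lchron W x (qt (ix x))" unfolding qe by (simp add: xx)
      then show "0 < slack x (qt (ix x))" using chron_iff_slack[OF WL xs pqs(2)] by simp
    qed
    \<comment> \<open>Only grid indices of actual points of \<open>U \<alpha>\<close> are used, so
      that every diamond meets \<open>U \<alpha>\<close>.\<close>
    define S where "S = (\<lambda>z. (pa z, qa z)) ` ix ` U \<alpha>"
    have ixU: "ix ` U \<alpha> \<subseteq> {..n} \<times> F" using facts(1) by blast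
    have fin: "finite ({..n} \<times> F)" using F(1) by simp
    have Sfin: "finite S" unfolding S_def using finite_subset[OF ixU fin] by simp
    have "card S \<le> card (ix ` U \<alpha>)" unfolding S_def using finite_subset[OF ixU fin] by (rule card_image_le)
    also have "\<dots> \<le> card ({..n} \<times> F)" by (rule card_mono[OF fin ixU])
    also have "\<dots> \<le> Suc n * P0" using F(2) by (simp only: card_cartesian_product card_atMost mult_le_mono2)
    finally have Scard: "card S \<le> Suc n * P0" .
    have main: "pa (ix x) \<in> U \<beta> \<and> qa (ix x) \<in> U \<beta> \<and> lcaus W (pa (ix x)) x \<and> lcaus W x (qa (ix x)) \<and>
       ltau W (pa (ix x)) (qa (ix x)) \<le> ennreal \<epsilon> \<and> past_tame X (U \<alpha>) (pa (ix x)) \<and> future_tame X (U \<alpha>) (qa (ix x))"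
      if x: "x \<in> U \<alpha>" for x
    proof -
      let ?p = "pt (ix x)" and ?q = "qt (ix x)"
      note f = facts[OF x]
      have xs: "x \<in> slab" and ax: "0 < slack a x" and xb: "0 < slack x b"
        using x mem_U[OF \<alpha>'] by (auto simp: a_def b_def)
      have ps: "?p \<in> slab" "?q \<in> slab" using f U_slab[OF \<beta>'] by auto
      have pp: "pa (ix x) \<in> slab" "qa (ix x) \<in> slab" using ps ab by (auto simp: pa_def qa_def)
      have sp: "0 < slack (pa (ix x)) x" "0 < slack x (qa (ix x))" using f ax xb by (auto simp: pa_def qa_def)
      have cx: "lcaus W (pa (ix x)) x" "lcaus W x (qa (ix x))"
        using slack_pos_imp(2)[OF pp(1) xs sp(1)] slack_pos_imp(2)[OF xs pp(2) sp(2)] by auto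
      have lp: "?p \<in> lpts W" "?q \<in> lpts W" "pa (ix x) \<in> lpts W" "qa (ix x) \<in> lpts W" "x \<in> lpts W"
        using ps pp xs slab_lpts by auto
      have c1: "lcaus W ?p (pa (ix x))"
        using slack_pos_imp(2)[OF ps(1) ab(1)] is_lplsD(2)[OF WL lp(1,1)] by (auto simp: pa_def)
      have c2: "lcaus W (qa (ix x)) ?q"
        using slack_pos_imp(2)[OF ab(2) ps(2)] is_lplsD(2)[OF WL lp(2,2)] by (auto simp: qa_def)
      have c3: "lcaus W (pa (ix x)) (qa (ix x))" using is_lplsD(5)[OF WL lp(3,5,4)] cx by blast
      have c4: "lcaus W ?p (qa (ix x))" using is_lplsD(5)[OF WL lp(1,3,4)] c1 c3 by blast
      \<comment> \<open>Replaced vertices lie causally inside the original grid diamond, so the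
        reverse triangle inequality bounds the new time separation by the old one.\<close>
      have "ltau W (pa (ix x)) (qa (ix x)) \<le> ltau W ?p (pa (ix x)) + ltau W (pa (ix x)) (qa (ix x))"
        by (rule add_increasing) auto
      also have "\<dots> \<le> ltau W ?p (qa (ix x))" by (rule is_lplsD(6)[OF WL lp(1,3,4) c1 c3])
      also have "\<dots> \<le> ltau W ?p (qa (ix x)) + ltau W (qa (ix x)) ?q" by (rule add_increasing2) auto
      also have "\<dots> \<le> ltau W ?p ?q" by (rule is_lplsD(6)[OF WL lp(1,4,2) c4 c2])
      also have "\<dots> \<le> ennreal (fst ?q - fst ?p)" by (rule tau_le_height[OF ps])
      also have "fst ?q - fst ?p = 3 * g" by (simp add: pt_def qt_def case_prod_beta algebra_simps)
      also have "ennreal (3 * g) \<le> ennreal \<epsilon>" using g by (intro ennreal_leI) auto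
      finally have t: "ltau W (pa (ix x)) (qa (ix x)) \<le> ennreal \<epsilon>" .
      have "slack (pa (ix x)) a \<le> 0" "slack b (qa (ix x)) \<le> 0"
        by (auto simp: pa_def qa_def) (auto simp: slack_def a_def b_def mdist_base)
      then have "past_tame X (U \<alpha>) (pa (ix x))" "future_tame X (U \<alpha>) (qa (ix x))"
        using tame_past_vertex[OF \<alpha>' pp(1) x sp(1)] tame_future_vertex[OF \<alpha>' pp(2) x sp(2)] by (auto simp: a_def b_def)
      moreover have "pa (ix x) \<in> U \<beta>" "qa (ix x) \<in> U \<beta>" using f abU by (auto simp: pa_def qa_def)
      ultimately show ?thesis using cx t by blast
    qed
    have net: "is_net X (U \<alpha>) \<epsilon> S"
      unfolding is_net_def
    proof (intro conjI)
      show "S \<subseteq> lpts X \<times> lpts X" using main UX by (auto simp: S_def)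
      have mem: "x \<in> caus_diamond X (pa (ix x)) (qa (ix x))" if x: "x \<in> U \<alpha>" for x
        using main[OF x] UX U_antimono[OF \<beta>'(1) \<beta>(2) st] x
        by (auto simp: caus_diamond_def caus_future_def caus_past_def X_simps)
      show "\<forall>(p, q)\<in>S. ltau X p q \<le> ennreal \<epsilon> \<and> U \<alpha> \<inter> caus_diamond X p q \<noteq> {}"
        using main mem by (auto simp: S_def X_simps)
      show "U \<alpha> \<subseteq> (\<Union>(p, q)\<in>S. caus_diamond X p q)"
        using mem by (auto simp: S_def)
    qed
    show "\<exists>S. finite S \<and> card S \<le> Suc n * P0 \<and>
       S \<subseteq> chron_diamond (generalized_cone J Y f) (s0 + \<beta>, y) (t0 - \<beta>, y) \<times> chron_diamond (generalized_cone J Y f) (s0 + \<beta>, y) (t0 - \<beta>, y) \<and>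
       is_net X (chron_diamond (generalized_cone J Y f) (s0 + \<alpha>, y) (t0 - \<alpha>, y)) \<epsilon> S \<and>
       (\<forall>(p, q)\<in>S. past_tame X (chron_diamond (generalized_cone J Y f) (s0 + \<alpha>, y) (t0 - \<alpha>, y)) p \<and>
          future_tame X (chron_diamond (generalized_cone J Y f) (s0 + \<alpha>, y) (t0 - \<alpha>, y)) q)"
      unfolding W_def[symmetric] U_def[symmetric]
    proof (intro exI[of _ S] conjI Sfin Scard net)
      show "S \<subseteq> U \<beta> \<times> U \<beta>" using main by (auto simp: S_def)
      show "\<forall>(p, q)\<in>S. past_tame X (U \<alpha>) p \<and> future_tame X (U \<alpha>) q" using main by (auto simp: S_def)
    qed
  qed
qed

section \<open>Limits of labelled vertex systems\<close>

text \<open>Since the limit space may be chosen freely, it is built from the labels \<open>a\<close> of the vertices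
  \<open>x n a\<close> alone, with the discrete metric, for which lower semicontinuity is no condition; forward
  density is achieved by making every label of \<open>U\<^sub>k\<close> a vertex eventually.\<close>

locale vertex_system =
  fixes X :: "nat \<Rightarrow> 'a lpls" and U :: "nat \<Rightarrow> nat \<Rightarrow> 'a set" and act :: "'l::countable set"
    and lev :: "'l \<Rightarrow> nat" and x :: "nat \<Rightarrow> 'l \<Rightarrow> 'a" and D :: "nat \<Rightarrow> nat \<Rightarrow> ('l \<times> 'l) set"
    and t :: "'l \<Rightarrow> 'l \<Rightarrow> real" and c :: "'l \<Rightarrow> 'l \<Rightarrow> bool"
  assumes cov: "is_covered_lpls (X n, U n)"
    and fin_tau: "p \<in> lpts (X n) \<Longrightarrow> q \<in> lpts (X n) \<Longrightarrow> ltau (X n) p q < \<top>"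
    and x_U: "a \<in> act \<Longrightarrow> x n a \<in> U n (lev a)"
    and t_lim: "a \<in> act \<Longrightarrow> b \<in> act \<Longrightarrow> (\<lambda>n. enn2real (ltau (X n) (x n a) (x n b))) \<longlonglongrightarrow> t a b"
    and c_lim: "a \<in> act \<Longrightarrow> b \<in> act \<Longrightarrow> \<forall>\<^sub>F n in sequentially. lcaus (X n) (x n a) (x n b) = c a b"
    and D_fin: "finite (D k l)"
    and D_act: "D k l \<subseteq> act \<times> act"
    and D_mono: "vertices (D k l) \<subseteq> vertices (D k (Suc l))"
    and D_exhaust: "a \<in> act \<Longrightarrow> lev a \<le> k \<Longrightarrow> \<exists>l. a \<in> vertices (D k l)"
    and D_net: "\<forall>\<^sub>F n in sequentially. is_net (X n) (U n k) (1 / real (Suc l)) ((\<lambda>(p, q). (x n p, x n q)) ` D k l)"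
    and D_wit: "(a, b) \<in> D k l \<Longrightarrow>
      \<exists>d\<in>act. lev d \<le> k \<and> (\<forall>n. lcaus (X n) (x n a) (x n d) \<and> lcaus (X n) (x n d) (x n b))"
begin

definition code :: "'l \<Rightarrow> real" where "code a = real (to_nat a)"

text \<open>Chronology is read off from the limit time separation and not defined as a limit of
  chronologies: time separations of chronological pairs may tend to 0, and then positivity of \<tau>
  would no longer characterize the relation. Causality is the eventual truth value.\<close>

definition Z :: "real lpls" where
  "Z = \<lparr>lmet = metric (code ` act, discrete_metric.dd), lchron = (\<lambda>u v. 0 < t (inv code u) (inv code v)),
        lcaus = (\<lambda>u v. c (inv code u) (inv code v)), ltau = (\<lambda>u v. ennreal (t (inv code u) (inv code v)))\<rparr>"

definition UZ :: "nat \<Rightarrow> real set" where "UZ k = code ` {a \<in> act. lev a \<le> k}"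

lemma inj_code: "inj code" by (auto simp: code_def inj_def)

lemma inv_code [simp]: "inv code (code a) = a" using inj_code by simp

lemma mtopology_Z: "lpts Z = code ` act" "ltop Z = discrete_topology (code ` act)"
proof -
  show "lpts Z = code ` act"
    by (simp add: Z_def Metric_space.mspace_metric[OF metric_M_dd])
  have "mspace (metric (code ` act, discrete_metric.dd :: real \<Rightarrow> _)) = code ` act"
    "mdist (metric (code ` act, discrete_metric.dd :: real \<Rightarrow> _)) = discrete_metric.dd"
    by (simp_all add: Metric_space.mspace_metric[OF metric_M_dd] Metric_space.mdist_metric[OF metric_M_dd])
  then show "ltop Z = discrete_topology (code ` act)"
    by (simp add: Z_def mtopology_of_def discrete_metric.mtopology_discrete_metric)
qed

lemma Z_simps [simp]:
  "lchron Z (code a) (code b) \<longleftrightarrow> 0 < t a b" "lcaus Z (code a) (code b) \<longleftrightarrow> c a b"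
  "ltau Z (code a) (code b) = ennreal (t a b)"
  by (simp_all add: Z_def)

lemma lpls: "is_lpls (X n)" and U_mono: "i \<le> k \<Longrightarrow> U n i \<subseteq> U n k" and U_lpts: "U n k \<subseteq> lpts (X n)"
proof -
  show "is_lpls (X n)" using cov[of n] by (simp add: is_covered_lpls_def)
  have "U n k \<subseteq> U n (Suc k)" for k using cov[of n] by (simp add: is_covered_lpls_def)
  then show "i \<le> k \<Longrightarrow> U n i \<subseteq> U n k" using lift_Suc_mono_le[of "U n"] by blast
  show "U n k \<subseteq> lpts (X n)" using cov[of n] by (auto simp: is_covered_lpls_def)
qed

lemma x_lpts: "a \<in> act \<Longrightarrow> x n a \<in> lpts (X n)" using x_U U_lpts by blast

lemma t_nonneg: "a \<in> act \<Longrightarrow> b \<in> act \<Longrightarrow> 0 \<le> t a b"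
  by (rule LIMSEQ_le_const[OF t_lim]) auto

lemma ltau_real: "a \<in> act \<Longrightarrow> b \<in> act \<Longrightarrow> ltau (X n) (x n a) (x n b) = ennreal (enn2real (ltau (X n) (x n a) (x n b)))"
  using fin_tau[OF x_lpts x_lpts] by simp

lemma c_trans:
  assumes a: "a \<in> act" "b \<in> act" "d \<in> act" and c: "c a b" "c b d"
  shows "c a d" and "t a b + t b d \<le> t a d"
proof -
  have "\<forall>\<^sub>F n in sequentially. lcaus (X n) (x n a) (x n b) \<and> lcaus (X n) (x n b) (x n d) \<and> lcaus (X n) (x n a) (x n d) = c a d"
    using c_lim[OF a(1,2)] c_lim[OF a(2,3)] c_lim[OF a(1,3)] by eventually_elim (use c in auto)
  then have ev: "\<forall>\<^sub>F n in sequentially. c a d \<and>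
      enn2real (ltau (X n) (x n a) (x n b)) + enn2real (ltau (X n) (x n b) (x n d)) \<le> enn2real (ltau (X n) (x n a) (x n d))"
  proof (rule eventually_mono)
    fix n assume n: "lcaus (X n) (x n a) (x n b) \<and> lcaus (X n) (x n b) (x n d) \<and> lcaus (X n) (x n a) (x n d) = c a d"
    note L = x_lpts[OF a(1), of n] x_lpts[OF a(2), of n] x_lpts[OF a(3), of n]
    have "lcaus (X n) (x n a) (x n d)" using is_lplsD(5)[OF lpls L] n by blast
    moreover have "ltau (X n) (x n a) (x n b) + ltau (X n) (x n b) (x n d) \<le> ltau (X n) (x n a) (x n d)"
      using is_lplsD(6)[OF lpls L] n by blast
    then have "enn2real (ltau (X n) (x n a) (x n b) + ltau (X n) (x n b) (x n d)) \<le> enn2real (ltau (X n) (x n a) (x n d))"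
      using fin_tau[OF L(1,3)] by (intro enn2real_mono)
    ultimately show "c a d \<and>
      enn2real (ltau (X n) (x n a) (x n b)) + enn2real (ltau (X n) (x n b) (x n d)) \<le> enn2real (ltau (X n) (x n a) (x n d))"
      using n fin_tau[OF L(1,2)] fin_tau[OF L(2,3)] by (simp add: enn2real_plus)
  qed
  then show "c a d" using eventually_happens'[OF sequentially_bot ev] by auto
  show "t a b + t b d \<le> t a d"
    by (rule tendsto_le[OF _ t_lim tendsto_add[OF t_lim t_lim]]) (use a ev in \<open>auto elim: eventually_mono\<close>)
qed

lemma c_refl: "a \<in> act \<Longrightarrow> c a a"
  using eventually_happens'[OF sequentially_bot c_lim[of a a]] is_lplsD(2)[OF lpls x_lpts x_lpts] by auto

lemma t_pos_imp_c:
  assumes a: "a \<in> act" "b \<in> act" and t: "0 < t a b"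
  shows "c a b"
proof -
  have "\<forall>\<^sub>F n in sequentially. 0 < enn2real (ltau (X n) (x n a) (x n b))"
    by (rule order_tendstoD(1)[OF t_lim[OF a] t])
  then have "\<forall>\<^sub>F n in sequentially. lcaus (X n) (x n a) (x n b) \<and> lcaus (X n) (x n a) (x n b) = c a b"
    using c_lim[OF a]
  proof eventually_elim
    case (elim n)
    have "0 < ltau (X n) (x n a) (x n b)" using elim(1) by (auto simp: enn2real_positive_iff)
    then have "lchron (X n) (x n a) (x n b)" using lpls[of n] x_lpts a unfolding is_lpls_def by blast
    then have "lcaus (X n) (x n a) (x n b)" using lpls[of n] x_lpts a unfolding is_lpls_def by blast
    then show ?case using elim by simp
  qed
  then show ?thesis using eventually_happens'[OF sequentially_bot] by blast
qed

lemma is_covered_Z: "is_covered_lpls (Z, UZ)"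
proof -
  have "is_lpls Z"
    unfolding is_lpls_def mtopology_Z prod_topology_discrete_topology[symmetric]
  proof (intro conjI ballI impI allI)
    fix p q r assume "p \<in> code ` act" "q \<in> code ` act" "r \<in> code ` act"
    then obtain a b d where *: "a \<in> act" "b \<in> act" "d \<in> act" "p = code a" "q = code b" "r = code d" by auto
    show "lcaus Z p r" if "lcaus Z p q" "lcaus Z q r"
      using that c_trans(1)[OF *(1-3)] unfolding *(4-6) Z_simps by blast
    show "lchron Z p r" if "lchron Z p q" "lchron Z q r"
      using that c_trans(2)[OF *(1-3) t_pos_imp_c t_pos_imp_c] *(1-3) unfolding *(4-6) Z_simps by simp
    show "ltau Z p q + ltau Z q r \<le> ltau Z p r" if "lcaus Z p q" "lcaus Z q r"
      using that c_trans(2)[OF *(1-3)] *(1-3) t_nonneg unfolding *(4-6) Z_simps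
      by (simp add: ennreal_leI flip: ennreal_plus)
  next
    fix p q assume "p \<in> code ` act" "q \<in> code ` act"
    then obtain a b where *: "a \<in> act" "b \<in> act" "p = code a" "q = code b" by auto
    show "lchron Z p q \<Longrightarrow> lcaus Z p q" using * t_pos_imp_c by simp
    show "0 < ltau Z p q \<longleftrightarrow> lchron Z p q" using * t_nonneg by simp
  next
    fix p assume "p \<in> code ` act"
    then show "lcaus Z p p" using c_refl by auto
  qed auto
  then show ?thesis
    by (auto simp: is_covered_lpls_def UZ_def mtopology_Z)
qed

lemma vertices_act: "vertices (D k l) \<subseteq> act"
  using D_act[of k l] by (auto simp: vertices_def)

lemma finite_vertices: "finite (vertices (D k l))"
  using D_fin[of k l] by (simp add: vertices_def)

lemma vertices_image: "vertices ((\<lambda>(p, q). (h p, h q)) ` S) = h ` vertices S"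
  by (force simp: vertices_def)

text \<open>That a diamond meets \<open>UZ k\<close> cannot be read off from points varying with
  \<open>n\<close>; it needs the witness label of \<open>D_wit\<close>, the same for all
  \<open>n\<close>. Covering transfers because finitely many causal relations are eventually those
  of the limit.\<close>

lemma net_Z: "is_net Z (UZ k) (1 / real (Suc l)) ((\<lambda>(p, q). (code p, code q)) ` D k l)"
  unfolding is_net_def
proof (intro conjI)
  show "(\<lambda>(p, q). (code p, code q)) ` D k l \<subseteq> lpts Z \<times> lpts Z" using D_act by (force simp: mtopology_Z)
  have "t p q \<le> 1 / real (Suc l) \<and> UZ k \<inter> caus_diamond Z (code p) (code q) \<noteq> {}" if pq: "(p, q) \<in> D k l" for p q
  proof
    have a: "p \<in> act" "q \<in> act" using pq D_act by auto
    have "\<forall>\<^sub>F n in sequentially. enn2real (ltau (X n) (x n p) (x n q)) \<le> 1 / real (Suc l)"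
      using D_net[of k l]
    proof eventually_elim
      case (elim n)
      then have "ltau (X n) (x n p) (x n q) \<le> ennreal (1 / real (Suc l))" using pq by (auto simp: is_net_def)
      then show ?case by (intro enn2real_leI) auto
    qed
    then show "t p q \<le> 1 / real (Suc l)" by (intro tendsto_upperbound[OF t_lim[OF a]]) auto
    obtain w where w: "w \<in> act" "lev w \<le> k" "\<And>n. lcaus (X n) (x n p) (x n w) \<and> lcaus (X n) (x n w) (x n q)"
      using D_wit[OF pq] by blast
    have "c p w" "c w q"
      using eventually_happens'[OF sequentially_bot c_lim[OF a(1) w(1)]] eventually_happens'[OF sequentially_bot c_lim[OF w(1) a(2)]] w(3) by auto
    then have "code w \<in> UZ k \<inter> caus_diamond Z (code p) (code q)"
      using w a by (auto simp: UZ_def caus_diamond_def caus_future_def caus_past_def mtopology_Z)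
    then show "UZ k \<inter> caus_diamond Z (code p) (code q) \<noteq> {}" by blast
  qed
  then show "\<forall>(p, q)\<in>(\<lambda>(p, q). (code p, code q)) ` D k l.
      ltau Z p q \<le> ennreal (1 / real (Suc l)) \<and> UZ k \<inter> caus_diamond Z p q \<noteq> {}"
    by (auto intro!: ennreal_leI)
  show "UZ k \<subseteq> (\<Union>(p, q)\<in>(\<lambda>(p, q). (code p, code q)) ` D k l. caus_diamond Z p q)"
  proof
    \<comment> \<open>The relations of \<open>a\<close> to the finitely many vertices of
      \<open>D k l\<close> are eventually the limit ones, so a single late \<open>n\<close> tells
      which diamond contains \<open>a\<close>.\<close>
    fix u assume "u \<in> UZ k"
    then obtain a where a: "a \<in> act" "lev a \<le> k" "u = code a" by (auto simp: UZ_def)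
    have "\<forall>\<^sub>F n in sequentially. \<forall>z\<in>D k l. lcaus (X n) (x n (fst z)) (x n a) = c (fst z) a \<and> lcaus (X n) (x n a) (x n (snd z)) = c a (snd z)"
      using D_act[of k l] a c_lim by (intro eventually_ball_finite[OF D_fin] ballI eventually_conj) auto
    then have "\<forall>\<^sub>F n in sequentially. \<exists>z\<in>D k l. c (fst z) a \<and> c a (snd z)"
      using D_net[of k l]
    proof eventually_elim
      case (elim n)
      have "x n a \<in> U n k" using x_U[OF a(1)] U_mono[OF a(2)] by blast
      then have "x n a \<in> (\<Union>(p, q)\<in>(\<lambda>(p, q). (x n p, x n q)) ` D k l. caus_diamond (X n) p q)"
        using elim(2) unfolding is_net_def by blast
      then obtain z where "z \<in> D k l" "x n a \<in> caus_diamond (X n) (x n (fst z)) (x n (snd z))" by auto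
      then show ?case using elim(1) by (auto simp: caus_diamond_def caus_future_def caus_past_def)
    qed
    then obtain z where z: "z \<in> D k l" "c (fst z) a" "c a (snd z)" using eventually_happens'[OF sequentially_bot] by blast
    then have "fst z \<in> act" "snd z \<in> act" using D_act[of k l] by auto
    then have "u \<in> caus_diamond Z (code (fst z)) (code (snd z))"
      using a z by (auto simp: caus_diamond_def caus_future_def caus_past_def mtopology_Z)
    then show "u \<in> (\<Union>(p, q)\<in>(\<lambda>(p, q). (code p, code q)) ` D k l. caus_diamond Z p q)"
      using z(1) by (auto intro!: bexI[of _ z] simp: case_prod_beta)
  qed
qed

lemma tau_gap_le: "0 \<le> r \<Longrightarrow> 0 \<le> s \<Longrightarrow> tau_gap (ennreal r) (ennreal s) \<le> ennreal \<bar>r - s\<bar>"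
  by (auto simp: tau_gap_def ennreal_minus intro!: ennreal_leI)

definition Rel :: "nat \<Rightarrow> nat \<Rightarrow> nat \<Rightarrow> ('a \<times> real) set" where
  "Rel k n l = (\<lambda>a. (x n a, code a)) ` vertices (D k l)"

text \<open>Only finitely many vertices occur, so the sum of all deviations dominates the supremum
  and still tends to 0.\<close>

lemma distortion_tendsto: "(\<lambda>n. distortion (X n) Z (Rel k n l)) \<longlonglongrightarrow> 0"
proof -
  let ?V = "vertices (D k l)"
  define g where "g = (\<lambda>n. \<Sum>a\<in>?V. \<Sum>b\<in>?V. \<bar>enn2real (ltau (X n) (x n a) (x n b)) - t a b\<bar>)"
  have "(\<lambda>n. \<bar>enn2real (ltau (X n) (x n a) (x n b)) - t a b\<bar>) \<longlonglongrightarrow> 0" if "a \<in> ?V" "b \<in> ?V" for a b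
    by (rule tendsto_rabs_zero[OF LIM_zero]) (use that vertices_act[of k l] in \<open>auto intro: t_lim\<close>)
  then have "g \<longlonglongrightarrow> 0" unfolding g_def by (intro tendsto_null_sum) auto
  then have g0: "(\<lambda>n. ennreal (g n)) \<longlonglongrightarrow> 0" using tendsto_ennrealI by fastforce
  have le: "distortion (X n) Z (Rel k n l) \<le> ennreal (g n)" for n
    unfolding distortion_def
  proof (rule SUP_least)
    fix z assume "z \<in> Rel k n l \<times> Rel k n l"
    then obtain a b where ab: "a \<in> ?V" "b \<in> ?V" and z: "z = ((x n a, code a), (x n b, code b))"
      by (auto simp: Rel_def)
    have act: "a \<in> act" "b \<in> act" using ab vertices_act[of k l] by auto
    have "tau_gap (ltau (X n) (x n a) (x n b)) (ennreal (t a b)) \<le> ennreal \<bar>enn2real (ltau (X n) (x n a) (x n b)) - t a b\<bar>"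
      by (subst ltau_real[OF act]) (rule tau_gap_le, use t_nonneg[OF act] in auto)
    also have "\<dots> \<le> ennreal (g n)"
    proof (rule ennreal_leI)
      have "\<bar>enn2real (ltau (X n) (x n a) (x n b)) - t a b\<bar> \<le> (\<Sum>b\<in>?V. \<bar>enn2real (ltau (X n) (x n a) (x n b)) - t a b\<bar>)"
        by (rule member_le_sum[OF ab(2)]) (auto simp: finite_vertices)
      also have "\<dots> \<le> g n" unfolding g_def
        by (rule member_le_sum[OF ab(1)]) (auto simp: finite_vertices sum_nonneg)
      finally show "\<bar>enn2real (ltau (X n) (x n a) (x n b)) - t a b\<bar> \<le> g n" .
    qed
    finally show "(case z of (x, xa) \<Rightarrow> (case x of (v, w) \<Rightarrow> \<lambda>(v', w'). tau_gap (ltau (X n) v v') (ltau Z w w')) xa) \<le> ennreal (g n)"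
      by (simp add: z)
  qed
  show ?thesis
    by (rule tendsto_sandwich[OF _ _ tendsto_const g0]) (auto simp: le)
qed

theorem converges: "LGH_converges (\<lambda>n. (X n, U n)) (Z, UZ)"
  unfolding LGH_converges_def fst_conv snd_conv
proof (intro allI)
  fix k
  define Sn where "Sn = (\<lambda>n l. (\<lambda>(p, q). (x n p, x n q)) ` D k l)"
  define S where "S = (\<lambda>l. (\<lambda>(p, q). (code p, code q)) ` D k l)"
  have vSn: "vertices (Sn n l) = x n ` vertices (D k l)" and vS: "vertices (S l) = code ` vertices (D k l)" for n l
    by (simp_all add: Sn_def S_def vertices_image)
  have corr: "correspondence (vertices (Sn n l)) (vertices (S l)) (Rel k n l)" for n l
    by (auto simp: correspondence_def vSn vS Rel_def image_image)
  have match: "matches_diamonds (Sn n l) (S l) (Rel k n l)" for n l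
  proof -
    have "(x n (fst z), code (fst z)) \<in> Rel k n l" "(x n (snd z), code (snd z)) \<in> Rel k n l" if "z \<in> D k l" for z
      using that by (auto simp: Rel_def vertices_def)
    then show ?thesis by (auto simp: matches_diamonds_def Sn_def S_def) (force intro: bexI)+
  qed
  have Rmono: "Rel k n l \<subseteq> Rel k n (Suc l)" for n l using D_mono[of k l] by (auto simp: Rel_def)
  have fd: "forward_dense Z (\<Union>l. vertices (S l)) (UZ k)"
    unfolding forward_dense_def
  proof
    fix u assume "u \<in> UZ k"
    then obtain a where a: "a \<in> act" "lev a \<le> k" "u = code a" by (auto simp: UZ_def)
    obtain l where "a \<in> vertices (D k l)" using D_exhaust[OF a(1,2)] by blast
    then show "\<exists>v :: nat \<Rightarrow> real. range v \<subseteq> (\<Union>l. vertices (S l)) \<and>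
        (\<forall>i. lcaus Z (v i) (v (Suc i)) \<and> lcaus Z (v i) u) \<and> limitin (ltop Z) v u sequentially"
      using a c_refl by (intro exI[of _ "\<lambda>_. u"]) (auto simp: vS mtopology_Z)
  qed
  show "\<exists>Sn S R. (\<forall>l. finite (S l) \<and> is_net Z (UZ k) (1 / real (Suc l)) (S l) \<and> vertices (S l) \<subseteq> vertices (S (Suc l)) \<and>
             (\<forall>\<^sub>F n in sequentially. finite (Sn n l) \<and> is_net (X n) (U n k) (1 / real (Suc l)) (Sn n l) \<and>
                vertices (Sn n l) \<subseteq> vertices (Sn n (Suc l)) \<and>
                correspondence (vertices (Sn n l)) (vertices (S l)) (R n l) \<and> R n l \<subseteq> R n (Suc l) \<and>
                matches_diamonds (Sn n l) (S l) (R n l)) \<and>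
             (\<lambda>n. distortion (X n) Z (R n l)) \<longlonglongrightarrow> 0) \<and> forward_dense Z (\<Union>l. vertices (S l)) (UZ k)"
  proof (intro exI[of _ Sn] exI[of _ S] exI[of _ "Rel k"] conjI allI fd distortion_tendsto)
    fix l
    show "finite (S l)" using D_fin by (simp add: S_def)
    show "is_net Z (UZ k) (1 / real (Suc l)) (S l)" unfolding S_def by (rule net_Z)
    show "vertices (S l) \<subseteq> vertices (S (Suc l))" using D_mono[of k l] by (auto simp: vS)
    show "\<forall>\<^sub>F n in sequentially. finite (Sn n l) \<and> is_net (X n) (U n k) (1 / real (Suc l)) (Sn n l) \<and>
                vertices (Sn n l) \<subseteq> vertices (Sn n (Suc l)) \<and>
                correspondence (vertices (Sn n l)) (vertices (S l)) (Rel k n l) \<and> Rel k n l \<subseteq> Rel k n (Suc l) \<and>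
                matches_diamonds (Sn n l) (S l) (Rel k n l)"
      using D_net[of k l]
    proof eventually_elim
      case (elim n)
      have "finite (Sn n l)" using D_fin by (simp add: Sn_def)
      moreover have "is_net (X n) (U n k) (1 / real (Suc l)) (Sn n l)" using elim by (simp add: Sn_def)
      moreover have "vertices (Sn n l) \<subseteq> vertices (Sn n (Suc l))" using D_mono[of k l] by (auto simp: vSn)
      ultimately show ?case using corr match Rmono by blast
    qed
  qed
qed

end

text \<open>Repetitions are allowed, so that nets of different cardinalities in different spaces
  share the index set \<open>{..<n}\<close>; labels must not depend on the space.\<close>

lemma finite_enumeration:
  assumes "finite S" "S \<noteq> {}" "card S \<le> n"
  obtains h :: "nat \<Rightarrow> 'b" where "h ` {..<n} = S"
proof -
  obtain g where g: "bij_betw g {0..<card S} S" using ex_bij_betw_nat_finite[OF assms(1)] by blast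
  have pos: "0 < card S" using assms by (simp add: card_gt_0_iff)
  show ?thesis
  proof (rule that[of "\<lambda>i. g (if i < card S then i else 0)"], safe)
    fix i show "g (if i < card S then i else 0) \<in> S" using g pos by (auto simp: bij_betw_def)
  next
    fix s assume "s \<in> S"
    then have "s \<in> g ` {0..<card S}" using g by (simp add: bij_betw_def)
    then obtain i where "i < card S" "g i = s" by auto
    then show "s \<in> (\<lambda>i. g (if i < card S then i else 0)) ` {..<n}"
      using assms(3) by (intro image_eqI[of _ _ i]) auto
  qed
qed

lemma diagonal_convergent:
  fixes F :: "nat \<Rightarrow> nat \<Rightarrow> real"
  assumes "\<And>k n. \<bar>F k n\<bar> \<le> B"
  shows "\<exists>r :: nat \<Rightarrow> nat. strict_mono r \<and> (\<forall>k. convergent (F k \<circ> r))"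
proof -
  interpret subseqs "\<lambda>k s. convergent (F k \<circ> s)"
  proof
    fix k and s :: "nat \<Rightarrow> nat" assume "strict_mono s"
    have "bounded (range (F k \<circ> s))" unfolding bounded_iff using assms by auto
    then show "\<exists>r'. strict_mono r' \<and> convergent (F k \<circ> (s \<circ> r'))"
      using bounded_imp_convergent_subsequence by (fastforce simp: convergent_def o_assoc)
  qed
  have "convergent (F k \<circ> diagseq)" for k
  proof -
    \<comment> \<open>Only a tail of the diagonal sequence is a subsequence of the one chosen for
      \<open>k\<close>; the shift does not affect convergence.\<close>
    have "convergent (F k \<circ> (diagseq \<circ> (+) (Suc k)))"
      by (rule diagseq_holds) (auto simp: o_assoc intro: convergent_subseq_convergent)
    then show ?thesis by (auto simp: convergent_def o_def add.commute[of "Suc k"] dest: LIMSEQ_offset simp del: add_Suc add_Suc_right)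
  qed
  then show ?thesis using subseq_diagseq by blast
qed

text \<open>\<open>A\<close> is a cover set and \<open>B\<close> the next larger one, to which the
  vertices are allowed to belong. The cardinality bound \<open>P\<close> is kept explicit because it
  has to be common to all spaces.\<close>

definition tame_net :: "'a lpls \<Rightarrow> 'a set \<Rightarrow> 'a set \<Rightarrow> real \<Rightarrow> nat \<Rightarrow> ('a \<times> 'a) set \<Rightarrow> bool" where
  "tame_net X A B \<epsilon> P S \<longleftrightarrow> finite S \<and> card S \<le> P \<and> S \<subseteq> B \<times> B \<and> is_net X A \<epsilon> S \<and>
     (\<forall>(p, q)\<in>S. past_tame X A p \<and> future_tame X A q)"

text \<open>The points \<open>g 0 0\<close> and \<open>g 1 0\<close> are the vertices of a diamond meeting \<open>A\<close> at \<open>g 2 0\<close>; the points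
  \<open>g 3 j\<close> and \<open>g 4 j\<close> of \<open>A\<close> make them vertices of arbitrarily short diamonds, which lets old vertices
  be kept in finer nets.\<close>

definition net_frame :: "'a lpls \<Rightarrow> 'a set \<Rightarrow> 'a set \<Rightarrow> (nat \<Rightarrow> nat \<Rightarrow> 'a) \<Rightarrow> bool" where
  "net_frame X A B g \<longleftrightarrow> g 0 0 \<in> B \<and> g 1 0 \<in> B \<and>
     (\<forall>j. g 2 j \<in> A \<and> lcaus X (g 0 0) (g 2 j) \<and> lcaus X (g 2 j) (g 1 0) \<and>
          g 3 j \<in> A \<and> lcaus X (g 0 0) (g 3 j) \<and> ltau X (g 0 0) (g 3 j) \<le> ennreal (1 / real (Suc j)) \<and>
          g 4 j \<in> A \<and> lcaus X (g 4 j) (g 1 0) \<and> ltau X (g 4 j) (g 1 0) \<le> ennreal (1 / real (Suc j)))"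

lemma tame_net_frames:
  assumes S: "tame_net X A B \<epsilon> P S" and A: "A \<noteq> {}"
  obtains G where "\<And>i. i < P \<Longrightarrow> net_frame X A B (G i)" "(\<lambda>i. (G i 0 0, G i 1 0)) ` {..<P} = S"
proof -
  have fin: "finite S" "card S \<le> P" and SB: "S \<subseteq> B \<times> B" and net: "is_net X A \<epsilon> S"
    and tame: "\<And>z. z \<in> S \<Longrightarrow> past_tame X A (fst z) \<and> future_tame X A (snd z)"
    using S by (auto simp: tame_net_def)
  have "S \<noteq> {}" using net A by (auto simp: is_net_def)
  then obtain h where h: "h ` {..<P} = S" by (rule finite_enumeration[OF fin(1) _ fin(2)])
  have "\<exists>g. net_frame X A B g \<and> g 0 0 = fst z \<and> g 1 0 = snd z" if z: "z \<in> S" for z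
  proof -
    obtain w where w: "w \<in> A" "lcaus X (fst z) w" "lcaus X w (snd z)"
      using net z by (fastforce simp: is_net_def caus_diamond_def caus_future_def caus_past_def)
    have "\<forall>j. \<exists>u\<in>A. lcaus X (fst z) u \<and> ltau X (fst z) u \<le> ennreal (1 / real (Suc j))"
      using tame[OF z] unfolding past_tame_def by simp
    then obtain a where a: "\<And>j. a j \<in> A \<and> lcaus X (fst z) (a j) \<and> ltau X (fst z) (a j) \<le> ennreal (1 / real (Suc j))"
      by metis
    have "\<forall>j. \<exists>u\<in>A. lcaus X u (snd z) \<and> ltau X u (snd z) \<le> ennreal (1 / real (Suc j))"
      using tame[OF z] unfolding future_tame_def by simp
    then obtain b where b: "\<And>j. b j \<in> A \<and> lcaus X (b j) (snd z) \<and> ltau X (b j) (snd z) \<le> ennreal (1 / real (Suc j))"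
      by metis
    define g where "g = (\<lambda>i :: nat. if i = 0 then (\<lambda>_. fst z) else if i = 1 then (\<lambda>_. snd z)
      else if i = 2 then (\<lambda>_. w) else if i = 3 then a else b)"
    have g: "g 0 j = fst z" "g 1 j = snd z" "g 2 j = w" "g 3 j = a j" "g 4 j = b j" for j by (simp_all add: g_def)
    have "fst z \<in> B" "snd z \<in> B" using z SB by auto
    then have "net_frame X A B g" unfolding net_frame_def g using w a b by blast
    then show ?thesis using g by blast
  qed
  then have "\<forall>i. \<exists>g. i < P \<longrightarrow> net_frame X A B g \<and> g 0 0 = fst (h i) \<and> g 1 0 = snd (h i)" using h by blast
  then obtain G where G: "\<And>i. i < P \<Longrightarrow> net_frame X A B (G i) \<and> G i 0 0 = fst (h i) \<and> G i 1 0 = snd (h i)" by metis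
  have "(\<lambda>i. (G i 0 0, G i 1 0)) ` {..<P} = h ` {..<P}" by (rule image_cong) (use G in auto)
  then show ?thesis using that[of G] G h by simp
qed

text \<open>Degenerate diamonds \<open>(a, a)\<close> will occur in nets; the reverse triangle
  inequality for \<open>p\<close>, \<open>p\<close>, \<open>p\<close> leaves 0 as the only finite
  value.\<close>

lemma tau_self_eq_0:
  assumes "is_lpls X" "p \<in> lpts X" "ltau X p p < \<top>"
  shows "ltau X p p = 0"
proof -
  have "ltau X p p + ltau X p p \<le> ltau X p p"
    by (rule is_lplsD(6)[OF assms(1,2,2,2)]) (use is_lplsD(2)[OF assms(1,2,2)] in auto)
  then show ?thesis using assms(3) ennreal_add_left_cancel_le[of "ltau X p p" "ltau X p p" 0] by auto
qed

text \<open>The uniform bounds \<open>P k l\<close> let the vertices in all spaces carry the same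
  labels, so it remains to make countably many bounded real sequences converge. By
  \<open>dich\<close>, labels belonging to \<open>k\<close> are either available for every
  \<open>n\<close> or not introduced at all.\<close>

theorem tame_nets_imp_subconvergent:
  fixes X :: "nat \<Rightarrow> 'a lpls" and U :: "nat \<Rightarrow> nat \<Rightarrow> 'a set" and P :: "nat \<Rightarrow> nat \<Rightarrow> nat"
  assumes cov: "\<And>n. is_covered_lpls (X n, U n)"
    and \<Lambda>: "\<And>n p q. p \<in> lpts (X n) \<Longrightarrow> q \<in> lpts (X n) \<Longrightarrow> ltau (X n) p q \<le> ennreal \<Lambda>" "0 \<le> \<Lambda>"
    and dich: "\<And>k. (\<forall>n. U n k \<noteq> {}) \<or> (\<forall>\<^sub>F n in sequentially. U n k = {})"
    and nets: "\<And>n k l. U n k \<noteq> {} \<Longrightarrow> \<exists>S. tame_net (X n) (U n k) (U n (Suc k)) (1 / real (Suc l)) (P k l) S"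
  shows "\<exists>r (Z :: real covered). strict_mono r \<and> is_covered_lpls Z \<and> LGH_converges (\<lambda>n. (X (r n), U (r n))) Z"
proof -
  have lpls: "is_lpls (X n)" and U_lpts: "U n k \<subseteq> lpts (X n)" and U_Suc: "U n k \<subseteq> U n (Suc k)" for n k
    using cov[of n] by (auto simp: is_covered_lpls_def)
  have fin_tau: "ltau (X n) p q < \<top>" if "p \<in> lpts (X n)" "q \<in> lpts (X n)" for n p q
    using order.strict_trans1[OF \<Lambda>(1)[OF that] ennreal_less_top] .
  define ok where "ok = (\<lambda>k. \<forall>n. U n k \<noteq> {})"
  define Q where "Q = (\<lambda>n k l G. (\<forall>i<P k l. net_frame (X n) (U n k) (U n (Suc k)) (G i)) \<and>
      is_net (X n) (U n k) (1 / real (Suc l)) ((\<lambda>i. (G i 0 0, G i 1 0)) ` {..<P k l}))"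
  have Q: "\<exists>G. Q n k l G" if "ok k" for n k l
  proof -
    have ne: "U n k \<noteq> {}" using that by (simp add: ok_def)
    obtain S where S: "tame_net (X n) (U n k) (U n (Suc k)) (1 / real (Suc l)) (P k l) S" using nets[OF ne] by blast
    show ?thesis
    proof (rule tame_net_frames[OF S ne])
      fix G assume "\<And>i. i < P k l \<Longrightarrow> net_frame (X n) (U n k) (U n (Suc k)) (G i)" "(\<lambda>i. (G i 0 0, G i 1 0)) ` {..<P k l} = S"
      then show ?thesis using S by (intro exI[of _ G]) (simp add: tame_net_def Q_def)
    qed
  qed
  define G where "G = (\<lambda>n k l. SOME G. Q n k l G)"
  have G: "(\<forall>i<P k l. net_frame (X n) (U n k) (U n (Suc k)) (G n k l i)) \<and>
      is_net (X n) (U n k) (1 / real (Suc l)) ((\<lambda>i. (G n k l i 0 0, G n k l i 1 0)) ` {..<P k l})" if "ok k" for n k l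
  proof -
    have "Q n k l (G n k l)" unfolding G_def using Q[OF that] by (rule someI_ex)
    then show ?thesis unfolding Q_def .
  qed
  have frame: "G n k l i 0 0 \<in> U n (Suc k)" "G n k l i 1 0 \<in> U n (Suc k)" "G n k l i 2 j \<in> U n k"
      "lcaus (X n) (G n k l i 0 0) (G n k l i 2 j)" "lcaus (X n) (G n k l i 2 j) (G n k l i 1 0)"
      "G n k l i 3 j \<in> U n k" "lcaus (X n) (G n k l i 0 0) (G n k l i 3 j)"
      "ltau (X n) (G n k l i 0 0) (G n k l i 3 j) \<le> ennreal (1 / real (Suc j))"
      "G n k l i 4 j \<in> U n k" "lcaus (X n) (G n k l i 4 j) (G n k l i 1 0)"
      "ltau (X n) (G n k l i 4 j) (G n k l i 1 0) \<le> ennreal (1 / real (Suc j))"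
    if "ok k" "i < P k l" for n k l i j
    using G[OF that(1)] that(2) unfolding net_frame_def by blast+
  \<comment> \<open>A label \<open>(h, k, l, i, j)\<close> names a point of the frame of the
    \<open>i\<close>-th diamond in the \<open>l\<close>-th net of \<open>U n k\<close>:
    \<open>h\<close> is its role in \<open>net_frame\<close> and \<open>j\<close> the precision of a
    companion. Vertices, with \<open>h \<le> 1\<close>, are used with \<open>j = 0\<close>
    only.\<close>
  define x where "x = (\<lambda>n (h :: nat, k, l, i, j). G n k l i h j)"
  define act where "act = {(h :: nat, k, l, i, j :: nat). h \<le> 4 \<and> ok k \<and> i < P k l \<and> (h \<le> 1 \<longrightarrow> j = 0)}"
  \<comment> \<open>Vertices are only known to lie in the next larger cover set, the other frame
    points in \<open>U n k\<close> itself.\<close>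
  define lev where "lev = (\<lambda>(h :: nat, k :: nat, l :: nat, i :: nat, j :: nat). if h \<le> 1 then Suc k else k)"
  have xU: "x n a \<in> U n (lev a)" if "a \<in> act" for n a
  proof -
    obtain h k l i j where a: "a = (h, k, l, i, j)" by (metis prod_cases5)
    have "h = 0 \<or> h = 1 \<or> h = 2 \<or> h = 3 \<or> h = 4" using that by (auto simp: act_def a)
    then show ?thesis using that frame by (auto simp: act_def a x_def lev_def)
  qed
  have x_lpts: "x n a \<in> lpts (X n)" if "a \<in> act" for n a using xU[OF that] U_lpts by blast
  \<comment> \<open>Time separations and causal relations of all pairs of labels are coded into one
    countable family of bounded real sequences, truth values being 0 and 1.\<close>
  define F where "F = (\<lambda>s n. case from_nat s of (a, b, u) \<Rightarrow>
    if a \<in> act \<and> b \<in> act then if u then enn2real (ltau (X n) (x n a) (x n b)) else of_bool (lcaus (X n) (x n a) (x n b)) else (0 :: real))"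
  have F: "\<bar>F s n\<bar> \<le> max \<Lambda> 1" for s n
  proof -
    have "enn2real (ltau (X n) (x n a) (x n b)) \<le> \<Lambda>" if "a \<in> act" "b \<in> act" for a b
      using \<Lambda> x_lpts that by (intro enn2real_leI) auto
    then show ?thesis by (auto simp: F_def split: prod.splits intro: max.coboundedI1)
  qed
  obtain r :: "nat \<Rightarrow> nat" where r: "strict_mono r" "\<forall>s. convergent (F s \<circ> r)"
    using diagonal_convergent[of F, OF F] by (elim exE conjE)
  define t where "t = (\<lambda>a b. lim (\<lambda>n. enn2real (ltau (X (r n)) (x (r n) a) (x (r n) b))))"
  have t: "(\<lambda>n. enn2real (ltau (X (r n)) (x (r n) a) (x (r n) b))) \<longlonglongrightarrow> t a b" if "a \<in> act" "b \<in> act" for a b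
    using r(2)[rule_format, of "to_nat (a, b, True)"] that unfolding t_def
    by (simp add: F_def convergent_LIMSEQ_iff o_def)
  \<comment> \<open>The limit of truth values is 0 or 1, so the threshold \<open>1 / 2\<close>
    recovers the eventual truth value.\<close>
  define c where "c = (\<lambda>a b. 1 / 2 < lim (\<lambda>n. of_bool (lcaus (X (r n)) (x (r n) a) (x (r n) b)) :: real))"
  have c: "\<forall>\<^sub>F n in sequentially. lcaus (X (r n)) (x (r n) a) (x (r n) b) = c a b" if "a \<in> act" "b \<in> act" for a b
  proof -
    define L where "L = lim (\<lambda>n. of_bool (lcaus (X (r n)) (x (r n) a) (x (r n) b)) :: real)"
    have "(\<lambda>n. of_bool (lcaus (X (r n)) (x (r n) a) (x (r n) b)) :: real) \<longlonglongrightarrow> L"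
      using r(2)[rule_format, of "to_nat (a, b, False)"] that unfolding L_def
      by (simp add: F_def convergent_LIMSEQ_iff o_def)
    then have "\<forall>\<^sub>F n in sequentially. dist (of_bool (lcaus (X (r n)) (x (r n) a) (x (r n) b)) :: real) L < 1 / 2"
      by (rule tendstoD) simp
    then show ?thesis
      unfolding c_def L_def[symmetric]
    proof (rule eventually_mono)
      fix n assume "dist (of_bool (lcaus (X (r n)) (x (r n) a) (x (r n) b)) :: real) L < 1 / 2"
      then have "\<bar>of_bool (lcaus (X (r n)) (x (r n) a) (x (r n) b)) - L\<bar> < 1 / 2" by (simp only: dist_real_def)
      then have "of_bool (lcaus (X (r n)) (x (r n) a) (x (r n) b)) - 1 / 2 < L" "L < of_bool (lcaus (X (r n)) (x (r n) a) (x (r n) b)) + 1 / 2"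
        by linarith+
      then show "lcaus (X (r n)) (x (r n) a) (x (r n) b) = (1 / 2 < L)"
        by (cases "lcaus (X (r n)) (x (r n) a) (x (r n) b)") auto
    qed
  qed
  \<comment> \<open>A finite set of labels for each \<open>l\<close>, exhausting the labels of level
    at most \<open>k\<close> as \<open>l\<close> grows.\<close>
  define E where "E = (\<lambda>k l. {a \<in> act. lev a \<le> k \<and> fst (snd (snd a)) \<le> l \<and> snd (snd (snd (snd a))) \<le> l})"
  \<comment> \<open>Three kinds of diamonds: those of the \<open>l\<close>-th net; vertices of all
    nets up to \<open>l\<close>, paired with companions of precision \<open>l\<close>; and
    degenerate diamonds \<open>(a, a)\<close>. The second kind retains old vertices that may lie
    outside \<open>U n k\<close>; the third retains the labels of level at most \<open>k\<close> and
    makes each of them a vertex eventually.\<close>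
  define D where "D = (\<lambda>k l. if ok k then (\<lambda>i. ((0, k, l, i, 0), (1, k, l, i, 0))) ` {..<P k l} \<union>
      (\<Union>l'\<le>l. (\<lambda>i. ((0, k, l', i, 0), (3, k, l', i, l))) ` {..<P k l'}) \<union>
      (\<Union>l'\<le>l. (\<lambda>i. ((4, k, l', i, l), (1, k, l', i, 0))) ` {..<P k l'}) \<union> (\<lambda>a. (a, a)) ` E k l else {})"
  have lev_ok: "ok k" if "a \<in> act" "lev a \<le> k" for a k
  proof -
    obtain h k' l i j where a: "a = (h, k', l, i, j)" by (metis prod_cases5)
    have "ok k'" "k' \<le> k" using that by (auto simp: act_def lev_def a split: if_splits)
    moreover have "U n k' \<subseteq> U n k" for n using lift_Suc_mono_le[of "U n", OF U_Suc] \<open>k' \<le> k\<close> by blast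
    ultimately show ?thesis unfolding ok_def by blast
  qed
  have E_fin: "finite (E k l)" for k l
  proof (rule finite_subset)
    show "E k l \<subseteq> {..4} \<times> {..k} \<times> {..l} \<times> (\<Union>k'\<le>k. \<Union>l'\<le>l. {..<P k' l'}) \<times> {..l}"
      by (force simp: E_def act_def lev_def split: if_splits)
  qed auto
  have D_act: "D k l \<subseteq> act \<times> act" for k l
    by (auto simp: D_def act_def E_def)
  have vertices_D: "vertices (D k l) = (if ok k then {(h, k, l', i, 0) | h l' i. h \<le> 1 \<and> l' \<le> l \<and> i < P k l'} \<union>
      {(h, k, l', i, l) | h l' i. h \<in> {3, 4} \<and> l' \<le> l \<and> i < P k l'} \<union> E k l else {})" for k l
  proof (cases "ok k")
    case True
    have "a \<in> vertices (D k l) \<longleftrightarrow> a \<in> {(h, k, l', i, 0) | h l' i. h \<le> 1 \<and> l' \<le> l \<and> i < P k l'} \<union>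
      {(h, k, l', i, l) | h l' i. h \<in> {3, 4} \<and> l' \<le> l \<and> i < P k l'} \<union> E k l" for a
      by (simp add: D_def vertices_def True image_Un image_UN image_image Bex_def image_iff le_Suc_eq) (auto; fail)
    then show ?thesis using True by auto
  next
    case False
    then show ?thesis by (simp add: D_def vertices_def)
  qed
  interpret vertex_system "\<lambda>n. X (r n)" "\<lambda>n. U (r n)" act lev "\<lambda>n. x (r n)" D t c
  proof
    show "is_covered_lpls (X (r n), U (r n))" for n by (rule cov)
    show "ltau (X (r n)) p q < \<top>" if "p \<in> lpts (X (r n))" "q \<in> lpts (X (r n))" for n p q by (rule fin_tau[OF that])
    show "x (r n) a \<in> U (r n) (lev a)" if "a \<in> act" for a n by (rule xU[OF that])
    show "(\<lambda>n. enn2real (ltau (X (r n)) (x (r n) a) (x (r n) b))) \<longlonglongrightarrow> t a b" if "a \<in> act" "b \<in> act" for a b by (rule t[OF that])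
    show "\<forall>\<^sub>F n in sequentially. lcaus (X (r n)) (x (r n) a) (x (r n) b) = c a b" if "a \<in> act" "b \<in> act" for a b by (rule c[OF that])
    show "finite (D k l)" for k l by (simp add: D_def E_fin)
    show "D k l \<subseteq> act \<times> act" for k l by (rule D_act)
    show "vertices (D k l) \<subseteq> vertices (D k (Suc l))" for k l
      unfolding vertices_D by (auto simp: E_def act_def lev_def)
    show "\<exists>l. a \<in> vertices (D k l)" if "a \<in> act" "lev a \<le> k" for a k
    proof (rule exI[of _ "max (fst (snd (snd a))) (snd (snd (snd (snd a))))"])
      show "a \<in> vertices (D k (max (fst (snd (snd a))) (snd (snd (snd (snd a))))))"
        using that lev_ok[OF that] unfolding vertices_D by (auto simp: E_def)
    qed
    show "\<exists>d\<in>act. lev d \<le> k \<and> (\<forall>n. lcaus (X (r n)) (x (r n) a) (x (r n) d) \<and> lcaus (X (r n)) (x (r n) d) (x (r n) b))"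
      if ab: "(a, b) \<in> D k l" for a b k l
    proof -
      have ok: "ok k" using ab by (auto simp: D_def split: if_splits)
      have refl: "lcaus (X n) (x n d) (x n d)" if "d \<in> act" for n d using is_lplsD(2)[OF lpls x_lpts[OF that] x_lpts[OF that]] by simp
      consider i where "i < P k l" "a = (0, k, l, i, 0)" "b = (1, k, l, i, 0)"
        | l' i where "i < P k l'" "a = (0, k, l', i, 0)" "b = (3, k, l', i, l)"
        | l' i where "i < P k l'" "a = (4, k, l', i, l)" "b = (1, k, l', i, 0)"
        | "a \<in> E k l" "b = a"
        using ab ok by (auto simp: D_def)
      then show ?thesis
      proof cases
        case 1
        then show ?thesis using ok frame by (intro bexI[of _ "(2, k, l, i, 0)"]) (auto simp: act_def lev_def x_def)
      next
        case 2
        then have "b \<in> act" "lev b \<le> k" using ok by (auto simp: act_def lev_def)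
        then show ?thesis using 2 ok frame(7) refl[of b] by (intro bexI[of _ b]) (auto simp: x_def)
      next
        case 3
        then have "a \<in> act" "lev a \<le> k" using ok by (auto simp: act_def lev_def)
        then show ?thesis using 3 ok frame(10) refl[of a] by (intro bexI[of _ a]) (auto simp: x_def)
      next
        case 4
        then show ?thesis using refl[of a] by (intro bexI[of _ a]) (auto simp: E_def)
      qed
    qed
    show "\<forall>\<^sub>F n in sequentially. is_net (X (r n)) (U (r n) k) (1 / real (Suc l)) ((\<lambda>(p, q). (x (r n) p, x (r n) q)) ` D k l)" for k l
    proof (cases "ok k")
      case False
      \<comment> \<open>Here \<open>U n k\<close> is eventually empty and \<open>D k l\<close> has
        no elements, so the empty family is a net.\<close>
      then have "\<forall>\<^sub>F n in sequentially. U n k = {}" using dich[of k] by (auto simp: ok_def)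
      then have "\<forall>\<^sub>F n in sequentially. U (r n) k = {}" by (rule eventually_subseq[OF r(1)])
      then show ?thesis by (rule eventually_mono) (simp add: is_net_def D_def False)
    next
      case ok: True
      have "is_net (X n) (U n k) (1 / real (Suc l)) ((\<lambda>(p, q). (x n p, x n q)) ` D k l)" for n
      proof -
        let ?R = "(\<lambda>i. (G n k l i 0 0, G n k l i 1 0)) ` {..<P k l}"
        have R: "is_net (X n) (U n k) (1 / real (Suc l)) ?R" using G[OF ok] by blast
        have sub: "?R \<subseteq> (\<lambda>(p, q). (x n p, x n q)) ` D k l"
        proof
          fix z assume "z \<in> ?R"
          then obtain i where "i < P k l" "z = (G n k l i 0 0, G n k l i 1 0)" by auto
          then show "z \<in> (\<lambda>(p, q). (x n p, x n q)) ` D k l"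
            using ok by (intro image_eqI[of _ _ "((0, k, l, i, 0), (1, k, l, i, 0))"]) (auto simp: x_def D_def)
        qed
        have good: "ltau (X n) (x n a) (x n b) \<le> ennreal (1 / real (Suc l)) \<and> U n k \<inter> caus_diamond (X n) (x n a) (x n b) \<noteq> {}"
          if ab: "(a, b) \<in> D k l" for a b
        proof -
          have act: "a \<in> act" "b \<in> act" using ab D_act by auto
          note L = x_lpts[OF act(1), of n] x_lpts[OF act(2), of n]
          have refl: "lcaus (X n) p p" if "p \<in> lpts (X n)" for p using is_lplsD(2)[OF lpls that that] by simp
          have memI: "U n k \<inter> caus_diamond (X n) (x n a) (x n b) \<noteq> {}"
            if "w \<in> U n k" "lcaus (X n) (x n a) w" "lcaus (X n) w (x n b)" for w
            using that L U_lpts[of n k] by (auto simp: caus_diamond_def caus_future_def caus_past_def)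
          consider i where "i < P k l" "a = (0, k, l, i, 0)" "b = (1, k, l, i, 0)"
            | l' i where "i < P k l'" "a = (0, k, l', i, 0)" "b = (3, k, l', i, l)"
            | l' i where "i < P k l'" "a = (4, k, l', i, l)" "b = (1, k, l', i, 0)"
            | "a \<in> E k l" "b = a"
            using ab ok by (auto simp: D_def)
          then show ?thesis
          proof cases
            case 1
            then have "(x n a, x n b) \<in> ?R" by (auto simp: x_def)
            then show ?thesis using R by (auto simp: is_net_def)
          next
            case 2
            then show ?thesis using frame(6-8)[OF ok 2(1)] memI[of "x n b"] refl[OF L(2)] by (auto simp: x_def)
          next
            case 3
            then show ?thesis using frame(9-11)[OF ok 3(1)] memI[of "x n a"] refl[OF L(1)] by (auto simp: x_def)
          next
            case 4
            have "lev a \<le> k" using 4 by (simp add: E_def)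
            then have "x n a \<in> U n k" using xU[OF act(1), of n] lift_Suc_mono_le[of "U n", OF U_Suc] by blast
            then show ?thesis using 4 memI[of "x n a"] refl[OF L(1)] tau_self_eq_0[OF lpls L(1) fin_tau[OF L(1) L(1)]] by simp
          qed
        qed
        show ?thesis
          unfolding is_net_def
        proof (intro conjI)
          show "(\<lambda>(p, q). (x n p, x n q)) ` D k l \<subseteq> lpts (X n) \<times> lpts (X n)" using D_act x_lpts by fastforce
          show "\<forall>(p, q)\<in>(\<lambda>(p, q). (x n p, x n q)) ` D k l.
              ltau (X n) p q \<le> ennreal (1 / real (Suc l)) \<and> U n k \<inter> caus_diamond (X n) p q \<noteq> {}" using good by auto
          have "U n k \<subseteq> (\<Union>(p, q)\<in>?R. caus_diamond (X n) p q)" using R unfolding is_net_def by blast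
          also have "\<dots> \<subseteq> (\<Union>(p, q)\<in>(\<lambda>(p, q). (x n p, x n q)) ` D k l. caus_diamond (X n) p q)"
            by (rule UN_mono[OF sub]) simp
          finally show "U n k \<subseteq> (\<Union>(p, q)\<in>(\<lambda>(p, q). (x n p, x n q)) ` D k l. caus_diamond (X n) p q)" .
        qed
      qed
      then show ?thesis by simp
    qed
  qed
  show ?thesis
    by (intro exI[of _ r] exI[of _ "(Z, UZ)"] conjI r(1) is_covered_Z converges)
qed

text \<open>Passing to a subsequence, each \<open>U k\<close> is either always nonempty or eventually empty.\<close>

lemma subsequence_dichotomy:
  fixes U :: "nat \<Rightarrow> nat \<Rightarrow> 'a set"
  assumes mono: "\<And>n k. U n k \<subseteq> U n (Suc k)"
  shows "\<exists>r. strict_mono r \<and> (\<forall>k. (\<forall>n. U (r n) k \<noteq> {}) \<or> (\<forall>\<^sub>F n in sequentially. U (r n) k = {}))"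
proof (cases "\<exists>k. infinite {n. U n k \<noteq> {}}")
  case False
  then have "\<forall>\<^sub>F n in sequentially. U n k = {}" for k
    using False by (simp add: cofinite_eq_sequentially[symmetric] eventually_cofinite)
  then show ?thesis by (intro exI[of _ id]) (simp add: strict_mono_def)
next
  case True
  define k0 where "k0 = (LEAST k. infinite {n. U n k \<noteq> {}})"
  have inf: "infinite {n. U n k0 \<noteq> {}}" unfolding k0_def using True by (rule LeastI_ex)
  let ?r = "enumerate {n. U n k0 \<noteq> {}}"
  have r: "strict_mono ?r" using inf by (intro strict_monoI enumerate_mono)
  have rU: "U (?r n) k0 \<noteq> {}" for n using enumerate_in_set[OF inf] by blast
  show ?thesis
  proof (intro exI[of _ ?r] conjI r allI)
    fix k
    show "(\<forall>n. U (?r n) k \<noteq> {}) \<or> (\<forall>\<^sub>F n in sequentially. U (?r n) k = {})"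
    proof (cases "k0 \<le> k")
      case True
      then have "U n k0 \<subseteq> U n k" for n using lift_Suc_mono_le[of "U n", OF mono] by blast
      then show ?thesis using rU by blast
    next
      case False
      then have "\<not> infinite {n. U n k \<noteq> {}}" unfolding k0_def not_le by (rule not_less_Least)
      then have "\<forall>\<^sub>F n in sequentially. U n k = {}" by (simp add: cofinite_eq_sequentially[symmetric] eventually_cofinite)
      then show ?thesis using eventually_subseq[OF r] by blast
    qed
  qed
qed

theorem LGH_precompact_tame_nets:
  fixes \<C> :: "'a covered set"
  assumes cov: "\<And>X U. (X, U) \<in> \<C> \<Longrightarrow> is_covered_lpls (X, U)"
    and \<Lambda>: "\<And>X U p q. (X, U) \<in> \<C> \<Longrightarrow> p \<in> lpts X \<Longrightarrow> q \<in> lpts X \<Longrightarrow> ltau X p q \<le> ennreal \<Lambda>" "0 \<le> \<Lambda>"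
    and nets: "\<And>X U k l. (X, U) \<in> \<C> \<Longrightarrow> U k \<noteq> {} \<Longrightarrow> \<exists>S. tame_net X (U k) (U (Suc k)) (1 / real (Suc l)) (P k l) S"
  shows "LGH_precompact \<C>"
  unfolding LGH_precompact_def
proof (intro allI impI)
  fix Xs :: "nat \<Rightarrow> 'a covered" assume Xs: "range Xs \<subseteq> \<C>"
  define X where "X = (\<lambda>n. fst (Xs n))"
  define U where "U = (\<lambda>n. snd (Xs n))"
  have C: "(X n, U n) \<in> \<C>" for n using Xs by (auto simp: X_def U_def)
  have U_Suc: "U n k \<subseteq> U n (Suc k)" for n k using cov[OF C, of n] by (simp add: is_covered_lpls_def)
  obtain r1 :: "nat \<Rightarrow> nat" where r1: "strict_mono r1"
    "\<forall>k. (\<forall>n. U (r1 n) k \<noteq> {}) \<or> (\<forall>\<^sub>F n in sequentially. U (r1 n) k = {})"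
    using subsequence_dichotomy[of U, OF U_Suc] by (elim exE conjE)
  obtain r2 :: "nat \<Rightarrow> nat" and Z :: "real covered" where
    r2: "strict_mono r2" "is_covered_lpls Z" "LGH_converges (\<lambda>n. (X (r1 (r2 n)), U (r1 (r2 n)))) Z"
  proof -
    have "\<exists>r (Z :: real covered). strict_mono r \<and> is_covered_lpls Z \<and> LGH_converges (\<lambda>n. (X (r1 (r n)), U (r1 (r n)))) Z"
    proof (rule tame_nets_imp_subconvergent[OF cov[OF C] _ \<Lambda>(2)])
      show "ltau (X (r1 n)) p q \<le> ennreal \<Lambda>" if "p \<in> lpts (X (r1 n))" "q \<in> lpts (X (r1 n))" for n p q
        by (rule \<Lambda>(1)[OF C that])
      show "(\<forall>n. U (r1 n) k \<noteq> {}) \<or> (\<forall>\<^sub>F n in sequentially. U (r1 n) k = {})" for k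
        using r1(2) by blast
      show "\<exists>S. tame_net (X (r1 n)) (U (r1 n) k) (U (r1 n) (Suc k)) (1 / real (Suc l)) (P k l) S"
        if "U (r1 n) k \<noteq> {}" for n k l by (rule nets[OF C that])
    qed
    then show ?thesis by (elim exE conjE) (rule that)
  qed
  have "(\<lambda>n. (X (r1 (r2 n)), U (r1 (r2 n)))) = Xs \<circ> (r1 \<circ> r2)" by (auto simp: X_def U_def)
  then show "\<exists>r (Z :: real covered). strict_mono r \<and> is_covered_lpls Z \<and> LGH_converges (Xs \<circ> r) Z"
    using r2 strict_mono_o[OF r1(1) r2(1)] by (intro exI[of _ "r1 \<circ> r2"] exI[of _ Z]) simp
qed

section \<open>Precompactness of the class of cone diamonds\<close>

theorem theorem1p4:
  fixes m M k K N \<Lambda> :: real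
  assumes "0 < m" and "m \<le> M" and "1 < N" and "0 < \<Lambda>" and "ennreal \<Lambda> < model_diam k / 2"
  shows "LGH_precompact (cone_diamonds m M k K N \<Lambda> :: (real \<times> 'y) covered set)"
proof -
  have N0: "0 < N" and \<Lambda>0: "0 \<le> \<Lambda>" using assms by auto
  let ?\<alpha> = "\<lambda>i. 1 / real (Suc i)"
  \<comment> \<open>The bound has to be chosen before the space, so the quantification over all
    cones is packed into \<open>Q\<close>. The cover set with index \<open>i\<close> has margin
    \<open>1 / real (Suc i)\<close> to the tips, and the vertices belong to the set with the next
    smaller margin.\<close>
  define Q where "Q = (\<lambda>i l P. \<forall>J (Y :: 'y metric) f s t y X \<mm>. cone_diamond J Y f s t m M y X \<longrightarrow>
     tau_diam X (lpts X) \<le> ennreal \<Lambda> \<longrightarrow> radon_measure (ltop X) \<mm> \<longrightarrow> full_support (ltop X) \<mm> \<longrightarrow>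
     TMCPe K N X \<mm> \<longrightarrow> TMCPe K N (lreverse X) \<mm> \<longrightarrow> s + ?\<alpha> i < t - ?\<alpha> i \<longrightarrow>
     (\<exists>S. tame_net X (chron_diamond (generalized_cone J Y f) (s + ?\<alpha> i, y) (t - ?\<alpha> i, y))
        (chron_diamond (generalized_cone J Y f) (s + ?\<alpha> (Suc i), y) (t - ?\<alpha> (Suc i), y)) (?\<alpha> l) P S))"
  have "\<exists>P. Q i l P" for i l
    unfolding Q_def tame_net_def
    by (rule uniform_net[OF assms(1,2) N0 \<Lambda>0]) (simp_all add: divide_strict_left_mono)
  then obtain P where P: "\<And>i l. Q i l (P i l)" by metis
  show ?thesis
  proof (rule LGH_precompact_tame_nets[OF _ _ \<Lambda>0])
    fix X :: "(real \<times> 'y) lpls" and U assume XU: "(X, U) \<in> cone_diamonds m M k K N \<Lambda>"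
    then show cov: "is_covered_lpls (X, U)" by (simp add: cone_diamonds_def)
    obtain J and Y :: "'y metric" and f s t y \<mm> where
      Y: "length_space Y" "open J" "is_interval J" "continuous_on J f" "\<forall>r\<in>J. m \<le> f r \<and> f r \<le> M"
      and W: "regular_lorentzian_length_space (generalized_cone J Y f)" "globally_hyperbolic (generalized_cone J Y f)"
      and st: "s \<in> J" "t \<in> J" "y \<in> mspace Y"
      and X: "X = lrestrict (generalized_cone J Y f) (chron_diamond (generalized_cone J Y f) (s, y) (t, y))"
      and td: "tau_diam X (lpts X) \<le> ennreal \<Lambda>"
      and \<mm>: "radon_measure (ltop X) \<mm>" "full_support (ltop X) \<mm>" "TMCPe K N X \<mm>" "TMCPe K N (lreverse X) \<mm>"
      and U: "U = (\<lambda>n. chron_diamond (generalized_cone J Y f) (s + ?\<alpha> n, y) (t - ?\<alpha> n, y))"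
      using XU unfolding cone_diamonds_def Let_def mem_Collect_eq case_prod_conv
      by (elim exE conjE) (rule that; assumption)
    show "ltau X p q \<le> ennreal \<Lambda>" if "p \<in> lpts X" "q \<in> lpts X" for p q
    proof -
      have "ltau X p q \<le> tau_diam X (lpts X)"
        unfolding tau_diam_def by (rule SUP_upper2[of "(p, q)"]) (use that in auto)
      then show ?thesis using td by simp
    qed
    show "\<exists>S. tame_net X (U i) (U (Suc i)) (?\<alpha> l) (P i l) S" if ne: "U i \<noteq> {}" for i l
    proof -
      \<comment> \<open>A point of \<open>U i\<close> lies in time strictly between the two tips, so
        nonemptiness yields \<open>s < t\<close>, as the slab requires.\<close>
      obtain x where "lchron (generalized_cone J Y f) (s + ?\<alpha> i, y) x" "lchron (generalized_cone J Y f) x (t - ?\<alpha> i, y)"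
        using ne by (auto simp: U chron_diamond_def chron_future_def chron_past_def)
      then have lt: "s + ?\<alpha> i < t - ?\<alpha> i" by (auto dest!: chron_imp_fst_less)
      moreover have "0 < ?\<alpha> i" by simp
      ultimately have "s < t" by linarith
      then have slab: "cone_slab J Y f s t m M" using Y st assms(1) by unfold_locales auto
      interpret cone_slab J Y f s t m M by (rule slab)
      have "cone_diamond J Y f s t m M y X"
        using W st X cov
        by unfold_locales (auto simp: W_def is_covered_lpls_def regular_lorentzian_length_space_def lorentzian_length_space_def)
      then show ?thesis
        using P[of i l, unfolded Q_def, rule_format] td \<mm> lt unfolding U by blast
    qed
  qed
qed

end
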